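(* There are a positive constant $\bar C$ and, for each $K\ge1$, a positive constant $\underline C(K)$ such that for all $t>0$, \[\sup_x\bigl(V^\infty(t,x)-V^\lambda(t,x)\bigr)\le \bar C\,t^{-\frac12-\lambda_0}\lambda^{-(2\lambda_0-1)}\quad\forall\lambda>0,\] and \[\underline C(K)\,t^{-\frac12-\lambda_0}\lambda^{-(2\lambda_0-1)}\le\inf_{|x|\le K\sqrt t}\bigl(V^\infty(t,x)-V^\lambda(t,x)\bigr)\quad\forall\lambda\ge t^{-1/2}.\]
   Context: For $\lambda>0$, $V^\lambda(t,x)$ is the unique solution, $C^{1,2}$ on $[0,\infty)\times\mathbb{R}\setminus\{(0,0)\}$, of $\partial_tV=\frac12\partial_x^2V-\frac12V^2$ with $V(0,\cdot)=\lambda\delta_0$. $V^\lambda$ is nondecreasing in $\lambda$ and $V^\infty(t,x)=\lim_{\lambda\to\infty}V^\lambda(t,x)$ (finite, with $V^\infty(t,x)\le2/t$). Let $F(x)=V^\infty(1,x)$, a positive symmetric $C^2$ function vanishing at infinity. Let $m$ be the standard normal law and $Lh=\frac12h''-\frac x2h'$. The operator $L^Fh=Lh-Fh$ (the $L^2(m)$-generator of the Ornstein–Uhlenbeck semigroup killed at rate $F$) has a complete orthonormal system in $L^2(m)$ of $C^2$ eigenfunctions $\psi_n$ with $L^F\psi_n=-\lambda_n\psi_n$, $0\le\lambda_0\le\lambda_1\le\dots\to\infty$, $\lambda_0$ simple with positive eigenfunction; $\lambda_0$ denotes this lowest value (it satisfies $1/2<\lambda_0<1$). *)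

theory Defs
  imports "HOL-Analysis.Analysis"
begin

text \<open>Classical (C^{1,2}) nonnegative solution on t > 0 of
  d/dt V = 1/2 V_xx - 1/2 V^2 with initial trace lam * delta_0
  (weak convergence against continuous compactly supported test functions),
  normalised to 0 for t \<le> 0.\<close>
definition is_sol :: "real \<Rightarrow> (real \<Rightarrow> real \<Rightarrow> real) \<Rightarrow> bool" where
  "is_sol lam V \<longleftrightarrow>
     (\<forall>t x. t \<le> 0 \<longrightarrow> V t x = 0) \<and>
     (\<forall>t x. t > 0 \<longrightarrow> V t x \<ge> 0) \<and>
     (\<exists>Vt Vx Vxx.
        (\<forall>t x. t > 0 \<longrightarrow>
            ((\<lambda>s. V s x) has_real_derivative Vt t x) (at t) \<and>
            ((\<lambda>y. V t y) has_real_derivative Vx t x) (at x) \<and>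
            ((\<lambda>y. Vx t y) has_real_derivative Vxx t x) (at x) \<and>
            Vt t x = Vxx t x / 2 - (V t x)\<^sup>2 / 2) \<and>
        continuous_on ({0<..} \<times> UNIV) (\<lambda>(t,x). V t x) \<and>
        continuous_on ({0<..} \<times> UNIV) (\<lambda>(t,x). Vt t x) \<and>
        continuous_on ({0<..} \<times> UNIV) (\<lambda>(t,x). Vx t x) \<and>
        continuous_on ({0<..} \<times> UNIV) (\<lambda>(t,x). Vxx t x)) \<and>
     (\<forall>t > 0. integrable lborel (\<lambda>x. V t x)) \<and>
     (\<forall>\<phi>::real \<Rightarrow> real. continuous_on UNIV \<phi> \<longrightarrow> (\<exists>R. \<forall>x. \<bar>x\<bar> > R \<longrightarrow> \<phi> x = 0) \<longrightarrow>
        ((\<lambda>t. LINT x|lborel. V t x * \<phi> x) \<longlongrightarrow> lam * \<phi> 0) (at_right 0))"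

definition Vsol :: "real \<Rightarrow> real \<Rightarrow> real \<Rightarrow> real" where
  "Vsol lam = (THE V. is_sol lam V)"

definition Vinf :: "real \<Rightarrow> real \<Rightarrow> real" where
  "Vinf t x = Lim at_top (\<lambda>lam. Vsol lam t x)"

definition Fpot :: "real \<Rightarrow> real" where
  "Fpot x = Vinf 1 x"

definition eigvals_LF :: "real set" where
  "eigvals_LF = {\<mu>. \<exists>\<psi> \<psi>' \<psi>''.
      (\<forall>x. (\<psi> has_real_derivative \<psi>' x) (at x)) \<and>
      (\<forall>x. (\<psi>' has_real_derivative \<psi>'' x) (at x)) \<and>
      continuous_on UNIV \<psi>'' \<and>
      integrable lborel (\<lambda>x. (\<psi> x)\<^sup>2 * exp (- x\<^sup>2 / 2)) \<and>
      (\<exists>x. \<psi> x \<noteq> 0) \<and>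
      (\<forall>x. \<psi>'' x / 2 - x / 2 * \<psi>' x - Fpot x * \<psi> x = - \<mu> * \<psi> x)}"

definition lambda0 :: real where
  "lambda0 = Inf eigvals_LF"

end

theory Submission
  imports Defs "HOL-Probability.Probability"
begin

text \<open>By scaling it suffices to treat \<open>\<lambda> = 1\<close>. In the coordinates \<open>s = ln t\<close>, \<open>y = x / \<surd>t\<close> the solution
  becomes \<open>N(s, y) = t V(t, x)\<close> with \<open>N\<^sub>s = N\<^sub>y\<^sub>y / 2 + y N\<^sub>y / 2 + N - N\<^sup>2 / 2\<close>, it increases in \<open>s\<close>, and
  its limit \<open>F\<close> is the stationary solution. The deficit \<open>D = F - N\<close> satisfies
  \<open>D\<^sub>s = (M - F) D + D\<^sup>2 / 2\<close> with \<open>M G = G\<^sub>y\<^sub>y / 2 + y G\<^sub>y / 2 + G\<close>, and for \<open>p(y) = exp (- y\<^sup>2 / 2)\<close> the ground state \<open>\<psi>\<close>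
  gives \<open>(M - F)(p \<psi>) = - \<beta> p \<psi>\<close> with \<open>\<beta> = \<lambda>\<^sub>0 - 1/2\<close>. Combinations of \<open>exp (- \<beta> s) p \<psi>\<close> with corrections of size
  \<open>exp (- 2 \<beta> s)\<close> are super- and subsolutions, so \<open>D\<close> decays exactly like \<open>exp (- \<beta> s)\<close>, which is the claim in the
  original variables. The ground state itself is found by shooting, starting from the explicit
  positive solution \<open>F / p\<close> of the equation at a lower level.\<close>

section \<open>Gaussian averages\<close>

text \<open>\<open>Vsol\<close> is a definite description over solutions that are merely integrable
  in space at each time, so uniqueness has to be proved in that class before \<open>Vinf\<close> and
  \<open>Fpot\<close> can be computed; the absorption term supplies the missing control at infinity.
  Once uniqueness holds, \<lambda> acts only as the time shift s = ln (\<lambda>^2 t). The Dirac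
  mass sits at s = -\<infinity>, where the solution is squeezed between two multiples of the heat
  kernel whose ratio tends to 1. Since \<open>lambda0\<close> is an infimum, it must be shown to be
  attained by a positive function of moderate growth. The profile satisfies M F = F^2 / 2, so F / p
  is a positive solution for the halved potential F / 2 at level 1/2; comparison with the full
  potential gives \<open>lambda0\<close> > 1/2, that is \<beta> > 0. The remainder D^2 / 2 has a
  favourable sign in the lower bound only; in the upper bound it is paid for by the gap between the
  rates \<beta> and 2 \<beta>. The tails of p \<psi> need not dominate those of D, so a term p cosh
  (2 y) is added for the upper bound and subtracted for the lower one.\<close>

definition gauss :: "real measure" where
  "gauss = density lborel std_normal_density"

lemma prob_space_gauss: "prob_space gauss"
  unfolding gauss_def by (rule prob_space_normal_density) simp

interpretation gauss: prob_space gauss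
  by (rule prob_space_gauss)

lemma sets_gauss [measurable_cong, simp]: "sets gauss = sets borel"
  by (simp add: gauss_def)

lemma space_gauss [simp]: "space gauss = UNIV"
  by (simp add: gauss_def)

lemma integral_gauss:
  fixes f :: "real \<Rightarrow> real"
  assumes "f \<in> borel_measurable borel"
  shows "(\<integral>z. f z \<partial>gauss) = (\<integral>z. std_normal_density z * f z \<partial>lborel)"
  unfolding gauss_def using assms by (subst integral_density) auto

lemma integrable_gauss_iff:
  fixes f :: "real \<Rightarrow> real"
  assumes "f \<in> borel_measurable borel"
  shows "integrable gauss f \<longleftrightarrow> integrable lborel (\<lambda>z. std_normal_density z * f z)"
  unfolding gauss_def using assms by (subst integrable_density) auto

lemma integrable_gauss_exp: "integrable gauss (\<lambda>z. exp (a * z))"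
proof -
  have eq: "std_normal_density z * exp (a * z) = exp (a\<^sup>2 / 2) * normal_density a 1 z" for z
    by (simp add: normal_density_def exp_add [symmetric] power2_eq_square field_simps)
  show ?thesis
    by (subst integrable_gauss_iff) (auto simp: eq)
qed

lemma integrable_gauss_exp_abs: "integrable gauss (\<lambda>z. exp (a * \<bar>z\<bar>))"
proof (rule Bochner_Integration.integrable_bound)
  show "integrable gauss (\<lambda>z. exp (a * z) + exp ((-a) * z))"
    by (intro Bochner_Integration.integrable_add integrable_gauss_exp)
  show "AE z in gauss. norm (exp (a * \<bar>z\<bar>)) \<le> norm (exp (a * z) + exp ((-a) * z))"
  proof (rule AE_I2)
    fix z :: real
    have "exp (a * \<bar>z\<bar>) \<le> exp (a * z) + exp ((-a) * z)"
      by (cases "z \<ge> 0") auto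
    then show "norm (exp (a * \<bar>z\<bar>)) \<le> norm (exp (a * z) + exp ((-a) * z))"
      by simp
  qed
qed auto

lemma integrable_gauss_abs: "integrable gauss abs"
proof (rule Bochner_Integration.integrable_bound[OF integrable_gauss_exp_abs[of 1]])
  show "AE z in gauss. norm \<bar>z\<bar> \<le> norm (exp (1 * \<bar>z\<bar>))"
    using exp_ge_add_one_self by (intro AE_I2) (smt (verit) norm_ge_zero real_norm_def)
qed auto

lemma integrable_gauss_linear: "integrable gauss (\<lambda>z. B * (1 + \<bar>z\<bar>))"
  using integrable_gauss_abs by auto

definition gabs :: real where "gabs = (\<integral>z. \<bar>z\<bar> \<partial>gauss)"

section \<open>Continuity and differentiation under an integral\<close>

lemma continuous_on_integral_dominated:
  fixes f :: "'a::{first_countable_topology, t2_space} \<Rightarrow> 'b \<Rightarrow> real"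
  assumes "\<And>z. z \<in> space M \<Longrightarrow> continuous_on S (\<lambda>x. f x z)"
    and "\<And>x. x \<in> S \<Longrightarrow> f x \<in> borel_measurable M"
    and "\<And>x z. x \<in> S \<Longrightarrow> z \<in> space M \<Longrightarrow> \<bar>f x z\<bar> \<le> g z"
    and "integrable M g"
  shows "continuous_on S (\<lambda>x. \<integral>z. f x z \<partial>M)"
  unfolding continuous_on_sequentially o_def
proof (intro allI ballI impI, elim conjE)
  fix u a assume u: "a \<in> S" "\<forall>n. u n \<in> S" "u \<longlonglongrightarrow> a"
  show "(\<lambda>n. \<integral>z. f (u n) z \<partial>M) \<longlonglongrightarrow> (\<integral>z. f a z \<partial>M)"
  proof (rule integral_dominated_convergence[where w = g])
    show "AE z in M. (\<lambda>n. f (u n) z) \<longlonglongrightarrow> f a z"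
      using assms(1) u by (intro AE_I2) (auto simp: continuous_on_sequentially o_def)
    show "AE z in M. norm (f (u n) z) \<le> g z" for n
      using assms(3) u by (intro AE_I2) auto
  qed (use assms u in auto)
qed

text \<open>The mean value inequality on the convex set \<open>S\<close> bounds all difference
  quotients by \<open>g\<close>, so dominated convergence applies along any sequence tending to
  \<open>x0\<close>. Its first \<open>n0\<close> terms may leave \<open>S\<close>; they are dropped
  and restored by \<open>LIMSEQ_offset\<close>.\<close>

lemma has_real_derivative_integral_dominated:
  fixes f :: "real \<Rightarrow> 'b \<Rightarrow> real"
  assumes f': "\<And>x z. x \<in> S \<Longrightarrow> z \<in> space M \<Longrightarrow> ((\<lambda>x. f x z) has_real_derivative f' x z) (at x)"
    and S: "open S" "convex S" "x0 \<in> S"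
    and int: "\<And>x. x \<in> S \<Longrightarrow> integrable M (f x)"
    and meas: "f' x0 \<in> borel_measurable M"
    and bound: "\<And>x z. x \<in> S \<Longrightarrow> z \<in> space M \<Longrightarrow> \<bar>f' x z\<bar> \<le> g z"
    and g: "integrable M g"
  shows "((\<lambda>x. \<integral>z. f x z \<partial>M) has_real_derivative (\<integral>z. f' x0 z \<partial>M)) (at x0)"
  unfolding has_field_derivative_iff tendsto_at_iff_sequentially
proof (intro allI impI)
  fix u :: "nat \<Rightarrow> real"
  assume u: "\<forall>i. u i \<in> UNIV - {x0}" "u \<longlonglongrightarrow> x0"
  have evS: "eventually (\<lambda>n. u n \<in> S) sequentially"
    using S u(2) by (rule_tac topological_tendstoD)
  then obtain n0 where n0: "\<And>n. n \<ge> n0 \<Longrightarrow> u n \<in> S"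
    by (auto simp: eventually_sequentially)
  define v where "v n = u (n + n0)" for n
  have v: "v n \<in> S" "v n \<noteq> x0" for n
    using n0 u by (auto simp: v_def)
  have vlim: "v \<longlonglongrightarrow> x0"
    unfolding v_def using u(2) by (rule LIMSEQ_ignore_initial_segment)
  have "(\<lambda>n. \<integral>z. (f (v n) z - f x0 z) / (v n - x0) \<partial>M) \<longlonglongrightarrow> (\<integral>z. f' x0 z \<partial>M)"
  proof (rule integral_dominated_convergence[where w = g])
    show "AE z in M. (\<lambda>n. (f (v n) z - f x0 z) / (v n - x0)) \<longlonglongrightarrow> f' x0 z"
    proof (rule AE_I2)
      fix z assume "z \<in> space M"
      then have "((\<lambda>y. (f y z - f x0 z) / (y - x0)) \<longlongrightarrow> f' x0 z) (at x0)"
        using f'[OF S(3)] by (simp add: has_field_derivative_iff)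
      then show "(\<lambda>n. (f (v n) z - f x0 z) / (v n - x0)) \<longlonglongrightarrow> f' x0 z"
        using v vlim by (auto simp: tendsto_at_iff_sequentially o_def)
    qed
    show "AE z in M. norm ((f (v n) z - f x0 z) / (v n - x0)) \<le> g z" for n
    proof (rule AE_I2)
      fix z assume z: "z \<in> space M"
      have "norm (f (v n) z - f x0 z) \<le> g z * norm (v n - x0)"
        by (rule field_differentiable_bound[OF S(2), where f' = "\<lambda>x. f' x z"])
           (use f' z v S bound in \<open>auto intro: has_field_derivative_at_within\<close>)
      then show "norm ((f (v n) z - f x0 z) / (v n - x0)) \<le> g z"
        using v(2)[of n] by (simp add: field_simps)
    qed
    show "(\<lambda>z. (f (v n) z - f x0 z) / (v n - x0)) \<in> borel_measurable M" for n
      using int[OF v(1)[of n]] int[OF S(3)] by measurable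
  qed (use meas g in auto)
  also have "(\<lambda>n. \<integral>z. (f (v n) z - f x0 z) / (v n - x0) \<partial>M) =
      (\<lambda>n. ((\<integral>z. f (v n) z \<partial>M) - (\<integral>z. f x0 z \<partial>M)) / (v n - x0))"
    using int[OF v(1)] int[OF S(3)] by (intro ext) simp
  finally have "(\<lambda>n. ((\<integral>z. f (u (n + n0)) z \<partial>M) - (\<integral>z. f x0 z \<partial>M)) / (u (n + n0) - x0))
      \<longlonglongrightarrow> (\<integral>z. f' x0 z \<partial>M)"
    by (simp add: v_def)
  then have "(\<lambda>n. ((\<integral>z. f (u n) z \<partial>M) - (\<integral>z. f x0 z \<partial>M)) / (u n - x0))
      \<longlonglongrightarrow> (\<integral>z. f' x0 z \<partial>M)"
    by (rule LIMSEQ_offset)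
  then show "((\<lambda>y. ((\<integral>z. f y z \<partial>M) - (\<integral>z. f x0 z \<partial>M)) / (y - x0)) \<circ> u)
      \<longlonglongrightarrow> (\<integral>z. f' x0 z \<partial>M)"
    by (simp add: o_def)
qed

text \<open>A Cameron--Martin shift moves the increment of the argument into an exponential density.\<close>

lemma gauss_shift:
  fixes f :: "real \<Rightarrow> real"
  assumes [measurable]: "f \<in> borel_measurable borel"
  shows "(\<integral>z. f (z + d) \<partial>gauss) = (\<integral>z. f z * exp (d * z - d\<^sup>2 / 2) \<partial>gauss)"
proof -
  have "(\<integral>z. f (z + d) \<partial>gauss) = (\<integral>z. std_normal_density z * f (z + d) \<partial>lborel)"
    by (rule integral_gauss) measurable
  also have "\<dots> = (\<integral>z. std_normal_density (z - d) * f z \<partial>lborel)"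
    using lborel_integral_real_affine[of 1 "\<lambda>z. std_normal_density (z - d) * f z" d]
    by (simp add: add.commute)
  also have "\<dots> = (\<integral>z. std_normal_density z * (f z * exp (d * z - d\<^sup>2 / 2)) \<partial>lborel)"
  proof (rule Bochner_Integration.integral_cong)
    fix z
    have "exp (- (z - d)\<^sup>2 / 2) = exp (- z\<^sup>2 / 2) * exp (d * z - d\<^sup>2 / 2)"
      by (simp add: exp_add [symmetric] power2_eq_square field_simps)
    then show "std_normal_density (z - d) * f z
        = std_normal_density z * (f z * exp (d * z - d\<^sup>2 / 2))"
      by (simp add: normal_density_def)
  qed simp
  also have "\<dots> = (\<integral>z. f z * exp (d * z - d\<^sup>2 / 2) \<partial>gauss)"
    by (rule integral_gauss[symmetric]) measurable
  finally show ?thesis .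
qed

text \<open>The increment of v is written as s d and moved by \<open>gauss_shift\<close> into the
  density exp (d z - d^2 / 2), whose derivative at d = 0 is z. The derivative thus falls on the
  Gaussian, and \<open>k\<close> enters only through its bound.\<close>

lemma gauss_convolution_derivative:
  fixes k :: "real \<Rightarrow> real"
  assumes [measurable]: "k \<in> borel_measurable borel" and B: "\<And>x. \<bar>k x\<bar> \<le> B" and s: "s \<noteq> 0"
  shows "((\<lambda>v. \<integral>z. k (v + s * z) \<partial>gauss) has_real_derivative
           (\<integral>z. z * k (v + s * z) \<partial>gauss) / s) (at v)"
proof -
  have B0: "B \<ge> 0" using B[of 0] by linarith
  have eq: "(\<integral>z. k (v + s * (z + d)) \<partial>gauss)
      = (\<integral>z. k (v + s * z) * exp (d * z - d\<^sup>2 / 2) \<partial>gauss)" for d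
    using gauss_shift[of "\<lambda>z. k (v + s * z)" d] by simp
  have int: "integrable gauss (\<lambda>z. k (v + s * z) * exp (d * z - d\<^sup>2 / 2))" for d
  proof (rule Bochner_Integration.integrable_bound)
    show "integrable gauss (\<lambda>z. B * exp (d * z))"
      by (intro integrable_mult_right integrable_gauss_exp)
    show "AE z in gauss. norm (k (v + s * z) * exp (d * z - d\<^sup>2 / 2)) \<le> norm (B * exp (d * z))"
      using B B0 by (intro AE_I2) (auto simp: abs_mult intro!: mult_mono)
  qed simp
  \<comment> \<open>For |d| < 1 both exp (d z - d^2 / 2) and |z - d| are at most exp |z|, which
    gives the majorant \<open>B * exp (2 * \<bar>z\<bar>)\<close>.\<close>
  have "((\<lambda>d. \<integral>z. k (v + s * z) * exp (d * z - d\<^sup>2 / 2) \<partial>gauss) has_real_derivative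
      (\<integral>z. k (v + s * z) * (exp (0 * z - 0\<^sup>2 / 2) * (z - 0)) \<partial>gauss)) (at 0)"
  proof (rule has_real_derivative_integral_dominated
      [where S = "{-1<..<1}" and g = "\<lambda>z. B * exp (2 * \<bar>z\<bar>)"
        and f' = "\<lambda>d z. k (v + s * z) * (exp (d * z - d\<^sup>2 / 2) * (z - d))"])
    fix d z :: real assume d: "d \<in> {-1<..<1}"
    show "((\<lambda>d. k (v + s * z) * exp (d * z - d\<^sup>2 / 2)) has_real_derivative
        k (v + s * z) * (exp (d * z - d\<^sup>2 / 2) * (z - d))) (at d)"
      by (auto intro!: derivative_eq_intros)
    have "\<bar>d\<bar> * \<bar>z\<bar> \<le> 1 * \<bar>z\<bar>"
      using d by (intro mult_right_mono) auto
    then have "d * z \<le> \<bar>z\<bar>"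
      using abs_le_D1[of "d * z" "\<bar>z\<bar>"] by (simp add: abs_mult)
    then have "exp (d * z - d\<^sup>2 / 2) \<le> exp \<bar>z\<bar>"
      by (smt (verit) exp_le_cancel_iff zero_le_power2 divide_nonneg_pos)
    moreover have "\<bar>z - d\<bar> \<le> exp \<bar>z\<bar>"
      using d exp_ge_add_one_self[of "\<bar>z\<bar>"] by (simp only: greaterThanLessThan_iff) arith
    ultimately have "exp (d * z - d\<^sup>2 / 2) * \<bar>z - d\<bar> \<le> exp \<bar>z\<bar> * exp \<bar>z\<bar>"
      by (intro mult_mono) auto
    also have "\<dots> = exp (2 * \<bar>z\<bar>)" by (simp add: exp_add [symmetric])
    finally show "\<bar>k (v + s * z) * (exp (d * z - d\<^sup>2 / 2) * (z - d))\<bar> \<le> B * exp (2 * \<bar>z\<bar>)"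
      using B B0 by (auto simp: abs_mult intro!: mult_mono)
  qed (use int integrable_gauss_exp_abs[of 2] in auto)
  then have 1: "((\<lambda>d. \<integral>z. k (v + s * (z + d)) \<partial>gauss) has_real_derivative
      (\<integral>z. z * k (v + s * z) \<partial>gauss)) (at ((v - v) / s))"
    by (simp add: eq mult.commute)
  have 2: "((\<lambda>v'. (v' - v) / s) has_real_derivative 1 / s) (at v)"
    using s by (auto intro!: derivative_eq_intros)
  have "((\<lambda>v'. \<integral>z. k (v + s * (z + (v' - v) / s)) \<partial>gauss) has_real_derivative
      (\<integral>z. z * k (v + s * z) \<partial>gauss) * (1 / s)) (at v)"
    using DERIV_chain2[OF 1 2] .
  moreover have "v + s * (z + (v' - v) / s) = v' + s * z" for v' z
    using s by (simp add: field_simps)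
  ultimately show ?thesis by simp
qed

text \<open>Continuity is local in time. The bounds available for dominated convergence hold only on
  bounded time intervals, so continuity is first obtained on slabs.\<close>

lemma continuous_on_halfspaceI:
  fixes f :: "real \<times> 'a::t2_space \<Rightarrow> 'b::topological_space"
  assumes "\<And>T. continuous_on ({0..T} \<times> X) f"
  shows "continuous_on ({0..} \<times> X) f"
  unfolding continuous_on_eq_continuous_within
proof (rule ballI)
  fix a :: "real \<times> 'a" assume a: "a \<in> {0..} \<times> X"
  define T where "T = fst a + 1"
  have "at a within {0..} \<times> X = at a within {0..T} \<times> X"
    by (rule at_within_nhd[where S = "{..<T} \<times> UNIV"])
       (use a in \<open>auto simp: T_def open_Times mem_Times_iff\<close>)
  moreover have "continuous (at a within {0..T} \<times> X) f"
    using assms[of T] a by (cases a) (auto simp: continuous_on_eq_continuous_within T_def)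
  ultimately show "continuous (at a within {0..} \<times> X) f" by simp
qed

section \<open>Averages of the Mehler kernel along a quarter circle\<close>

text \<open>Bounds are uniform in space but only locally uniform in time, because the functions in
  question may grow like exp (2 \<open>cgauss\<close> r).\<close>

definition bcont :: "(real \<Rightarrow> real \<Rightarrow> real) \<Rightarrow> bool" where
  "bcont k \<longleftrightarrow> continuous_on ({0..} \<times> UNIV) (\<lambda>(r, x). k r x) \<and>
     (\<forall>T. \<exists>B. \<forall>r\<in>{0..T}. \<forall>x. \<bar>k r x\<bar> \<le> B)"

lemma bcont_continuous: "bcont k \<Longrightarrow> continuous_on ({0..} \<times> UNIV) (\<lambda>(r, x). k r x)"
  by (simp add: bcont_def)

lemma bcont_bound:
  assumes "bcont k"
  obtains B where "B \<ge> 0" "\<And>r x. 0 \<le> r \<Longrightarrow> r \<le> T \<Longrightarrow> \<bar>k r x\<bar> \<le> B"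
proof -
  obtain B where B: "\<forall>r\<in>{0..T}. \<forall>x. \<bar>k r x\<bar> \<le> B"
    using assms by (metis bcont_def)
  show ?thesis by (rule that[of "max 0 B"]) (use B in \<open>auto simp: le_max_iff_disj\<close>)
qed

lemma bcont_space:
  assumes "bcont k" "0 \<le> r"
  shows "continuous_on UNIV (k r)"
proof -
  have "continuous_on UNIV (\<lambda>x. (\<lambda>(r, x). k r x) (r, x))"
    by (rule continuous_on_compose2[OF bcont_continuous[OF assms(1)]])
       (use assms(2) in \<open>auto intro!: continuous_intros\<close>)
  then show ?thesis by simp
qed

lemma bcont_measurable:
  assumes "bcont k" "0 \<le> r"
  shows "k r \<in> borel_measurable borel"
  using bcont_space[OF assms] by (rule borel_measurable_continuous_onI)

text \<open>This is Mehler's formula for the semigroup of h'' - y h' at time - ln (cos \<theta>).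
  The companion \<open>mehler1\<close> carries the first Hermite polynomial, which appears when a
  derivative falls on the kernel.\<close>

definition mehler :: "(real \<Rightarrow> real \<Rightarrow> real) \<Rightarrow> real \<Rightarrow> real \<Rightarrow> real \<Rightarrow> real" where
  "mehler k r y \<theta> = (\<integral>z. k r (y * cos \<theta> + sin \<theta> * z) \<partial>gauss)"

definition mehler1 :: "(real \<Rightarrow> real \<Rightarrow> real) \<Rightarrow> real \<Rightarrow> real \<Rightarrow> real \<Rightarrow> real" where
  "mehler1 k r y \<theta> = (\<integral>z. z * k r (y * cos \<theta> + sin \<theta> * z) \<partial>gauss)"

lemma gauss_integrable_bounded:
  fixes f :: "real \<Rightarrow> real"
  assumes "f \<in> borel_measurable borel" "\<And>z. \<bar>f z\<bar> \<le> B"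
  shows "integrable gauss f"
  by (rule gauss.integrable_const_bound[where B = B]) (use assms in \<open>auto simp: measurable_cong_sets[OF sets_gauss refl]\<close>)

lemma gauss_integrable_linear:
  fixes f :: "real \<Rightarrow> real"
  assumes "f \<in> borel_measurable borel" "\<And>z. \<bar>f z\<bar> \<le> B * (1 + \<bar>z\<bar>)"
  shows "integrable gauss f"
proof (rule Bochner_Integration.integrable_bound[OF integrable_gauss_linear[of B]])
  show "AE z in gauss. norm (f z) \<le> norm (B * (1 + \<bar>z\<bar>))"
    using assms(2) by (intro AE_I2) (smt (verit) real_norm_def)
qed (use assms in \<open>auto simp: measurable_cong_sets[OF sets_gauss refl]\<close>)

lemma gabs_nonneg: "0 \<le> gabs"
  by (simp add: gabs_def)

lemma mehler_bound:
  assumes "bcont k" "0 \<le> r" "\<And>x. \<bar>k r x\<bar> \<le> B"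
  shows "\<bar>mehler k r y \<theta>\<bar> \<le> B" "\<bar>mehler1 k r y \<theta>\<bar> \<le> B * gabs"
proof -
  note [measurable] = bcont_measurable[OF assms(1,2)]
  have B: "B \<ge> 0" using assms(3)[of 0] by linarith
  have int: "integrable gauss (\<lambda>z. k r (y * cos \<theta> + sin \<theta> * z))"
    by (rule gauss_integrable_bounded[where B = B]) (use assms in auto)
  have "\<bar>mehler k r y \<theta>\<bar> \<le> (\<integral>z. \<bar>k r (y * cos \<theta> + sin \<theta> * z)\<bar> \<partial>gauss)"
    unfolding mehler_def by (rule integral_abs_bound)
  also have "\<dots> \<le> (\<integral>z. B \<partial>gauss)"
    by (rule integral_mono) (use int assms(3) in auto)
  finally show "\<bar>mehler k r y \<theta>\<bar> \<le> B" using gauss.prob_space by simp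
  have 1: "\<bar>z * k r (y * cos \<theta> + sin \<theta> * z)\<bar> \<le> B * \<bar>z\<bar>" for z
    using mult_left_mono[OF assms(3), of "\<bar>z\<bar>"] by (simp add: abs_mult mult.commute)
  have int: "integrable gauss (\<lambda>z. z * k r (y * cos \<theta> + sin \<theta> * z))"
    by (rule gauss_integrable_linear[where B = B])
       (use order_trans[OF 1] B in \<open>auto simp: distrib_left\<close>)
  have "\<bar>mehler1 k r y \<theta>\<bar> \<le> (\<integral>z. \<bar>z * k r (y * cos \<theta> + sin \<theta> * z)\<bar> \<partial>gauss)"
    unfolding mehler1_def by (rule integral_abs_bound)
  also have "\<dots> \<le> (\<integral>z. B * \<bar>z\<bar> \<partial>gauss)"
    by (rule integral_mono) (use int 1 integrable_gauss_abs in auto)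
  finally show "\<bar>mehler1 k r y \<theta>\<bar> \<le> B * gabs" by (simp add: gabs_def)
qed

lemma continuous_on_mehler_arg:
  assumes "bcont k"
  shows "continuous_on ({0..} \<times> UNIV) (\<lambda>(r, y, \<theta>). k r (y * cos \<theta> + sin \<theta> * z))"
proof -
  have "continuous_on ({0..} \<times> UNIV) (\<lambda>p::real \<times> real \<times> real.
     (\<lambda>(r, x). k r x) (fst p, fst (snd p) * cos (snd (snd p)) + sin (snd (snd p)) * z))"
    by (rule continuous_on_compose2[OF bcont_continuous[OF assms]]) (auto intro!: continuous_intros)
  then show ?thesis by (simp add: case_prod_beta)
qed

lemma continuous_on_mehler:
  assumes "bcont k"
  shows "continuous_on ({0..} \<times> UNIV) (\<lambda>(r, y, \<theta>). mehler k r y \<theta>)"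
    and "continuous_on ({0..} \<times> UNIV) (\<lambda>(r, y, \<theta>). mehler1 k r y \<theta>)"
proof -
  show "continuous_on ({0..} \<times> UNIV) (\<lambda>(r, y, \<theta>). mehler k r y \<theta>)"
  proof (rule continuous_on_halfspaceI)
    fix T :: real
    have sub: "{0..T} \<times> (UNIV :: (real \<times> real) set) \<subseteq> {0..} \<times> UNIV" by auto
    obtain B where B: "B \<ge> 0" "\<And>r x. 0 \<le> r \<Longrightarrow> r \<le> T \<Longrightarrow> \<bar>k r x\<bar> \<le> B"
      using bcont_bound[OF assms] by blast
    show "continuous_on ({0..T} \<times> UNIV) (\<lambda>(r, y, \<theta>). mehler k r y \<theta>)"
      unfolding mehler_def case_prod_beta
    proof (rule continuous_on_integral_dominated[where g = "\<lambda>_. B"])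
      fix z
      show "continuous_on ({0..T} \<times> UNIV) (\<lambda>x. k (fst x)
          (fst (snd x) * cos (snd (snd x)) + sin (snd (snd x)) * z))"
        using continuous_on_subset[OF continuous_on_mehler_arg[OF assms, of z] sub]
        by (auto simp: case_prod_beta)
    qed (use B assms bcont_measurable[OF assms] in auto)
  qed
  show "continuous_on ({0..} \<times> UNIV) (\<lambda>(r, y, \<theta>). mehler1 k r y \<theta>)"
  proof (rule continuous_on_halfspaceI)
    fix T :: real
    have sub: "{0..T} \<times> (UNIV :: (real \<times> real) set) \<subseteq> {0..} \<times> UNIV" by auto
    obtain B where B: "B \<ge> 0" "\<And>r x. 0 \<le> r \<Longrightarrow> r \<le> T \<Longrightarrow> \<bar>k r x\<bar> \<le> B"
      using bcont_bound[OF assms] by blast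
    show "continuous_on ({0..T} \<times> UNIV) (\<lambda>(r, y, \<theta>). mehler1 k r y \<theta>)"
      unfolding mehler1_def case_prod_beta
    proof (rule continuous_on_integral_dominated[where g = "\<lambda>z. B * \<bar>z\<bar>"])
      fix z
      show "continuous_on ({0..T} \<times> UNIV) (\<lambda>x. z * k (fst x)
          (fst (snd x) * cos (snd (snd x)) + sin (snd (snd x)) * z))"
        using continuous_on_subset[OF continuous_on_mehler_arg[OF assms, of z] sub]
        by (intro continuous_on_mult_left) (auto simp: case_prod_beta)
      show "\<bar>z * k (fst x) (fst (snd x) * cos (snd (snd x)) + sin (snd (snd x)) * z)\<bar> \<le> B * \<bar>z\<bar>"
        if "x \<in> {0..T} \<times> UNIV" for x
        using mult_left_mono[OF B(2)[of "fst x"], of "\<bar>z\<bar>"] that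
        by (auto simp: abs_mult mult.commute)
    qed (use B assms bcont_measurable[OF assms] integrable_gauss_abs in auto)
  qed
qed

text \<open>With r = \<tau> cos \<theta>, hence |dr| = \<tau> sin \<theta> d\<theta>, the product of
  \<tau> and \<open>ouint sin k\<close> is a Duhamel integral over the times in [0, \<tau>]. The
  weight \<open>a\<close> is left free because differentiation turns sin into cos or into products
  of the two.\<close>

definition ouint :: "(real \<Rightarrow> real) \<Rightarrow> (real \<Rightarrow> real \<Rightarrow> real) \<Rightarrow> real \<Rightarrow> real \<Rightarrow> real" where
  "ouint a k \<tau> y = integral {0..pi/2} (\<lambda>\<theta>. a \<theta> * mehler k (\<tau> * cos \<theta>) y \<theta>)"

definition ouint1 :: "(real \<Rightarrow> real) \<Rightarrow> (real \<Rightarrow> real \<Rightarrow> real) \<Rightarrow> real \<Rightarrow> real \<Rightarrow> real" where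
  "ouint1 a k \<tau> y = integral {0..pi/2} (\<lambda>\<theta>. a \<theta> * mehler1 k (\<tau> * cos \<theta>) y \<theta>)"

lemma cos_quarter: "\<theta> \<in> {0..pi/2} \<Longrightarrow> 0 \<le> cos \<theta>" "\<theta> \<in> {0..pi/2} \<Longrightarrow> 0 \<le> sin \<theta>"
  by (auto intro!: cos_ge_zero sin_ge_zero)

lemma continuous_on_mehler_quarter:
  assumes k: "bcont k" and a: "continuous_on {0..pi/2} a"
  shows "continuous_on (({0..} \<times> UNIV) \<times> {0..pi/2})
           (\<lambda>(x, \<theta>). a \<theta> * mehler k (fst x * cos \<theta>) (snd x) \<theta>)" (is ?A)
    and "continuous_on (({0..} \<times> UNIV) \<times> {0..pi/2})
           (\<lambda>(x, \<theta>). a \<theta> * mehler1 k (fst x * cos \<theta>) (snd x) \<theta>)" (is ?B)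
proof -
  have a': "continuous_on (({0..} \<times> UNIV) \<times> {0..pi/2}) (\<lambda>p::(real \<times> real) \<times> real. a (snd p))"
    by (rule continuous_on_compose2[OF a]) (auto intro!: continuous_intros)
  have "continuous_on (({0..} \<times> UNIV) \<times> {0..pi/2}) (\<lambda>p::(real \<times> real) \<times> real.
     (\<lambda>(r, y, \<theta>). mehler k r y \<theta>) (fst (fst p) * cos (snd p), snd (fst p), snd p))"
    by (rule continuous_on_compose2[OF continuous_on_mehler(1)[OF k]])
       (auto intro!: continuous_intros mult_nonneg_nonneg cos_quarter)
  from continuous_on_mult[OF a' this] show ?A by (simp add: case_prod_beta)
  have "continuous_on (({0..} \<times> UNIV) \<times> {0..pi/2}) (\<lambda>p::(real \<times> real) \<times> real.
     (\<lambda>(r, y, \<theta>). mehler1 k r y \<theta>) (fst (fst p) * cos (snd p), snd (fst p), snd p))"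
    by (rule continuous_on_compose2[OF continuous_on_mehler(2)[OF k]])
       (auto intro!: continuous_intros mult_nonneg_nonneg cos_quarter)
  from continuous_on_mult[OF a' this] show ?B by (simp add: case_prod_beta)
qed

lemma integrable_mehler_quarter:
  assumes k: "bcont k" and a: "continuous_on {0..pi/2} a" and \<tau>: "0 \<le> \<tau>"
  shows "(\<lambda>\<theta>. a \<theta> * mehler k (\<tau> * cos \<theta>) y \<theta>) integrable_on {0..pi/2}"
    and "(\<lambda>\<theta>. a \<theta> * mehler1 k (\<tau> * cos \<theta>) y \<theta>) integrable_on {0..pi/2}"
proof -
  show "(\<lambda>\<theta>. a \<theta> * mehler k (\<tau> * cos \<theta>) y \<theta>) integrable_on {0..pi/2}"
  proof (rule integrable_continuous_real)
    have "continuous_on {0..pi/2} (\<lambda>\<theta>. (\<lambda>(x, \<theta>). a \<theta> * mehler k (fst x * cos \<theta>) (snd x) \<theta>) ((\<tau>, y), \<theta>))"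
      by (rule continuous_on_compose2[OF continuous_on_mehler_quarter(1)[OF k a]])
         (use \<tau> in \<open>auto intro!: continuous_intros\<close>)
    then show "continuous_on {0..pi/2} (\<lambda>\<theta>. a \<theta> * mehler k (\<tau> * cos \<theta>) y \<theta>)" by simp
  qed
  show "(\<lambda>\<theta>. a \<theta> * mehler1 k (\<tau> * cos \<theta>) y \<theta>) integrable_on {0..pi/2}"
  proof (rule integrable_continuous_real)
    have "continuous_on {0..pi/2} (\<lambda>\<theta>. (\<lambda>(x, \<theta>). a \<theta> * mehler1 k (fst x * cos \<theta>) (snd x) \<theta>) ((\<tau>, y), \<theta>))"
      by (rule continuous_on_compose2[OF continuous_on_mehler_quarter(2)[OF k a]])
         (use \<tau> in \<open>auto intro!: continuous_intros\<close>)
    then show "continuous_on {0..pi/2} (\<lambda>\<theta>. a \<theta> * mehler1 k (\<tau> * cos \<theta>) y \<theta>)" by simp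
  qed
qed

lemma quarter_arg:
  assumes "\<theta> \<in> {0..pi/2}" "0 \<le> r" "r \<le> T"
  shows "0 \<le> r * cos \<theta>" "r * cos \<theta> \<le> T"
proof -
  show "0 \<le> r * cos \<theta>" by (rule mult_nonneg_nonneg[OF assms(2) cos_quarter(1)[OF assms(1)]])
  have "r * cos \<theta> \<le> r * 1" by (rule mult_left_mono[OF cos_le_one assms(2)])
  then show "r * cos \<theta> \<le> T" using assms(3) by linarith
qed

lemma bcont_ouint:
  assumes k: "bcont k" and a: "continuous_on {0..pi/2} a"
  shows "bcont (ouint a k)" "bcont (ouint1 a k)"
proof -
  obtain A where A: "\<And>\<theta>. \<theta> \<in> {0..pi/2} \<Longrightarrow> \<bar>a \<theta>\<bar> \<le> A"
    using compact_continuous_image[OF a compact_Icc, THEN compact_imp_bounded]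
    unfolding bounded_iff by (metis imageI real_norm_def)
  have A0: "A \<ge> 0" using A[of 0] by (auto intro: order_trans[OF abs_ge_zero])
  have bd: "\<bar>integral {0..pi/2} (\<lambda>\<theta>. a \<theta> * m \<theta>)\<bar> \<le> (A * C) * (pi / 2)"
    if "\<And>\<theta>. \<theta> \<in> {0..pi/2} \<Longrightarrow> \<bar>m \<theta>\<bar> \<le> C" "C \<ge> 0"
      "(\<lambda>\<theta>. a \<theta> * m \<theta>) integrable_on {0..pi/2}" for m C
  proof -
    have "norm (a \<theta> * m \<theta>) \<le> A * C" if "\<theta> \<in> cbox 0 (pi/2)" for \<theta>
      using that A A0 \<open>C \<ge> 0\<close> \<open>\<And>\<theta>. \<theta> \<in> {0..pi/2} \<Longrightarrow> \<bar>m \<theta>\<bar> \<le> C\<close>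
      by (auto simp: abs_mult intro!: mult_mono)
    then show ?thesis
      using has_integral_bound[OF _ integrable_integral[OF that(3), folded cbox_interval], of "A * C"]
        A0 that(2) by (simp del: cbox_interval)
  qed
  show "bcont (ouint a k)"
    unfolding bcont_def
  proof (intro conjI allI)
    show "continuous_on ({0..} \<times> UNIV) (\<lambda>(r, x). ouint a k r x)"
      using integral_continuous_on_param[of "{0..} \<times> UNIV" 0 "pi/2",
          OF continuous_on_mehler_quarter(1)[OF k a, folded cbox_interval]]
      by (simp add: ouint_def case_prod_beta)
    fix T
    obtain B where B: "B \<ge> 0" "\<And>r x. 0 \<le> r \<Longrightarrow> r \<le> T \<Longrightarrow> \<bar>k r x\<bar> \<le> B"
      using bcont_bound[OF k] by blast
    have "\<bar>ouint a k r x\<bar> \<le> (A * B) * (pi / 2)" if "r \<in> {0..T}" for r x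
      unfolding ouint_def
    proof (rule bd)
      fix \<theta> assume t: "\<theta> \<in> {0..pi/2}"
      have "0 \<le> r" "r \<le> T" using that by auto
      note r = quarter_arg[OF t this]
      show "\<bar>mehler k (r * cos \<theta>) x \<theta>\<bar> \<le> B"
        by (rule mehler_bound(1)[OF k r(1) B(2)[OF r]])
    next
      show "(\<lambda>\<theta>. a \<theta> * mehler k (r * cos \<theta>) x \<theta>) integrable_on {0..pi/2}"
        by (rule integrable_mehler_quarter(1)[OF k a]) (use that in simp)
    qed (use B in simp)
    then show "\<exists>B. \<forall>r\<in>{0..T}. \<forall>x. \<bar>ouint a k r x\<bar> \<le> B" by blast
  qed
  show "bcont (ouint1 a k)"
    unfolding bcont_def
  proof (intro conjI allI)
    show "continuous_on ({0..} \<times> UNIV) (\<lambda>(r, x). ouint1 a k r x)"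
      using integral_continuous_on_param[of "{0..} \<times> UNIV" 0 "pi/2",
          OF continuous_on_mehler_quarter(2)[OF k a, folded cbox_interval]]
      by (simp add: ouint1_def case_prod_beta)
    fix T
    obtain B where B: "B \<ge> 0" "\<And>r x. 0 \<le> r \<Longrightarrow> r \<le> T \<Longrightarrow> \<bar>k r x\<bar> \<le> B"
      using bcont_bound[OF k] by blast
    have "\<bar>ouint1 a k r x\<bar> \<le> (A * (B * gabs)) * (pi / 2)" if "r \<in> {0..T}" for r x
      unfolding ouint1_def
    proof (rule bd)
      fix \<theta> assume t: "\<theta> \<in> {0..pi/2}"
      have "0 \<le> r" "r \<le> T" using that by auto
      note r = quarter_arg[OF t this]
      show "\<bar>mehler1 k (r * cos \<theta>) x \<theta>\<bar> \<le> B * gabs"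
        by (rule mehler_bound(2)[OF k r(1) B(2)[OF r]])
    next
      show "(\<lambda>\<theta>. a \<theta> * mehler1 k (r * cos \<theta>) x \<theta>) integrable_on {0..pi/2}"
        by (rule integrable_mehler_quarter(2)[OF k a]) (use that in simp)
    qed (use B gabs_nonneg in simp)
    then show "\<exists>B. \<forall>r\<in>{0..T}. \<forall>x. \<bar>ouint1 a k r x\<bar> \<le> B" by blast
  qed
qed

lemma continuous_on_mehler_section:
  assumes k: "bcont k" and a: "continuous_on {0..pi/2} a" and \<tau>: "0 \<le> \<tau>"
  shows "continuous_on (UNIV \<times> {0..pi/2}) (\<lambda>(y, \<theta>). a \<theta> * mehler k (\<tau> * cos \<theta>) y \<theta>)"
    and "continuous_on (UNIV \<times> {0..pi/2}) (\<lambda>(y, \<theta>). a \<theta> * mehler1 k (\<tau> * cos \<theta>) y \<theta>)"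
proof -
  have "continuous_on (UNIV \<times> {0..pi/2}) (\<lambda>p. (\<lambda>(x, \<theta>). a \<theta> * mehler k (fst x * cos \<theta>) (snd x) \<theta>)
      ((\<tau>, fst p), snd p))"
    by (rule continuous_on_compose2[OF continuous_on_mehler_quarter(1)[OF k a]])
       (use \<tau> in \<open>auto intro!: continuous_intros\<close>)
  then show "continuous_on (UNIV \<times> {0..pi/2}) (\<lambda>(y, \<theta>). a \<theta> * mehler k (\<tau> * cos \<theta>) y \<theta>)"
    by (simp add: case_prod_beta)
  have "continuous_on (UNIV \<times> {0..pi/2}) (\<lambda>p. (\<lambda>(x, \<theta>). a \<theta> * mehler1 k (fst x * cos \<theta>) (snd x) \<theta>)
      ((\<tau>, fst p), snd p))"
    by (rule continuous_on_compose2[OF continuous_on_mehler_quarter(2)[OF k a]])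
       (use \<tau> in \<open>auto intro!: continuous_intros\<close>)
  then show "continuous_on (UNIV \<times> {0..pi/2}) (\<lambda>(y, \<theta>). a \<theta> * mehler1 k (\<tau> * cos \<theta>) y \<theta>)"
    by (simp add: case_prod_beta)
qed

text \<open>The factor \<open>sin \<theta>\<close> cancels the singularity of the gradient of the Mehler kernel.\<close>

lemma ouint_derivative:
  assumes k: "bcont k" and b: "continuous_on {0..pi/2} b" and \<tau>: "0 \<le> \<tau>"
  shows "((\<lambda>y. ouint (\<lambda>\<theta>. sin \<theta> * b \<theta>) k \<tau> y) has_real_derivative
           ouint1 (\<lambda>\<theta>. cos \<theta> * b \<theta>) k \<tau> y) (at y)"
proof -
  have cs: "continuous_on {0..pi/2} (\<lambda>\<theta>. sin \<theta> * b \<theta>)" "continuous_on {0..pi/2} (\<lambda>\<theta>. cos \<theta> * b \<theta>)"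
    using b by (auto intro!: continuous_intros)
  have "((\<lambda>y. integral (cbox 0 (pi/2)) (\<lambda>\<theta>. sin \<theta> * b \<theta> * mehler k (\<tau> * cos \<theta>) y \<theta>)) has_field_derivative
      integral (cbox 0 (pi/2)) (\<lambda>\<theta>. cos \<theta> * b \<theta> * mehler1 k (\<tau> * cos \<theta>) y \<theta>)) (at y within UNIV)"
  proof (rule leibniz_rule_field_derivative)
    fix y \<theta> :: real assume "\<theta> \<in> cbox 0 (pi/2)"
    then have t: "\<theta> \<in> {0..pi/2}" by simp
    then have r: "0 \<le> \<tau> * cos \<theta>" using \<tau> cos_quarter by auto
    note [measurable] = bcont_measurable[OF k r]
    obtain B where B: "B \<ge> 0" "\<And>x. \<bar>k (\<tau> * cos \<theta>) x\<bar> \<le> B"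
      using bcont_bound[OF k, of "\<tau> * cos \<theta>"] r by (metis order_refl)
    show "((\<lambda>y. sin \<theta> * b \<theta> * mehler k (\<tau> * cos \<theta>) y \<theta>) has_real_derivative
        cos \<theta> * b \<theta> * mehler1 k (\<tau> * cos \<theta>) y \<theta>) (at y within UNIV)"
    \<comment> \<open>At \<theta> = 0 the kernel is a point mass and cannot be differentiated, but
      both sides vanish: the left through its weight, the right because the Gaussian has mean
      0.\<close>
    proof (cases "sin \<theta> = 0")
      case True
      then have "\<theta> = 0"
        using t sin_gt_zero[of \<theta>] pi_half_less_two pi_gt_zero by (auto simp: less_le)
      moreover have "(\<integral>z. z \<partial>gauss) = 0"
      proof -
        have "(\<integral>z. z \<partial>gauss) = (\<integral>z. std_normal_density z * z ^ (2 * 0 + 1) \<partial>lborel)"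
          by (subst integral_gauss) auto
        also have "\<dots> = 0"
          using std_normal_moment_odd[of 0] by (rule has_bochner_integral_integral_eq)
        finally show ?thesis .
      qed
      ultimately show ?thesis
        by (simp add: mehler_def mehler1_def)
    next
      case False
      have 1: "((\<lambda>v. \<integral>z. k (\<tau> * cos \<theta>) (v + sin \<theta> * z) \<partial>gauss) has_real_derivative
          mehler1 k (\<tau> * cos \<theta>) y \<theta> / sin \<theta>) (at (y * cos \<theta>))"
        unfolding mehler1_def
        by (rule gauss_convolution_derivative[OF _ B(2) False]) measurable
      have 2: "((\<lambda>y. y * cos \<theta>) has_real_derivative cos \<theta>) (at y)"
        by (auto intro!: derivative_eq_intros)
      have "((\<lambda>y. sin \<theta> * b \<theta> * (\<integral>z. k (\<tau> * cos \<theta>) (y * cos \<theta> + sin \<theta> * z) \<partial>gauss)) has_real_derivative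
          (sin \<theta> * b \<theta>) * (mehler1 k (\<tau> * cos \<theta>) y \<theta> / sin \<theta> * cos \<theta>)) (at y)"
        by (intro DERIV_cmult DERIV_chain2[OF 1 2])
      then show ?thesis using False by (simp add: mehler_def mult_ac)
    qed
  next
    show "continuous_on (UNIV \<times> cbox 0 (pi / 2)) (\<lambda>(y, \<theta>). cos \<theta> * b \<theta> * mehler1 k (\<tau> * cos \<theta>) y \<theta>)"
      using continuous_on_mehler_section(2)[OF k cs(2) \<tau>] by simp
  qed (use integrable_mehler_quarter(1)[OF k cs(1) \<tau>] in auto)
  then show ?thesis by (simp add: ouint_def ouint1_def)
qed

text \<open>Here the derivative falls on \<open>k\<close> instead of the kernel. The derivative in
  \<theta> is the one that later replaces a time derivative of \<open>k\<close>.\<close>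

lemma mehler_derivative:
  assumes k: "bcont k" and k': "bcont k'" and r: "0 \<le> r"
    and d: "\<And>x. (k r has_real_derivative k' r x) (at x)"
  shows "((\<lambda>y. mehler k r y \<theta>) has_real_derivative cos \<theta> * mehler k' r y \<theta>) (at y)"
    and "((\<lambda>\<theta>. mehler k r y \<theta>) has_real_derivative
            - y * sin \<theta> * mehler k' r y \<theta> + cos \<theta> * mehler1 k' r y \<theta>) (at \<theta>)"
proof -
  note [measurable] = bcont_measurable[OF k r] bcont_measurable[OF k' r]
  obtain B where B: "B \<ge> 0" "\<And>x. \<bar>k r x\<bar> \<le> B"
    using bcont_bound[OF k, of r] r by (metis order_refl)
  obtain B' where B': "B' \<ge> 0" "\<And>x. \<bar>k' r x\<bar> \<le> B'"
    using bcont_bound[OF k', of r] r by (metis order_refl)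
  have int: "integrable gauss (\<lambda>z. k r (u z))" if "u \<in> borel_measurable borel" for u
    by (rule gauss_integrable_bounded[where B = B]) (use that B in auto)
  have int': "integrable gauss (\<lambda>z. k' r (y * cos \<theta> + sin \<theta> * z))"
    by (rule gauss_integrable_bounded[where B = B']) (use B' in auto)
  have int1': "integrable gauss (\<lambda>z. z * k' r (y * cos \<theta> + sin \<theta> * z))"
  proof (rule gauss_integrable_linear[where B = B'])
    show "\<bar>z * k' r (y * cos \<theta> + sin \<theta> * z)\<bar> \<le> B' * (1 + \<bar>z\<bar>)" for z
    proof -
      have "\<bar>z * k' r (y * cos \<theta> + sin \<theta> * z)\<bar> \<le> \<bar>z\<bar> * B'"
        unfolding abs_mult using B' by (intro mult_left_mono) auto
      then show ?thesis using B' by (simp add: algebra_simps)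
    qed
  qed simp
  have "((\<lambda>y. mehler k r y \<theta>) has_real_derivative
      (\<integral>z. k' r (y * cos \<theta> + sin \<theta> * z) * cos \<theta> \<partial>gauss)) (at y)"
    unfolding mehler_def
  proof (rule has_real_derivative_integral_dominated[where S = UNIV and g = "\<lambda>_. B'"
        and f' = "\<lambda>y z. k' r (y * cos \<theta> + sin \<theta> * z) * cos \<theta>"])
    fix y z
    show "((\<lambda>y. k r (y * cos \<theta> + sin \<theta> * z)) has_real_derivative
        k' r (y * cos \<theta> + sin \<theta> * z) * cos \<theta>) (at y)"
      by (rule DERIV_chain2[OF d]) (auto intro!: derivative_eq_intros)
    have "\<bar>k' r (y * cos \<theta> + sin \<theta> * z)\<bar> * \<bar>cos \<theta>\<bar> \<le> B' * 1"
      using B' by (intro mult_mono) auto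
    then show "\<bar>k' r (y * cos \<theta> + sin \<theta> * z) * cos \<theta>\<bar> \<le> B'" by (simp add: abs_mult)
    show "(\<lambda>z. k' r (y * cos \<theta> + sin \<theta> * z) * cos \<theta>) \<in> borel_measurable gauss"
      by measurable
  qed (auto intro!: int)
  then show "((\<lambda>y. mehler k r y \<theta>) has_real_derivative cos \<theta> * mehler k' r y \<theta>) (at y)"
    by (simp add: mehler_def mult.commute)
  have "((\<lambda>\<theta>. mehler k r y \<theta>) has_real_derivative
      (\<integral>z. k' r (y * cos \<theta> + sin \<theta> * z) * (- y * sin \<theta> + cos \<theta> * z) \<partial>gauss)) (at \<theta>)"
    unfolding mehler_def
  proof (rule has_real_derivative_integral_dominated[where S = UNIV
        and g = "\<lambda>z. (B' * (1 + \<bar>y\<bar>)) * (1 + \<bar>z\<bar>)"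
        and f' = "\<lambda>\<theta> z. k' r (y * cos \<theta> + sin \<theta> * z) * (- y * sin \<theta> + cos \<theta> * z)"])
    fix \<theta> z
    show "((\<lambda>\<theta>. k r (y * cos \<theta> + sin \<theta> * z)) has_real_derivative
        k' r (y * cos \<theta> + sin \<theta> * z) * (- y * sin \<theta> + cos \<theta> * z)) (at \<theta>)"
      by (rule DERIV_chain2[OF d]) (auto intro!: derivative_eq_intros)
    have "\<bar>- y * sin \<theta> + cos \<theta> * z\<bar> \<le> \<bar>y\<bar> * \<bar>sin \<theta>\<bar> + \<bar>cos \<theta>\<bar> * \<bar>z\<bar>"
      by (metis abs_minus_cancel abs_mult abs_triangle_ineq mult_minus_left)
    also have "\<dots> \<le> \<bar>y\<bar> * 1 + 1 * \<bar>z\<bar>"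
      by (intro add_mono mult_mono) auto
    also have "\<dots> \<le> (1 + \<bar>y\<bar>) * (1 + \<bar>z\<bar>)" by (simp add: algebra_simps)
    finally have "\<bar>k' r (y * cos \<theta> + sin \<theta> * z)\<bar> * \<bar>- y * sin \<theta> + cos \<theta> * z\<bar>
        \<le> B' * ((1 + \<bar>y\<bar>) * (1 + \<bar>z\<bar>))"
      using B' by (intro mult_mono) auto
    then show "\<bar>k' r (y * cos \<theta> + sin \<theta> * z) * (- y * sin \<theta> + cos \<theta> * z)\<bar>
        \<le> (B' * (1 + \<bar>y\<bar>)) * (1 + \<bar>z\<bar>)" by (simp add: abs_mult mult.assoc)
  qed (auto intro!: int integrable_gauss_abs integrable_gauss_linear simp del: integrable_mult_left_iff integrable_mult_right_iff)
  also have "(\<integral>z. k' r (y * cos \<theta> + sin \<theta> * z) * (- y * sin \<theta> + cos \<theta> * z) \<partial>gauss)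
      = (\<integral>z. (- y * sin \<theta>) * k' r (y * cos \<theta> + sin \<theta> * z)
          + cos \<theta> * (z * k' r (y * cos \<theta> + sin \<theta> * z)) \<partial>gauss)"
    by (simp add: algebra_simps)
  also have "\<dots> = - y * sin \<theta> * mehler k' r y \<theta> + cos \<theta> * mehler1 k' r y \<theta>"
    unfolding mehler_def mehler1_def using int' int1' by (subst Bochner_Integration.integral_add) auto
  finally show "((\<lambda>\<theta>. mehler k r y \<theta>) has_real_derivative
      - y * sin \<theta> * mehler k' r y \<theta> + cos \<theta> * mehler1 k' r y \<theta>) (at \<theta>)" .
qed

text \<open>A second formula for the spatial derivative, with the derivative on the source.
  Comparing it with \<open>ouint_derivative\<close> by uniqueness of derivatives replaces an
  integration by parts.\<close>

lemma ouint_derivative':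
  assumes k: "bcont k" and k': "bcont k'" and a: "continuous_on {0..pi/2} a" and \<tau>: "0 \<le> \<tau>"
    and d: "\<And>r x. 0 \<le> r \<Longrightarrow> (k r has_real_derivative k' r x) (at x)"
  shows "((\<lambda>y. ouint a k \<tau> y) has_real_derivative ouint (\<lambda>\<theta>. a \<theta> * cos \<theta>) k' \<tau> y) (at y)"
proof -
  have cs: "continuous_on {0..pi/2} (\<lambda>\<theta>. a \<theta> * cos \<theta>)"
    using a by (auto intro!: continuous_intros)
  have "((\<lambda>y. integral (cbox 0 (pi/2)) (\<lambda>\<theta>. a \<theta> * mehler k (\<tau> * cos \<theta>) y \<theta>)) has_field_derivative
      integral (cbox 0 (pi/2)) (\<lambda>\<theta>. a \<theta> * cos \<theta> * mehler k' (\<tau> * cos \<theta>) y \<theta>)) (at y within UNIV)"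
  proof (rule leibniz_rule_field_derivative)
    fix y \<theta> :: real assume "\<theta> \<in> cbox 0 (pi/2)"
    then have r: "0 \<le> \<tau> * cos \<theta>" using \<tau> cos_quarter by auto
    show "((\<lambda>y. a \<theta> * mehler k (\<tau> * cos \<theta>) y \<theta>) has_real_derivative
        a \<theta> * cos \<theta> * mehler k' (\<tau> * cos \<theta>) y \<theta>) (at y within UNIV)"
      using DERIV_cmult[OF mehler_derivative(1)[OF k k' r d[OF r]]] by (simp add: mult.assoc)
  next
    show "continuous_on (UNIV \<times> cbox 0 (pi / 2)) (\<lambda>(y, \<theta>). a \<theta> * cos \<theta> * mehler k' (\<tau> * cos \<theta>) y \<theta>)"
      using continuous_on_mehler_section(1)[OF k' cs \<tau>] by simp
  qed (use integrable_mehler_quarter(1)[OF k a \<tau>] in auto)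
  then show ?thesis by (simp add: ouint_def)
qed

lemma integral_has_real_derivative_halfline:
  fixes g :: "real \<Rightarrow> real"
  assumes "continuous_on {0..} g" "0 \<le> R"
  shows "((\<lambda>R. integral {0..R} g) has_real_derivative g R) (at R within {0..})"
proof -
  have "at R within {0..} = at R within {0..R + 1}"
    by (rule at_within_nhd[where S = "{..<R + 1}"]) (use assms in auto)
  moreover have "((\<lambda>R. integral {0..R} g) has_real_derivative g R) (at R within {0..R + 1})"
    by (rule integral_has_real_derivative) (use assms in \<open>auto intro: continuous_on_subset\<close>)
  ultimately show ?thesis by simp
qed

text \<open>Integrating \<open>d/d\<theta>\<close> of \<open>\<integral>\<^sub>0\<^bsup>\<tau> cos \<theta>\<^esup> K r \<theta> dr\<close> over \<open>\<theta>\<close> moves the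
  \<open>\<tau>\<close>-dependence out of the argument of \<open>K\<close>, whose time derivative need not exist.\<close>

lemma time_derivative_quarter:
  fixes K K' :: "real \<Rightarrow> real \<Rightarrow> real"
  assumes cK: "continuous_on ({0..} \<times> {0..pi/2}) (\<lambda>(r, \<theta>). K r \<theta>)"
    and cK': "continuous_on ({0..} \<times> {0..pi/2}) (\<lambda>(r, \<theta>). K' r \<theta>)"
    and d: "\<And>r \<theta>. 0 \<le> r \<Longrightarrow> \<theta> \<in> {0..pi/2} \<Longrightarrow>
              (K r has_real_derivative K' r \<theta>) (at \<theta> within {0..pi/2})"
    and \<tau>: "0 < \<tau>"
  shows "((\<lambda>\<tau>. \<tau> * integral {0..pi/2} (\<lambda>\<theta>. sin \<theta> * K (\<tau> * cos \<theta>) \<theta>)) has_real_derivative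
           K \<tau> 0 + integral {0..pi/2} (\<lambda>\<theta>. cos \<theta> * K' (\<tau> * cos \<theta>) \<theta>)) (at \<tau>)"
proof -
  let ?X = "{0..pi/2::real}"
  define KK where "KK R \<theta> = integral {0..R} (\<lambda>r. K r \<theta>)" for R \<theta>
  define KK' where "KK' R \<theta> = integral {0..R} (\<lambda>r. K' r \<theta>)" for R \<theta>
  have sec: "continuous_on {0..} (\<lambda>r. g r \<theta>)"
    if "continuous_on ({0..} \<times> ?X) (\<lambda>(r, \<theta>). g r \<theta>)" "\<theta> \<in> ?X" for g :: "real \<Rightarrow> real \<Rightarrow> real" and \<theta>
    using continuous_on_compose2[OF that(1), of "{0..}" "\<lambda>r. (r, \<theta>)"] that(2)
    by (simp add: image_subset_iff continuous_on_Pair continuous_on_const continuous_on_id)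
  have dR: "((\<lambda>R. KK R \<theta>) has_real_derivative K R \<theta>) (at R within {0..})"
    "((\<lambda>R. KK' R \<theta>) has_real_derivative K' R \<theta>) (at R within {0..})"
    if "0 \<le> R" "\<theta> \<in> ?X" for R \<theta>
    unfolding KK_def KK'_def
    by (intro integral_has_real_derivative_halfline sec cK cK' that)+
  have dT: "(KK R has_real_derivative KK' R \<theta>) (at \<theta> within ?X)" if "0 \<le> R" "\<theta> \<in> ?X" for R \<theta>
  proof -
    have "((\<lambda>\<theta>. integral (cbox 0 R) (\<lambda>r. K r \<theta>)) has_field_derivative
        integral (cbox 0 R) (\<lambda>r. K' r \<theta>)) (at \<theta> within ?X)"
    proof (rule leibniz_rule_field_derivative)
      show "(\<lambda>r. K r \<theta>) integrable_on cbox 0 R" if "\<theta> \<in> ?X" for \<theta>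
        using continuous_on_subset[OF sec[OF cK that], of "{0..R}"]
        by (simp add: integrable_continuous_real)
      have "continuous_on (?X \<times> {0..R}) (\<lambda>p. (\<lambda>(r, \<theta>). K' r \<theta>) (snd p, fst p))"
        by (rule continuous_on_compose2[OF cK']) (auto intro!: continuous_intros)
      then show "continuous_on (?X \<times> cbox 0 R) (\<lambda>(\<theta>, r). K' r \<theta>)"
        by (simp add: case_prod_beta)
    qed (use that d in auto)
    then show ?thesis by (simp add: KK_def [abs_def] KK'_def)
  qed
  have chain: "((\<lambda>\<theta>. KK (\<sigma> * cos \<theta>) \<theta>) has_real_derivative
      KK' (\<sigma> * cos \<theta>) \<theta> - \<sigma> * sin \<theta> * K (\<sigma> * cos \<theta>) \<theta>) (at \<theta> within ?X)"
    if \<sigma>: "0 < \<sigma>" and \<theta>: "\<theta> \<in> ?X" for \<sigma> \<theta>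
  proof -
    let ?R = "\<sigma> * cos \<theta>"
    have R: "0 \<le> ?R" using \<sigma> cos_quarter[OF \<theta>] by simp
    have D: "((\<lambda>(\<theta>, R). KK R \<theta>) has_derivative
        (\<lambda>(tx, ty). KK' ?R \<theta> * tx + blinfun_apply (blinfun_mult_right (K ?R \<theta>)) ty))
        (at (\<theta>, ?R) within ?X \<times> {0..})"
    proof (rule has_derivative_partialsI[where fy = "\<lambda>\<theta> R. blinfun_mult_right (K R \<theta>)"])
      show "((\<lambda>\<theta>. KK ?R \<theta>) has_derivative (\<lambda>tx. KK' ?R \<theta> * tx)) (at \<theta> within ?X)"
        using dT[OF R \<theta>] by (simp add: has_field_derivative_def)
      show "((\<lambda>R. KK R \<theta>) has_derivative blinfun_apply (blinfun_mult_right (K R \<theta>))) (at R within {0..})"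
        if "\<theta> \<in> ?X" "R \<in> {0..}" for \<theta> R
        using dR(1)[of R \<theta>] that by (simp add: has_field_derivative_def)
      have "continuous_on (?X \<times> {0..}) (\<lambda>p. (\<lambda>(r, \<theta>). K r \<theta>) (snd p, fst p))"
        by (rule continuous_on_compose2[OF cK]) (auto intro!: continuous_intros)
      then have "continuous_on (?X \<times> {0..}) (\<lambda>p. blinfun_mult_right (K (snd p) (fst p)))"
        by (simp add: case_prod_beta bounded_linear.continuous_on[OF bounded_linear_blinfun_mult_right])
      then have "continuous (at (\<theta>, ?R) within ?X \<times> {0..}) (\<lambda>p. blinfun_mult_right (K (snd p) (fst p)))"
        using \<theta> R unfolding continuous_on_eq_continuous_within by blast
      then show "continuous (at (\<theta>, ?R) within ?X \<times> {0..}) (\<lambda>(\<theta>, R). blinfun_mult_right (K R \<theta>))"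
        by (simp only: case_prod_beta')
    qed (use R in \<open>auto simp: convex_real_interval\<close>)
    have E: "((\<lambda>\<theta>. (\<theta>, \<sigma> * cos \<theta>)) has_derivative (\<lambda>t. (t, - \<sigma> * sin \<theta> * t))) (at \<theta> within ?X)"
      by (auto intro!: derivative_eq_intros)
    have "((\<lambda>\<theta>. (\<lambda>(\<theta>, R). KK R \<theta>) (\<theta>, \<sigma> * cos \<theta>)) has_derivative
        (\<lambda>t. (\<lambda>(tx, ty). KK' ?R \<theta> * tx + blinfun_apply (blinfun_mult_right (K ?R \<theta>)) ty)
          (t, - \<sigma> * sin \<theta> * t))) (at \<theta> within ?X)"
      by (rule has_derivative_in_compose[OF E has_derivative_subset[OF D]])
         (use \<sigma> cos_quarter in auto)
    then show ?thesis
      unfolding has_field_derivative_def split_conv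
      by (rule has_derivative_eq_rhs) (rule ext, simp add: algebra_simps)
  qed
  have intK: "(\<lambda>\<theta>. sin \<theta> * K (\<sigma> * cos \<theta>) \<theta>) integrable_on ?X" if "0 < \<sigma>" for \<sigma>
  proof (rule integrable_continuous_real)
    have "continuous_on ?X (\<lambda>\<theta>. (\<lambda>(r, \<theta>). K r \<theta>) (\<sigma> * cos \<theta>, \<theta>))"
      by (rule continuous_on_compose2[OF cK]) (use that cos_quarter in \<open>auto intro!: continuous_intros\<close>)
    then show "continuous_on ?X (\<lambda>\<theta>. sin \<theta> * K (\<sigma> * cos \<theta>) \<theta>)"
      by (auto intro!: continuous_intros)
  qed
  have FTC: "((\<lambda>\<theta>. KK' (\<sigma> * cos \<theta>) \<theta> - \<sigma> * sin \<theta> * K (\<sigma> * cos \<theta>) \<theta>) has_integral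
      (KK (\<sigma> * cos (pi/2)) (pi/2) - KK (\<sigma> * cos 0) 0)) ?X" if "0 < \<sigma>" for \<sigma>
    by (rule fundamental_theorem_of_calculus)
       (use chain that in \<open>auto simp: has_real_derivative_iff_has_vector_derivative [symmetric]\<close>)
  \<comment> \<open>The endpoint pi/2 contributes nothing, since there the upper limit
    \<open>\<sigma> * cos (pi/2)\<close> of the primitive is 0. The identity expresses the quantity
    to be differentiated through the primitives \<open>KK\<close> and \<open>KK'\<close>, which are
    differentiable in \<sigma> although \<open>K\<close> need not be.\<close>
  have id: "integral ?X (\<lambda>\<theta>. KK' (\<sigma> * cos \<theta>) \<theta>)
      = \<sigma> * integral ?X (\<lambda>\<theta>. sin \<theta> * K (\<sigma> * cos \<theta>) \<theta>) - KK \<sigma> 0"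
    and intKK': "(\<lambda>\<theta>. KK' (\<sigma> * cos \<theta>) \<theta>) integrable_on ?X" if "0 < \<sigma>" for \<sigma>
  proof -
    have "((\<lambda>\<theta>. (KK' (\<sigma> * cos \<theta>) \<theta> - \<sigma> * sin \<theta> * K (\<sigma> * cos \<theta>) \<theta>)
        + \<sigma> * (sin \<theta> * K (\<sigma> * cos \<theta>) \<theta>)) has_integral
      ((KK (\<sigma> * cos (pi/2)) (pi/2) - KK (\<sigma> * cos 0) 0)
        + \<sigma> * integral ?X (\<lambda>\<theta>. sin \<theta> * K (\<sigma> * cos \<theta>) \<theta>))) ?X"
      by (intro has_integral_add FTC that has_integral_mult_right integrable_integral intK)
    then have "((\<lambda>\<theta>. KK' (\<sigma> * cos \<theta>) \<theta>) has_integral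
      (\<sigma> * integral ?X (\<lambda>\<theta>. sin \<theta> * K (\<sigma> * cos \<theta>) \<theta>) - KK \<sigma> 0)) ?X"
      by (simp add: mult.assoc KK_def[of 0])
    then show "integral ?X (\<lambda>\<theta>. KK' (\<sigma> * cos \<theta>) \<theta>)
      = \<sigma> * integral ?X (\<lambda>\<theta>. sin \<theta> * K (\<sigma> * cos \<theta>) \<theta>) - KK \<sigma> 0"
      "(\<lambda>\<theta>. KK' (\<sigma> * cos \<theta>) \<theta>) integrable_on ?X"
      by (auto simp: integral_unique)
  qed
  have "((\<lambda>\<sigma>. integral (cbox 0 (pi/2)) (\<lambda>\<theta>. KK' (\<sigma> * cos \<theta>) \<theta>)) has_field_derivative
      integral (cbox 0 (pi/2)) (\<lambda>\<theta>. cos \<theta> * K' (\<tau> * cos \<theta>) \<theta>)) (at \<tau> within {0<..})"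
  proof (rule leibniz_rule_field_derivative)
    fix \<sigma> \<theta> :: real assume \<sigma>: "\<sigma> \<in> {0<..}" and "\<theta> \<in> cbox 0 (pi/2)"
    then have \<theta>: "\<theta> \<in> ?X" by simp
    then have R: "0 \<le> \<sigma> * cos \<theta>" using \<sigma> cos_quarter by auto
    have "((\<lambda>R. KK' R \<theta>) \<circ> (\<lambda>\<sigma>. \<sigma> * cos \<theta>) has_real_derivative K' (\<sigma> * cos \<theta>) \<theta> * cos \<theta>)
        (at \<sigma> within {0<..})"
    proof (rule DERIV_image_chain)
      show "((\<lambda>R. KK' R \<theta>) has_real_derivative K' (\<sigma> * cos \<theta>) \<theta>)
          (at (\<sigma> * cos \<theta>) within (\<lambda>\<sigma>. \<sigma> * cos \<theta>) ` {0<..})"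
        by (rule has_field_derivative_subset[OF dR(2)[OF R \<theta>]]) (use cos_quarter[OF \<theta>] in auto)
    qed (auto intro!: derivative_eq_intros)
    then show "((\<lambda>\<sigma>. KK' (\<sigma> * cos \<theta>) \<theta>) has_real_derivative cos \<theta> * K' (\<sigma> * cos \<theta>) \<theta>)
        (at \<sigma> within {0<..})"
      by (simp add: o_def mult.commute)
  next
    have "continuous_on ({0<..} \<times> ?X) (\<lambda>p. (\<lambda>(r, \<theta>). K' r \<theta>) (fst p * cos (snd p), snd p))"
      by (rule continuous_on_compose2[OF cK'])
         (auto intro!: continuous_intros mult_nonneg_nonneg cos_quarter)
    then have "continuous_on ({0<..} \<times> ?X)
        (\<lambda>p. cos (snd p) * (\<lambda>(r, \<theta>). K' r \<theta>) (fst p * cos (snd p), snd p))"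
      by (intro continuous_intros)
    then show "continuous_on ({0<..} \<times> cbox 0 (pi/2)) (\<lambda>(\<sigma>, \<theta>). cos \<theta> * K' (\<sigma> * cos \<theta>) \<theta>)"
      by (simp add: case_prod_beta')
    show "(\<lambda>\<theta>. KK' (\<sigma> * cos \<theta>) \<theta>) integrable_on cbox 0 (pi/2)" if "\<sigma> \<in> {0<..}" for \<sigma>
      using intKK'[of \<sigma>] that by simp
    show "\<tau> \<in> {0<..}" using \<tau> by simp
    show "convex {0::real<..}" by (rule convex_real_interval)
  qed
  then have 1: "((\<lambda>\<sigma>. integral ?X (\<lambda>\<theta>. KK' (\<sigma> * cos \<theta>) \<theta>)) has_real_derivative
      integral ?X (\<lambda>\<theta>. cos \<theta> * K' (\<tau> * cos \<theta>) \<theta>)) (at \<tau>)"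
    using \<tau> by (simp add: at_within_open[of \<tau> "{0<..}"])
  have 2: "((\<lambda>\<sigma>. KK \<sigma> 0) has_real_derivative K \<tau> 0) (at \<tau>)"
  proof -
    have "((\<lambda>\<sigma>. KK \<sigma> 0) has_real_derivative K \<tau> 0) (at \<tau> within {0<..})"
      by (rule has_field_derivative_subset[OF dR(1)]) (use \<tau> in auto)
    then show ?thesis using \<tau> by (simp add: at_within_open[of \<tau> "{0<..}"])
  qed
  have "((\<lambda>\<sigma>. KK \<sigma> 0 + integral ?X (\<lambda>\<theta>. KK' (\<sigma> * cos \<theta>) \<theta>)) has_real_derivative
      K \<tau> 0 + integral ?X (\<lambda>\<theta>. cos \<theta> * K' (\<tau> * cos \<theta>) \<theta>)) (at \<tau>)"
    by (intro DERIV_add 1 2)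
  then show ?thesis
    by (rule has_field_derivative_transform_within_open[where S = "{0<..}"]) (use \<tau> id in auto)
qed

text \<open>At angle 0 the Mehler kernel is the identity, so the boundary term of
  \<open>time_derivative_quarter\<close> is the source \<open>k \<tau> y\<close>; the remaining
  terms come from the \<theta>-derivative of the average.\<close>

lemma ouint_time_derivative:
  assumes k: "bcont k" and k': "bcont k'" and \<tau>: "0 < \<tau>"
    and d: "\<And>r x. 0 \<le> r \<Longrightarrow> (k r has_real_derivative k' r x) (at x)"
  shows "((\<lambda>\<tau>. \<tau> * ouint sin k \<tau> y) has_real_derivative
     k \<tau> y - y * ouint (\<lambda>\<theta>. sin \<theta> * cos \<theta>) k' \<tau> y + ouint1 (\<lambda>\<theta>. cos \<theta> * cos \<theta>) k' \<tau> y) (at \<tau>)"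
proof -
  let ?X = "{0..pi/2::real}"
  let ?K' = "\<lambda>r \<theta>. - y * sin \<theta> * mehler k' r y \<theta> + cos \<theta> * mehler1 k' r y \<theta>"
  have c: "continuous_on ({0..} \<times> ?X) (\<lambda>p. (\<lambda>(r, y, \<theta>). m r y \<theta>) (fst p, y, snd p))"
    if "continuous_on ({0..} \<times> UNIV) (\<lambda>(r, y, \<theta>). m r y \<theta>)" for m :: "real \<Rightarrow> real \<Rightarrow> real \<Rightarrow> real"
    by (rule continuous_on_compose2[OF that]) (auto intro!: continuous_intros)
  have "((\<lambda>\<tau>. \<tau> * integral ?X (\<lambda>\<theta>. sin \<theta> * mehler k (\<tau> * cos \<theta>) y \<theta>)) has_real_derivative
      mehler k \<tau> y 0 + integral ?X (\<lambda>\<theta>. cos \<theta> * ?K' (\<tau> * cos \<theta>) \<theta>)) (at \<tau>)"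
  proof (rule time_derivative_quarter[OF _ _ _ \<tau>])
    show "continuous_on ({0..} \<times> ?X) (\<lambda>(r, \<theta>). mehler k r y \<theta>)"
      using c[OF continuous_on_mehler(1)[OF k]] by (simp add: case_prod_beta)
    show "continuous_on ({0..} \<times> ?X) (\<lambda>(r, \<theta>). ?K' r \<theta>)"
      using c[OF continuous_on_mehler(1)[OF k']] c[OF continuous_on_mehler(2)[OF k']]
      by (auto simp: case_prod_beta intro!: continuous_intros)
    show "(mehler k r y has_real_derivative ?K' r \<theta>) (at \<theta> within ?X)" if "0 \<le> r" for r \<theta>
      by (rule has_field_derivative_at_within[OF mehler_derivative(2)[OF k k' that d[OF that]]])
  qed
  moreover have "mehler k \<tau> y 0 = k \<tau> y"
    using gauss.prob_space by (simp add: mehler_def)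
  moreover have "integral ?X (\<lambda>\<theta>. cos \<theta> * ?K' (\<tau> * cos \<theta>) \<theta>)
      = - y * ouint (\<lambda>\<theta>. sin \<theta> * cos \<theta>) k' \<tau> y + ouint1 (\<lambda>\<theta>. cos \<theta> * cos \<theta>) k' \<tau> y"
  proof -
    have "integral ?X (\<lambda>\<theta>. cos \<theta> * ?K' (\<tau> * cos \<theta>) \<theta>)
      = integral ?X (\<lambda>\<theta>. - y * (sin \<theta> * cos \<theta> * mehler k' (\<tau> * cos \<theta>) y \<theta>)
          + cos \<theta> * cos \<theta> * mehler1 k' (\<tau> * cos \<theta>) y \<theta>)"
      by (simp add: algebra_simps)
    also have "\<dots> = integral ?X (\<lambda>\<theta>. - y * (sin \<theta> * cos \<theta> * mehler k' (\<tau> * cos \<theta>) y \<theta>))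
      + integral ?X (\<lambda>\<theta>. cos \<theta> * cos \<theta> * mehler1 k' (\<tau> * cos \<theta>) y \<theta>)"
      by (intro Henstock_Kurzweil_Integration.integral_add integrable_on_mult_right
            integrable_mehler_quarter k' less_imp_le[OF \<tau>] continuous_intros)
    also have "\<dots> = - y * ouint (\<lambda>\<theta>. sin \<theta> * cos \<theta>) k' \<tau> y + ouint1 (\<lambda>\<theta>. cos \<theta> * cos \<theta>) k' \<tau> y"
      by (simp only: ouint_def ouint1_def integral_mult_right)
    finally show ?thesis .
  qed
  ultimately have "((\<lambda>\<tau>. \<tau> * ouint sin k \<tau> y) has_real_derivative k \<tau> y +
     (- y * ouint (\<lambda>\<theta>. sin \<theta> * cos \<theta>) k' \<tau> y + ouint1 (\<lambda>\<theta>. cos \<theta> * cos \<theta>) k' \<tau> y)) (at \<tau>)"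
    by (simp only: ouint_def)
  then show ?thesis by (simp add: algebra_simps)
qed

section \<open>Closure properties of locally bounded continuous functions\<close>

lemma bcont_mult:
  assumes "bcont f" "bcont g"
  shows "bcont (\<lambda>r x. f r x * g r x)"
  unfolding bcont_def
proof (intro conjI allI)
  show "continuous_on ({0..} \<times> UNIV) (\<lambda>(r, x). f r x * g r x)"
    using continuous_on_mult[OF bcont_continuous[OF assms(1)] bcont_continuous[OF assms(2)]]
    by (simp add: case_prod_beta')
  fix T
  obtain B where B: "B \<ge> 0" "\<And>r x. 0 \<le> r \<Longrightarrow> r \<le> T \<Longrightarrow> \<bar>f r x\<bar> \<le> B"
    using bcont_bound[OF assms(1)] by blast
  obtain C where C: "C \<ge> 0" "\<And>r x. 0 \<le> r \<Longrightarrow> r \<le> T \<Longrightarrow> \<bar>g r x\<bar> \<le> C"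
    using bcont_bound[OF assms(2)] by blast
  have "\<bar>f r x * g r x\<bar> \<le> B * C" if "r \<in> {0..T}" for r x
    unfolding abs_mult using B C that by (intro mult_mono) auto
  then show "\<exists>B. \<forall>r\<in>{0..T}. \<forall>x. \<bar>f r x * g r x\<bar> \<le> B" by blast
qed

lemma bcont_add:
  assumes "bcont f" "bcont g"
  shows "bcont (\<lambda>r x. f r x + g r x)"
  unfolding bcont_def
proof (intro conjI allI)
  show "continuous_on ({0..} \<times> UNIV) (\<lambda>(r, x). f r x + g r x)"
    using continuous_on_add[OF bcont_continuous[OF assms(1)] bcont_continuous[OF assms(2)]]
    by (simp add: case_prod_beta')
  fix T
  obtain B where B: "B \<ge> 0" "\<And>r x. 0 \<le> r \<Longrightarrow> r \<le> T \<Longrightarrow> \<bar>f r x\<bar> \<le> B"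
    using bcont_bound[OF assms(1)] by blast
  obtain C where C: "C \<ge> 0" "\<And>r x. 0 \<le> r \<Longrightarrow> r \<le> T \<Longrightarrow> \<bar>g r x\<bar> \<le> C"
    using bcont_bound[OF assms(2)] by blast
  have "\<bar>f r x + g r x\<bar> \<le> B + C" if "r \<in> {0..T}" for r x
    using B(2)[of r x] C(2)[of r x] that by (auto simp: abs_le_iff)
  then show "\<exists>B. \<forall>r\<in>{0..T}. \<forall>x. \<bar>f r x + g r x\<bar> \<le> B" by blast
qed

lemma bcont_time:
  assumes "continuous_on {0..} f"
  shows "bcont (\<lambda>r x. f r)"
  unfolding bcont_def
proof (intro conjI allI)
  show "continuous_on ({0..} \<times> UNIV) (\<lambda>(r, x). f r)"
    unfolding case_prod_beta'
    by (rule continuous_on_compose2[OF assms]) (auto intro!: continuous_intros)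
  fix T
  have "bounded (f ` {0..T})"
    using continuous_on_subset[OF assms, of "{0..T}"]
    by (intro compact_imp_bounded compact_continuous_image) auto
  then show "\<exists>B. \<forall>r\<in>{0..T}. \<forall>x. \<bar>f r\<bar> \<le> B"
    by (auto simp: bounded_iff)
qed

lemma bcont_space_fun:
  assumes "continuous_on UNIV f" "\<And>x. \<bar>f x\<bar> \<le> B"
  shows "bcont (\<lambda>r x. f x)"
  unfolding bcont_def
proof (intro conjI allI)
  show "continuous_on ({0..} \<times> UNIV) (\<lambda>(r, x). f x)"
    unfolding case_prod_beta'
    by (rule continuous_on_compose2[OF assms(1)]) (auto intro!: continuous_intros)
qed (use assms in auto)

lemma bcont_diff: "bcont f \<Longrightarrow> bcont g \<Longrightarrow> bcont (\<lambda>r x. f r x - g r x)"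
  using bcont_add[of f "\<lambda>r x. (-1) * g r x"] bcont_mult[of "\<lambda>r x. -1" g] bcont_time[of "\<lambda>r. -1"]
  by simp

section \<open>The self-similar solution\<close>

definition cgauss :: real where "cgauss = 1 / sqrt (2 * pi)"

lemma cgauss_pos: "cgauss > 0"
  by (simp add: cgauss_def)

text \<open>Write \<open>N = c \<tau> exp (- y\<^sup>2 / 2) exp (- 2 c \<tau>) Y(\<tau>, y)\<close> with \<open>\<tau> = exp (s / 2) = \<surd>t\<close> and \<open>c\<close> the constant
  \<open>cgauss\<close>. The equation for \<open>N\<close> becomes \<open>\<tau> Y\<^sub>\<tau> = 2 c \<tau> \<kappa>(Y) - y Y\<^sub>y + Y\<^sub>y\<^sub>y\<close>, whose Duhamel formula, with
  earlier times parametrised as \<open>\<tau> cos \<theta>\<close>, is the fixed point equation of \<open>picard\<close>.\<close>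

definition kap :: "(real \<Rightarrow> real \<Rightarrow> real) \<Rightarrow> real \<Rightarrow> real \<Rightarrow> real" where
  "kap Y r x = Y r x - exp (- x\<^sup>2 / 2) * exp (- (2 * cgauss * r)) * (Y r x)\<^sup>2 / 2"

definition picard :: "(real \<Rightarrow> real \<Rightarrow> real) \<Rightarrow> real \<Rightarrow> real \<Rightarrow> real" where
  "picard Y r x = 1 + 2 * cgauss * (r * ouint sin (kap Y) r x)"

text \<open>In the variables of N this range is 0 \<le> N \<le> c \<tau> exp (- y^2 / 2), the bound
  by the heat kernel. On it the Gaussian weight times \<open>Y\<close> is at most 1, which makes
  \<open>kap\<close> nonnegative and 1-Lipschitz.\<close>

definition admissible :: "(real \<Rightarrow> real \<Rightarrow> real) \<Rightarrow> bool" where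
  "admissible Y \<longleftrightarrow> continuous_on ({0..} \<times> UNIV) (\<lambda>(r, x). Y r x) \<and>
     (\<forall>r x. 0 \<le> r \<longrightarrow> 0 \<le> Y r x \<and> Y r x \<le> exp (2 * cgauss * r))"

section \<open>The Picard iteration in a weighted supremum norm\<close>

lemma admissible_bcont:
  assumes "admissible Y"
  shows "bcont Y"
  unfolding bcont_def
proof (intro conjI allI)
  fix T
  have "\<bar>Y r x\<bar> \<le> exp (2 * cgauss * T)" if "r \<in> {0..T}" for r x
  proof -
    have "\<bar>Y r x\<bar> \<le> exp (2 * cgauss * r)" using assms that by (auto simp: admissible_def)
    also have "\<dots> \<le> exp (2 * cgauss * T)" using that cgauss_pos by simp
    finally show ?thesis .
  qed
  then show "\<exists>B. \<forall>r\<in>{0..T}. \<forall>x. \<bar>Y r x\<bar> \<le> B" by blast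
qed (use assms in \<open>simp add: admissible_def\<close>)

lemma bcont_weight: "bcont (\<lambda>r x. exp (- x\<^sup>2 / 2) * exp (- (2 * cgauss * r)))"
  by (intro bcont_mult bcont_time bcont_space_fun[where B = 1]) (auto intro!: continuous_intros)

lemma kap_bcont:
  assumes "admissible Y"
  shows "bcont (kap Y)"
proof -
  note Y = admissible_bcont[OF assms]
  have "bcont (\<lambda>r x. Y r x - 1/2 * ((exp (- x\<^sup>2 / 2) * exp (- (2 * cgauss * r))) * (Y r x * Y r x)))"
    by (intro bcont_diff bcont_mult Y bcont_weight bcont_time continuous_intros)
  moreover have "kap Y = (\<lambda>r x. Y r x - 1/2 * ((exp (- x\<^sup>2 / 2) * exp (- (2 * cgauss * r))) * (Y r x * Y r x)))"
    by (simp add: fun_eq_iff kap_def power2_eq_square)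
  ultimately show ?thesis by simp
qed

lemma weight_le_1:
  assumes "0 \<le> a" "a \<le> exp (2 * cgauss * r)"
  shows "exp (- x\<^sup>2 / 2) * exp (- (2 * cgauss * r)) * a \<le> 1"
proof -
  have "exp (- x\<^sup>2 / 2) * (exp (- (2 * cgauss * r)) * a) \<le> 1 * (exp (- (2 * cgauss * r)) * exp (2 * cgauss * r))"
    using assms by (intro mult_mono) auto
  then show ?thesis by (simp add: exp_minus mult.assoc)
qed

lemma kap_bounds:
  assumes "admissible Y" "0 \<le> r"
  shows "0 \<le> kap Y r x" "kap Y r x \<le> exp (2 * cgauss * r)"
proof -
  let ?w = "exp (- x\<^sup>2 / 2) * exp (- (2 * cgauss * r))"
  have Y: "0 \<le> Y r x" "Y r x \<le> exp (2 * cgauss * r)" using assms by (auto simp: admissible_def)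
  have "kap Y r x = Y r x * (1 - ?w * Y r x / 2)"
    by (simp add: kap_def power2_eq_square algebra_simps)
  moreover have "1 - ?w * Y r x / 2 \<ge> 0" using weight_le_1[OF Y, of x] by simp
  ultimately show "0 \<le> kap Y r x" using Y by simp
  have "0 \<le> ?w * (Y r x)\<^sup>2 / 2" by simp
  then show "kap Y r x \<le> exp (2 * cgauss * r)" using Y unfolding kap_def by linarith
qed

lemma kap_lipschitz:
  assumes "admissible Y" "admissible Z" "0 \<le> r"
  shows "\<bar>kap Y r x - kap Z r x\<bar> \<le> \<bar>Y r x - Z r x\<bar>"
proof -
  let ?w = "exp (- x\<^sup>2 / 2) * exp (- (2 * cgauss * r))"
  have Y: "0 \<le> Y r x" "Y r x \<le> exp (2 * cgauss * r)" and Z: "0 \<le> Z r x" "Z r x \<le> exp (2 * cgauss * r)"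
    using assms by (auto simp: admissible_def)
  have eq: "kap Y r x - kap Z r x = (Y r x - Z r x) * (1 - (?w * Y r x + ?w * Z r x) / 2)"
    by (simp add: kap_def power2_eq_square field_simps)
  have "0 \<le> ?w * Y r x" "0 \<le> ?w * Z r x" using Y Z by auto
  then have "\<bar>1 - (?w * Y r x + ?w * Z r x) / 2\<bar> \<le> 1"
    using weight_le_1[OF Y, of x] weight_le_1[OF Z, of x]
    by (simp only: abs_le_iff) (intro conjI; argo)
  then show ?thesis
    unfolding eq abs_mult by (simp add: mult_left_le)
qed

text \<open>The Mehler average preserves bounds that are uniform in space, and under s = r cos
  \<theta> the quarter circle integral becomes an integral over [0, r]; the right side is the
  integral of D exp (a s) there.\<close>

lemma ouint_exp_bound:
  assumes k: "bcont k" and r: "0 \<le> r" and a: "0 < a" and D: "0 \<le> D"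
    and b: "\<And>s x. 0 \<le> s \<Longrightarrow> s \<le> r \<Longrightarrow> \<bar>k s x\<bar> \<le> D * exp (a * s)"
  shows "\<bar>r * ouint sin k r y\<bar> \<le> D * ((exp (a * r) - 1) / a)"
proof -
  have I: "((\<lambda>\<theta>. D * (r * sin \<theta> * exp (a * (r * cos \<theta>)))) has_integral
      (- D * exp (a * (r * cos (pi/2))) / a - (- D * exp (a * (r * cos 0)) / a))) {0..pi/2}"
    by (rule fundamental_theorem_of_calculus)
       (use a in \<open>auto intro!: derivative_eq_intros
         simp: has_real_derivative_iff_has_vector_derivative [symmetric]\<close>)
  have int: "(\<lambda>\<theta>. r * (sin \<theta> * mehler k (r * cos \<theta>) y \<theta>)) integrable_on {0..pi/2}"
    by (intro integrable_on_mult_right integrable_mehler_quarter k r continuous_intros)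
  have "r * ouint sin k r y = integral {0..pi/2} (\<lambda>\<theta>. r * (sin \<theta> * mehler k (r * cos \<theta>) y \<theta>))"
    by (simp add: ouint_def)
  also have "norm \<dots> \<le> integral {0..pi/2} (\<lambda>\<theta>. D * (r * sin \<theta> * exp (a * (r * cos \<theta>))))"
  proof (rule integral_norm_bound_integral[OF int has_integral_integrable[OF I]])
    fix \<theta> assume t: "\<theta> \<in> {0..pi/2}"
    note q = quarter_arg[OF t r order_refl]
    have "\<bar>mehler k (r * cos \<theta>) y \<theta>\<bar> \<le> D * exp (a * (r * cos \<theta>))"
      by (rule mehler_bound(1)[OF k q(1) b[OF q]])
    then have "r * sin \<theta> * \<bar>mehler k (r * cos \<theta>) y \<theta>\<bar> \<le> r * sin \<theta> * (D * exp (a * (r * cos \<theta>)))"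
      using r cos_quarter(2)[OF t] by (intro mult_left_mono) auto
    then show "norm (r * (sin \<theta> * mehler k (r * cos \<theta>) y \<theta>)) \<le> D * (r * sin \<theta> * exp (a * (r * cos \<theta>)))"
      using r cos_quarter(2)[OF t] by (simp add: abs_mult mult_ac)
  qed
  also have "\<dots> = D * ((exp (a * r) - 1) / a)"
    using integral_unique[OF I] by (simp add: algebra_simps diff_divide_distrib)
  finally show ?thesis by simp
qed

lemma ouint_nonneg:
  assumes k: "bcont k" and r: "0 \<le> r" and b: "\<And>s x. 0 \<le> s \<Longrightarrow> 0 \<le> k s x"
  shows "0 \<le> ouint sin k r y"
  unfolding ouint_def
proof (rule Henstock_Kurzweil_Integration.integral_nonneg)
  show "(\<lambda>\<theta>. sin \<theta> * mehler k (r * cos \<theta>) y \<theta>) integrable_on {0..pi/2}"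
    by (intro integrable_mehler_quarter k r continuous_intros)
  fix \<theta> assume t: "\<theta> \<in> {0..pi/2}"
  show "0 \<le> sin \<theta> * mehler k (r * cos \<theta>) y \<theta>"
    unfolding mehler_def using cos_quarter[OF t] r b
    by (intro mult_nonneg_nonneg Bochner_Integration.integral_nonneg) auto
qed

lemma ouint_diff:
  assumes k: "bcont k" and l: "bcont l" and r: "0 \<le> r"
  shows "ouint sin (\<lambda>r x. k r x - l r x) r y = ouint sin k r y - ouint sin l r y"
proof -
  have m: "mehler (\<lambda>r x. k r x - l r x) s y \<theta> = mehler k s y \<theta> - mehler l s y \<theta>" if s: "0 \<le> s" for s \<theta>
  proof -
    note [measurable] = bcont_measurable[OF k s] bcont_measurable[OF l s]
    obtain B where "\<And>x. \<bar>k s x\<bar> \<le> B" using bcont_bound[OF k, of s] s by (metis order_refl)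
    moreover obtain C where "\<And>x. \<bar>l s x\<bar> \<le> C" using bcont_bound[OF l, of s] s by (metis order_refl)
    ultimately show ?thesis
      unfolding mehler_def
      by (intro Bochner_Integration.integral_diff gauss_integrable_bounded[where B = B]
            gauss_integrable_bounded[where B = C]) auto
  qed
  have "ouint sin (\<lambda>r x. k r x - l r x) r y = integral {0..pi/2}
      (\<lambda>\<theta>. sin \<theta> * mehler k (r * cos \<theta>) y \<theta> - sin \<theta> * mehler l (r * cos \<theta>) y \<theta>)"
    unfolding ouint_def
    by (rule Henstock_Kurzweil_Integration.integral_cong)
       (use m quarter_arg(1)[OF _ r order_refl] in \<open>simp add: right_diff_distrib\<close>)
  also have "\<dots> = ouint sin k r y - ouint sin l r y"
    unfolding ouint_def
    by (intro Henstock_Kurzweil_Integration.integral_diff integrable_mehler_quarter k l r continuous_intros)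
  finally show ?thesis .
qed

text \<open>The upper bound reproduces itself: 1 plus the integral of 2 c exp (2 c s) over [0, r] is
  exp (2 c r). The lower bound 1 holds because the source \<open>kap\<close> is nonnegative.\<close>

lemma admissible_picard:
  assumes Y: "admissible Y"
  shows "admissible (picard Y)" and "0 \<le> r \<Longrightarrow> 1 \<le> picard Y r x"
proof -
  note k = kap_bcont[OF Y]
  have "bcont (\<lambda>r x. 1 + 2 * cgauss * (r * ouint sin (kap Y) r x))"
    by (intro bcont_add bcont_mult bcont_time bcont_ouint k continuous_intros)
  then have c: "continuous_on ({0..} \<times> UNIV) (\<lambda>(r, x). picard Y r x)"
    unfolding picard_def by (rule bcont_continuous)
  have "1 \<le> picard Y r x" if "0 \<le> r" for r x
    using ouint_nonneg[OF k that kap_bounds(1)[OF Y], of x] that cgauss_pos by (simp add: picard_def)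
  moreover have "picard Y r x \<le> exp (2 * cgauss * r)" if "0 \<le> r" for r x
  proof -
    have "\<bar>r * ouint sin (kap Y) r x\<bar> \<le> 1 * ((exp (2 * cgauss * r) - 1) / (2 * cgauss))"
      by (rule ouint_exp_bound[OF k that]) (use kap_bounds[OF Y] cgauss_pos in \<open>auto simp: abs_le_iff intro: order_trans[of _ 0]\<close>)
    then show ?thesis using cgauss_pos by (simp add: picard_def abs_le_iff field_simps)
  qed
  ultimately show "admissible (picard Y)" "0 \<le> r \<Longrightarrow> 1 \<le> picard Y r x"
    using c by (auto simp: admissible_def intro: order_trans[OF zero_le_one])
qed

text \<open>The weight grows at rate 4 c, twice the prefactor 2 c of the integral term, so the
  contraction factor is 1/2 on the entire half line and no restriction to short times
  arises.\<close>

lemma picard_contraction: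
  assumes Y: "admissible Y" and Z: "admissible Z" and D: "0 \<le> D"
    and b: "\<And>r x. 0 \<le> r \<Longrightarrow> \<bar>Y r x - Z r x\<bar> \<le> D * exp (4 * cgauss * r)" and r: "0 \<le> r"
  shows "\<bar>picard Y r x - picard Z r x\<bar> \<le> D / 2 * exp (4 * cgauss * r)"
proof -
  note k = kap_bcont[OF Y] and l = kap_bcont[OF Z]
  have "\<bar>r * ouint sin (\<lambda>r x. kap Y r x - kap Z r x) r x\<bar>
      \<le> D * ((exp (4 * cgauss * r) - 1) / (4 * cgauss))"
    by (rule ouint_exp_bound[OF bcont_diff[OF k l] r])
       (use cgauss_pos D order_trans[OF kap_lipschitz[OF Y Z] b] in auto)
  then have 1: "2 * cgauss * \<bar>r * ouint sin (\<lambda>r x. kap Y r x - kap Z r x) r x\<bar>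
      \<le> D / 2 * (exp (4 * cgauss * r) - 1)"
    using cgauss_pos by (simp add: field_simps)
  have "picard Y r x - picard Z r x = 2 * cgauss * (r * ouint sin (\<lambda>r x. kap Y r x - kap Z r x) r x)"
    by (simp add: picard_def ouint_diff[OF k l r] algebra_simps)
  then have "\<bar>picard Y r x - picard Z r x\<bar> = 2 * cgauss * \<bar>r * ouint sin (\<lambda>r x. kap Y r x - kap Z r x) r x\<bar>"
    using cgauss_pos by (simp add: abs_mult)
  also have "\<dots> \<le> D / 2 * (exp (4 * cgauss * r) - 1)" by (rule 1)
  also have "\<dots> \<le> D / 2 * exp (4 * cgauss * r)" using D by (intro mult_left_mono) auto
  finally show ?thesis .
qed

text \<open>The increments are at most (1/2)^n in the weighted norm, so the iterates converge
  uniformly on slabs and the limit stays admissible. The equation passes to the limit by applying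
  the contraction estimate to the limit and the n-th iterate.\<close>

lemma picard_fixed_point: "\<exists>Y. admissible Y \<and> (\<forall>r x. 0 \<le> r \<longrightarrow> Y r x = picard Y r x)"
proof -
  define Yn where "Yn n = (picard ^^ n) (\<lambda>r x. 1)" for n
  have Y0: "Yn 0 = (\<lambda>r x. 1)" and YS: "Yn (Suc n) = picard (Yn n)" for n
    by (simp_all add: Yn_def)
  have adm: "admissible (Yn n)" for n
  proof (induction n)
    case 0
    show ?case using cgauss_pos by (auto simp: Y0 admissible_def case_prod_beta')
  qed (simp add: YS admissible_picard)
  have step: "\<bar>Yn (Suc n) r x - Yn n r x\<bar> \<le> (1/2) ^ n * exp (4 * cgauss * r)" if "0 \<le> r" for n r x
    using that
  proof (induction n arbitrary: r x)
    case 0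
    have "0 \<le> Yn (Suc 0) r x" "Yn (Suc 0) r x \<le> exp (2 * cgauss * r)" "1 \<le> exp (2 * cgauss * r)"
      using adm[of "Suc 0"] 0 cgauss_pos by (auto simp: admissible_def)
    moreover have "exp (2 * cgauss * r) \<le> exp (4 * cgauss * r)" using 0 cgauss_pos by simp
    ultimately have "\<bar>Yn (Suc 0) r x - 1\<bar> \<le> exp (4 * cgauss * r)" by arith
    then show ?case by (simp add: Y0)
  next
    case (Suc n)
    show ?case
      using picard_contraction[OF adm[of "Suc n"] adm[of n] _ Suc.IH Suc.prems] by (simp add: YS)
  qed
  define Y where "Y r x = 1 + (\<Sum>n. Yn (Suc n) r x - Yn n r x)" for r x
  have unif: "uniform_limit ({0..T} \<times> UNIV) (\<lambda>n (r, x). Yn n r x) (\<lambda>(r, x). Y r x) sequentially" for T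
  proof -
    have "uniform_limit ({0..T} \<times> UNIV) (\<lambda>n p. \<Sum>i<n. Yn (Suc i) (fst p) (snd p) - Yn i (fst p) (snd p))
        (\<lambda>p. \<Sum>i. Yn (Suc i) (fst p) (snd p) - Yn i (fst p) (snd p)) sequentially"
    proof (rule Weierstrass_m_test)
      fix n :: nat and p :: "real \<times> real" assume p: "p \<in> {0..T} \<times> UNIV"
      then have r: "0 \<le> fst p" "fst p \<le> T" by auto
      have "\<bar>Yn (Suc n) (fst p) (snd p) - Yn n (fst p) (snd p)\<bar> \<le> (1/2) ^ n * exp (4 * cgauss * fst p)"
        by (rule step[OF r(1)])
      also have "\<dots> \<le> (1/2) ^ n * exp (4 * cgauss * T)"
        using r cgauss_pos by (intro mult_left_mono) auto
      finally show "norm (Yn (Suc n) (fst p) (snd p) - Yn n (fst p) (snd p)) \<le> (1/2) ^ n * exp (4 * cgauss * T)"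
        by simp
    next
      show "summable (\<lambda>n. (1/2) ^ n * exp (4 * cgauss * T))"
        by (intro summable_mult2 summable_geometric) simp
    qed
    from uniform_limit_add[OF this uniform_limit_const]
    have "uniform_limit ({0..T} \<times> UNIV)
        (\<lambda>n p. (\<Sum>i<n. Yn (Suc i) (fst p) (snd p) - Yn i (fst p) (snd p)) + 1)
        (\<lambda>p. (\<Sum>i. Yn (Suc i) (fst p) (snd p) - Yn i (fst p) (snd p)) + 1) sequentially" .
    moreover have "(\<Sum>i<n. Yn (Suc i) r x - Yn i r x) + 1 = Yn n r x" for n r x
      using sum_lessThan_telescope[of "\<lambda>i. Yn i r x" n] by (simp add: Y0)
    ultimately show ?thesis by (simp add: Y_def case_prod_beta' add.commute)
  qed
  have lim: "(\<lambda>n. Yn n r x) \<longlonglongrightarrow> Y r x" if "0 \<le> r" for r x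
    using tendsto_uniform_limitI[OF unif[of r], of "(r, x)"] that by simp
  have "admissible Y"
    unfolding admissible_def
  proof (intro conjI allI impI)
    show "continuous_on ({0..} \<times> UNIV) (\<lambda>(r, x). Y r x)"
    proof (rule continuous_on_halfspaceI)
      fix T :: real
      have "continuous_on ({0..T} \<times> UNIV) (\<lambda>(r, x). Yn n r x)" for n
        by (rule continuous_on_subset[of "{0..} \<times> UNIV"]) (use adm[of n] in \<open>auto simp: admissible_def\<close>)
      then show "continuous_on ({0..T} \<times> UNIV) (\<lambda>(r, x). Y r x)"
        by (intro uniform_limit_theorem[OF _ unif]) auto
    qed
    fix r x :: real assume r: "0 \<le> r"
    show "0 \<le> Y r x"
      by (rule LIMSEQ_le_const[OF lim[OF r]]) (use adm r in \<open>auto simp: admissible_def\<close>)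
    show "Y r x \<le> exp (2 * cgauss * r)"
      by (rule LIMSEQ_le_const2[OF lim[OF r]]) (use adm r in \<open>auto simp: admissible_def\<close>)
  qed
  moreover have "Y r x = picard Y r x" if r: "0 \<le> r" for r x
  proof -
    have tail: "\<bar>Yn (n + m) r x - Yn n r x\<bar> \<le> (2 * (1/2) ^ n - 2 * (1/2) ^ (n + m)) * exp (4 * cgauss * r)"
      if "0 \<le> r" for n m r x
    proof (induction m)
      case (Suc m)
      have "\<bar>Yn (n + Suc m) r x - Yn n r x\<bar>
          \<le> \<bar>Yn (Suc (n + m)) r x - Yn (n + m) r x\<bar> + \<bar>Yn (n + m) r x - Yn n r x\<bar>" by simp
      also have "\<dots> \<le> (1/2) ^ (n + m) * exp (4 * cgauss * r)
          + (2 * (1/2) ^ n - 2 * (1/2) ^ (n + m)) * exp (4 * cgauss * r)"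
        by (intro add_mono step Suc.IH that)
      also have "\<dots> = (2 * (1/2) ^ n - 2 * (1/2) ^ (n + Suc m)) * exp (4 * cgauss * r)"
        by (simp add: algebra_simps)
      finally show ?case .
    qed simp
    have dist: "\<bar>Y r x - Yn n r x\<bar> \<le> (2 * (1/2) ^ n) * exp (4 * cgauss * r)" if "0 \<le> r" for n r x
    proof (rule LIMSEQ_le_const2)
      show "(\<lambda>m. \<bar>Yn (m + n) r x - Yn n r x\<bar>) \<longlonglongrightarrow> \<bar>Y r x - Yn n r x\<bar>"
        by (intro tendsto_intros LIMSEQ_ignore_initial_segment lim that)
      have "\<bar>Yn (m + n) r x - Yn n r x\<bar> \<le> (2 * (1/2) ^ n) * exp (4 * cgauss * r)" for m
      proof -
        have "(2 * (1/2) ^ n - 2 * (1/2) ^ (n + m)) * exp (4 * cgauss * r) \<le> (2 * (1/2) ^ n) * exp (4 * cgauss * r)"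
          by (intro mult_right_mono) auto
        from order_trans[OF tail[OF that] this] show ?thesis by (simp add: add.commute)
      qed
      then show "\<exists>N. \<forall>m\<ge>N. \<bar>Yn (m + n) r x - Yn n r x\<bar> \<le> (2 * (1/2) ^ n) * exp (4 * cgauss * r)"
        by blast
    qed
    have "(\<lambda>n. \<bar>picard Y r x - Yn (Suc n) r x\<bar>) \<longlonglongrightarrow> 0"
    proof (rule tendsto_sandwich[of "\<lambda>_. 0"])
      show "\<forall>\<^sub>F n in sequentially. \<bar>picard Y r x - Yn (Suc n) r x\<bar> \<le> (1/2) ^ n * exp (4 * cgauss * r)"
        using picard_contraction[OF \<open>admissible Y\<close> adm _ dist r, of _ x] by (auto simp: YS)
      show "(\<lambda>n. (1/2) ^ n * exp (4 * cgauss * r)) \<longlonglongrightarrow> 0"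
        by (intro tendsto_mult_left_zero LIMSEQ_power_zero) simp
    qed auto
    then have "(\<lambda>n. picard Y r x - Yn (Suc n) r x) \<longlonglongrightarrow> 0" by (rule tendsto_rabs_zero_cancel)
    moreover have "(\<lambda>n. picard Y r x - Yn (Suc n) r x) \<longlonglongrightarrow> picard Y r x - Y r x"
      by (intro tendsto_intros LIMSEQ_Suc lim r)
    ultimately show ?thesis using LIMSEQ_unique by fastforce
  qed
  ultimately show ?thesis by blast
qed

section \<open>Regularity of the fixed point\<close>

lemma abs_times_gaussian_le_1: "\<bar>x * exp (- x\<^sup>2 / 2)\<bar> \<le> (1::real)"
proof -
  have "0 \<le> (\<bar>x\<bar> - 1)\<^sup>2" by simp
  then have "\<bar>x\<bar> \<le> 1 + x\<^sup>2 / 2" by (simp add: power2_diff)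
  also have "\<dots> \<le> exp (x\<^sup>2 / 2)" by (rule exp_ge_add_one_self)
  finally show ?thesis by (simp add: abs_mult exp_minus field_simps)
qed

text \<open>Two rounds of smoothing: a bounded continuous source gives one spatial derivative, which
  makes \<open>kap\<close> differentiable in space, and this new source \<open>k'\<close> gives the
  second one. The time derivative is then read off from
  \<open>ouint_time_derivative\<close>.\<close>

lemma profile_exists:
  obtains Y Y1 Y2 Yt :: "real \<Rightarrow> real \<Rightarrow> real" where
    "bcont Y" "bcont Y1" "bcont Y2" "continuous_on ({0..} \<times> UNIV) (\<lambda>(r, x). Yt r x)"
    "\<And>r x. 0 \<le> r \<Longrightarrow> 1 \<le> Y r x"
    "\<And>r x. 0 \<le> r \<Longrightarrow> Y r x \<le> exp (2 * cgauss * r)"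
    "\<And>r x. 0 \<le> r \<Longrightarrow> (Y r has_real_derivative Y1 r x) (at x)"
    "\<And>r x. 0 \<le> r \<Longrightarrow> (Y1 r has_real_derivative Y2 r x) (at x)"
    "\<And>r x. 0 < r \<Longrightarrow> ((\<lambda>r. Y r x) has_real_derivative Yt r x) (at r)"
    "\<And>r x. 0 \<le> r \<Longrightarrow> r * Yt r x = 2 * cgauss * r * kap Y r x - x * Y1 r x + Y2 r x"
proof -
  obtain Y where adm: "admissible Y" and fp: "\<And>r x. 0 \<le> r \<Longrightarrow> Y r x = picard Y r x"
    using picard_fixed_point by blast
  note bY = admissible_bcont[OF adm] and bk = kap_bcont[OF adm]
  define w where "w r x = exp (- x\<^sup>2 / 2) * exp (- (2 * cgauss * r))" for r x :: real
  define Y1 where "Y1 r x = 2 * cgauss * (r * ouint1 cos (kap Y) r x)" for r x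
  define k' where "k' r x = Y1 r x * (1 - w r x * Y r x)
      + x * exp (- x\<^sup>2 / 2) * exp (- (2 * cgauss * r)) * (Y r x * Y r x) * (1/2)" for r x
  define u1 where "u1 = ouint (\<lambda>\<theta>. sin \<theta> * cos \<theta>) k'"
  define u2 where "u2 = ouint1 (\<lambda>\<theta>. cos \<theta> * cos \<theta>) k'"
  define Y2 where "Y2 r x = 2 * cgauss * (r * u2 r x)" for r x
  define Yt where "Yt r x = 2 * cgauss * (kap Y r x - x * u1 r x + u2 r x)" for r x
  have bY1: "bcont Y1"
    unfolding Y1_def by (intro bcont_mult bcont_time bcont_ouint bk continuous_intros)
  have "bcont (\<lambda>r x. Y1 r x * (1 - w r x * Y r x)
      + x * exp (- x\<^sup>2 / 2) * exp (- (2 * cgauss * r)) * (Y r x * Y r x) * (1/2))"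
    unfolding w_def
    by (intro bcont_add bcont_mult bcont_diff bcont_time bY bY1 bcont_weight
          bcont_space_fun[where B = 1] abs_times_gaussian_le_1 continuous_intros) auto
  then have bk': "bcont k'" by (simp add: k'_def [abs_def])
  have bu: "bcont u1" "bcont u2"
    unfolding u1_def u2_def by (intro bcont_ouint bk' continuous_intros)+
  have bY2: "bcont Y2"
    unfolding Y2_def by (intro bcont_mult bcont_time bu continuous_intros)
  have cYt: "continuous_on ({0..} \<times> UNIV) (\<lambda>(r, x). Yt r x)"
  proof -
    have "continuous_on ({0..} \<times> UNIV) (\<lambda>p. 2 * cgauss * ((\<lambda>(r, x). kap Y r x) p
        - snd p * (\<lambda>(r, x). u1 r x) p + (\<lambda>(r, x). u2 r x) p))"
      by (intro continuous_intros bcont_continuous bk bu)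
    then show ?thesis by (simp add: Yt_def case_prod_beta')
  qed
  have d1: "((\<lambda>x. ouint sin (kap Y) r x) has_real_derivative ouint1 cos (kap Y) r x) (at x)" if "0 \<le> r" for r x
    using ouint_derivative[OF bk, of "\<lambda>_. 1" r x] that by simp
  have Yeq: "Y r = (\<lambda>x. 1 + 2 * cgauss * (r * ouint sin (kap Y) r x))" if "0 \<le> r" for r
    using fp[OF that] by (simp add: picard_def fun_eq_iff)
  have dY: "(Y r has_real_derivative Y1 r x) (at x)" if "0 \<le> r" for r x
    unfolding Yeq[OF that] Y1_def by (auto intro!: derivative_eq_intros d1[OF that])
  have dk: "(kap Y r has_real_derivative k' r x) (at x)" if "0 \<le> r" for r x
    unfolding kap_def[abs_def]
    by (rule derivative_eq_intros dY[OF that] refl | simp)+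
       (simp add: k'_def w_def power2_eq_square field_simps)
  \<comment> \<open>The two formulas for the gradient, with the derivative on the kernel and on the
    source, must agree. The second one can be differentiated once more.\<close>
  have eq1: "ouint1 cos (kap Y) r x = u1 r x" if "0 \<le> r" for r x
    unfolding u1_def
    by (rule DERIV_unique[OF d1[OF that]])
       (intro ouint_derivative' bk bk' dk that continuous_intros)
  have du1: "(u1 r has_real_derivative u2 r x) (at x)" if "0 \<le> r" for r x
    unfolding u1_def u2_def by (intro ouint_derivative bk' that continuous_intros)
  have dY1: "(Y1 r has_real_derivative Y2 r x) (at x)" if "0 \<le> r" for r x
  proof -
    have "Y1 r = (\<lambda>x. 2 * cgauss * (r * u1 r x))" using eq1[OF that] by (simp add: Y1_def fun_eq_iff)
    then show ?thesis unfolding Y2_def by (auto intro!: derivative_eq_intros du1[OF that])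
  qed
  have dt: "((\<lambda>r. Y r x) has_real_derivative Yt r x) (at r)" if r: "0 < r" for r x
  proof -
    have "((\<lambda>r. r * ouint sin (kap Y) r x) has_real_derivative (kap Y r x - x * u1 r x + u2 r x)) (at r)"
      unfolding u1_def u2_def by (intro ouint_time_derivative bk bk' r dk)
    from DERIV_add[OF DERIV_const DERIV_cmult[OF this]]
    have "((\<lambda>r. 1 + 2 * cgauss * (r * ouint sin (kap Y) r x)) has_real_derivative Yt r x) (at r)"
      unfolding Yt_def by simp
    then show ?thesis
      by (rule has_field_derivative_transform_within_open[where S = "{0<..}"])
         (use r Yeq in \<open>auto simp: fun_eq_iff\<close>)
  qed
  have pde: "r * Yt r x = 2 * cgauss * r * kap Y r x - x * Y1 r x + Y2 r x" if "0 \<le> r" for r x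
    using eq1[OF that, of x] by (simp add: Yt_def Y1_def Y2_def algebra_simps)
  show ?thesis
  proof (rule that[OF bY bY1 bY2 cYt _ _ dY dY1 dt])
    show "1 \<le> Y r x" if "0 \<le> r" for r x
      using admissible_picard(2)[OF adm that] fp[OF that] by simp
    show "Y r x \<le> exp (2 * cgauss * r)" if "0 \<le> r" for r x
      using adm that by (simp add: admissible_def)
  qed (use pde in auto)
qed

text \<open>Joint differentiability at a point follows from one partial derivative there together
  with continuity of the other.\<close>

lemma DERIV_chain_two:
  fixes f :: "real \<Rightarrow> real \<Rightarrow> real"
  assumes fs: "((\<lambda>s. f s (b t)) has_real_derivative fs) (at (a t))"
    and fy: "\<And>s y. (f s has_real_derivative fy s y) (at y)"
    and c: "continuous_on UNIV (\<lambda>(s, y). fy s y)"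
    and a: "(a has_real_derivative a') (at t)" and b: "(b has_real_derivative b') (at t)"
  shows "((\<lambda>t. f (a t) (b t)) has_real_derivative fs * a' + fy (a t) (b t) * b') (at t)"
proof -
  have D: "((\<lambda>(s, y). f s y) has_derivative
      (\<lambda>(tx, ty). fs * tx + blinfun_apply (blinfun_mult_right (fy (a t) (b t))) ty))
      (at (a t, b t) within UNIV \<times> UNIV)"
  proof (rule has_derivative_partialsI[where fy = "\<lambda>s y. blinfun_mult_right (fy s y)"])
    show "((\<lambda>s. f s (b t)) has_derivative (\<lambda>tx. fs * tx)) (at (a t) within UNIV)"
      using fs by (simp add: has_field_derivative_def)
    show "(f s has_derivative blinfun_apply (blinfun_mult_right (fy s y))) (at y within UNIV)" for s y
      using fy[of s y] by (simp add: has_field_derivative_def)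
    have "continuous_on UNIV (\<lambda>p. blinfun_mult_right ((\<lambda>(s, y). fy s y) p))"
      by (rule bounded_linear.continuous_on[OF bounded_linear_blinfun_mult_right c])
    then have "continuous_on UNIV (\<lambda>p. blinfun_mult_right (fy (fst p) (snd p)))"
      by (simp only: case_prod_beta')
    then have "continuous (at (a t, b t)) (\<lambda>p. blinfun_mult_right (fy (fst p) (snd p)))"
      unfolding continuous_on_eq_continuous_within by simp
    then show "continuous (at (a t, b t) within UNIV \<times> UNIV) (\<lambda>(s, y). blinfun_mult_right (fy s y))"
      by (simp only: case_prod_beta' UNIV_Times_UNIV)
  qed auto
  have E: "((\<lambda>t. (a t, b t)) has_derivative (\<lambda>h. (a' * h, b' * h))) (at t)"
    using a b by (auto intro!: derivative_eq_intros simp: has_field_derivative_def)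
  have "((\<lambda>t. (\<lambda>(s, y). f s y) (a t, b t)) has_derivative
      (\<lambda>h. (\<lambda>(tx, ty). fs * tx + blinfun_apply (blinfun_mult_right (fy (a t) (b t))) ty) (a' * h, b' * h))) (at t)"
    by (rule has_derivative_in_compose[OF E has_derivative_subset[OF D]]) auto
  then show ?thesis
    unfolding has_field_derivative_def split_conv
    by (rule has_derivative_eq_rhs) (rule ext, simp add: algebra_simps)
qed

text \<open>The last two bounds are 1 \<le> Y \<le> exp (2 c \<tau>) after multiplication by the
  prefactor. Their ratio tends to 1 as s tends to -\<infinity>, and this is what carries the initial
  trace.\<close>

lemma selfsimilar_solution_exists:
  obtains N Ns Ny Nyy :: "real \<Rightarrow> real \<Rightarrow> real" where
    "continuous_on UNIV (\<lambda>(s, y). N s y)" "continuous_on UNIV (\<lambda>(s, y). Ns s y)"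
    "continuous_on UNIV (\<lambda>(s, y). Ny s y)" "continuous_on UNIV (\<lambda>(s, y). Nyy s y)"
    "\<And>s y. ((\<lambda>s. N s y) has_real_derivative Ns s y) (at s)"
    "\<And>s y. (N s has_real_derivative Ny s y) (at y)"
    "\<And>s y. (Ny s has_real_derivative Nyy s y) (at y)"
    "\<And>s y. Ns s y = Nyy s y / 2 + y / 2 * Ny s y + N s y - (N s y)\<^sup>2 / 2"
    "\<And>s y. cgauss * exp (s / 2) * exp (- y\<^sup>2 / 2) * exp (- (2 * cgauss * exp (s / 2))) \<le> N s y"
    "\<And>s y. N s y \<le> cgauss * exp (s / 2) * exp (- y\<^sup>2 / 2)"
proof -
  obtain Y Y1 Y2 Yt :: "real \<Rightarrow> real \<Rightarrow> real" where
    Y: "bcont Y" "bcont Y1" "bcont Y2" "continuous_on ({0..} \<times> UNIV) (\<lambda>(r, x). Yt r x)"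
    and lb: "\<And>r x. 0 \<le> r \<Longrightarrow> 1 \<le> Y r x"
    and ub: "\<And>r x. 0 \<le> r \<Longrightarrow> Y r x \<le> exp (2 * cgauss * r)"
    and dY: "\<And>r x. 0 \<le> r \<Longrightarrow> (Y r has_real_derivative Y1 r x) (at x)"
    and dY1: "\<And>r x. 0 \<le> r \<Longrightarrow> (Y1 r has_real_derivative Y2 r x) (at x)"
    and dYt: "\<And>r x. 0 < r \<Longrightarrow> ((\<lambda>r. Y r x) has_real_derivative Yt r x) (at r)"
    and pde: "\<And>r x. 0 \<le> r \<Longrightarrow> r * Yt r x = 2 * cgauss * r * kap Y r x - x * Y1 r x + Y2 r x"
    using profile_exists by blast
  define w where "w s y = cgauss * exp (s / 2) * exp (- y\<^sup>2 / 2) * exp (- (2 * cgauss * exp (s / 2)))" for s y :: real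
  have w0: "w s y > 0" for s y using cgauss_pos by (simp add: w_def)
  define N where "N s y = w s y * Y (exp (s / 2)) y" for s y
  define Ny where "Ny s y = w s y * (Y1 (exp (s / 2)) y - y * Y (exp (s / 2)) y)" for s y
  define Nyy where "Nyy s y = w s y * (Y2 (exp (s / 2)) y - 2 * y * Y1 (exp (s / 2)) y
      + (y\<^sup>2 - 1) * Y (exp (s / 2)) y)" for s y
  define Ns where "Ns s y = w s y * ((1 / 2 - cgauss * exp (s / 2)) * Y (exp (s / 2)) y
      + exp (s / 2) / 2 * Yt (exp (s / 2)) y)" for s y
  have c: "continuous_on UNIV (\<lambda>p. f (exp (fst p / 2)) (snd p))"
    if "continuous_on ({0..} \<times> UNIV) (\<lambda>(r, x). f r x)" for f :: "real \<Rightarrow> real \<Rightarrow> real"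
  proof -
    have "continuous_on UNIV (\<lambda>p::real \<times> real. (\<lambda>(r, x). f r x) (exp (fst p / 2), snd p))"
      by (rule continuous_on_compose2[OF that]) (auto intro!: continuous_intros)
    then show ?thesis by simp
  qed
  have cw: "continuous_on UNIV (\<lambda>p. w (fst p) (snd p))"
    unfolding w_def by (intro continuous_intros) auto
  note cc = c[OF bcont_continuous[OF Y(1)]] c[OF bcont_continuous[OF Y(2)]]
    c[OF bcont_continuous[OF Y(3)]] c[OF Y(4)]
  have dwy: "(w s has_real_derivative - y * w s y) (at y)" for s y
    unfolding w_def[abs_def] by (auto intro!: derivative_eq_intros)
  have dws: "((\<lambda>s. w s y) has_real_derivative (1 / 2 - cgauss * exp (s / 2)) * w s y) (at s)" for s y
    unfolding w_def[abs_def] by (auto intro!: derivative_eq_intros simp: algebra_simps)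
  show ?thesis
  proof (rule that[of N Ns Ny Nyy])
    show "continuous_on UNIV (\<lambda>(s, y). N s y)" "continuous_on UNIV (\<lambda>(s, y). Ns s y)"
      "continuous_on UNIV (\<lambda>(s, y). Ny s y)" "continuous_on UNIV (\<lambda>(s, y). Nyy s y)"
      unfolding case_prod_beta' N_def Ns_def Ny_def Nyy_def
      by (intro continuous_intros cc cw; simp)+
    fix s y :: real
    have r: "0 \<le> exp (s / 2)" "0 < exp (s / 2)" by simp_all
    show "((\<lambda>s. N s y) has_real_derivative Ns s y) (at s)"
    proof -
      have "((\<lambda>s. exp (s / 2)) has_real_derivative exp (s / 2) / 2) (at s)"
        by (auto intro!: derivative_eq_intros)
      from DERIV_chain2[OF dYt[OF r(2)] this]
      have "((\<lambda>s. Y (exp (s / 2)) y) has_real_derivative Yt (exp (s / 2)) y * (exp (s / 2) / 2)) (at s)" .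
      from DERIV_mult[OF dws this] show ?thesis
        unfolding N_def Ns_def by (rule DERIV_cong) (simp add: algebra_simps)
    qed
    show "(N s has_real_derivative Ny s y) (at y)"
      unfolding N_def[abs_def] Ny_def
      by (rule DERIV_cong[OF DERIV_mult[OF dwy dY[OF r(1)]]]) (simp add: algebra_simps)
    have "((\<lambda>y. Y1 (exp (s / 2)) y - y * Y (exp (s / 2)) y) has_real_derivative
        Y2 (exp (s / 2)) y - (1 * Y (exp (s / 2)) y + Y1 (exp (s / 2)) y * y)) (at y)"
      by (intro DERIV_diff DERIV_mult DERIV_ident dY dY1 r)
    from DERIV_mult[OF dwy this]
    show "(Ny s has_real_derivative Nyy s y) (at y)"
      unfolding Ny_def[abs_def] Nyy_def
      by (rule DERIV_cong) (simp add: algebra_simps power2_eq_square)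
    show "Ns s y = Nyy s y / 2 + y / 2 * Ny s y + N s y - (N s y)\<^sup>2 / 2"
    proof -
      have k: "kap Y (exp (s / 2)) y * cgauss * exp (s / 2)
          = Y (exp (s / 2)) y * cgauss * exp (s / 2) - w s y * (Y (exp (s / 2)) y)\<^sup>2 / 2"
        by (simp add: kap_def w_def algebra_simps)
      have "exp (s / 2) * Yt (exp (s / 2)) y = 2 * (kap Y (exp (s / 2)) y * cgauss * exp (s / 2))
          - y * Y1 (exp (s / 2)) y + Y2 (exp (s / 2)) y"
        using pde[OF r(1), of y] by (simp add: algebra_simps)
      then have e: "exp (s / 2) * Yt (exp (s / 2)) y = 2 * Y (exp (s / 2)) y * cgauss * exp (s / 2)
          - w s y * (Y (exp (s / 2)) y)\<^sup>2 - y * Y1 (exp (s / 2)) y + Y2 (exp (s / 2)) y"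
        unfolding k by (simp add: algebra_simps)
      have "Ns s y = w s y * ((1 / 2 - cgauss * exp (s / 2)) * Y (exp (s / 2)) y
          + (exp (s / 2) * Yt (exp (s / 2)) y) / 2)"
        by (simp add: Ns_def)
      then show ?thesis
        unfolding e by (simp add: Nyy_def Ny_def N_def field_simps power2_eq_square)
    qed
    show "cgauss * exp (s / 2) * exp (- y\<^sup>2 / 2) * exp (- (2 * cgauss * exp (s / 2))) \<le> N s y"
      using mult_left_mono[OF lb[OF r(1), of y], of "w s y"] w0[of s y] by (simp add: N_def w_def)
    have "N s y \<le> w s y * exp (2 * cgauss * exp (s / 2))"
      unfolding N_def using ub[OF r(1), of y] w0[of s y] by (intro mult_left_mono) auto
    also have "\<dots> = cgauss * exp (s / 2) * exp (- y\<^sup>2 / 2)"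
      by (simp add: w_def exp_minus)
    finally show "N s y \<le> cgauss * exp (s / 2) * exp (- y\<^sup>2 / 2)" .
  qed
qed

section \<open>The fundamental solution in the original variables\<close>

definition hk :: "real \<Rightarrow> real \<Rightarrow> real" where
  "hk t x = normal_density 0 (sqrt t) x"

lemma hk_eq: "0 < t \<Longrightarrow> hk t x = cgauss / sqrt t * exp (- x\<^sup>2 / (2 * t))"
  by (simp add: hk_def normal_density_def cgauss_def real_sqrt_mult)

lemma hk_pos: "0 < t \<Longrightarrow> 0 < hk t x"
  by (simp add: hk_def normal_density_pos)

lemma hk_integrable: "0 < t \<Longrightarrow> integrable lborel (hk t)"
  unfolding hk_def by (rule integrable_normal_density) simp

lemma hk_integral: "0 < t \<Longrightarrow> (\<integral>x. hk t x \<partial>lborel) = 1"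
  unfolding hk_def by (rule integral_normal_density) simp

lemma hk_gauss:
  fixes f :: "real \<Rightarrow> real"
  assumes t: "0 < t" and [measurable]: "f \<in> borel_measurable borel"
  shows "(\<integral>x. hk t x * f x \<partial>lborel) = (\<integral>z. f (sqrt t * z) \<partial>gauss)"
proof -
  have "(\<integral>x. hk t x * f x \<partial>lborel)
      = sqrt t * (\<integral>z. hk t (sqrt t * z) * f (sqrt t * z) \<partial>lborel)"
    using lborel_integral_real_affine[of "sqrt t" "\<lambda>x. hk t x * f x" 0] t by simp
  also have "\<dots> = (\<integral>z. sqrt t * (hk t (sqrt t * z) * f (sqrt t * z)) \<partial>lborel)"
    by simp
  also have "\<dots> = (\<integral>z. std_normal_density z * f (sqrt t * z) \<partial>lborel)"
    by (rule Bochner_Integration.integral_cong)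
       (use t in \<open>simp_all add: hk_eq cgauss_def std_normal_density_def power_mult_distrib\<close>)
  also have "\<dots> = (\<integral>z. f (sqrt t * z) \<partial>gauss)"
    by (rule integral_gauss[symmetric]) measurable
  finally show ?thesis .
qed

lemma compact_support_bounded:
  fixes \<phi> :: "real \<Rightarrow> real"
  assumes c: "continuous_on UNIV \<phi>" and R: "\<forall>x. \<bar>x\<bar> > R \<longrightarrow> \<phi> x = 0"
  obtains M where "M \<ge> 0" "\<And>x. \<bar>\<phi> x\<bar> \<le> M"
proof -
  have "compact (\<phi> ` {-\<bar>R\<bar>..\<bar>R\<bar>})"
    by (rule compact_continuous_image) (use c in \<open>auto intro: continuous_on_subset\<close>)
  then have "bounded (\<phi> ` {-\<bar>R\<bar>..\<bar>R\<bar>})" by (rule compact_imp_bounded)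
  then obtain M where M: "\<And>x. x \<in> {-\<bar>R\<bar>..\<bar>R\<bar>} \<Longrightarrow> \<bar>\<phi> x\<bar> \<le> M"
    unfolding bounded_iff by (metis imageI real_norm_def)
  show ?thesis
  proof (rule that[of "max M 0"])
    show "\<bar>\<phi> x\<bar> \<le> max M 0" for x
      using M[of x] R by (cases "x \<in> {-\<bar>R\<bar>..\<bar>R\<bar>}") (auto simp: le_max_iff_disj)
  qed simp
qed

lemma hk_trace:
  fixes \<phi> :: "real \<Rightarrow> real"
  assumes c: "continuous_on UNIV \<phi>" and M: "\<And>x. \<bar>\<phi> x\<bar> \<le> M"
  shows "((\<lambda>t. \<integral>x. hk t x * \<phi> x \<partial>lborel) \<longlongrightarrow> \<phi> 0) (at_right 0)"
proof -
  have [measurable]: "\<phi> \<in> borel_measurable borel" using c by (rule borel_measurable_continuous_onI)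
  define f where "f t = (\<integral>z. \<phi> (sqrt t * z) \<partial>gauss)" for t
  \<comment> \<open>\<open>sqrt\<close> is extended to negative arguments as an odd continuous
    function, so \<open>f\<close> is continuous on the whole line and its right limit at 0 is
    \<open>f 0\<close>.\<close>
  have "continuous_on UNIV f"
    unfolding f_def
  proof (rule continuous_on_integral_dominated[where g = "\<lambda>_. M"])
    show "continuous_on UNIV (\<lambda>t. \<phi> (sqrt t * z))" for z
      by (rule continuous_on_compose2[OF c]) (auto intro!: continuous_intros)
  qed (use M in auto)
  then have "isCont f 0" by (simp add: continuous_on_eq_continuous_at)
  then have "(f \<longlongrightarrow> f 0) (at 0)" by (simp only: isCont_def)
  then have 1: "(f \<longlongrightarrow> f 0) (at_right 0)" by (rule tendsto_within_subset) simp
  have 2: "f 0 = \<phi> 0" using gauss.prob_space by (simp add: f_def)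
  have 3: "eventually (\<lambda>t. f t = (\<integral>x. hk t x * \<phi> x \<partial>lborel)) (at_right 0)"
    unfolding eventually_at_right_field by (auto intro!: exI[of _ 1] simp: hk_gauss f_def)
  show ?thesis using 1 unfolding 2 tendsto_cong[OF 3] .
qed

text \<open>The solution is only obtained existentially, so its properties become assumptions of a
  locale, which the final proof interprets with the solution constructed above.\<close>

locale selfsimilar =
  fixes N Ns Ny Nyy :: "real \<Rightarrow> real \<Rightarrow> real"
  assumes N_cont: "continuous_on UNIV (\<lambda>(s, y). N s y)" "continuous_on UNIV (\<lambda>(s, y). Ns s y)"
      "continuous_on UNIV (\<lambda>(s, y). Ny s y)" "continuous_on UNIV (\<lambda>(s, y). Nyy s y)"
    and dNs: "\<And>s y. ((\<lambda>s. N s y) has_real_derivative Ns s y) (at s)"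
    and dNy: "\<And>s y. (N s has_real_derivative Ny s y) (at y)"
    and dNyy: "\<And>s y. (Ny s has_real_derivative Nyy s y) (at y)"
    and N_pde: "\<And>s y. Ns s y = Nyy s y / 2 + y / 2 * Ny s y + N s y - (N s y)\<^sup>2 / 2"
    and N_lower: "\<And>s y. cgauss * exp (s / 2) * exp (- y\<^sup>2 / 2) * exp (- (2 * cgauss * exp (s / 2))) \<le> N s y"
    and N_upper: "\<And>s y. N s y \<le> cgauss * exp (s / 2) * exp (- y\<^sup>2 / 2)"
begin

definition U :: "real \<Rightarrow> real \<Rightarrow> real" where
  "U t x = (if t \<le> 0 then 0 else N (ln t) (x / sqrt t) / t)"

lemma hk_selfsimilar:
  assumes "0 < t"
  shows "cgauss * exp (ln t / 2) * exp (- (x / sqrt t)\<^sup>2 / 2) / t = hk t x"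
proof -
  have "exp (ln t / 2) = sqrt t"
    using assms by (simp add: ln_sqrt [symmetric])
  moreover have "(x / sqrt t)\<^sup>2 = x\<^sup>2 / t"
    using assms by (simp add: power_divide)
  moreover have "sqrt t / t = 1 / sqrt t"
    using assms by (simp add: field_simps)
  ultimately show ?thesis
    using assms by (simp add: hk_eq field_simps)
qed

lemma U_upper: "0 < t \<Longrightarrow> U t x \<le> hk t x"
  using divide_right_mono[OF N_upper[of "ln t" "x / sqrt t"], of t]
  by (simp only: hk_selfsimilar) (simp add: U_def)

lemma U_lower: "0 < t \<Longrightarrow> exp (- (2 * cgauss * sqrt t)) * hk t x \<le> U t x"
proof -
  assume t: "0 < t"
  have "exp (- (2 * cgauss * sqrt t)) * hk t x = (cgauss * exp (ln t / 2) * exp (- (x / sqrt t)\<^sup>2 / 2)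
      * exp (- (2 * cgauss * exp (ln t / 2)))) / t"
    using t by (simp add: hk_selfsimilar[symmetric] ln_sqrt [symmetric])
  also have "\<dots> \<le> U t x"
    using divide_right_mono[OF N_lower[of "ln t" "x / sqrt t"], of t] t by (simp add: U_def)
  finally show ?thesis .
qed

lemma U_pos: "0 < t \<Longrightarrow> 0 < U t x"
  by (rule less_le_trans[OF _ U_lower]) (simp_all add: hk_pos)

lemma U_measurable: "0 < t \<Longrightarrow> U t \<in> borel_measurable borel"
proof -
  assume t: "0 < t"
  have "continuous_on UNIV (N (ln t))"
    using dNy by (meson DERIV_isCont continuous_at_imp_continuous_on)
  then have "continuous_on UNIV (U t)"
    unfolding U_def[abs_def] using t
    by (auto intro!: continuous_intros continuous_on_compose2[of UNIV "N (ln t)"])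
  then show ?thesis by (rule borel_measurable_continuous_onI)
qed

text \<open>The trace is inherited from the heat kernel: \<open>U_lower\<close> and
  \<open>U_upper\<close> bound the integral of |U - hk| at time t by 1 - exp (- 2 c \<surd>t), which
  tends to 0.\<close>

lemma U_is_sol: "is_sol 1 U"
  unfolding is_sol_def
proof (intro conjI allI impI)
  show "U t x = 0" if "t \<le> 0" for t x using that by (simp add: U_def)
  show "0 \<le> U t x" if "0 < t" for t x using U_pos[OF that, of x] by simp
  define Ut where "Ut t x = (Ns (ln t) (x / sqrt t) - x / sqrt t / 2 * Ny (ln t) (x / sqrt t)
      - N (ln t) (x / sqrt t)) / t\<^sup>2" for t x
  define Ux where "Ux t x = Ny (ln t) (x / sqrt t) / (t * sqrt t)" for t x
  define Uxx where "Uxx t x = Nyy (ln t) (x / sqrt t) / t\<^sup>2" for t x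
  show "\<exists>Vt Vx Vxx.
     (\<forall>t x. 0 < t \<longrightarrow>
            ((\<lambda>s. U s x) has_real_derivative Vt t x) (at t) \<and>
            (U t has_real_derivative Vx t x) (at x) \<and>
            (Vx t has_real_derivative Vxx t x) (at x) \<and>
            Vt t x = Vxx t x / 2 - (U t x)\<^sup>2 / 2) \<and>
     continuous_on ({0<..} \<times> UNIV) (\<lambda>(t, x). U t x) \<and>
     continuous_on ({0<..} \<times> UNIV) (\<lambda>(t, x). Vt t x) \<and>
     continuous_on ({0<..} \<times> UNIV) (\<lambda>(t, x). Vx t x) \<and>
     continuous_on ({0<..} \<times> UNIV) (\<lambda>(t, x). Vxx t x)"
  proof (rule exI[of _ Ut], rule exI[of _ Ux], rule exI[of _ Uxx], intro conjI allI impI)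
    fix t x :: real assume t: "0 < t"
    have sq: "sqrt t * sqrt t = t" "sqrt t > 0" using t by auto
    have sq3: "sqrt t / t = 1 / sqrt t" using t by (simp add: field_simps)
    have "((\<lambda>t. x / sqrt t) has_real_derivative - (x / sqrt t / (2 * t))) (at t)"
      using t by (auto intro!: derivative_eq_intros simp: field_simps)
    from DERIV_chain_two[where f = N, OF dNs dNy N_cont(3) DERIV_ln_divide[OF t] this]
    have "((\<lambda>t. N (ln t) (x / sqrt t)) has_real_derivative
        Ns (ln t) (x / sqrt t) * (1 / t) + Ny (ln t) (x / sqrt t) * - (x / sqrt t / (2 * t))) (at t)" .
    from DERIV_divide[OF this DERIV_ident]
    have "((\<lambda>t. N (ln t) (x / sqrt t) / t) has_real_derivative Ut t x) (at t)"
      by (rule DERIV_cong) (use t sq3 in \<open>simp_all add: Ut_def power2_eq_square field_simps\<close>)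
    then show "((\<lambda>s. U s x) has_real_derivative Ut t x) (at t)"
      by (rule has_field_derivative_transform_within_open[where S = "{0<..}"]) (use t in \<open>auto simp: U_def\<close>)
    have dx: "((\<lambda>x. x / sqrt t) has_real_derivative 1 / sqrt t) (at x)"
      by (rule DERIV_cdivide[OF DERIV_ident])
    from DERIV_cdivide[OF DERIV_chain2[OF dNy[of "ln t"] dx], of t]
    show "(U t has_real_derivative Ux t x) (at x)"
      using t by (simp add: U_def[abs_def] Ux_def mult.commute)
    from DERIV_cdivide[OF DERIV_chain2[OF dNyy[of "ln t"] dx], of "t * sqrt t"]
    show "(Ux t has_real_derivative Uxx t x) (at x)"
      using t sq by (simp add: Ux_def[abs_def] Uxx_def power2_eq_square mult_ac)
    show "Ut t x = Uxx t x / 2 - (U t x)\<^sup>2 / 2"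
      using t by (simp add: Ut_def Uxx_def U_def N_pde power_divide field_simps power2_eq_square)
  next
    have c: "continuous_on ({0<..} \<times> UNIV) (\<lambda>p. f (ln (fst p)) (snd p / sqrt (fst p)))"
      if "continuous_on UNIV (\<lambda>(s, y). f s y)" for f :: "real \<Rightarrow> real \<Rightarrow> real"
    proof -
      have "continuous_on ({0<..} \<times> UNIV) (\<lambda>p::real \<times> real. (\<lambda>(s, y). f s y) (ln (fst p), snd p / sqrt (fst p)))"
        by (rule continuous_on_compose2[OF that]) (auto intro!: continuous_intros)
      then show ?thesis by simp
    qed
    note cc = c[OF N_cont(1)] c[OF N_cont(2)] c[OF N_cont(3)] c[OF N_cont(4)]
    have "continuous_on ({0<..} \<times> UNIV) (\<lambda>p. N (ln (fst p)) (snd p / sqrt (fst p)) / fst p)"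
      by (intro continuous_intros cc) auto
    then show "continuous_on ({0<..} \<times> UNIV) (\<lambda>(t, x). U t x)"
      by (rule continuous_on_cong[THEN iffD1, rotated -1]) (auto simp: U_def)
    show "continuous_on ({0<..} \<times> UNIV) (\<lambda>(t, x). Ut t x)"
      unfolding case_prod_beta' Ut_def by (intro continuous_intros cc) auto
    show "continuous_on ({0<..} \<times> UNIV) (\<lambda>(t, x). Ux t x)"
      unfolding case_prod_beta' Ux_def by (intro continuous_intros cc) auto
    show "continuous_on ({0<..} \<times> UNIV) (\<lambda>(t, x). Uxx t x)"
      unfolding case_prod_beta' Uxx_def by (intro continuous_intros cc) auto
  qed
  show int: "integrable lborel (U t)" if t: "0 < t" for t
    by (rule Bochner_Integration.integrable_bound[OF hk_integrable[OF t]])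
       (use U_measurable[OF t] U_upper[OF t] less_imp_le[OF U_pos[OF t]] less_imp_le[OF hk_pos[OF t]] in auto)
  fix \<phi> :: "real \<Rightarrow> real"
  assume c: "continuous_on UNIV \<phi>" and "\<exists>R. \<forall>x. \<bar>x\<bar> > R \<longrightarrow> \<phi> x = 0"
  then obtain R where R: "\<forall>x. \<bar>x\<bar> > R \<longrightarrow> \<phi> x = 0" by blast
  obtain M where M: "M \<ge> 0" "\<And>x. \<bar>\<phi> x\<bar> \<le> M" using compact_support_bounded[OF c R] by blast
  have [measurable]: "\<phi> \<in> borel_measurable borel" using c by (rule borel_measurable_continuous_onI)
  have bd: "integrable lborel (\<lambda>x. f x * \<phi> x)" if "integrable lborel f" for f :: "real \<Rightarrow> real"
  proof (rule Bochner_Integration.integrable_bound)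
    show "integrable lborel (\<lambda>x. M * f x)" using that by simp
    show "AE x in lborel. norm (f x * \<phi> x) \<le> norm (M * f x)"
      using M by (intro AE_I2) (simp add: abs_mult mult.commute mult_right_mono)
  qed (use that in auto)
  have diff: "\<bar>(\<integral>x. U t x * \<phi> x \<partial>lborel) - (\<integral>x. hk t x * \<phi> x \<partial>lborel)\<bar>
      \<le> M * (1 - exp (- (2 * cgauss * sqrt t)))" if t: "0 < t" for t
  proof -
    have "(\<integral>x. U t x * \<phi> x \<partial>lborel) - (\<integral>x. hk t x * \<phi> x \<partial>lborel)
        = (\<integral>x. U t x * \<phi> x - hk t x * \<phi> x \<partial>lborel)"
      by (intro Bochner_Integration.integral_diff[symmetric] bd int hk_integrable t)
    also have "\<bar>\<dots>\<bar> \<le> (\<integral>x. \<bar>U t x * \<phi> x - hk t x * \<phi> x\<bar> \<partial>lborel)"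
      by (rule integral_abs_bound)
    also have "\<dots> \<le> (\<integral>x. M * (1 - exp (- (2 * cgauss * sqrt t))) * hk t x \<partial>lborel)"
    proof (rule integral_mono)
      show "integrable lborel (\<lambda>x. \<bar>U t x * \<phi> x - hk t x * \<phi> x\<bar>)"
        by (intro integrable_abs Bochner_Integration.integrable_diff bd int hk_integrable t)
      show "integrable lborel (\<lambda>x. M * (1 - exp (- (2 * cgauss * sqrt t))) * hk t x)"
        using hk_integrable[OF t] by simp
      fix x
      have "\<bar>U t x - hk t x\<bar> \<le> (1 - exp (- (2 * cgauss * sqrt t))) * hk t x"
        using U_upper[OF t, of x] U_lower[OF t, of x] by (simp add: algebra_simps)
      then have "\<bar>U t x - hk t x\<bar> * \<bar>\<phi> x\<bar> \<le> ((1 - exp (- (2 * cgauss * sqrt t))) * hk t x) * M"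
        using M by (intro mult_mono) (auto intro: order_trans[OF abs_ge_zero])
      then show "\<bar>U t x * \<phi> x - hk t x * \<phi> x\<bar> \<le> M * (1 - exp (- (2 * cgauss * sqrt t))) * hk t x"
        by (simp only: left_diff_distrib [symmetric] abs_mult) (simp add: mult_ac)
    qed
    also have "\<dots> = M * (1 - exp (- (2 * cgauss * sqrt t)))"
      using hk_integral[OF t] by simp
    finally show ?thesis .
  qed
  have "((\<lambda>t. M * (1 - exp (- (2 * cgauss * sqrt t)))) \<longlongrightarrow> M * (1 - exp (- (2 * cgauss * sqrt 0)))) (at_right 0)"
    by (intro tendsto_intros)
  then have z: "((\<lambda>t. M * (1 - exp (- (2 * cgauss * sqrt t)))) \<longlongrightarrow> 0) (at_right 0)"
    by simp
  have "((\<lambda>t. (\<integral>x. U t x * \<phi> x \<partial>lborel) - (\<integral>x. hk t x * \<phi> x \<partial>lborel)) \<longlongrightarrow> 0) (at_right 0)"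
    by (rule Lim_null_comparison[OF _ z])
       (use diff in \<open>auto simp: eventually_at_right_field intro!: exI[of _ 1]\<close>)
  from tendsto_add[OF this hk_trace[OF c M(2)]]
  show "((\<lambda>t. \<integral>x. U t x * \<phi> x \<partial>lborel) \<longlongrightarrow> 1 * \<phi> 0) (at_right 0)" by simp
qed

end

section \<open>Maximum principle and scaling\<close>

lemma second_derivative_at_max:
  fixes f :: "real \<Rightarrow> real"
  assumes d: "\<And>y. (f has_real_derivative f' y) (at y)" and d2: "(f' has_real_derivative f'') (at x)"
    and m: "\<And>y. f y \<le> f x"
  shows "f' x = 0" "f'' \<le> 0"
proof -
  show z: "f' x = 0"
    by (rule DERIV_local_max[OF d zero_less_one]) (use m in auto)
  show "f'' \<le> 0"
  proof (rule ccontr)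
    assume "\<not> f'' \<le> 0"
    then obtain e where e: "e > 0" "\<And>h. 0 < h \<Longrightarrow> h < e \<Longrightarrow> f' x < f' (x + h)"
      using DERIV_pos_inc_right[OF d2] by auto
    obtain \<xi> where \<xi>: "x < \<xi>" "\<xi> < x + e / 2" "f (x + e / 2) - f x = (x + e / 2 - x) * f' \<xi>"
      using MVT2[of x "x + e / 2" f f'] d e(1) by auto
    have "f' \<xi> > 0" using e(2)[of "\<xi> - x"] \<xi> e(1) z by simp
    then have "(x + e / 2 - x) * f' \<xi> > 0" using e(1) by (intro mult_pos_pos) auto
    then have "f (x + e / 2) - f x > 0" using \<xi>(3) by linarith
    with m[of "x + e / 2"] show False by simp
  qed
qed

text \<open>The differential inequality is demanded only where \<open>w\<close> is positive, so that
  the sign of w can be used against quadratic terms, and \<beta> may depend on the point since the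
  gradient vanishes at a maximum. The factor exp (- K t) with K > C makes the zeroth order term
  strictly dissipative.\<close>

lemma maximum_principle:
  fixes w :: "real \<Rightarrow> real \<Rightarrow> real"
  assumes cont: "continuous_on ({a..b} \<times> UNIV) (\<lambda>(t, x). w t x)"
    and init: "\<And>x. w a x \<le> 0"
    and decay: "\<And>e. e > 0 \<Longrightarrow> \<exists>R. \<forall>t\<in>{a..b}. \<forall>x. \<bar>x\<bar> > R \<longrightarrow> w t x \<le> e"
    and pde: "\<And>t x. a < t \<Longrightarrow> t \<le> b \<Longrightarrow> 0 < w t x \<Longrightarrow>
       \<exists>wt wx wxx \<beta>. ((\<lambda>s. w s x) has_real_derivative wt) (at t) \<and>
         (\<forall>y. (w t has_real_derivative wx y) (at y)) \<and> (wx has_real_derivative wxx) (at x) \<and>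
         wt \<le> wxx / 2 + \<beta> * wx x + C * w t x"
    and t: "t \<in> {a..b}"
  shows "w t x \<le> 0"
proof (rule ccontr)
  assume "\<not> w t x \<le> 0"
  then have pos: "w t x > 0" by simp
  define K where "K = \<bar>C\<bar> + 1"
  define v where "v t x = exp (- (K * t)) * w t x" for t x
  define m where "m = v t x"
  have K: "K > 0" "K > C" by (auto simp: K_def)
  have m0: "m > 0" using pos by (simp add: m_def v_def)
  \<comment> \<open>Once \<open>w\<close> is below this level far out, \<open>v\<close> is at most
    m/2 there, because exp (- K t) \<le> exp (- K a). A value at least m is therefore maximal on a
    compact rectangle.\<close>
  have "0 < m * exp (K * a) / 2" using m0 by simp
  from decay[OF this]
  obtain R where R: "\<And>t x. t \<in> {a..b} \<Longrightarrow> \<bar>x\<bar> > R \<Longrightarrow> w t x \<le> m * exp (K * a) / 2"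
    by blast
  have out: "v t x \<le> m / 2" if "t \<in> {a..b}" "\<bar>x\<bar> > R" for t x
  proof -
    have "v t x \<le> exp (- (K * t)) * (m * exp (K * a) / 2)"
      unfolding v_def using R[OF that] by (intro mult_left_mono) auto
    also have "\<dots> = m / 2 * exp (K * a - K * t)" by (simp add: exp_diff exp_minus field_simps)
    also have "\<dots> \<le> m / 2 * 1" using m0 K that by (intro mult_left_mono) auto
    finally show ?thesis by simp
  qed
  define R' where "R' = max \<bar>R\<bar> \<bar>x\<bar>"
  define S where "S = {a..b} \<times> {-R'..R'}"
  have "continuous_on S (\<lambda>p. (\<lambda>(t, x). w t x) p)"
    by (rule continuous_on_subset[OF cont]) (auto simp: S_def)
  then have cv: "continuous_on S (\<lambda>p. v (fst p) (snd p))"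
    unfolding v_def case_prod_beta' by (intro continuous_intros)
  have tx: "(t, x) \<in> S" using t by (auto simp: S_def R'_def)
  obtain p where p: "p \<in> S" "\<And>q. q \<in> S \<Longrightarrow> v (fst q) (snd q) \<le> v (fst p) (snd p)"
    using continuous_attains_sup[OF _ _ cv] tx by (auto simp: S_def compact_Times)
  define t2 x2 where "t2 = fst p" and "x2 = snd p"
  have mle: "m \<le> v t2 x2" using p(2)[OF tx] by (simp add: m_def t2_def x2_def)
  have t2: "t2 \<in> {a..b}" using p(1) by (auto simp: S_def t2_def)
  have max: "v s y \<le> v t2 x2" if "s \<in> {a..b}" for s y
  proof (cases "\<bar>y\<bar> \<le> R'")
    case True
    then show ?thesis using p(2)[of "(s, y)"] that by (auto simp: S_def t2_def x2_def abs_le_iff)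
  next
    case False
    then have "\<bar>y\<bar> > R" by (auto simp: R'_def)
    from out[OF that this] mle m0 show ?thesis by linarith
  qed
  have w2: "w t2 x2 > 0" using less_le_trans[OF m0 mle] by (simp add: v_def zero_less_mult_iff)
  then have "t2 \<noteq> a" using init[of x2] by auto
  then have "a < t2" "t2 \<le> b" using t2 by auto
  from pde[OF this w2] obtain wt wx wxx \<beta> where
    d: "((\<lambda>s. w s x2) has_real_derivative wt) (at t2)"
      "\<And>y. (w t2 has_real_derivative wx y) (at y)" "(wx has_real_derivative wxx) (at x2)"
    and le: "wt \<le> wxx / 2 + \<beta> * wx x2 + C * w t2 x2" by blast
  have "w t2 y \<le> w t2 x2" for y
    using max[OF t2, of y] by (simp add: v_def)
  from second_derivative_at_max[OF d(2,3) this] have "wx x2 = 0" "wxx \<le> 0" by auto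
  with le have 1: "wt \<le> C * w t2 x2" by simp
  have dv: "((\<lambda>s. v s x2) has_real_derivative exp (- (K * t2)) * (wt - K * w t2 x2)) (at t2)"
    unfolding v_def by (auto intro!: derivative_eq_intros d(1) simp: algebra_simps)
  \<comment> \<open>Only earlier times are compared, since the maximum may lie on the final time
    \<open>b\<close>.\<close>
  have "\<not> exp (- (K * t2)) * (wt - K * w t2 x2) < 0"
  proof
    assume "exp (- (K * t2)) * (wt - K * w t2 x2) < 0"
    from DERIV_neg_dec_left[OF dv this] obtain e where
      e: "e > 0" "\<And>h. 0 < h \<Longrightarrow> h < e \<Longrightarrow> v t2 x2 < v (t2 - h) x2" by auto
    define h where "h = min (e / 2) (t2 - a)"
    have "0 < h" "h < e" "t2 - h \<in> {a..b}"
      using e(1) \<open>a < t2\<close> t2 by (auto simp: h_def min_def)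
    with e(2)[of h] max[of "t2 - h" x2] show False by simp
  qed
  then have "K * w t2 x2 \<le> wt" by (simp add: mult_less_0_iff)
  with 1 have "K * w t2 x2 \<le> C * w t2 x2" by linarith
  with w2 K show False by simp
qed

section \<open>Scaling and reflection of solutions\<close>

definition C12 :: "(real \<Rightarrow> real \<Rightarrow> real) \<Rightarrow> (real \<Rightarrow> real \<Rightarrow> real) \<Rightarrow> (real \<Rightarrow> real \<Rightarrow> real)
    \<Rightarrow> (real \<Rightarrow> real \<Rightarrow> real) \<Rightarrow> bool" where
  "C12 V Vt Vx Vxx \<longleftrightarrow> (\<forall>t x. t > 0 \<longrightarrow>
      ((\<lambda>s. V s x) has_real_derivative Vt t x) (at t) \<and>
      (V t has_real_derivative Vx t x) (at x) \<and> (Vx t has_real_derivative Vxx t x) (at x)) \<and>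
    continuous_on ({0<..} \<times> UNIV) (\<lambda>(t,x). V t x) \<and>
    continuous_on ({0<..} \<times> UNIV) (\<lambda>(t,x). Vt t x) \<and>
    continuous_on ({0<..} \<times> UNIV) (\<lambda>(t,x). Vx t x) \<and>
    continuous_on ({0<..} \<times> UNIV) (\<lambda>(t,x). Vxx t x)"

lemma C12D:
  assumes "C12 V Vt Vx Vxx"
  shows "t > 0 \<Longrightarrow> ((\<lambda>s. V s x) has_real_derivative Vt t x) (at t)"
    "t > 0 \<Longrightarrow> (V t has_real_derivative Vx t x) (at x)"
    "t > 0 \<Longrightarrow> (Vx t has_real_derivative Vxx t x) (at x)"
    "continuous_on ({0<..} \<times> UNIV) (\<lambda>(t,x). V t x)"
    "continuous_on ({0<..} \<times> UNIV) (\<lambda>(t,x). Vt t x)"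
    "continuous_on ({0<..} \<times> UNIV) (\<lambda>(t,x). Vx t x)"
    "continuous_on ({0<..} \<times> UNIV) (\<lambda>(t,x). Vxx t x)"
  using assms by (auto simp: C12_def)

lemma is_sol_derivatives:
  assumes "is_sol lam V"
  obtains Vt Vx Vxx where "C12 V Vt Vx Vxx"
    "\<And>t x. t > 0 \<Longrightarrow> Vt t x = Vxx t x / 2 - (V t x)\<^sup>2 / 2"
proof -
  from assms[unfolded is_sol_def, THEN conjunct2, THEN conjunct2, THEN conjunct1]
  have "\<exists>Vt Vx Vxx. C12 V Vt Vx Vxx \<and> (\<forall>t x. t > 0 \<longrightarrow> Vt t x = Vxx t x / 2 - (V t x)\<^sup>2 / 2)"
    unfolding C12_def
    apply (elim exE)
    subgoal for Vt Vx Vxx by (rule exI[of _ Vt], rule exI[of _ Vx], rule exI[of _ Vxx]) blast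
    done
  then show thesis using that by blast
qed

lemma is_solD:
  assumes "is_sol lam V"
  shows "t \<le> 0 \<Longrightarrow> V t x = 0" "0 < t \<Longrightarrow> 0 \<le> V t x" "0 < t \<Longrightarrow> integrable lborel (V t)"
    "continuous_on UNIV \<phi> \<Longrightarrow> \<exists>R. \<forall>x. \<bar>x\<bar> > R \<longrightarrow> \<phi> x = 0 \<Longrightarrow>
       ((\<lambda>t. LINT x|lborel. V t x * \<phi> x) \<longlongrightarrow> lam * \<phi> 0) (at_right 0)"
  using assms unfolding is_sol_def by (simp_all del: split_paired_All)

text \<open>The mass becomes r^2 / |r| = |r| times the old one. Negative \<open>r\<close> is
  allowed, so that r = -1 yields the reflection.\<close>

lemma is_sol_scale:
  assumes V: "is_sol lam V" and r: "r \<noteq> 0"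
  shows "is_sol (\<bar>r\<bar> * lam) (\<lambda>t x. r\<^sup>2 * V (r\<^sup>2 * t) (r * x))"
proof -
  have r2: "r\<^sup>2 > 0" using r by simp
  obtain Vt Vx Vxx where C: "C12 V Vt Vx Vxx"
    and pde: "\<And>t x. t > 0 \<Longrightarrow> Vt t x = Vxx t x / 2 - (V t x)\<^sup>2 / 2"
    using is_sol_derivatives[OF V] by blast
  note d = C12D(1-3)[OF C] pde and c = C12D(4-7)[OF C]
  note nonpos = is_solD(1)[OF V] and nonneg = is_solD(2)[OF V] and int = is_solD(3)[OF V]
    and tr = is_solD(4)[OF V]
  have cc: "continuous_on ({0<..} \<times> UNIV) (\<lambda>p. f (r\<^sup>2 * fst p) (r * snd p))"
    if "continuous_on ({0<..} \<times> UNIV) (\<lambda>(t,x). f t x)" for f :: "real \<Rightarrow> real \<Rightarrow> real"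
  proof -
    have "continuous_on ({0<..} \<times> UNIV) (\<lambda>p::real \<times> real. (\<lambda>(t,x). f t x) (r\<^sup>2 * fst p, r * snd p))"
      by (rule continuous_on_compose2[OF that]) (use r2 in \<open>auto intro!: continuous_intros\<close>)
    then show ?thesis by simp
  qed
  show ?thesis
    unfolding is_sol_def
  proof (intro conjI allI impI)
    show "r\<^sup>2 * V (r\<^sup>2 * t) (r * x) = 0" if "t \<le> 0" for t x
      using nonpos[of "r\<^sup>2 * t" "r * x"] that by (simp add: mult_nonneg_nonpos)
    show "0 \<le> r\<^sup>2 * V (r\<^sup>2 * t) (r * x)" if "0 < t" for t x
      using nonneg[of "r\<^sup>2 * t" "r * x"] that r2 by simp
    show "integrable lborel (\<lambda>x. r\<^sup>2 * V (r\<^sup>2 * t) (r * x))" if "0 < t" for t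
      using lborel_integrable_real_affine[OF int[of "r\<^sup>2 * t"] r, of 0] that r2 by simp
    show "\<exists>Wt Wx Wxx. (\<forall>t x. 0 < t \<longrightarrow>
            ((\<lambda>s. r\<^sup>2 * V (r\<^sup>2 * s) (r * x)) has_real_derivative Wt t x) (at t) \<and>
            ((\<lambda>y. r\<^sup>2 * V (r\<^sup>2 * t) (r * y)) has_real_derivative Wx t x) (at x) \<and>
            (Wx t has_real_derivative Wxx t x) (at x) \<and>
            Wt t x = Wxx t x / 2 - (r\<^sup>2 * V (r\<^sup>2 * t) (r * x))\<^sup>2 / 2) \<and>
        continuous_on ({0<..} \<times> UNIV) (\<lambda>(t,x). r\<^sup>2 * V (r\<^sup>2 * t) (r * x)) \<and>
        continuous_on ({0<..} \<times> UNIV) (\<lambda>(t,x). Wt t x) \<and>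
        continuous_on ({0<..} \<times> UNIV) (\<lambda>(t,x). Wx t x) \<and>
        continuous_on ({0<..} \<times> UNIV) (\<lambda>(t,x). Wxx t x)"
    proof (rule exI[of _ "\<lambda>t x. r\<^sup>2 * (Vt (r\<^sup>2 * t) (r * x) * r\<^sup>2)"],
        rule exI[of _ "\<lambda>t x. r\<^sup>2 * (Vx (r\<^sup>2 * t) (r * x) * r)"],
        rule exI[of _ "\<lambda>t x. r\<^sup>2 * (Vxx (r\<^sup>2 * t) (r * x) * r * r)"], intro conjI allI impI)
      fix t x :: real assume t: "0 < t"
      have rt: "0 < r\<^sup>2 * t" using t r2 by simp
      have l: "((\<lambda>x. c * x) has_real_derivative c) (at x)" for c x :: real
        by (auto intro!: derivative_eq_intros)
      show "((\<lambda>s. r\<^sup>2 * V (r\<^sup>2 * s) (r * x)) has_real_derivative r\<^sup>2 * (Vt (r\<^sup>2 * t) (r * x) * r\<^sup>2)) (at t)"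
        by (intro DERIV_cmult DERIV_chain2[OF d(1)[OF rt] l])
      show "((\<lambda>y. r\<^sup>2 * V (r\<^sup>2 * t) (r * y)) has_real_derivative r\<^sup>2 * (Vx (r\<^sup>2 * t) (r * x) * r)) (at x)"
        by (intro DERIV_cmult DERIV_chain2[OF d(2)[OF rt] l])
      show "((\<lambda>x. r\<^sup>2 * (Vx (r\<^sup>2 * t) (r * x) * r)) has_real_derivative r\<^sup>2 * (Vxx (r\<^sup>2 * t) (r * x) * r * r)) (at x)"
        by (intro DERIV_cmult DERIV_cmult_right DERIV_chain2[OF d(3)[OF rt] l])
      show "r\<^sup>2 * (Vt (r\<^sup>2 * t) (r * x) * r\<^sup>2) = r\<^sup>2 * (Vxx (r\<^sup>2 * t) (r * x) * r * r) / 2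
          - (r\<^sup>2 * V (r\<^sup>2 * t) (r * x))\<^sup>2 / 2"
        unfolding d(4)[OF rt] by (simp add: power2_eq_square algebra_simps)
    qed (unfold case_prod_beta', (intro continuous_intros cc c)+)
  next
    fix \<phi> :: "real \<Rightarrow> real"
    assume \<phi>: "continuous_on UNIV \<phi>" "\<exists>R. \<forall>x. \<bar>x\<bar> > R \<longrightarrow> \<phi> x = 0"
    obtain R where R: "\<And>x. \<bar>x\<bar> > R \<Longrightarrow> \<phi> x = 0" using \<phi>(2) by blast
    have "\<phi> (x / r) = 0" if "\<bar>x\<bar> > \<bar>r\<bar> * R" for x
      by (rule R) (use that r in \<open>simp add: field_simps\<close>)
    then have 1: "((\<lambda>t. LINT x|lborel. V t x * \<phi> (x / r)) \<longlongrightarrow> lam * \<phi> (0 / r)) (at_right 0)"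
      by (intro tr exI[of _ "\<bar>r\<bar> * R"] continuous_on_compose2[OF \<phi>(1)])
         (use r in \<open>auto intro!: continuous_intros\<close>)
    have 2: "filterlim (\<lambda>t. r\<^sup>2 * t) (at_right 0) (at_right 0)"
      unfolding filterlim_at
      using r2 by (auto simp: eventually_at_right_field intro!: exI[of _ 1] tendsto_eq_intros)
    have "((\<lambda>t. \<bar>r\<bar> * (LINT x|lborel. V (r\<^sup>2 * t) x * \<phi> (x / r))) \<longlongrightarrow> \<bar>r\<bar> * (lam * \<phi> (0 / r))) (at_right 0)"
      by (intro tendsto_intros filterlim_compose[OF 1 2])
    moreover have "\<bar>r\<bar> * (LINT x|lborel. V (r\<^sup>2 * t) x * \<phi> (x / r))
        = (LINT x|lborel. r\<^sup>2 * V (r\<^sup>2 * t) (r * x) * \<phi> x)" for t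
    proof -
      have "(LINT x|lborel. V (r\<^sup>2 * t) x * \<phi> (x / r)) = \<bar>r\<bar> * (LINT x|lborel. V (r\<^sup>2 * t) (r * x) * \<phi> x)"
        using lborel_integral_real_affine[OF r, of "\<lambda>x. V (r\<^sup>2 * t) x * \<phi> (x / r)" 0] r by simp
      then have "\<bar>r\<bar> * (LINT x|lborel. V (r\<^sup>2 * t) x * \<phi> (x / r))
          = r\<^sup>2 * (LINT x|lborel. V (r\<^sup>2 * t) (r * x) * \<phi> x)"
        by (simp add: power2_eq_square abs_mult_self_eq flip: mult.assoc)
      then show ?thesis by (simp add: mult.assoc)
    qed
    ultimately show "((\<lambda>t. LINT x|lborel. r\<^sup>2 * V (r\<^sup>2 * t) (r * x) * \<phi> x) \<longlongrightarrow> \<bar>r\<bar> * lam * \<phi> 0) (at_right 0)"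
      by (simp add: mult.assoc)
  qed
qed

section \<open>Uniqueness by duality with the heat kernel\<close>

lemma hk_deriv_x: "0 < \<rho> \<Longrightarrow> (hk \<rho> has_real_derivative - (z / \<rho>) * hk \<rho> z) (at z)"
proof -
  assume r: "0 < \<rho>"
  have "((\<lambda>x. exp (- x\<^sup>2 / (2 * \<rho>))) has_real_derivative
      - (z / \<rho>) * exp (- z\<^sup>2 / (2 * \<rho>))) (at z)"
    using r by (auto intro!: derivative_eq_intros)
  from DERIV_cmult[OF this, of "cgauss / sqrt \<rho>"]
  have "((\<lambda>x. cgauss / sqrt \<rho> * exp (- x\<^sup>2 / (2 * \<rho>))) has_real_derivative
      - (z / \<rho>) * (cgauss / sqrt \<rho> * exp (- z\<^sup>2 / (2 * \<rho>)))) (at z)"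
    by (simp add: mult_ac)
  moreover have "hk \<rho> = (\<lambda>x. cgauss / sqrt \<rho> * exp (- x\<^sup>2 / (2 * \<rho>)))"
    using hk_eq[OF r] by auto
  ultimately show ?thesis by simp
qed

lemma hk_deriv_t:
  assumes r: "0 < \<rho>"
  shows "((\<lambda>\<rho>. hk \<rho> z) has_real_derivative (z\<^sup>2 / \<rho>\<^sup>2 - 1 / \<rho>) / 2 * hk \<rho> z) (at \<rho>)"
proof -
  have sq: "sqrt \<rho> * sqrt \<rho> = \<rho>" using r by simp
  have "((\<lambda>\<rho>. cgauss / sqrt \<rho> * exp (- z\<^sup>2 / (2 * \<rho>))) has_real_derivative
      (z\<^sup>2 / \<rho>\<^sup>2 - 1 / \<rho>) / 2 * (cgauss / sqrt \<rho> * exp (- z\<^sup>2 / (2 * \<rho>)))) (at \<rho>)"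
    using r by (auto intro!: derivative_eq_intros) (simp add: field_simps power2_eq_square sq)
  then have "((\<lambda>\<rho>. hk \<rho> z) has_real_derivative
      (z\<^sup>2 / \<rho>\<^sup>2 - 1 / \<rho>) / 2 * (cgauss / sqrt \<rho> * exp (- z\<^sup>2 / (2 * \<rho>)))) (at \<rho>)"
    by (rule has_field_derivative_transform_within_open[where S = "{0<..}"]) (use r hk_eq in auto)
  then show ?thesis using hk_eq[OF r] by simp
qed

lemma continuous_on_hk: "continuous_on ({0<..} \<times> UNIV) (\<lambda>(\<rho>, z). hk \<rho> z)"
proof -
  have "continuous_on ({0<..} \<times> UNIV) (\<lambda>p. cgauss / sqrt (fst p) * exp (- (snd p)\<^sup>2 / (2 * fst p)))"
    by (intro continuous_intros) auto
  then show ?thesis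
    by (rule continuous_on_cong[THEN iffD1, rotated -1]) (auto simp: hk_eq)
qed

text \<open>|z / \<rho>| is the logarithmic gradient of the kernel, whose square enters the estimate
  of the cutoff error. The bound is v exp (- v) \<le> 1 with v = z^2 / (2 \<rho>), uniform as long
  as the age \<rho> stays away from 0.\<close>

lemma hk_gradient_bound:
  assumes "0 < \<rho>0"
  obtains B where "B > 0" "\<And>\<rho> z. \<rho>0 \<le> \<rho> \<Longrightarrow> hk \<rho> z * (1 + (z / \<rho>)\<^sup>2) \<le> B"
proof
  let ?B = "cgauss / sqrt \<rho>0 * (1 + 2 / \<rho>0)"
  show "?B > 0" using assms cgauss_pos by (intro mult_pos_pos divide_pos_pos) (auto simp: add_pos_pos)
  fix \<rho> z assume r: "\<rho>0 \<le> \<rho>"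
  then have r0: "0 < \<rho>" using assms by simp
  define v where "v = z\<^sup>2 / (2 * \<rho>)"
  have v0: "0 \<le> v" using r0 by (simp add: v_def)
  have "v \<le> exp v" using exp_ge_add_one_self[of v] by linarith
  then have ve: "exp (- v) * v \<le> 1" by (simp add: exp_minus field_simps)
  have "exp (- v) * (1 + (z / \<rho>)\<^sup>2) = exp (- v) + 2 / \<rho> * (exp (- v) * v)"
    using r0 by (simp add: v_def field_simps power2_eq_square)
  also have "\<dots> \<le> 1 + 2 / \<rho>0 * 1"
    using r r0 assms v0 ve by (intro add_mono mult_mono) (auto intro!: divide_left_mono)
  finally have e: "exp (- v) * (1 + (z / \<rho>)\<^sup>2) \<le> 1 + 2 / \<rho>0" by simp
  have "hk \<rho> z * (1 + (z / \<rho>)\<^sup>2) = cgauss / sqrt \<rho> * (exp (- v) * (1 + (z / \<rho>)\<^sup>2))"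
    using hk_eq[OF r0, of z] by (simp add: v_def)
  also have "\<dots> \<le> ?B"
  proof (rule mult_mono)
    show "cgauss / sqrt \<rho> \<le> cgauss / sqrt \<rho>0"
      using r assms cgauss_pos by (intro divide_left_mono mult_pos_pos) auto
  qed (use e assms cgauss_pos in auto)
  finally show "hk \<rho> z * (1 + (z / \<rho>)\<^sup>2) \<le> ?B" .
qed

text \<open>It is used only on [-R, R], where it and its first derivative vanish at the endpoints.
  The fourth power leaves a factor equal to the square root of the cutoff in both derivatives, as
  Young's inequality requires.\<close>

definition cutoff :: "real \<Rightarrow> real \<Rightarrow> real" where "cutoff R y = (1 - (y / R)\<^sup>2) ^ 4"
definition cutoff1 :: "real \<Rightarrow> real \<Rightarrow> real" where
  "cutoff1 R y = - 8 * (y / R\<^sup>2) * (1 - (y / R)\<^sup>2) ^ 3"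
definition cutoff2 :: "real \<Rightarrow> real \<Rightarrow> real" where
  "cutoff2 R y = - 8 / R\<^sup>2 * (1 - (y / R)\<^sup>2) ^ 3 + 48 * (y / R\<^sup>2)\<^sup>2 * (1 - (y / R)\<^sup>2)\<^sup>2"

lemma cutoff_deriv:
  shows "(cutoff R has_real_derivative cutoff1 R y) (at y)"
    and "(cutoff1 R has_real_derivative cutoff2 R y) (at y)"
proof -
  define c where "c = 1 / R"
  have c: "cutoff R = (\<lambda>y. (1 - (c * y)\<^sup>2) ^ 4)"
    "cutoff1 R = (\<lambda>y. - 8 * (c\<^sup>2 * y) * (1 - (c * y)\<^sup>2) ^ 3)"
    "cutoff2 R = (\<lambda>y. - 8 * c\<^sup>2 * (1 - (c * y)\<^sup>2) ^ 3 + 48 * (c\<^sup>2 * y)\<^sup>2 * (1 - (c * y)\<^sup>2)\<^sup>2)"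
    by (simp_all add: fun_eq_iff cutoff_def cutoff1_def cutoff2_def c_def power_divide)
  show "(cutoff R has_real_derivative cutoff1 R y) (at y)"
    unfolding c by (auto intro!: derivative_eq_intros) (simp add: power2_eq_square)
  show "(cutoff1 R has_real_derivative cutoff2 R y) (at y)"
    unfolding c by (auto intro!: derivative_eq_intros) (simp add: power2_eq_square algebra_simps)
qed

lemma cutoff_range:
  assumes "R > 0" "\<bar>y\<bar> \<le> R"
  shows "0 \<le> 1 - (y / R)\<^sup>2" "1 - (y / R)\<^sup>2 \<le> 1" "0 \<le> cutoff R y" "cutoff R y \<le> 1"
proof -
  have "\<bar>y / R\<bar> \<le> 1" using assms by simp
  then have "(y / R)\<^sup>2 \<le> 1" by (simp only: abs_square_le_1)
  then show "0 \<le> 1 - (y / R)\<^sup>2" by simp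
  show "1 - (y / R)\<^sup>2 \<le> 1" by simp
  then show "0 \<le> cutoff R y" "cutoff R y \<le> 1"
    using \<open>0 \<le> 1 - (y / R)\<^sup>2\<close> by (auto simp: cutoff_def intro: power_le_one)
qed

text \<open>The commutator is the square root of the cutoff times a quantity of order (1 + |g|) / R,
  where \<open>g\<close> will be the logarithmic gradient of the kernel. The constant is 36 = 8 + 4
  + 24, one summand for each term of \<open>?k\<close>.\<close>

lemma cutoff_terms:
  assumes R: "R \<ge> 1" and y: "\<bar>y\<bar> \<le> R"
  defines "w \<equiv> 1 - (y / R)\<^sup>2"
  obtains k where "cutoff R y = (w\<^sup>2)\<^sup>2" "g * cutoff1 R y + cutoff2 R y / 2 = w\<^sup>2 * k"
    "\<bar>k\<bar> \<le> 36 * (1 + \<bar>g\<bar>) / R"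
proof
  let ?u = "y / R"
  let ?k = "- 8 * g * (?u / R) * w - 4 / R\<^sup>2 * w + 24 * (?u / R)\<^sup>2"
  have R0: "R > 0" using R by simp
  have w: "0 \<le> w" "w \<le> 1" using cutoff_range[OF R0 y] by (auto simp: w_def)
  have u: "\<bar>?u\<bar> \<le> 1" using y R0 by simp
  show "cutoff R y = (w\<^sup>2)\<^sup>2" by (simp add: cutoff_def w_def)
  have yR: "y / R\<^sup>2 = ?u / R" by (simp add: power2_eq_square)
  show "g * cutoff1 R y + cutoff2 R y / 2 = w\<^sup>2 * ?k"
    unfolding cutoff1_def cutoff2_def yR w_def[symmetric]
    using R0 by (simp add: field_simps power2_eq_square power3_eq_cube)
  have iR: "1 / R \<le> 1" "0 \<le> 1 / R" using R by auto
  have uR: "\<bar>?u / R\<bar> \<le> 1 / R" using divide_right_mono[OF u, of R] R0 unfolding abs_divide[of "y / R"] by simp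
  have a: "\<bar>8 * g * (?u / R) * w\<bar> \<le> 8 * \<bar>g\<bar> * (1 / R) * 1"
    unfolding abs_mult using uR w R0 by (intro mult_mono) auto
  have iR2: "1 / R\<^sup>2 \<le> 1 / R"
    using mult_left_mono[OF iR(1,2)] by (simp add: power2_eq_square)
  have b: "\<bar>4 / R\<^sup>2 * w\<bar> \<le> 4 * (1 / R) * 1"
    unfolding abs_mult using iR2 w R0 by (intro mult_mono) auto
  have "(?u / R)\<^sup>2 \<le> (1 / R)\<^sup>2" using uR by (metis abs_ge_zero power2_abs power_mono)
  then have c: "\<bar>24 * (?u / R)\<^sup>2\<bar> \<le> 24 * (1 / R)" using iR2 by (simp add: power_divide)
  have "\<bar>?k\<bar> \<le> \<bar>8 * g * (?u / R) * w\<bar> + \<bar>4 / R\<^sup>2 * w\<bar> + \<bar>24 * (?u / R)\<^sup>2\<bar>" by linarith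
  also have "\<dots> \<le> 8 * \<bar>g\<bar> * (1 / R) * 1 + 4 * (1 / R) * 1 + 24 * (1 / R)"
    by (intro add_mono a b c)
  also have "\<dots> = (28 + 8 * \<bar>g\<bar>) / R" by (simp add: add_divide_distrib)
  also have "\<dots> \<le> 36 * (1 + \<bar>g\<bar>) / R" using R0 by (intro divide_right_mono) auto
  finally show "\<bar>?k\<bar> \<le> 36 * (1 + \<bar>g\<bar>) / R" .
qed

definition pairing :: "(real \<Rightarrow> real \<Rightarrow> real) \<Rightarrow> real \<Rightarrow> real \<Rightarrow> real \<Rightarrow> real \<Rightarrow> real" where
  "pairing u R T x0 s = integral {-R..R} (\<lambda>y. u s y * (hk (T - s) (x0 - y) * cutoff R y))"

text \<open>Pairing with the backward heat kernel leaves only the source \<open>u\<^sub>t - u\<^sub>x\<^sub>x / 2\<close> and the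
  commutator with the cutoff.\<close>

lemma pairing_derivative:
  assumes C: "C12 u ut ux uxx" and R: "R > 0" and s: "0 < s" "s < T"
  shows "(pairing u R T x0 has_real_derivative
     integral {-R..R} (\<lambda>y. hk (T - s) (x0 - y) * ((ut s y - uxx s y / 2) * cutoff R y
       + u s y * ((x0 - y) / (T - s) * cutoff1 R y + cutoff2 R y / 2)))) (at s)"
proof -
  define q where "q s y = hk (T - s) (x0 - y)" for s y
  define g where "g s y = (x0 - y) / (T - s)" for s y
  define i where "i s = 1 / (T - s)" for s
  define qs where "qs s y = - ((g s y)\<^sup>2 - i s) / 2 * q s y" for s y
  define f where "f s y = u s y * (q s y * cutoff R y)" for s y
  define fs where "fs s y = ut s y * (q s y * cutoff R y) + u s y * (qs s y * cutoff R y)" for s y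
  let ?U = "{0<..<T}"
  have dq: "(q s has_real_derivative g s y * q s y) (at y)" if "s < T" for s y
    unfolding q_def[abs_def] g_def
    by (rule DERIV_cong[OF DERIV_chain2[OF hk_deriv_x]])
       (use that in \<open>auto intro!: derivative_eq_intros\<close>)
  have dqs: "((\<lambda>s. q s y) has_real_derivative qs s y) (at s)" if "s < T" for s y
    unfolding q_def[abs_def] qs_def g_def i_def
    by (rule DERIV_cong[OF DERIV_chain2[OF hk_deriv_t]])
       (use that in \<open>auto intro!: derivative_eq_intros simp: power_divide q_def\<close>)
  have dg: "(g s has_real_derivative - i s) (at y)" if "s < T" for s y
  proof -
    have "((\<lambda>y. (x0 - y) / (T - s)) has_real_derivative (0 - 1) / (T - s)) (at y)"
      by (intro DERIV_cdivide DERIV_diff DERIV_const DERIV_ident)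
    then show ?thesis by (simp add: g_def[abs_def] i_def)
  qed
  have cq: "continuous_on (?U \<times> UNIV) (\<lambda>p. q (fst p) (snd p))"
  proof -
    have "continuous_on (?U \<times> UNIV) (\<lambda>p. (\<lambda>(\<rho>, z). hk \<rho> z) (T - fst p, x0 - snd p))"
      by (rule continuous_on_compose2[OF continuous_on_hk]) (auto intro!: continuous_intros)
    then show ?thesis by (simp add: q_def)
  qed
  have cu: "continuous_on (?U \<times> UNIV) (\<lambda>p. v (fst p) (snd p))"
    if "continuous_on ({0<..} \<times> UNIV) (\<lambda>(t, x). v t x)" for v :: "real \<Rightarrow> real \<Rightarrow> real"
  proof -
    have "continuous_on (?U \<times> UNIV) (\<lambda>(t, x). v t x)" by (rule continuous_on_subset[OF that]) auto
    then show ?thesis by (simp add: case_prod_beta')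
  qed
  have cut: "continuous_on A (\<lambda>p. cutoff R (snd p))" "continuous_on A (\<lambda>p. cutoff1 R (snd p))"
    "continuous_on A (\<lambda>p. cutoff2 R (snd p))" for A :: "(real \<times> real) set"
    unfolding cutoff_def cutoff1_def cutoff2_def using R by (intro continuous_intros; simp)+
  have cg: "continuous_on (?U \<times> UNIV) (\<lambda>p. g (fst p) (snd p))"
    unfolding g_def by (intro continuous_intros) auto
  have cT: "continuous_on (?U \<times> UNIV) (\<lambda>p::real \<times> real. i (fst p))"
    unfolding i_def by (intro continuous_intros) auto
  note cint = cq cut cg cT cu[OF C12D(4)[OF C]] cu[OF C12D(5)[OF C]]
  have cf: "continuous_on (?U \<times> UNIV) (\<lambda>p. f (fst p) (snd p))"
    unfolding f_def by (intro continuous_intros cint)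
  have cfs: "continuous_on (?U \<times> UNIV) (\<lambda>p. fs (fst p) (snd p))"
    unfolding fs_def qs_def by (intro continuous_intros cint) auto
  have sec: "continuous_on {-R..R} (h s)" if "continuous_on (?U \<times> UNIV) (\<lambda>p. h (fst p) (snd p))" "s \<in> ?U"
    for h :: "real \<Rightarrow> real \<Rightarrow> real" and s
  proof -
    have "continuous_on {-R..R} (\<lambda>y. (\<lambda>p. h (fst p) (snd p)) (s, y))"
      by (rule continuous_on_compose2[OF that(1)]) (use that(2) in \<open>auto intro!: continuous_intros\<close>)
    then show ?thesis by simp
  qed
  have sU: "s \<in> ?U" using s by simp
  have "((\<lambda>s. integral (cbox (-R) R) (f s)) has_field_derivative integral (cbox (-R) R) (fs s)) (at s within ?U)"
  proof (rule leibniz_rule_field_derivative)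
    fix s y assume s: "s \<in> ?U"
    then have "0 < s" "s < T" by auto
    show "((\<lambda>s. f s y) has_real_derivative fs s y) (at s within ?U)"
      unfolding f_def fs_def
      by (rule has_field_derivative_at_within)
         (auto intro!: derivative_eq_intros C12D(1)[OF C] dqs \<open>0 < s\<close> \<open>s < T\<close> simp: algebra_simps)
  next
    show "f s integrable_on cbox (-R) R" if "s \<in> ?U" for s
      using sec[OF cf that] by (simp add: integrable_continuous_real)
    have "continuous_on (?U \<times> cbox (-R) R) (\<lambda>p. fs (fst p) (snd p))"
      by (rule continuous_on_subset[OF cfs]) auto
    then show "continuous_on (?U \<times> cbox (-R) R) (\<lambda>(s, y). fs s y)"
      by (simp add: case_prod_beta')
  qed (use sU in auto)
  then have 1: "(pairing u R T x0 has_real_derivative integral {-R..R} (fs s)) (at s)"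
    using sU by (simp add: at_within_open[of s ?U] f_def[abs_def] pairing_def[abs_def] q_def)
  \<comment> \<open>\<open>G\<close> is the boundary flux of Green's identity for u and the kernel
    times the cutoff; it vanishes at both ends because \<open>cutoff\<close> and
    \<open>cutoff1\<close> do.\<close>
  define G where "G y = (ux s y * (q s y * cutoff R y)
      - u s y * (g s y * q s y * cutoff R y + q s y * cutoff1 R y)) / 2" for y
  define H where "H y = q s y * ((ut s y - uxx s y / 2) * cutoff R y
       + u s y * (g s y * cutoff1 R y + cutoff2 R y / 2))" for y
  have dG: "(G has_real_derivative fs s y - H y) (at y)" for y
    unfolding G_def[abs_def]
  proof (rule DERIV_cong)
    show "((\<lambda>y. (ux s y * (q s y * cutoff R y)
        - u s y * (g s y * q s y * cutoff R y + q s y * cutoff1 R y)) / 2) has_real_derivative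
      (uxx s y * (q s y * cutoff R y) + (g s y * q s y * cutoff R y + cutoff1 R y * q s y) * ux s y
       - (ux s y * (g s y * q s y * cutoff R y + q s y * cutoff1 R y)
          + ((- i s * q s y + g s y * q s y * g s y) * cutoff R y + cutoff1 R y * (g s y * q s y)
            + (g s y * q s y * cutoff1 R y + cutoff2 R y * q s y)) * u s y)) / 2) (at y)"
      by (intro DERIV_cdivide DERIV_diff DERIV_mult DERIV_add C12D(2,3)[OF C s(1)] dq[OF s(2)]
          dg[OF s(2)] cutoff_deriv)
    show "(uxx s y * (q s y * cutoff R y) + (g s y * q s y * cutoff R y + cutoff1 R y * q s y) * ux s y
       - (ux s y * (g s y * q s y * cutoff R y + q s y * cutoff1 R y)
          + ((- i s * q s y + g s y * q s y * g s y) * cutoff R y + cutoff1 R y * (g s y * q s y)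
            + (g s y * q s y * cutoff1 R y + cutoff2 R y * q s y)) * u s y)) / 2 = fs s y - H y"
      unfolding fs_def H_def qs_def power2_eq_square by (simp add: field_simps)
  qed
  have "((\<lambda>y. fs s y - H y) has_integral G R - G (-R)) {-R..R}"
    by (rule fundamental_theorem_of_calculus)
       (use R dG in \<open>auto simp: has_real_derivative_iff_has_vector_derivative [symmetric]
         intro: has_field_derivative_at_within\<close>)
  moreover have "G R = 0" "G (- R) = 0"
    using R by (simp_all add: G_def cutoff_def cutoff1_def)
  ultimately have 2: "((\<lambda>y. fs s y - H y) has_integral 0) {-R..R}" by simp
  have 3: "fs s integrable_on {-R..R}"
    using sec[OF cfs sU] by (simp add: integrable_continuous_real)
  from has_integral_diff[OF integrable_integral[OF 3] 2]
  have "(H has_integral integral {-R..R} (fs s)) {-R..R}" by simp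
  then have "integral {-R..R} H = integral {-R..R} (fs s)" by (rule integral_unique)
  with 1 show ?thesis by (simp add: H_def[abs_def] q_def g_def)
qed

lemma pairing_increment:
  assumes C: "C12 u ut ux uxx" and R: "R > 0" and r: "0 < r" "r \<le> t" "t < T"
    and b: "\<And>s. r \<le> s \<Longrightarrow> s \<le> t \<Longrightarrow>
      integral {-R..R} (\<lambda>y. hk (T - s) (x0 - y) * ((ut s y - uxx s y / 2) * cutoff R y
       + u s y * ((x0 - y) / (T - s) * cutoff1 R y + cutoff2 R y / 2))) \<le> M"
  shows "pairing u R T x0 t \<le> pairing u R T x0 r + M * (t - r)"
proof -
  have "pairing u R T x0 t - M * t \<le> pairing u R T x0 r - M * r"
  proof (rule DERIV_nonpos_imp_nonincreasing[OF r(2)])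
    fix s assume s: "r \<le> s" "s \<le> t"
    show "\<exists>y. ((\<lambda>s. pairing u R T x0 s - M * s) has_real_derivative y) (at s) \<and> y \<le> 0"
      by (rule exI, rule conjI, rule DERIV_diff[OF pairing_derivative[OF C R] DERIV_cmult_Id])
         (use r s b[OF s] in auto)
  qed
  then show ?thesis by (simp add: algebra_simps)
qed

section \<open>Limits of the pairing as the initial time tends to zero\<close>

lemma lborel_integral_compact_support:
  fixes f :: "real \<Rightarrow> real"
  assumes c: "continuous_on UNIV f" and z: "\<And>y. \<bar>y\<bar> > R \<Longrightarrow> f y = 0"
  shows "(\<integral>y. f y \<partial>lborel) = integral {-R..R} f"
proof -
  have "set_integrable lborel {-R..R} f"
    by (rule borel_integrable_atLeastAtMost') (rule continuous_on_subset[OF c], simp)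
  from set_borel_integral_eq_integral(2)[OF this]
  have "(\<integral>y. indicator {-R..R} y * f y \<partial>lborel) = integral {-R..R} f"
    by (simp add: set_lebesgue_integral_def)
  moreover have "indicator {-R..R} y * f y = f y" for y
  proof (cases "y \<in> {-R..R}")
    case False
    then have "\<bar>y\<bar> > R" by (auto simp: abs_if)
    then show ?thesis by (simp add: z)
  qed simp
  ultimately show ?thesis by simp
qed

lemma continuous_on_space:
  assumes "continuous_on ({0<..} \<times> UNIV) (\<lambda>(t, x). u t x)" "0 < (t::real)"
  shows "continuous_on UNIV (u t)"
proof -
  have "continuous_on UNIV (\<lambda>x. (\<lambda>(t, x). u t x) (t, x))"
    by (rule continuous_on_compose2[OF assms(1)]) (use assms(2) in \<open>auto intro!: continuous_intros\<close>)
  then show ?thesis by simp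
qed

lemma continuous_on_hk_x: "0 < \<rho> \<Longrightarrow> continuous_on UNIV (\<lambda>y. hk \<rho> (x0 - y))"
  by (rule continuous_on_compose2[OF continuous_on_space[OF continuous_on_hk]])
     (auto intro!: continuous_intros)

lemma continuous_on_cutoff: "R > 0 \<Longrightarrow> continuous_on A (cutoff R)"
  unfolding cutoff_def by (intro continuous_intros) auto

text \<open>The final time is moved to T + r together with the initial time r, so the kernel keeps
  age T and the test function does not depend on r. Only then does the trace condition, stated for
  fixed test functions, apply. The \<open>max 0\<close> extends the cutoff by zero.\<close>

lemma pairing_start:
  assumes c: "continuous_on ({0<..} \<times> UNIV) (\<lambda>(t, x). u t x)" and R: "R > 0" and T: "0 < T"
    and tr: "\<And>\<phi>. continuous_on UNIV \<phi> \<Longrightarrow> \<exists>R. \<forall>x. \<bar>x\<bar> > R \<longrightarrow> \<phi> x = 0 \<Longrightarrow>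
       ((\<lambda>t. LINT x|lborel. u t x * \<phi> x) \<longlongrightarrow> l * \<phi> 0) (at_right 0)"
  shows "((\<lambda>r. pairing u R (T + r) x0 r) \<longlongrightarrow> l * hk T x0) (at_right 0)"
proof -
  define \<phi> where "\<phi> y = hk T (x0 - y) * (max 0 (1 - (y / R)\<^sup>2)) ^ 4" for y
  have c\<phi>: "continuous_on UNIV \<phi>"
    unfolding \<phi>_def by (intro continuous_intros continuous_on_hk_x T) (use R in auto)
  have \<phi>out: "\<phi> y = 0" if "\<bar>y\<bar> > R" for y
  proof -
    have "1 < \<bar>y / R\<bar>" using that R by simp
    then have "1 < (y / R)\<^sup>2" using power_strict_mono[of 1 "\<bar>y / R\<bar>" 2] by (simp add: power_divide)
    then show ?thesis by (simp add: \<phi>_def)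
  qed
  have \<phi>in: "\<phi> y = hk T (x0 - y) * cutoff R y" if "y \<in> {-R..R}" for y
    using cutoff_range(1)[OF R, of y] that by (auto simp: \<phi>_def cutoff_def abs_le_iff max_def)
  have "((\<lambda>t. LINT x|lborel. u t x * \<phi> x) \<longlongrightarrow> l * \<phi> 0) (at_right 0)"
    by (intro tr c\<phi> exI[of _ R]) (use \<phi>out in auto)
  moreover have "\<phi> 0 = hk T x0" by (simp add: \<phi>_def)
  moreover
  have "(LINT x|lborel. u r x * \<phi> x) = pairing u R (T + r) x0 r" if "0 < r" for r
  proof -
    have "(LINT x|lborel. u r x * \<phi> x) = integral {-R..R} (\<lambda>x. u r x * \<phi> x)"
      by (rule lborel_integral_compact_support)
         (use \<phi>out in \<open>auto intro!: continuous_intros c\<phi> continuous_on_space[OF c that]\<close>)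
    also have "\<dots> = pairing u R (T + r) x0 r"
      unfolding pairing_def by (rule Henstock_Kurzweil_Integration.integral_cong) (simp add: \<phi>in)
    finally show ?thesis .
  qed
  then have "eventually (\<lambda>r. (LINT x|lborel. u r x * \<phi> x) = pairing u R (T + r) x0 r) (at_right 0)"
    by (auto simp: eventually_at_right_field intro: exI[of _ 1])
  ultimately show ?thesis using tendsto_cong by fastforce
qed

lemma pairing_end:
  assumes c: "continuous_on ({0<..} \<times> UNIV) (\<lambda>(t, x). u t x)" and R: "R > 0" and t: "0 < t" "t < T"
  shows "((\<lambda>r. pairing u R (T + r) x0 (t + r)) \<longlongrightarrow> pairing u R T x0 t) (at_right 0)"
proof -
  define h where "h r = integral (cbox (-R) R) (\<lambda>y. u (t + r) y * (hk (T - t) (x0 - y) * cutoff R y))" for r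
  have "continuous_on {0..} h"
    unfolding h_def
  proof (rule integral_continuous_on_param)
    have "continuous_on ({0..} \<times> cbox (-R) R) (\<lambda>p. (\<lambda>(t, x). u t x) (t + fst p, snd p))"
      by (rule continuous_on_compose2[OF c]) (use t in \<open>auto intro!: continuous_intros\<close>)
    then have 1: "continuous_on ({0..} \<times> cbox (-R) R) (\<lambda>p. u (t + fst p) (snd p))" by simp
    have 2: "continuous_on ({0..} \<times> cbox (-R) R) (\<lambda>p::real \<times> real. hk (T - t) (x0 - snd p))"
      by (rule continuous_on_compose2[OF continuous_on_hk_x]) (use t in \<open>auto intro!: continuous_intros\<close>)
    have 3: "continuous_on ({0..} \<times> cbox (-R) R) (\<lambda>p::real \<times> real. cutoff R (snd p))"
      by (rule continuous_on_compose2[OF continuous_on_cutoff[OF R]]) (auto intro!: continuous_intros)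
    show "continuous_on ({0..} \<times> cbox (-R) R) (\<lambda>(r, y). u (t + r) y * (hk (T - t) (x0 - y) * cutoff R y))"
      unfolding case_prod_beta' by (intro continuous_intros 1 2 3)
  qed
  then have "(h \<longlongrightarrow> h 0) (at 0 within {0..})" by (auto simp: continuous_on_def)
  then have "(h \<longlongrightarrow> h 0) (at_right 0)" by (rule tendsto_within_subset) auto
  then show ?thesis by (simp add: h_def[abs_def] pairing_def)
qed

text \<open>Time runs from r to t + r while the kernel is centred at time T + r. All kernel ages
  that occur are at least T - t, which is why \<open>b\<close> is assumed for those; then r tends to
  0.\<close>

lemma pairing_bound:
  assumes C: "C12 u ut ux uxx" and R: "R > 0" and t: "0 < t" "t < T"
    and tr: "\<And>\<phi>. continuous_on UNIV \<phi> \<Longrightarrow> \<exists>R. \<forall>x. \<bar>x\<bar> > R \<longrightarrow> \<phi> x = 0 \<Longrightarrow>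
       ((\<lambda>t. LINT x|lborel. u t x * \<phi> x) \<longlongrightarrow> l * \<phi> 0) (at_right 0)"
    and b: "\<And>s \<rho>. 0 < s \<Longrightarrow> T - t \<le> \<rho> \<Longrightarrow>
      integral {-R..R} (\<lambda>y. hk \<rho> (x0 - y) * ((ut s y - uxx s y / 2) * cutoff R y
       + u s y * ((x0 - y) / \<rho> * cutoff1 R y + cutoff2 R y / 2))) \<le> M"
  shows "pairing u R T x0 t \<le> l * hk T x0 + M * t"
proof (rule tendsto_le)
  show "((\<lambda>r. pairing u R (T + r) x0 (t + r)) \<longlongrightarrow> pairing u R T x0 t) (at_right 0)"
    by (rule pairing_end[OF C12D(4)[OF C] R t])
  show "((\<lambda>r. pairing u R (T + r) x0 r + M * t) \<longlongrightarrow> l * hk T x0 + M * t) (at_right 0)"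
    by (intro tendsto_intros pairing_start[OF C12D(4)[OF C] R _ tr]) (use t in auto)
  have "pairing u R (T + r) x0 (t + r) \<le> pairing u R (T + r) x0 r + M * t" if "0 < r" for r
    using pairing_increment[OF C R that, of "t + r" "T + r" x0 M] b that t by auto
  then show "\<forall>\<^sub>F r in at_right 0. pairing u R (T + r) x0 (t + r) \<le> pairing u R (T + r) x0 r + M * t"
    by (auto simp: eventually_at_right_field intro: exI[of _ 1])
qed simp

section \<open>Localisation of the duality estimate at a point\<close>

definition tent :: "real \<Rightarrow> real \<Rightarrow> real" where "tent \<delta> z = max 0 (1 - \<bar>z\<bar> / \<delta>)"

lemma tent_bounds: "0 \<le> tent \<delta> z" "0 < \<delta> \<Longrightarrow> tent \<delta> z \<le> 1" "0 < \<delta> \<Longrightarrow> \<bar>z\<bar> \<ge> \<delta> \<Longrightarrow> tent \<delta> z = 0"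
  by (auto simp: tent_def)

lemma continuous_on_tent: "0 < \<delta> \<Longrightarrow> continuous_on UNIV (tent \<delta>)"
  unfolding tent_def by (intro continuous_intros) auto

text \<open>On the support of the tent |y| is at most \<open>S\<close>, so the cutoff is at least (1
  - (S / R)^2)^4 there. This tends to 1 as R grows, while the error K / R disappears.\<close>

lemma pairing_tent:
  assumes c: "continuous_on ({0<..} \<times> UNIV) (\<lambda>(t, x). u t x)" and t: "0 < t" "t < T"
    and \<delta>: "0 < \<delta>" and \<eta>: "0 \<le> \<eta>"
    and low: "\<And>y. \<eta> * tent \<delta> (x0 - y) \<le> u t y"
    and P: "\<And>R. 1 \<le> R \<Longrightarrow> pairing u R T x0 t \<le> A + K / R"
  shows "\<eta> * (\<integral>z. hk (T - t) z * tent \<delta> z \<partial>lborel) \<le> A"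
proof -
  define S where "S = \<bar>x0\<bar> + \<delta> + 1"
  define I where "I = (\<integral>z. hk (T - t) z * tent \<delta> z \<partial>lborel)"
  have \<rho>: "0 < T - t" using t by simp
  have I: "I = (\<integral>y. hk (T - t) (x0 - y) * tent \<delta> (x0 - y) \<partial>lborel)"
    using lborel_integral_real_affine[of "-1" "\<lambda>z. hk (T - t) z * tent \<delta> z" x0] by (simp add: I_def)
  have ct: "continuous_on UNIV (\<lambda>y. tent \<delta> (x0 - y))"
    by (rule continuous_on_compose2[OF continuous_on_tent[OF \<delta>]]) (auto intro!: continuous_intros)
  have main: "\<eta> * ((1 - (S / R)\<^sup>2) ^ 4 * I) \<le> A + K / R" if R: "R \<ge> S" for R
  proof -
    have R1: "R \<ge> 1" "R > 0" using R \<delta> by (auto simp: S_def)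
    have IR: "I = integral {-R..R} (\<lambda>y. hk (T - t) (x0 - y) * tent \<delta> (x0 - y))"
      unfolding I
    proof (rule lborel_integral_compact_support)
      show "continuous_on UNIV (\<lambda>y. hk (T - t) (x0 - y) * tent \<delta> (x0 - y))"
        by (intro continuous_intros continuous_on_hk_x \<rho> ct)
      fix y assume "\<bar>y\<bar> > R"
      then have "\<bar>x0 - y\<bar> \<ge> \<delta>" using R by (auto simp: S_def)
      then show "hk (T - t) (x0 - y) * tent \<delta> (x0 - y) = 0" by (simp add: tent_bounds(3)[OF \<delta>])
    qed
    have SR: "(S / R)\<^sup>2 \<le> 1"
      using R R1 \<delta> by (intro power_le_one) (auto simp: S_def)
    have "\<eta> * ((1 - (S / R)\<^sup>2) ^ 4 * I) = integral {-R..R}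
        (\<lambda>y. \<eta> * ((1 - (S / R)\<^sup>2) ^ 4 * (hk (T - t) (x0 - y) * tent \<delta> (x0 - y))))"
      unfolding IR by simp
    also have "\<dots> \<le> pairing u R T x0 t"
      unfolding pairing_def
    proof (rule integral_le)
      show "(\<lambda>y. \<eta> * ((1 - (S / R)\<^sup>2) ^ 4 * (hk (T - t) (x0 - y) * tent \<delta> (x0 - y)))) integrable_on {-R..R}"
        by (intro integrable_continuous_real continuous_intros
            continuous_on_subset[OF continuous_on_hk_x[OF \<rho>]] continuous_on_subset[OF ct]) auto
      show "(\<lambda>y. u t y * (hk (T - t) (x0 - y) * cutoff R y)) integrable_on {-R..R}"
        by (intro integrable_continuous_real continuous_intros continuous_on_cutoff R1
            continuous_on_subset[OF continuous_on_hk_x[OF \<rho>]]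
            continuous_on_subset[OF continuous_on_space[OF c t(1)]]) auto
      fix y assume y: "y \<in> {-R..R}"
      then have yR: "\<bar>y\<bar> \<le> R" by auto
      note cr = cutoff_range[OF R1(2) yR]
      have h0: "0 < hk (T - t) (x0 - y)" by (rule hk_pos[OF \<rho>])
      have u0: "0 \<le> u t y" using low[of y] tent_bounds(1)[of \<delta> "x0 - y"] \<eta> by (meson mult_nonneg_nonneg order_trans)
      show "\<eta> * ((1 - (S / R)\<^sup>2) ^ 4 * (hk (T - t) (x0 - y) * tent \<delta> (x0 - y)))
          \<le> u t y * (hk (T - t) (x0 - y) * cutoff R y)"
      proof (cases "\<bar>x0 - y\<bar> \<ge> \<delta>")
        case True
        then show ?thesis using u0 h0 cr by (simp add: tent_bounds(3)[OF \<delta>])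
      next
        case False
        then have "\<bar>y\<bar> \<le> S" by (auto simp: S_def)
        then have "\<bar>y / R\<bar> \<le> S / R" using R1 by (simp add: divide_right_mono)
        then have "(y / R)\<^sup>2 \<le> (S / R)\<^sup>2" by (metis abs_ge_zero power2_abs power_mono)
        then have "(1 - (S / R)\<^sup>2) ^ 4 \<le> cutoff R y"
          unfolding cutoff_def using SR by (intro power_mono) auto
        then have "(\<eta> * tent \<delta> (x0 - y)) * (hk (T - t) (x0 - y) * (1 - (S / R)\<^sup>2) ^ 4)
            \<le> u t y * (hk (T - t) (x0 - y) * cutoff R y)"
          using low h0 u0 SR by (intro mult_mono mult_left_mono) auto
        then show ?thesis by (simp add: mult_ac)
      qed
    qed
    also have "\<dots> \<le> A + K / R" by (rule P[OF R1(1)])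
    finally show ?thesis .
  qed
  have "((\<lambda>R. \<eta> * ((1 - (S / R)\<^sup>2) ^ 4 * I)) \<longlongrightarrow> \<eta> * ((1 - 0\<^sup>2) ^ 4 * I)) at_top"
    by (intro tendsto_intros tendsto_divide_0[OF tendsto_const] filterlim_at_top_imp_at_infinity filterlim_ident)
  moreover have "((\<lambda>R. A + K / R) \<longlongrightarrow> A + 0) at_top"
    by (intro tendsto_intros tendsto_divide_0[OF tendsto_const] filterlim_at_top_imp_at_infinity filterlim_ident)
  moreover have "eventually (\<lambda>R. \<eta> * ((1 - (S / R)\<^sup>2) ^ 4 * I) \<le> A + K / R) at_top"
    by (rule eventually_mono[OF eventually_ge_at_top[of S] main])
  ultimately have "\<eta> * ((1 - 0\<^sup>2) ^ 4 * I) \<le> A + 0"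
    using tendsto_le trivial_limit_at_top_linorder by blast
  then show ?thesis by (simp add: I_def)
qed

lemma integral_le_const:
  fixes f :: "real \<Rightarrow> real"
  assumes "0 \<le> R" "0 \<le> m" "\<And>y. y \<in> {-R..R} \<Longrightarrow> f y \<le> m"
  shows "integral {-R..R} f \<le> m * (2 * R)"
proof (cases "f integrable_on {-R..R}")
  case True
  have "integral {-R..R} f \<le> integral {-R..R} (\<lambda>_. m)"
    by (rule integral_le[OF True]) (use assms in auto)
  then show ?thesis using assms by (simp add: mult_ac)
next
  \<comment> \<open>A function that is not integrable has integral 0 by convention, and m is
    nonnegative.\<close>
  case False
  then show ?thesis using assms by (simp add: not_integrable_integral)
qed

lemma near_point:
  fixes u :: "real \<Rightarrow> real \<Rightarrow> real"
  assumes c: "continuous_on ({0<..} \<times> UNIV) (\<lambda>(t, x). u t x)" and T: "0 < T" and l: "l < u T x0"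
  obtains \<epsilon> where "0 < \<epsilon>" "\<And>t y. 0 < t \<Longrightarrow> \<bar>t - T\<bar> < \<epsilon> \<Longrightarrow> \<bar>x0 - y\<bar> < \<epsilon> \<Longrightarrow> l < u t y"
proof -
  have "open ({0::real<..} \<times> (UNIV :: real set))" by (simp add: open_Times)
  from continuous_on_open_vimage[OF this, THEN iffD1, OF c, rule_format, of "{l<..}"]
  have "open ((\<lambda>(t, x). u t x) -` {l<..} \<inter> {0<..} \<times> UNIV)" by simp
  moreover have "(T, x0) \<in> (\<lambda>(t, x). u t x) -` {l<..} \<inter> {0<..} \<times> UNIV" using T l by simp
  ultimately obtain A B where AB: "open A" "open B" "(T, x0) \<in> A \<times> B"
      "A \<times> B \<subseteq> (\<lambda>(t, x). u t x) -` {l<..} \<inter> {0<..} \<times> UNIV"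
    by (rule open_prod_elim)
  obtain d1 where d1: "d1 > 0" "\<And>t. \<bar>t - T\<bar> < d1 \<Longrightarrow> t \<in> A"
    using AB(1,3) unfolding open_dist by (auto simp: dist_real_def)
  obtain d2 where d2: "d2 > 0" "\<And>y. \<bar>y - x0\<bar> < d2 \<Longrightarrow> y \<in> B"
    using AB(2,3) unfolding open_dist by (auto simp: dist_real_def)
  show ?thesis
  proof (rule that[of "min d1 d2"])
    show "l < u t y" if "\<bar>t - T\<bar> < min d1 d2" "\<bar>x0 - y\<bar> < min d1 d2" for t y
    proof -
      have "(t, y) \<in> A \<times> B" using d1(2)[of t] d2(2)[of y] that by (auto simp: abs_minus_commute)
      with AB(4) show ?thesis by auto
    qed
  qed (use d1 d2 in auto)
qed

lemma tent_mass: "0 < \<delta> \<Longrightarrow> ((\<lambda>\<rho>. \<integral>z. hk \<rho> z * tent \<delta> z \<partial>lborel) \<longlongrightarrow> 1) (at_right 0)"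
  using hk_trace[OF continuous_on_tent, of \<delta> 1] tent_bounds[of \<delta>] by (simp add: tent_def[of \<delta> 0])

text \<open>The quadratic absorption controls the commutator with the cutoff by Young's inequality, so no
  growth condition at infinity is needed.\<close>

lemma is_sol_le_hk:
  assumes V: "is_sol 1 V" and T: "0 < T"
  shows "V T x0 \<le> hk T x0"
proof (rule ccontr)
  assume "\<not> V T x0 \<le> hk T x0"
  then obtain \<eta> where \<eta>: "hk T x0 < \<eta>" "\<eta> < V T x0" using dense[of "hk T x0" "V T x0"] by auto
  obtain Vt Vx Vxx where C: "C12 V Vt Vx Vxx"
    and pde: "\<And>t x. t > 0 \<Longrightarrow> Vt t x = Vxx t x / 2 - (V t x)\<^sup>2 / 2"
    using is_sol_derivatives[OF V] by blast
  have \<eta>0: "0 \<le> \<eta>" using \<eta>(1) hk_pos[OF T, of x0] by simp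
  obtain \<epsilon> where \<epsilon>: "0 < \<epsilon>" "\<And>t y. 0 < t \<Longrightarrow> \<bar>t - T\<bar> < \<epsilon> \<Longrightarrow> \<bar>x0 - y\<bar> < \<epsilon> \<Longrightarrow> \<eta> < V t y"
    using near_point[OF C12D(4)[OF C] T \<eta>(2)] by blast
  \<comment> \<open>A kernel of age \<rho> centred at (T, x0) sees V at time T - \<rho> near x0,
    where V still exceeds \<eta>. As \<rho> tends to 0 the tent captures the full mass, which forces
    \<eta> \<le> \<open>hk T x0\<close>.\<close>
  have step: "\<eta> * (\<integral>z. hk \<rho> z * tent \<epsilon> z \<partial>lborel) \<le> hk T x0" if \<rho>: "0 < \<rho>" "\<rho> < min \<epsilon> T" for \<rho>
  proof -
    define t where "t = T - \<rho>"
    have t: "0 < t" "t < T" "T - t = \<rho>" "\<bar>t - T\<bar> < \<epsilon>" using \<rho> by (auto simp: t_def)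
    obtain B where B: "B > 0" "\<And>r z. \<rho> \<le> r \<Longrightarrow> hk r z * (1 + (z / r)\<^sup>2) \<le> B"
      using hk_gradient_bound[OF \<rho>(1)] by blast
    have "\<eta> * (\<integral>z. hk (T - t) z * tent \<epsilon> z \<partial>lborel) \<le> hk T x0"
    proof (rule pairing_tent[OF C12D(4)[OF C] t(1,2) \<epsilon>(1) \<eta>0])
      show "\<eta> * tent \<epsilon> (x0 - y) \<le> V t y" for y
      proof (cases "\<bar>x0 - y\<bar> < \<epsilon>")
        case True
        have "\<eta> * tent \<epsilon> (x0 - y) \<le> \<eta> * 1" using \<eta>0 tent_bounds(2)[OF \<epsilon>(1)] by (intro mult_left_mono) auto
        then show ?thesis using \<epsilon>(2)[OF t(1,4) True] by linarith
      next
        case False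
        then show ?thesis using is_solD(2)[OF V t(1)] by (simp add: tent_bounds(3)[OF \<epsilon>(1)])
      qed
      fix R :: real assume R: "1 \<le> R"
      have "pairing V R T x0 t \<le> 1 * hk T x0 + (1296 * B / R\<^sup>2 * (2 * R)) * t"
      proof (rule pairing_bound[OF C _ t(1,2)])
        show "((\<lambda>t. LINT x|lborel. V t x * \<phi> x) \<longlongrightarrow> 1 * \<phi> 0) (at_right 0)"
          if "continuous_on UNIV \<phi>" "\<exists>R. \<forall>x. R < \<bar>x\<bar> \<longrightarrow> \<phi> x = 0" for \<phi>
          by (rule is_solD(4)[OF V that])
        fix s r :: real assume s: "0 < s" and r: "T - t \<le> r"
        then have r\<rho>: "\<rho> \<le> r" by (simp add: t(3))
        show "integral {-R..R} (\<lambda>y. hk r (x0 - y) * ((Vt s y - Vxx s y / 2) * cutoff R y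
            + V s y * ((x0 - y) / r * cutoff1 R y + cutoff2 R y / 2))) \<le> 1296 * B / R\<^sup>2 * (2 * R)"
        proof (rule integral_le_const)
          fix y assume "y \<in> {-R..R}"
          then have yR: "\<bar>y\<bar> \<le> R" by auto
          define g where "g = (x0 - y) / r"
          define w where "w = (1 - (y / R)\<^sup>2)\<^sup>2"
          define q where "q = hk r (x0 - y)"
          obtain k where k: "cutoff R y = w\<^sup>2" "g * cutoff1 R y + cutoff2 R y / 2 = w * k"
              "\<bar>k\<bar> \<le> 36 * (1 + \<bar>g\<bar>) / R"
            using cutoff_terms[OF R yR, of g] unfolding w_def by blast
          have q0: "0 < q" using hk_pos[of r] r\<rho> \<rho> by (simp add: q_def)
          \<comment> \<open>The absorption - (V w)^2 / 2 pays for the commutator V w k and leaves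
            k^2 / 2, of order R^(-2). This beats the length 2 R of the interval of
            integration.\<close>
          have "(V s y * w - k)\<^sup>2 \<ge> 0" by simp
          then have "- (V s y)\<^sup>2 / 2 * w\<^sup>2 + V s y * (w * k) \<le> k\<^sup>2 / 2"
            by (simp add: power2_eq_square algebra_simps)
          also have "k\<^sup>2 / 2 \<le> (36 * (1 + \<bar>g\<bar>) / R)\<^sup>2 / 2"
            using power_mono[OF k(3) abs_ge_zero, of 2] by simp
          also have "\<dots> \<le> 1296 / R\<^sup>2 * (1 + g\<^sup>2)"
          proof -
            have "0 \<le> (\<bar>g\<bar> - 1)\<^sup>2" by simp
            then have "(1 + \<bar>g\<bar>)\<^sup>2 \<le> 2 * (1 + g\<^sup>2)" by (simp add: power2_sum power2_diff)
            then have "648 / R\<^sup>2 * (1 + \<bar>g\<bar>)\<^sup>2 \<le> 648 / R\<^sup>2 * (2 * (1 + g\<^sup>2))" by (intro mult_left_mono) auto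
            moreover have "(36 * (1 + \<bar>g\<bar>) / R)\<^sup>2 / 2 = 648 / R\<^sup>2 * (1 + \<bar>g\<bar>)\<^sup>2"
              by (simp add: power_divide power_mult_distrib del: distrib_left_numeral)
            ultimately show ?thesis by simp
          qed
          finally have "q * (- (V s y)\<^sup>2 / 2 * w\<^sup>2 + V s y * (w * k)) \<le> q * (1296 / R\<^sup>2 * (1 + g\<^sup>2))"
            using q0 by (intro mult_left_mono) auto
          also have "\<dots> = 1296 / R\<^sup>2 * (q * (1 + g\<^sup>2))" by simp
          also have "\<dots> \<le> 1296 / R\<^sup>2 * B"
            using B(2)[OF r\<rho>] by (intro mult_left_mono) (auto simp: q_def g_def)
          finally have "q * (- (V s y)\<^sup>2 / 2 * w\<^sup>2 + V s y * (w * k)) \<le> 1296 * B / R\<^sup>2" by simp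
          moreover have "Vt s y - Vxx s y / 2 = - (V s y)\<^sup>2 / 2" using pde[OF s] by simp
          ultimately show "hk r (x0 - y) * ((Vt s y - Vxx s y / 2) * cutoff R y
            + V s y * ((x0 - y) / r * cutoff1 R y + cutoff2 R y / 2)) \<le> 1296 * B / R\<^sup>2"
            by (simp add: q_def[symmetric] g_def[symmetric] k(1,2))
        qed (use R B in auto)
      qed (use R in auto)
      also have "\<dots> = hk T x0 + (2592 * B * t) / R" using R by (simp add: power2_eq_square)
      finally show "pairing V R T x0 t \<le> hk T x0 + (2592 * B * t) / R" .
    qed
    then show ?thesis by (simp add: t(3))
  qed
  have "((\<lambda>\<rho>. \<eta> * (\<integral>z. hk \<rho> z * tent \<epsilon> z \<partial>lborel)) \<longlongrightarrow> \<eta> * 1) (at_right 0)"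
    by (intro tendsto_intros tent_mass \<epsilon>)
  moreover have "eventually (\<lambda>\<rho>. \<eta> * (\<integral>z. hk \<rho> z * tent \<epsilon> z \<partial>lborel) \<le> hk T x0) (at_right 0)"
    unfolding eventually_at_right_field using step \<epsilon>(1) T by (intro exI[of _ "min \<epsilon> T"]) auto
  ultimately have "\<eta> * 1 \<le> hk T x0"
    by (rule tendsto_upperbound) simp
  with \<eta>(1) show False by simp
qed

lemma hk_decay:
  assumes "0 < a" "0 < e"
  shows "\<exists>R. \<forall>t\<in>{a..b}. \<forall>x. \<bar>x\<bar> > R \<longrightarrow> hk t x \<le> e"
proof (intro exI ballI allI impI)
  fix t x assume t: "t \<in> {a..b}" and x: "\<bar>x\<bar> > sqrt (2 * b * (cgauss / sqrt a / e))"
  have t0: "0 < t" "0 < b" "t \<le> b" "a \<le> t" using t assms by auto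
  define v where "v = x\<^sup>2 / (2 * b)"
  define K where "K = cgauss / sqrt a / e"
  have K: "K > 0" using assms cgauss_pos by (auto simp: K_def)
  have bK: "2 * b * K > 0" using t0 K by simp
  have "sqrt (2 * b * K) \<le> \<bar>x\<bar>" using x by (simp add: K_def)
  then have "2 * b * K \<le> x\<^sup>2" using bK by (metis power2_abs sqrt_le_D)
  then have Kv: "K \<le> v" using t0 by (simp add: v_def field_simps)
  then have "e * K \<le> e * v" using assms by simp
  then have v: "cgauss / sqrt a \<le> e * v" "0 < v"
    using Kv K assms by (simp_all add: K_def)
  have "exp (- x\<^sup>2 / (2 * t)) \<le> exp (- v)"
    using t0 by (auto simp: v_def intro!: divide_left_mono)
  moreover have "exp (- v) \<le> 1 / v"
  proof -
    have "v \<le> exp v" using exp_ge_add_one_self[of v] by linarith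
    then show ?thesis using v(2) by (simp add: exp_minus field_simps)
  qed
  ultimately have e2: "exp (- x\<^sup>2 / (2 * t)) \<le> 1 / v" by linarith
  have "cgauss / sqrt t \<le> cgauss / sqrt a"
    using t0 assms cgauss_pos by (intro divide_left_mono mult_pos_pos) auto
  then have "hk t x \<le> cgauss / sqrt a * (1 / v)"
    unfolding hk_eq[OF t0(1)] using e2
    by (rule mult_mono) (use assms cgauss_pos in auto)
  also have "\<dots> \<le> e" using divide_right_mono[OF v(1), of v] v(2) by simp
  finally show "hk t x \<le> e" .
qed

section \<open>Comparison with the constructed solution\<close>

lemma C12_linear:
  assumes "C12 u ut ux uxx" "C12 v vt vx vxx"
  shows "C12 (\<lambda>t x. u t x - c * v t x) (\<lambda>t x. ut t x - c * vt t x) (\<lambda>t x. ux t x - c * vx t x)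
    (\<lambda>t x. uxx t x - c * vxx t x)"
  unfolding C12_def case_prod_beta'
  by (intro conjI allI impI DERIV_diff DERIV_cmult C12D(1-3)[OF assms(1)] C12D(1-3)[OF assms(2)]
      continuous_intros C12D(4-7)[OF assms(1), unfolded case_prod_beta']
      C12D(4-7)[OF assms(2), unfolded case_prod_beta'])

context selfsimilar
begin

text \<open>For c > 1 the multiple c U is a supersolution, since c U^2 \<le> (c U)^2, and it lies
  above the heat kernel, hence above V, at a small positive time. The maximum principle starts from
  there, away from the singular initial time.\<close>

lemma is_sol_le_multiple_U:
  assumes V: "is_sol 1 V" and c: "1 < c" and t: "0 < t"
  shows "V t x \<le> c * U t x"
proof -
  obtain Vt Vx Vxx where C: "C12 V Vt Vx Vxx"
    and pde: "\<And>t x. t > 0 \<Longrightarrow> Vt t x = Vxx t x / 2 - (V t x)\<^sup>2 / 2"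
    using is_sol_derivatives[OF V] by blast
  obtain Ut Ux Uxx where CU: "C12 U Ut Ux Uxx"
    and pdeU: "\<And>t x. t > 0 \<Longrightarrow> Ut t x = Uxx t x / 2 - (U t x)\<^sup>2 / 2"
    using is_sol_derivatives[OF U_is_sol] by blast
  \<comment> \<open>Chosen so that exp (2 \<open>cgauss\<close> \<tau>) = c: for \<surd>a \<le>
    \<tau> the loss in \<open>U_lower\<close> is compensated by the factor c.\<close>
  define \<tau> where "\<tau> = ln c / (2 * cgauss)"
  define a where "a = min t (\<tau>\<^sup>2)"
  have \<tau>: "0 < \<tau>" using c cgauss_pos by (simp add: \<tau>_def)
  have a: "0 < a" "a \<le> t" "a \<le> \<tau>\<^sup>2" using t \<tau> by (auto simp: a_def)
  have "sqrt a \<le> \<tau>" using a(3) \<tau> by (metis abs_of_pos real_sqrt_abs real_sqrt_le_iff)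
  then have "2 * cgauss * sqrt a \<le> ln c" using cgauss_pos by (simp add: \<tau>_def field_simps)
  then have "exp (2 * cgauss * sqrt a) \<le> c" using c by (metis exp_le_cancel_iff exp_ln less_trans zero_less_one)
  then have ce: "1 \<le> c * exp (- (2 * cgauss * sqrt a))" by (simp add: exp_minus field_simps)
  note CW = C12_linear[OF C CU, of c]
  have "V t x - c * U t x \<le> 0"
  proof (rule maximum_principle[where w = "\<lambda>t x. V t x - c * U t x" and a = a and b = t and C = 0])
    show "continuous_on ({a..t} \<times> UNIV) (\<lambda>(t, x). V t x - c * U t x)"
      by (rule continuous_on_subset[OF C12D(4)[OF CW]]) (use a in auto)
    show "V a x - c * U a x \<le> 0" for x
    proof -
      have "V a x \<le> hk a x" by (rule is_sol_le_hk[OF V a(1)])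
      also have "\<dots> \<le> (c * exp (- (2 * cgauss * sqrt a))) * hk a x"
        using mult_right_mono[OF ce less_imp_le[OF hk_pos[OF a(1)]]] by simp
      also have "\<dots> \<le> c * U a x"
        using U_lower[OF a(1), of x] c by (simp add: mult.assoc)
      finally show ?thesis by simp
    qed
    show "\<exists>R. \<forall>s\<in>{a..t}. \<forall>x. R < \<bar>x\<bar> \<longrightarrow> V s x - c * U s x \<le> e" if e: "0 < e" for e
    proof -
      obtain R where R: "\<forall>s\<in>{a..t}. \<forall>x. \<bar>x\<bar> > R \<longrightarrow> hk s x \<le> e"
        using hk_decay[OF a(1) e] by blast
      have "V s x - c * U s x \<le> e" if "s \<in> {a..t}" "R < \<bar>x\<bar>" for s x
      proof -
        have s: "0 < s" using that a by auto
        have "0 \<le> c * U s x" using c U_pos[OF s, of x] by simp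
        with is_sol_le_hk[OF V s, of x] R that show ?thesis by fastforce
      qed
      then show ?thesis by blast
    qed
    show "\<exists>wt wx wxx \<beta>. ((\<lambda>s. V s x - c * U s x) has_real_derivative wt) (at s) \<and>
         (\<forall>y. ((\<lambda>x. V s x - c * U s x) has_real_derivative wx y) (at y)) \<and> (wx has_real_derivative wxx) (at x) \<and>
         wt \<le> wxx / 2 + \<beta> * wx x + 0 * (V s x - c * U s x)"
      if s: "a < s" "s \<le> t" and w: "0 < V s x - c * U s x" for s x
    proof (intro exI conjI allI)
      have s0: "0 < s" using s a by simp
      show "((\<lambda>s. V s x - c * U s x) has_real_derivative Vt s x - c * Ut s x) (at s)"
        by (rule C12D(1)[OF CW s0])
      show "((\<lambda>x. V s x - c * U s x) has_real_derivative Vx s y - c * Ux s y) (at y)" for y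
        by (rule C12D(2)[OF CW s0])
      show "((\<lambda>x. Vx s x - c * Ux s x) has_real_derivative Vxx s x - c * Uxx s x) (at x)"
        by (rule C12D(3)[OF CW s0])
      have u: "0 < U s x" by (rule U_pos[OF s0])
      have "(c * U s x)\<^sup>2 \<le> (V s x)\<^sup>2" using w u c by (intro power_mono) auto
      moreover have "c * (U s x)\<^sup>2 \<le> (c * U s x)\<^sup>2"
        using c u by (simp add: power_mult_distrib power2_eq_square)
      ultimately show "Vt s x - c * Ut s x \<le> (Vxx s x - c * Uxx s x) / 2 + 0 * (Vx s x - c * Ux s x)
          + 0 * (V s x - c * U s x)"
        unfolding pde[OF s0] pdeU[OF s0] by (simp add: field_simps)
    qed
    show "t \<in> {a..t}" using a by simp
  qed
  then show ?thesis by simp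
qed

lemma is_sol_le_U:
  assumes V: "is_sol 1 V" and t: "0 < t"
  shows "V t x \<le> U t x"
proof -
  have "((\<lambda>c. c * U t x) \<longlongrightarrow> 1 * U t x) (at_right 1)" by (intro tendsto_intros)
  moreover have "eventually (\<lambda>c. V t x \<le> c * U t x) (at_right 1)"
    unfolding eventually_at_right_field using is_sol_le_multiple_U[OF V _ t] by (intro exI[of _ 2]) auto
  ultimately have "V t x \<le> 1 * U t x" by (rule tendsto_lowerbound) simp
  then show ?thesis by simp
qed

text \<open>The difference D = U - V is nonnegative, has zero trace and satisfies the heat
  inequality because V^2 \<le> U^2. No absorption of a fixed sign is left to pay for the cutoff, but
  D is at most the heat kernel, so the commutator costs at most O(1/R) times a mass of at most
  1.\<close>

lemma is_sol_eq_U: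
  assumes V: "is_sol 1 V"
  shows "V = U"
proof (intro ext)
  fix t x0
  show "V t x0 = U t x0"
  proof (cases "0 < t")
    case False
    then show ?thesis using is_solD(1)[OF V] by (simp add: U_def)
  next
    case t: True
    obtain Vt Vx Vxx where C: "C12 V Vt Vx Vxx"
      and pde: "\<And>t x. t > 0 \<Longrightarrow> Vt t x = Vxx t x / 2 - (V t x)\<^sup>2 / 2"
      using is_sol_derivatives[OF V] by blast
    obtain Ut Ux Uxx where CU: "C12 U Ut Ux Uxx"
      and pdeU: "\<And>t x. t > 0 \<Longrightarrow> Ut t x = Uxx t x / 2 - (U t x)\<^sup>2 / 2"
      using is_sol_derivatives[OF U_is_sol] by blast
    define D where "D t x = U t x - 1 * V t x" for t x
    note CD = C12_linear[OF CU C, of 1, folded D_def]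
    have D0: "0 \<le> D t x" if "0 < t" for t x using is_sol_le_U[OF V that] by (simp add: D_def)
    have Dhk: "D t x \<le> hk t x" if "0 < t" for t x
      using U_upper[OF that, of x] is_solD(2)[OF V that, of x] by (simp add: D_def)
    have "\<not> 0 < D t x0"
    proof
      assume pos: "0 < D t x0"
      define \<eta> where "\<eta> = D t x0 / 2"
      have \<eta>: "0 < \<eta>" "\<eta> < D t x0" using pos by (auto simp: \<eta>_def)
      obtain \<epsilon> where \<epsilon>: "0 < \<epsilon>" "\<And>s y. 0 < s \<Longrightarrow> \<bar>s - t\<bar> < \<epsilon> \<Longrightarrow> \<bar>x0 - y\<bar> < \<epsilon> \<Longrightarrow> \<eta> < D s y"
        using near_point[OF C12D(4)[OF CD] t \<eta>(2)] by blast
      have step: "\<eta> * (\<integral>z. hk \<rho> z * tent \<epsilon> z \<partial>lborel) \<le> 0" if \<rho>: "0 < \<rho>" for \<rho>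
      proof -
        \<comment> \<open>The kernel is now centred after time t: with zero trace the bound is 0 for
          every \<rho>, so D is tested at time t itself.\<close>
        define T where "T = t + \<rho>"
        have T: "t < T" "T - t = \<rho>" using \<rho> by (auto simp: T_def)
        obtain B where B: "B > 0" "\<And>r z. \<rho> \<le> r \<Longrightarrow> hk r z * (1 + (z / r)\<^sup>2) \<le> B"
          using hk_gradient_bound[OF \<rho>(1)] by blast
        have "\<eta> * (\<integral>z. hk (T - t) z * tent \<epsilon> z \<partial>lborel) \<le> 0"
        proof (rule pairing_tent[OF C12D(4)[OF CD] t T(1) \<epsilon>(1) less_imp_le[OF \<eta>(1)]])
          show "\<eta> * tent \<epsilon> (x0 - y) \<le> D t y" for y
          proof (cases "\<bar>x0 - y\<bar> < \<epsilon>")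
            case True
            have "\<eta> * tent \<epsilon> (x0 - y) \<le> \<eta> * 1" using \<eta> tent_bounds(2)[OF \<epsilon>(1)] by (intro mult_left_mono) auto
            then show ?thesis using \<epsilon>(2)[OF t _ True] \<epsilon>(1) by simp
          next
            case False
            then show ?thesis using D0[OF t] by (simp add: tent_bounds(3)[OF \<epsilon>(1)])
          qed
          fix R :: real assume R: "1 \<le> R"
          have "pairing D R T x0 t \<le> 0 * hk T x0 + (72 * B / R) * t"
          proof (rule pairing_bound[OF CD _ t T(1)])
            fix \<phi> :: "real \<Rightarrow> real"
            assume \<phi>: "continuous_on UNIV \<phi>" "\<exists>R. \<forall>x. R < \<bar>x\<bar> \<longrightarrow> \<phi> x = 0"
            obtain M where M: "M \<ge> 0" "\<And>x. \<bar>\<phi> x\<bar> \<le> M" using \<phi> compact_support_bounded by blast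
            have [measurable]: "\<phi> \<in> borel_measurable borel" using \<phi>(1) by (rule borel_measurable_continuous_onI)
            have bd: "integrable lborel (\<lambda>x. f x * \<phi> x)" if "integrable lborel f" for f :: "real \<Rightarrow> real"
            proof (rule Bochner_Integration.integrable_bound)
              show "integrable lborel (\<lambda>x. M * f x)" using that by simp
              show "AE x in lborel. norm (f x * \<phi> x) \<le> norm (M * f x)"
                using M by (intro AE_I2) (simp add: abs_mult mult.commute mult_right_mono)
            qed (use that in auto)
            have eq: "(LINT x|lborel. U s x * \<phi> x) - (LINT x|lborel. V s x * \<phi> x)
                = (LINT x|lborel. D s x * \<phi> x)" if "0 < s" for s
              unfolding D_def
              by (subst Bochner_Integration.integral_diff[symmetric])
                 (auto intro!: bd is_solD(3)[OF V that] is_solD(3)[OF U_is_sol that] simp: left_diff_distrib)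
            have "((\<lambda>s. (LINT x|lborel. U s x * \<phi> x) - (LINT x|lborel. V s x * \<phi> x)) \<longlongrightarrow> 1 * \<phi> 0 - 1 * \<phi> 0) (at_right 0)"
              by (intro tendsto_diff is_solD(4)[OF V \<phi>] is_solD(4)[OF U_is_sol \<phi>])
            moreover have "eventually (\<lambda>s. (LINT x|lborel. U s x * \<phi> x) - (LINT x|lborel. V s x * \<phi> x)
                = (LINT x|lborel. D s x * \<phi> x)) (at_right 0)"
              unfolding eventually_at_right_field using eq by (intro exI[of _ 1]) auto
            ultimately show "((\<lambda>s. LINT x|lborel. D s x * \<phi> x) \<longlongrightarrow> 0 * \<phi> 0) (at_right 0)"
              using tendsto_cong by fastforce
          next
            fix s r :: real assume s: "0 < s" and r: "T - t \<le> r"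
            then have r\<rho>: "\<rho> \<le> r" by (simp add: T(2))
            define f where "f y = hk r (x0 - y) * ((Ut s y - 1 * Vt s y - (Uxx s y - 1 * Vxx s y) / 2) * cutoff R y
               + D s y * ((x0 - y) / r * cutoff1 R y + cutoff2 R y / 2))" for y
            have hs: "set_integrable lborel {-R..R} (hk s)"
              by (rule borel_integrable_atLeastAtMost')
                 (rule continuous_on_subset[OF continuous_on_space[OF continuous_on_hk s]], simp)
            have hk1: "integral {-R..R} (hk s) \<le> 1"
            proof -
              have "integral {-R..R} (hk s) = (\<integral>y. indicator {-R..R} y * hk s y \<partial>lborel)"
                using set_borel_integral_eq_integral(2)[OF hs] by (simp add: set_lebesgue_integral_def)
              also have "\<dots> \<le> (\<integral>y. hk s y \<partial>lborel)"
                by (rule integral_mono)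
                   (use hs hk_integrable[OF s] hk_pos[OF s] in
                     \<open>auto simp: set_integrable_def indicator_def less_imp_le\<close>)
              finally show ?thesis by (simp add: hk_integral[OF s])
            qed
            have fle: "f y \<le> 72 * B / R * hk s y" if "y \<in> {-R..R}" for y
            proof -
              have yR: "\<bar>y\<bar> \<le> R" using that by auto
              define g where "g = (x0 - y) / r"
              define w where "w = (1 - (y / R)\<^sup>2)\<^sup>2"
              define q where "q = hk r (x0 - y)"
              obtain k where k: "cutoff R y = w\<^sup>2" "g * cutoff1 R y + cutoff2 R y / 2 = w * k"
                  "\<bar>k\<bar> \<le> 36 * (1 + \<bar>g\<bar>) / R"
                using cutoff_terms[OF R yR, of g] unfolding w_def by blast
              have q0: "0 < q" using hk_pos[of r] r\<rho> \<rho> by (simp add: q_def)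
              have w1: "0 \<le> w" "w \<le> 1"
                using cutoff_range(1,2)[of R y] R yR by (auto simp: w_def intro: power_le_one)
              have "(V s y)\<^sup>2 \<le> (U s y)\<^sup>2"
                using is_sol_le_U[OF V s] is_solD(2)[OF V s] by (intro power_mono) auto
              then have neg: "Ut s y - 1 * Vt s y - (Uxx s y - 1 * Vxx s y) / 2 \<le> 0"
                unfolding pde[OF s] pdeU[OF s] by (simp add: field_simps)
              have kk: "q * \<bar>k\<bar> \<le> 72 * B / R"
              proof -
                have "0 \<le> (\<bar>g\<bar> - 1)\<^sup>2" by simp
                then have "2 * \<bar>g\<bar> \<le> g\<^sup>2 + 1" by (simp add: power2_diff)
                moreover have "0 \<le> g\<^sup>2" by simp
                ultimately have "1 + \<bar>g\<bar> \<le> 2 * (1 + g\<^sup>2)" by argo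
                then have "36 * (1 + \<bar>g\<bar>) / R \<le> 72 * (1 + g\<^sup>2) / R" using R by (intro divide_right_mono) auto
                then have "q * \<bar>k\<bar> \<le> q * (72 * (1 + g\<^sup>2) / R)" using k(3) q0 by (intro mult_left_mono) auto
                also have "\<dots> = 72 / R * (q * (1 + g\<^sup>2))" by simp
                also have "\<dots> \<le> 72 / R * B" using B(2)[OF r\<rho>] R by (intro mult_left_mono) (auto simp: q_def g_def)
                finally show ?thesis by simp
              qed
              have "f y = q * ((Ut s y - 1 * Vt s y - (Uxx s y - 1 * Vxx s y) / 2) * w\<^sup>2) + (D s y * w) * (q * k)"
                unfolding f_def q_def[symmetric] g_def[symmetric] k(1,2) by (simp add: algebra_simps)
              also have "\<dots> \<le> 0 + (D s y * 1) * (q * \<bar>k\<bar>)"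
              proof (rule add_mono)
                show "q * ((Ut s y - 1 * Vt s y - (Uxx s y - 1 * Vxx s y) / 2) * w\<^sup>2) \<le> 0"
                  using q0 neg by (intro mult_nonneg_nonpos mult_nonpos_nonneg) auto
                have "(D s y * w) * (q * k) \<le> (D s y * w) * (q * \<bar>k\<bar>)"
                  using D0[OF s, of y] w1 q0 by (intro mult_left_mono) auto
                also have "\<dots> \<le> (D s y * 1) * (q * \<bar>k\<bar>)"
                  using D0[OF s, of y] w1 q0 by (intro mult_right_mono mult_left_mono) auto
                finally show "(D s y * w) * (q * k) \<le> (D s y * 1) * (q * \<bar>k\<bar>)" .
              qed
              also have "0 + (D s y * 1) * (q * \<bar>k\<bar>) = D s y * (q * \<bar>k\<bar>)" by simp
              also have "\<dots> \<le> hk s y * (72 * B / R)"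
                by (rule mult_mono) (use D0[OF s, of y] Dhk[OF s, of y] kk q0 in auto)
              finally show ?thesis by (simp add: mult.commute)
            qed
            have "integral {-R..R} f \<le> 72 * B / R"
            proof (cases "f integrable_on {-R..R}")
              case True
              have "integral {-R..R} f \<le> integral {-R..R} (\<lambda>y. 72 * B / R * hk s y)"
                by (intro integral_le[OF True] integrable_on_mult_right
                      set_borel_integral_eq_integral(1)[OF hs] fle)
              also have "\<dots> = 72 * B / R * integral {-R..R} (hk s)" by simp
              also have "\<dots> \<le> 72 * B / R * 1" using hk1 B R by (intro mult_left_mono) auto
              finally show ?thesis by simp
            next
              case False
              then show ?thesis using B R by (simp add: not_integrable_integral)
            qed
            then show "integral {-R..R} (\<lambda>y. hk r (x0 - y) * ((Ut s y - 1 * Vt s y - (Uxx s y - 1 * Vxx s y) / 2) * cutoff R y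
               + D s y * ((x0 - y) / r * cutoff1 R y + cutoff2 R y / 2))) \<le> 72 * B / R"
              by (simp add: f_def[abs_def])
          qed (use R in auto)
          then show "pairing D R T x0 t \<le> 0 + (72 * B * t) / R" by simp
        qed
        then show ?thesis by (simp add: T(2))
      qed
      have "((\<lambda>\<rho>. \<eta> * (\<integral>z. hk \<rho> z * tent \<epsilon> z \<partial>lborel)) \<longlongrightarrow> \<eta> * 1) (at_right 0)"
        by (intro tendsto_intros tent_mass \<epsilon>)
      moreover have "eventually (\<lambda>\<rho>. \<eta> * (\<integral>z. hk \<rho> z * tent \<epsilon> z \<partial>lborel) \<le> 0) (at_right 0)"
        unfolding eventually_at_right_field using step by (intro exI[of _ 1]) auto
      ultimately have "\<eta> * 1 \<le> 0" by (rule tendsto_upperbound) simp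
      with \<eta>(1) show False by simp
    qed
    then show ?thesis using D0[OF t, of x0] by (simp add: D_def)
  qed
qed

end

section \<open>Monotonicity in time and a stationary barrier\<close>

lemma gaussian_decay:
  assumes "0 < e"
  shows "\<exists>R. \<forall>y. \<bar>y\<bar> > R \<longrightarrow> K * exp (- y\<^sup>2 / 2) \<le> (e::real)"
proof -
  obtain R where R: "\<forall>t\<in>{1..1}. \<forall>x. \<bar>x\<bar> > R \<longrightarrow> hk t x \<le> e / (\<bar>K\<bar> + 1) * cgauss"
    using hk_decay[of 1 "e / (\<bar>K\<bar> + 1) * cgauss" 1] assms cgauss_pos by auto
  have "K * exp (- y\<^sup>2 / 2) \<le> e" if "\<bar>y\<bar> > R" for y
  proof -
    have "hk 1 y \<le> e / (\<bar>K\<bar> + 1) * cgauss" using R that by auto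
    then have "cgauss * exp (- y\<^sup>2 / 2) \<le> cgauss * (e / (\<bar>K\<bar> + 1))" by (simp add: hk_eq mult.commute)
    then have "exp (- y\<^sup>2 / 2) \<le> e / (\<bar>K\<bar> + 1)"
      by (simp only: mult_le_cancel_left_pos[OF cgauss_pos])
    then have "(\<bar>K\<bar> + 1) * exp (- y\<^sup>2 / 2) \<le> e" by (simp add: field_simps)
    moreover have "K * exp (- y\<^sup>2 / 2) \<le> (\<bar>K\<bar> + 1) * exp (- y\<^sup>2 / 2)" by (intro mult_right_mono) auto
    ultimately show ?thesis by linarith
  qed
  then show ?thesis by blast
qed

text \<open>The linear part of the self-similar equation maps \<open>(1 + y\<^sup>2) exp (- y\<^sup>2 / 2)\<close> to
  \<open>(3 - y\<^sup>2) / 2 exp (- y\<^sup>2 / 2)\<close>, which is positive only for \<open>y\<^sup>2 < 3\<close>; there \<open>exp (- y\<^sup>2 / 2) \<ge> exp (- 3/2)\<close>, and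
  the constant lets the quadratic absorption win.\<close>

definition barrier :: "real \<Rightarrow> real" where
  "barrier y = 3 * exp (3/2) * ((1 + y\<^sup>2) * exp (- y\<^sup>2 / 2))"

lemma barrier_pos: "0 < barrier y"
  unfolding barrier_def by (intro mult_pos_pos) (auto simp: add_pos_nonneg)

lemma barrier_le: "barrier y \<le> 6 * exp (3/2)"
proof -
  have "1 + y\<^sup>2 / 2 \<le> exp (y\<^sup>2 / 2)" by (rule exp_ge_add_one_self)
  then have "1 + y\<^sup>2 \<le> 2 * exp (y\<^sup>2 / 2)" by linarith
  then have "(1 + y\<^sup>2) * exp (- y\<^sup>2 / 2) \<le> 2" by (simp add: exp_minus field_simps)
  then show ?thesis unfolding barrier_def by simp
qed

context selfsimilar
begin

section \<open>Consequences of uniqueness in self-similar coordinates\<close>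

lemma N_pos: "0 < N s y"
  by (rule less_le_trans[OF _ N_lower]) (use cgauss_pos in simp)

text \<open>Scaling by 1 / lam carries any solution of mass lam to one of mass 1, where uniqueness
  is known; this resolves the definite description.\<close>

lemma Vsol_scaled:
  assumes lam: "0 < lam"
  shows "Vsol lam = (\<lambda>t x. lam\<^sup>2 * U (lam\<^sup>2 * t) (lam * x))"
  unfolding Vsol_def
proof (rule the_equality)
  show "is_sol lam (\<lambda>t x. lam\<^sup>2 * U (lam\<^sup>2 * t) (lam * x))"
    using is_sol_scale[OF U_is_sol, of lam] lam by simp
  fix V assume V: "is_sol lam V"
  have "is_sol 1 (\<lambda>t x. (1 / lam)\<^sup>2 * V ((1 / lam)\<^sup>2 * t) (1 / lam * x))"
    using is_sol_scale[OF V, of "1 / lam"] lam by simp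
  from is_sol_eq_U[OF this]
  have eq: "(1 / lam)\<^sup>2 * V ((1 / lam)\<^sup>2 * t) (1 / lam * x) = U t x" for t x by (simp add: fun_eq_iff)
  show "V = (\<lambda>t x. lam\<^sup>2 * U (lam\<^sup>2 * t) (lam * x))"
  proof (intro ext)
    fix t x
    show "V t x = lam\<^sup>2 * U (lam\<^sup>2 * t) (lam * x)"
      using eq[of "lam\<^sup>2 * t" "lam * x"] lam by (simp add: power_divide field_simps)
  qed
qed

text \<open>The parameter \<open>lam\<close> enters only through the logarithmic time ln (lam^2 t).
  Large lam is therefore large s, and the rate in lam is the rate at which N converges.\<close>

lemma Vsol_eq:
  assumes lam: "0 < lam" and t: "0 < t"
  shows "Vsol lam t x = N (ln (lam\<^sup>2 * t)) (x / sqrt t) / t"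
proof -
  have "\<not> lam\<^sup>2 * t \<le> 0" using assms by (simp add: not_le)
  moreover have "lam * x / sqrt (lam\<^sup>2 * t) = x / sqrt t"
    using assms by (simp add: real_sqrt_mult)
  ultimately show ?thesis using lam t by (simp add: Vsol_scaled U_def)
qed

text \<open>Reflection is scaling by -1, and the reflected solution coincides with U by
  uniqueness.\<close>

lemma N_even: "N s (- y) = N s y"
proof -
  have "is_sol 1 (\<lambda>t x. U t (- x))"
    using is_sol_scale[OF U_is_sol, of "-1"] by simp
  from is_sol_eq_U[OF this] have "U (exp s) (- (y * sqrt (exp s))) = U (exp s) (y * sqrt (exp s))"
    by (simp add: fun_eq_iff)
  then show ?thesis by (simp add: U_def)
qed

lemma continuous_on_N_strip: "continuous_on A (\<lambda>p. N (fst p + \<sigma>) (snd p))"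
proof -
  have "continuous_on A (\<lambda>p. (\<lambda>(s, y). N s y) (fst p + \<sigma>, snd p))"
    by (rule continuous_on_compose2[OF N_cont(1)]) (auto intro!: continuous_intros)
  then show ?thesis by simp
qed

text \<open>For s \<le> 0 the heat kernel bound lies below the barrier, because
  \<open>cgauss\<close> < 1. From s = 0 on, the maximum principle applies: where N exceeds the
  barrier the quadratic terms have the right sign.\<close>

lemma N_le_barrier: "N s y \<le> barrier y"
proof -
  define b1 where "b1 y = 3 * exp (3/2) * ((y - y ^ 3) * exp (- y\<^sup>2 / 2))" for y :: real
  define b2 where "b2 y = 3 * exp (3/2) * ((1 - 4 * y\<^sup>2 + y ^ 4) * exp (- y\<^sup>2 / 2))" for y :: real
  have db: "(barrier has_real_derivative b1 y) (at y)" for y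
    unfolding barrier_def[abs_def] b1_def
    by (auto intro!: derivative_eq_intros simp: algebra_simps power2_eq_square power3_eq_cube)
  have db1: "(b1 has_real_derivative b2 y) (at y)" for y
    unfolding b1_def[abs_def] b2_def
    by (auto intro!: derivative_eq_intros simp: algebra_simps power2_eq_square power3_eq_cube power4_eq_xxxx)
  have sup: "b2 y / 2 + y / 2 * b1 y + barrier y \<le> (barrier y)\<^sup>2 / 2" for y
  proof -
    define p where "p = exp (- y\<^sup>2 / 2)"
    have p0: "p > 0" by (simp add: p_def)
    have e: "b2 y / 2 + y / 2 * b1 y + barrier y = 3 * exp (3/2) * p * ((3 - y\<^sup>2) / 2)"
      by (simp add: b2_def b1_def barrier_def p_def field_simps power2_eq_square power3_eq_cube power4_eq_xxxx)
    show ?thesis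
    proof (cases "y\<^sup>2 \<ge> 3")
      case True
      then have "3 * exp (3/2) * p * ((3 - y\<^sup>2) / 2) \<le> 0"
        using p0 by (intro mult_nonneg_nonpos) auto
      then show ?thesis unfolding e by (rule order_trans) simp
    next
      case False
      then have "exp (- (3/2)) \<le> p" by (simp add: p_def)
      then have "1 \<le> exp (3/2) * p" by (simp add: exp_minus field_simps)
      have "3 * exp (3/2) * p * ((3 - y\<^sup>2) / 2) \<le> 3 * exp (3/2) * p * (3 / 2)"
        using p0 by (intro mult_left_mono) auto
      also have "\<dots> \<le> 3 * exp (3/2) * p * (3 / 2 * (exp (3/2) * p))"
        using p0 \<open>1 \<le> exp (3/2) * p\<close> by (intro mult_left_mono) auto
      also have "\<dots> = (3 * exp (3/2) * (1 * p))\<^sup>2 / 2" by (simp add: power2_eq_square)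
      also have "\<dots> \<le> (barrier y)\<^sup>2 / 2"
        unfolding barrier_def p_def[symmetric] using p0
        by (intro divide_right_mono power_mono mult_left_mono mult_right_mono) auto
      finally show ?thesis unfolding e .
    qed
  qed
  have small: "N s y \<le> barrier y" if "s \<le> 0" for s y
  proof -
    have "N s y \<le> cgauss * exp (s / 2) * exp (- y\<^sup>2 / 2)" by (rule N_upper)
    also have "\<dots> \<le> 1 * 1 * exp (- y\<^sup>2 / 2)"
      using that cgauss_pos pi_gt3 by (intro mult_right_mono mult_mono) (auto simp: cgauss_def)
    also have "\<dots> \<le> (3 * exp (3/2)) * ((1 + y\<^sup>2) * exp (- y\<^sup>2 / 2))"
    proof -
      have "1 \<le> exp (3/2 :: real)" by simp
      then have "1 \<le> 3 * exp (3/2 :: real)" by linarith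
      then have "1 * (1 * exp (- y\<^sup>2 / 2)) \<le> (3 * exp (3/2)) * ((1 + y\<^sup>2) * exp (- y\<^sup>2 / 2))"
        by (intro mult_mono) auto
      then show ?thesis by simp
    qed
    finally show ?thesis by (simp add: barrier_def)
  qed
  show ?thesis
  proof (cases "s \<le> 0")
    case False
    have "N s y - barrier y \<le> 0"
    proof (rule maximum_principle[where w = "\<lambda>s y. N s y - barrier y" and a = 0 and b = s and C = 1])
      have "continuous_on UNIV barrier"
        using db by (meson DERIV_isCont continuous_at_imp_continuous_on)
      then have "continuous_on ({0..s} \<times> UNIV) (\<lambda>p. barrier (snd p))"
        by (rule continuous_on_compose2) (auto intro!: continuous_intros)
      with continuous_on_N_strip[of _ 0]
      show "continuous_on ({0..s} \<times> UNIV) (\<lambda>(s, y). N s y - barrier y)"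
        unfolding case_prod_beta' by (auto intro!: continuous_intros)
      show "N 0 y - barrier y \<le> 0" for y using small[of 0 y] by simp
      show "\<exists>R. \<forall>r\<in>{0..s}. \<forall>y. R < \<bar>y\<bar> \<longrightarrow> N r y - barrier y \<le> e" if e: "0 < e" for e
      proof -
        obtain R where R: "\<forall>y. \<bar>y\<bar> > R \<longrightarrow> cgauss * exp (s / 2) * exp (- y\<^sup>2 / 2) \<le> e"
          using gaussian_decay[OF e] by blast
        have "N r y - barrier y \<le> e" if "r \<in> {0..s}" "R < \<bar>y\<bar>" for r y
        proof -
          have "N r y \<le> cgauss * exp (r / 2) * exp (- y\<^sup>2 / 2)" by (rule N_upper)
          also have "\<dots> \<le> cgauss * exp (s / 2) * exp (- y\<^sup>2 / 2)"
            using that cgauss_pos by (intro mult_right_mono mult_left_mono) auto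
          also have "\<dots> \<le> e" using R that by blast
          finally show ?thesis using barrier_pos[of y] by simp
        qed
        then show ?thesis by blast
      qed
      fix r y assume w: "0 < N r y - barrier y"
      show "\<exists>wt wx wxx \<beta>. ((\<lambda>s. N s y - barrier y) has_real_derivative wt) (at r) \<and>
         (\<forall>y. ((\<lambda>y. N r y - barrier y) has_real_derivative wx y) (at y)) \<and> (wx has_real_derivative wxx) (at y) \<and>
         wt \<le> wxx / 2 + \<beta> * wx y + 1 * (N r y - barrier y)"
      proof (intro exI conjI allI)
        show "((\<lambda>s. N s y - barrier y) has_real_derivative Ns r y - 0) (at r)"
          by (intro DERIV_diff dNs DERIV_const)
        show "((\<lambda>y. N r y - barrier y) has_real_derivative Ny r y - b1 y) (at y)" for y
          by (intro DERIV_diff dNy db)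
        show "((\<lambda>y. Ny r y - b1 y) has_real_derivative Nyy r y - b2 y) (at y)"
          by (intro DERIV_diff dNyy db1)
        have "(barrier y)\<^sup>2 \<le> (N r y)\<^sup>2" using w barrier_pos[of y] by (intro power_mono) auto
        with sup[of y] show "Ns r y - 0 \<le> (Nyy r y - b2 y) / 2 + y / 2 * (Ny r y - b1 y) + 1 * (N r y - barrier y)"
          unfolding N_pde by (simp add: field_simps)
      qed
    qed (use False in auto)
    then show ?thesis by simp
  qed (rule small)
qed

section \<open>Quantitative monotonicity in logarithmic time\<close>

definition Kbar :: real where "Kbar = 6 * exp (3/2)"

text \<open>At a very negative time the lower bound at a + \<sigma> exceeds the upper bound at a.
  Afterwards the Gaussian \<Theta> is a subsolution for the increment: the linear part maps it to
  \<Theta> / 2, and the absorption costs at most \<open>Kbar\<close> \<Theta>, since both values of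
  N are at most \<open>Kbar\<close>. The explicit gap is kept for the initial comparison in the
  lower estimate.\<close>

lemma N_increase:
  assumes \<sigma>: "0 < \<sigma>"
  obtains a c0 where "a \<le> A" "0 < c0"
    "\<And>s y. a \<le> s \<Longrightarrow> c0 * exp (- (Kbar * (s - a))) * exp (- y\<^sup>2 / 2) \<le> N (s + \<sigma>) y - N s y"
proof -
  \<comment> \<open>This makes the exponent 2 c exp ((a + \<sigma>) / 2) in the lower bound at most
    \<sigma> / 4, half of the growth exponent \<sigma> / 2; the surplus factor exp (\<sigma> / 4)
    remains and defines \<open>c0\<close>.\<close>
  define a where "a = min A (2 * ln (\<sigma> / (8 * cgauss)) - \<sigma>)"
  have "exp ((a + \<sigma>) / 2) \<le> exp (ln (\<sigma> / (8 * cgauss)))" by (simp add: a_def)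
  also have "\<dots> = \<sigma> / (8 * cgauss)" using \<sigma> cgauss_pos by simp
  finally have ea: "2 * cgauss * exp ((a + \<sigma>) / 2) \<le> \<sigma> / 4" using cgauss_pos by (simp add: field_simps)
  define c0 where "c0 = cgauss * exp (a / 2) * (exp (\<sigma> / 4) - 1)"
  have c0: "0 < c0" using \<sigma> cgauss_pos by (simp add: c0_def)
  define \<Theta> where "\<Theta> s y = c0 * exp (- (Kbar * (s - a))) * exp (- y\<^sup>2 / 2)" for s y :: real
  have \<Theta>0: "0 < \<Theta> s y" for s y using c0 by (simp add: \<Theta>_def)
  have init: "\<Theta> a y \<le> N (a + \<sigma>) y - N a y" for y
  proof -
    have "c0 + cgauss * exp (a / 2) = cgauss * exp (a / 2) * exp (\<sigma> / 4)"
      by (simp add: c0_def algebra_simps)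
    also have "\<dots> \<le> cgauss * exp (a / 2) * exp (\<sigma> / 2 - 2 * cgauss * exp ((a + \<sigma>) / 2))"
      using ea cgauss_pos by (intro mult_left_mono) auto
    also have "\<dots> = cgauss * exp ((a + \<sigma>) / 2) * exp (- (2 * cgauss * exp ((a + \<sigma>) / 2)))"
      by (simp add: mult.assoc exp_add [symmetric] add_divide_distrib)
    finally have "(c0 + cgauss * exp (a / 2)) * exp (- y\<^sup>2 / 2)
        \<le> cgauss * exp ((a + \<sigma>) / 2) * exp (- (2 * cgauss * exp ((a + \<sigma>) / 2))) * exp (- y\<^sup>2 / 2)"
      by (intro mult_right_mono) auto
    also have "\<dots> \<le> N (a + \<sigma>) y" using N_lower[of "a + \<sigma>" y] by (simp add: mult_ac)
    finally show ?thesis using N_upper[of a y] by (simp add: \<Theta>_def algebra_simps)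
  qed
  have d\<Theta>1: "((\<lambda>s. \<Theta> s y) has_real_derivative - Kbar * \<Theta> s y) (at s)" for s y
    unfolding \<Theta>_def by (auto intro!: derivative_eq_intros)
  have d\<Theta>2: "(\<Theta> s has_real_derivative - y * \<Theta> s y) (at y)" for s y
    unfolding \<Theta>_def[abs_def] by (auto intro!: derivative_eq_intros)
  have d\<Theta>3: "((\<lambda>y. - y * \<Theta> s y) has_real_derivative (y\<^sup>2 - 1) * \<Theta> s y) (at y)" for s y
    by (rule DERIV_cong[OF DERIV_mult[OF DERIV_minus[OF DERIV_ident] d\<Theta>2]])
       (simp add: algebra_simps power2_eq_square)
  have dsh: "((\<lambda>s. N (s + \<sigma>) y) has_real_derivative Ns (s + \<sigma>) y) (at s)" for s y
    using dNs[of y "s + \<sigma>"] by (simp add: DERIV_shift)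
  have "\<Theta> s y \<le> N (s + \<sigma>) y - N s y" if s: "a \<le> s" for s y
  proof -
    define w where "w s y = \<Theta> s y - (N (s + \<sigma>) y - N s y)" for s y
    have "w s y \<le> 0"
    proof (rule maximum_principle[where w = w and a = a and b = s and C = 1])
      have "continuous_on ({a..s} \<times> UNIV) (\<lambda>p. \<Theta> (fst p) (snd p))"
        unfolding \<Theta>_def by (intro continuous_intros) auto
      with continuous_on_N_strip[of _ 0] continuous_on_N_strip[of _ \<sigma>]
      show "continuous_on ({a..s} \<times> UNIV) (\<lambda>(s, y). w s y)"
        unfolding w_def case_prod_beta' by (auto intro!: continuous_intros)
      show "w a y \<le> 0" for y using init[of y] by (simp add: w_def)
      show "\<exists>R. \<forall>r\<in>{a..s}. \<forall>y. R < \<bar>y\<bar> \<longrightarrow> w r y \<le> e" if e: "0 < e" for e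
      proof -
        obtain R where R: "\<forall>y. \<bar>y\<bar> > R \<longrightarrow> (c0 + cgauss * exp (s / 2)) * exp (- y\<^sup>2 / 2) \<le> e"
          using gaussian_decay[OF e] by blast
        have "w r y \<le> e" if "r \<in> {a..s}" "R < \<bar>y\<bar>" for r y
        proof -
          have "N r y \<le> cgauss * exp (r / 2) * exp (- y\<^sup>2 / 2)" by (rule N_upper)
          also have "\<dots> \<le> cgauss * exp (s / 2) * exp (- y\<^sup>2 / 2)"
            using that cgauss_pos by (intro mult_right_mono mult_left_mono) auto
          finally have 1: "N r y \<le> cgauss * exp (s / 2) * exp (- y\<^sup>2 / 2)" .
          have "exp (- (Kbar * (r - a))) \<le> 1" using that by (simp add: Kbar_def)
          then have 2: "\<Theta> r y \<le> c0 * exp (- y\<^sup>2 / 2)"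
            unfolding \<Theta>_def using c0 by (intro mult_right_mono) (auto simp: mult_left_le)
          have "w r y \<le> (c0 + cgauss * exp (s / 2)) * exp (- y\<^sup>2 / 2)"
            using 1 2 N_pos[of "r + \<sigma>" y] by (simp add: w_def algebra_simps)
          then show ?thesis using R that by fastforce
        qed
        then show ?thesis by blast
      qed
      fix r y assume w: "0 < w r y"
      show "\<exists>wt wx wxx \<beta>. ((\<lambda>s. w s y) has_real_derivative wt) (at r) \<and>
         (\<forall>y. (w r has_real_derivative wx y) (at y)) \<and> (wx has_real_derivative wxx) (at y) \<and>
         wt \<le> wxx / 2 + \<beta> * wx y + 1 * w r y"
      proof (intro exI conjI allI)
        show "((\<lambda>s. w s y) has_real_derivative - Kbar * \<Theta> r y - (Ns (r + \<sigma>) y - Ns r y)) (at r)"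
          unfolding w_def by (intro DERIV_diff dNs dsh d\<Theta>1)
        show "(w r has_real_derivative - y * \<Theta> r y - (Ny (r + \<sigma>) y - Ny r y)) (at y)" for y
          unfolding w_def[abs_def] by (intro DERIV_diff dNy d\<Theta>2)
        show "((\<lambda>y. - y * \<Theta> r y - (Ny (r + \<sigma>) y - Ny r y)) has_real_derivative
            (y\<^sup>2 - 1) * \<Theta> r y - (Nyy (r + \<sigma>) y - Nyy r y)) (at y)"
          by (intro DERIV_diff dNyy d\<Theta>3)
        let ?D = "N (r + \<sigma>) y - N r y"
        have S: "0 < N (r + \<sigma>) y + N r y" "N (r + \<sigma>) y + N r y \<le> 2 * Kbar"
          using N_pos[of r y] N_pos[of "r + \<sigma>" y] N_le_barrier[of r y] N_le_barrier[of "r + \<sigma>" y] barrier_le[of y]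
          by (auto simp: Kbar_def)
        have "(N (r + \<sigma>) y + N r y) * ?D \<le> 2 * Kbar * \<Theta> r y"
        proof (cases "0 \<le> ?D")
          case True
          then show ?thesis using S w by (intro mult_mono) (auto simp: w_def)
        next
          case False
          then have "(N (r + \<sigma>) y + N r y) * ?D \<le> 0" using S by (intro mult_nonneg_nonpos) auto
          moreover have "0 \<le> 2 * Kbar * \<Theta> r y" using \<Theta>0[of r y] by (simp add: Kbar_def)
          ultimately show ?thesis by linarith
        qed
        then have "(N (r + \<sigma>) y)\<^sup>2 / 2 - (N r y)\<^sup>2 / 2 \<le> Kbar * \<Theta> r y"
          by (simp add: power2_eq_square algebra_simps)
        then have "(N (r + \<sigma>) y)\<^sup>2 / 2 - (N r y)\<^sup>2 / 2 \<le> Kbar * \<Theta> r y + \<Theta> r y / 2"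
          using \<Theta>0[of r y] by linarith
        then show "- Kbar * \<Theta> r y - (Ns (r + \<sigma>) y - Ns r y)
            \<le> ((y\<^sup>2 - 1) * \<Theta> r y - (Nyy (r + \<sigma>) y - Nyy r y)) / 2
              + y / 2 * (- y * \<Theta> r y - (Ny (r + \<sigma>) y - Ny r y)) + 1 * w r y"
          unfolding N_pde w_def by (simp add: field_simps power2_eq_square)
      qed
    qed (use s in auto)
    then show ?thesis by (simp add: w_def)
  qed
  then show thesis using that[of a c0] c0 by (simp add: \<Theta>_def a_def)
qed

lemma N_mono:
  assumes "s \<le> s'"
  shows "N s y \<le> N s' y"
proof (cases "s = s'")
  case False
  define \<sigma> where "\<sigma> = s' - s"
  have \<sigma>: "0 < \<sigma>" using False assms by (simp add: \<sigma>_def)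
  obtain a c0 where a: "a \<le> s" "0 < c0"
    "\<And>s y. a \<le> s \<Longrightarrow> c0 * exp (- (Kbar * (s - a))) * exp (- y\<^sup>2 / 2) \<le> N (s + \<sigma>) y - N s y"
    using N_increase[OF \<sigma>, of s] by blast
  have "0 \<le> c0 * exp (- (Kbar * (s - a))) * exp (- y\<^sup>2 / 2)" using a(2) by simp
  also have "\<dots> \<le> N (s + \<sigma>) y - N s y" by (rule a(3)[OF a(1)])
  finally show ?thesis by (simp add: \<sigma>_def)
qed simp

end

section \<open>The stationary profile\<close>

lemma antiderivative_exists:
  fixes f :: "real \<Rightarrow> real"
  assumes c: "continuous_on UNIV f"
  obtains A where "\<And>x. (A has_real_derivative f x) (at x)" "A 0 = 0"
    "\<And>x. 0 \<le> x \<Longrightarrow> A x = integral {0..x} f"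
proof -
  define A where "A x = (if 0 \<le> x then integral {0..x} f else - integral {x..0} f)" for x
  have ci: "f integrable_on {a..b}" for a b
    by (intro integrable_continuous_real continuous_on_subset[OF c]) auto
  have A: "A x = integral {-B..x} f - integral {-B..0} f" if "\<bar>x\<bar> \<le> B" for x B
  proof (cases "0 \<le> x")
    case True
    have "integral {-B..0} f + integral {0..x} f = integral {-B..x} f"
      by (rule Henstock_Kurzweil_Integration.integral_combine) (use True that ci in auto)
    then show ?thesis using True by (simp add: A_def)
  next
    case False
    have "integral {-B..x} f + integral {x..0} f = integral {-B..0} f"
      by (rule Henstock_Kurzweil_Integration.integral_combine) (use False that ci in auto)
    then show ?thesis using False by (simp add: A_def)
  qed
  have "(A has_real_derivative f x) (at x)" for x
  proof -
    define B where "B = \<bar>x\<bar> + 1"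
    have xi: "x \<in> {-B<..<B}" by (auto simp: B_def abs_if)
    have "((\<lambda>x. integral {-B..x} f) has_real_derivative f x) (at x within {-B..B})"
      by (rule integral_has_real_derivative) (use xi in \<open>auto intro: continuous_on_subset[OF c]\<close>)
    then have "((\<lambda>x. integral {-B..x} f) has_real_derivative f x) (at x)"
      using xi by (simp add: at_within_Icc_at)
    from DERIV_diff[OF this DERIV_const]
    have "((\<lambda>x. integral {-B..x} f - integral {-B..0} f) has_real_derivative f x) (at x)" by simp
    then show ?thesis
      by (rule has_field_derivative_transform_within_open[where S = "{-B<..<B}"])
         (use xi A[of _ B] in \<open>auto simp: abs_le_iff\<close>)
  qed
  then show ?thesis by (rule that) (auto simp: A_def)
qed

lemma antiderivative_parity:
  fixes f :: "real \<Rightarrow> real"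
  assumes d: "\<And>x. (A has_real_derivative f x) (at x)" and z: "A 0 = 0"
  shows "(\<And>x. f (- x) = f x) \<Longrightarrow> A (- x) = - A x" "(\<And>x. f (- x) = - f x) \<Longrightarrow> A (- x) = A x"
proof -
  have dm: "((\<lambda>x. A (- x)) has_real_derivative - f (- x)) (at x)" for x
    using DERIV_chain2[OF d DERIV_minus[OF DERIV_ident], of x] by simp
  show "A (- x) = - A x" if "\<And>x. f (- x) = f x"
  proof -
    have "\<forall>x. ((\<lambda>x. A (- x) + A x) has_real_derivative 0) (at x)"
      using DERIV_add[OF dm d] that by simp
    from DERIV_isconst_all[OF this, of x 0] show ?thesis using z by simp
  qed
  show "A (- x) = A x" if "\<And>x. f (- x) = - f x"
  proof -
    have "\<forall>x. ((\<lambda>x. A (- x) - A x) has_real_derivative 0) (at x)"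
      using DERIV_diff[OF dm d] that by simp
    from DERIV_isconst_all[OF this, of x 0] show ?thesis using z by simp
  qed
qed

context selfsimilar
begin

definition F :: "real \<Rightarrow> real" where "F y = (SUP s. N s y)"

lemma bdd_N: "bdd_above (range (\<lambda>s. N s y))"
  using N_le_barrier by (auto simp: bdd_above_def)

lemma N_le_F: "N s y \<le> F y"
  unfolding F_def by (rule cSUP_upper[OF _ bdd_N]) simp

lemma F_le_barrier: "F y \<le> barrier y"
  unfolding F_def by (rule cSUP_least) (use N_le_barrier in auto)

lemma F_pos: "0 < F y"
  by (rule less_le_trans[OF N_pos N_le_F])

lemma F_even: "F (- y) = F y"
  by (simp add: F_def N_even)

lemma N_tendsto_F: "((\<lambda>s. N s y) \<longlongrightarrow> F y) at_top"
proof (rule increasing_tendsto)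
  show "\<forall>\<^sub>F s in at_top. N s y \<le> F y" using N_le_F by simp
  fix x assume "x < F y"
  then obtain s where s: "x < N s y"
    using less_cSUP_iff[OF _ bdd_N, of x y] by (auto simp: F_def)
  have "x < N s' y" if "s \<le> s'" for s' using s N_mono[OF that, of y] by simp
  then show "\<forall>\<^sub>F s in at_top. x < N s y" unfolding eventually_at_top_linorder by blast
qed

lemma Vinf_eq:
  assumes t: "0 < t"
  shows "Vinf t x = F (x / sqrt t) / t"
proof -
  have "filterlim (\<lambda>lam. ln (lam\<^sup>2 * t)) at_top at_top"
  proof (rule filterlim_compose[OF ln_at_top])
    show "filterlim (\<lambda>lam. lam\<^sup>2 * t) at_top at_top"
      by (intro filterlim_at_top_mult_tendsto_pos[OF tendsto_const t] filterlim_pow_at_top filterlim_ident) simp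
  qed
  then have "((\<lambda>lam. N (ln (lam\<^sup>2 * t)) (x / sqrt t)) \<longlongrightarrow> F (x / sqrt t)) at_top"
    by (rule filterlim_compose[OF N_tendsto_F])
  then have "((\<lambda>lam. N (ln (lam\<^sup>2 * t)) (x / sqrt t) / t) \<longlongrightarrow> F (x / sqrt t) / t) at_top"
    by (intro tendsto_divide tendsto_const) (use t in auto)
  moreover have "eventually (\<lambda>lam. N (ln (lam\<^sup>2 * t)) (x / sqrt t) / t = Vsol lam t x) at_top"
    using eventually_gt_at_top[of 0] by (rule eventually_mono) (simp add: Vsol_eq[OF _ t])
  ultimately have "((\<lambda>lam. Vsol lam t x) \<longlongrightarrow> F (x / sqrt t) / t) at_top"
    using tendsto_cong by fastforce
  then show ?thesis unfolding Vinf_def by (intro tendsto_Lim) auto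
qed

lemma Fpot_eq: "Fpot = F"
  by (simp add: fun_eq_iff Fpot_def Vinf_eq)

text \<open>One unit of quantified growth from s = 0 separates N from its supremum by a multiple of
  the Gaussian.\<close>

lemma F_gap: obtains c where "0 < c" "\<And>y. c * exp (- y\<^sup>2 / 2) \<le> F y - N 0 y"
proof -
  obtain a c0 where a: "a \<le> 0" "0 < c0"
    "\<And>s y. a \<le> s \<Longrightarrow> c0 * exp (- (Kbar * (s - a))) * exp (- y\<^sup>2 / 2) \<le> N (s + 1) y - N s y"
    using N_increase[of 1 0] by auto
  show ?thesis
  proof (rule that[of "c0 * exp (- (Kbar * (0 - a)))"])
    fix y
    show "c0 * exp (- (Kbar * (0 - a))) * exp (- y\<^sup>2 / 2) \<le> F y - N 0 y"
      using a(3)[OF a(1), of y] N_le_F[of "0 + 1" y] by simp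
  qed (use a in simp)
qed

section \<open>Regularity of the profile through an integral equation\<close>

lemma Ny_0: "Ny s 0 = 0"
proof -
  have "((\<lambda>y. N s (- y)) has_real_derivative Ny s (- 0) * (- 1)) (at 0)"
    by (rule DERIV_chain2[OF dNy]) (auto intro!: derivative_eq_intros)
  then have "(N s has_real_derivative - Ny s 0) (at 0)" by (simp add: N_even)
  from DERIV_unique[OF this dNy] show ?thesis by simp
qed

lemma N_bound: "\<bar>N s y\<bar> \<le> Kbar"
  using N_pos[of s y] N_le_barrier[of s y] barrier_le[of y] by (simp add: Kbar_def)

lemma N_space_cont: "continuous_on A (N s)" "continuous_on A (Ns s)"
proof -
  show "continuous_on A (N s)"
    using dNy by (meson DERIV_isCont continuous_at_imp_continuous_on)
  have "continuous_on A (\<lambda>y. (\<lambda>(s, y). Ns s y) (s, y))"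
    by (rule continuous_on_compose2[OF N_cont(2)]) (auto intro!: continuous_intros)
  then show "continuous_on A (Ns s)" by simp
qed

lemma N_integral_limits:
  assumes r: "filterlim r at_top sequentially" and Y: "0 \<le> Y"
  shows "F integrable_on {0..Y}"
    "(\<lambda>n. integral {0..Y} (N (r n))) \<longlonglongrightarrow> integral {0..Y} F"
    "(\<lambda>z. (F z)\<^sup>2) integrable_on {0..Y}"
    "(\<lambda>n. integral {0..Y} (\<lambda>z. (N (r n) z)\<^sup>2)) \<longlonglongrightarrow> integral {0..Y} (\<lambda>z. (F z)\<^sup>2)"
    "(\<lambda>z. z * (F z)\<^sup>2) integrable_on {0..Y}"
    "(\<lambda>n. integral {0..Y} (\<lambda>z. z * (N (r n) z)\<^sup>2)) \<longlonglongrightarrow> integral {0..Y} (\<lambda>z. z * (F z)\<^sup>2)"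
    "(\<lambda>z. (Y - z) * F z) integrable_on {0..Y}"
    "(\<lambda>n. integral {0..Y} (\<lambda>z. (Y - z) * N (r n) z)) \<longlonglongrightarrow> integral {0..Y} (\<lambda>z. (Y - z) * F z)"
proof -
  have lim: "(\<lambda>n. N (r n) z) \<longlonglongrightarrow> F z" for z by (rule filterlim_compose[OF N_tendsto_F r])
  have K0: "0 \<le> Kbar" by (simp add: Kbar_def)
  have sq: "(N s z)\<^sup>2 \<le> Kbar\<^sup>2" for s z using N_bound[of s z] K0 by (metis power2_abs power_mono abs_ge_zero)
  note i = integrable_continuous_real
  have "(\<lambda>_. Kbar) integrable_on {0..Y}" by (rule integrable_const_ivl)
  from dominated_convergence[of "\<lambda>n. N (r n)" "{0..Y}", OF i[OF N_space_cont(1)] this _ lim]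
  show "F integrable_on {0..Y}" "(\<lambda>n. integral {0..Y} (N (r n))) \<longlonglongrightarrow> integral {0..Y} F"
    using N_bound by auto
  have c: "(\<lambda>_. Kbar\<^sup>2) integrable_on {0..Y}" "(\<lambda>_. Y * Kbar\<^sup>2) integrable_on {0..Y}"
    "(\<lambda>_. Y * Kbar) integrable_on {0..Y}" by (rule integrable_const_ivl)+
  have "(\<lambda>z. (N (r n) z)\<^sup>2) integrable_on {0..Y}" for n
    by (intro i continuous_intros N_space_cont)
  from dominated_convergence[of "\<lambda>n z. (N (r n) z)\<^sup>2" "{0..Y}", OF this c(1) _ tendsto_power[OF lim]]
  show "(\<lambda>z. (F z)\<^sup>2) integrable_on {0..Y}"
    "(\<lambda>n. integral {0..Y} (\<lambda>z. (N (r n) z)\<^sup>2)) \<longlonglongrightarrow> integral {0..Y} (\<lambda>z. (F z)\<^sup>2)"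
    using sq by auto
  have i3: "(\<lambda>z. z * (N (r n) z)\<^sup>2) integrable_on {0..Y}" for n
    by (intro i continuous_intros N_space_cont)
  have b3: "norm (z * (N (r n) z)\<^sup>2) \<le> Y * Kbar\<^sup>2" if "z \<in> {0..Y}" for n z
    using that sq by (auto simp: abs_mult intro!: mult_mono)
  from dominated_convergence[of "\<lambda>n z. z * (N (r n) z)\<^sup>2" "{0..Y}",
      OF i3 c(2) b3 tendsto_mult[OF tendsto_const tendsto_power[OF lim]]]
  show "(\<lambda>z. z * (F z)\<^sup>2) integrable_on {0..Y}"
    "(\<lambda>n. integral {0..Y} (\<lambda>z. z * (N (r n) z)\<^sup>2)) \<longlonglongrightarrow> integral {0..Y} (\<lambda>z. z * (F z)\<^sup>2)"
    by auto
  have i4: "(\<lambda>z. (Y - z) * N (r n) z) integrable_on {0..Y}" for n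
    by (intro i continuous_intros N_space_cont)
  have b4: "norm ((Y - z) * N (r n) z) \<le> Y * Kbar" if "z \<in> {0..Y}" for n z
    using that N_bound[of "r n" z] by (auto simp: abs_mult intro!: mult_mono)
  from dominated_convergence[of "\<lambda>n z. (Y - z) * N (r n) z" "{0..Y}",
      OF i4 c(3) b4 tendsto_mult[OF tendsto_const lim]]
  show "(\<lambda>z. (Y - z) * F z) integrable_on {0..Y}"
    "(\<lambda>n. integral {0..Y} (\<lambda>z. (Y - z) * N (r n) z)) \<longlonglongrightarrow> integral {0..Y} (\<lambda>z. (Y - z) * F z)"
    by auto
qed

text \<open>The time derivative of the second antiderivative of \<open>N\<close> vanishes along a sequence of
  times, so the limit inherits the twice integrated stationary equation without any compactness.\<close>

lemma F_integral_equation: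
  assumes Y: "0 \<le> Y"
  shows "F Y = F 0 - Y * integral {0..Y} F + Y * integral {0..Y} (\<lambda>z. (F z)\<^sup>2)
      - integral {0..Y} (\<lambda>z. z * (F z)\<^sup>2)"
proof -
  define g where "g s = integral {0..Y} (\<lambda>z. (Y - z) * N s z)" for s
  define G where "G s = N s Y / 2 - N s 0 / 2 + Y / 2 * integral {0..Y} (N s)
      - (Y * integral {0..Y} (\<lambda>z. (N s z)\<^sup>2) - integral {0..Y} (\<lambda>z. z * (N s z)\<^sup>2)) / 2" for s
  note i = integrable_continuous_real
  have dg: "(g has_real_derivative G s) (at s)" for s
  proof -
    have "((\<lambda>s. integral (cbox 0 Y) (\<lambda>z. (Y - z) * N s z)) has_field_derivative
        integral (cbox 0 Y) (\<lambda>z. (Y - z) * Ns s z)) (at s within UNIV)"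
    proof (rule leibniz_rule_field_derivative)
      show "((\<lambda>s. (Y - z) * N s z) has_real_derivative (Y - z) * Ns s z) (at s within UNIV)" for s z
        by (intro DERIV_cmult dNs)
      show "(\<lambda>z. (Y - z) * N s z) integrable_on cbox 0 Y" for s
        unfolding cbox_interval by (intro i continuous_intros N_space_cont)
      have "continuous_on (UNIV \<times> cbox 0 Y) (\<lambda>p. (Y - snd p) * (\<lambda>(s, y). Ns s y) p)"
        by (intro continuous_intros continuous_on_subset[OF N_cont(2)]) auto
      then show "continuous_on (UNIV \<times> cbox 0 Y) (\<lambda>(s, z). (Y - z) * Ns s z)"
        by (simp add: case_prod_beta')
    qed auto
    then have 1: "(g has_real_derivative integral {0..Y} (\<lambda>z. (Y - z) * Ns s z)) (at s)"
      by (simp add: g_def[abs_def])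
    \<comment> \<open>Integrating the weighted equation by parts moves the weight Y - z off the
      derivatives. Its boundary values are N s Y / 2 and N s 0 / 2, since the weight vanishes at Y
      and \<open>Ny\<close> vanishes at 0.\<close>
    define P where "P z = (Y - z) * (Ny s z / 2 + z / 2 * N s z) + N s z / 2" for z
    have dP: "(P has_real_derivative ((Y - z) * Ns s z - Y / 2 * N s z + (Y * (N s z)\<^sup>2 - z * (N s z)\<^sup>2) / 2)) (at z)" for z
    proof (rule DERIV_cong)
      show "(P has_real_derivative ((0 - 1) * (Ny s z / 2 + z / 2 * N s z)
          + (Nyy s z / 2 + (1 / 2 * N s z + Ny s z * (z / 2))) * (Y - z)) + Ny s z / 2) (at z)"
        unfolding P_def[abs_def]
        by (intro DERIV_add DERIV_mult DERIV_diff DERIV_const DERIV_ident DERIV_cdivide dNy dNyy)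
      show "(0 - 1) * (Ny s z / 2 + z / 2 * N s z)
          + (Nyy s z / 2 + (1 / 2 * N s z + Ny s z * (z / 2))) * (Y - z) + Ny s z / 2
          = (Y - z) * Ns s z - Y / 2 * N s z + (Y * (N s z)\<^sup>2 - z * (N s z)\<^sup>2) / 2"
        unfolding N_pde by (simp add: field_simps power2_eq_square)
    qed
    have "((\<lambda>z. (Y - z) * Ns s z - Y / 2 * N s z + (Y * (N s z)\<^sup>2 - z * (N s z)\<^sup>2) / 2) has_integral P Y - P 0) {0..Y}"
      by (rule fundamental_theorem_of_calculus[OF Y])
         (use dP in \<open>auto simp: has_real_derivative_iff_has_vector_derivative [symmetric]
            intro: has_field_derivative_at_within\<close>)
    moreover have "((\<lambda>z. Y / 2 * N s z) has_integral Y / 2 * integral {0..Y} (N s)) {0..Y}"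
      by (intro has_integral_mult_right integrable_integral i N_space_cont)
    moreover have "((\<lambda>z. (Y * (N s z)\<^sup>2 - z * (N s z)\<^sup>2) / 2) has_integral
        (Y * integral {0..Y} (\<lambda>z. (N s z)\<^sup>2) - integral {0..Y} (\<lambda>z. z * (N s z)\<^sup>2)) / 2) {0..Y}"
      by (intro has_integral_divide has_integral_diff has_integral_mult_right integrable_integral i
          continuous_intros N_space_cont)
    ultimately have "((\<lambda>z. ((Y - z) * Ns s z - Y / 2 * N s z + (Y * (N s z)\<^sup>2 - z * (N s z)\<^sup>2) / 2)
        + Y / 2 * N s z - (Y * (N s z)\<^sup>2 - z * (N s z)\<^sup>2) / 2) has_integral (P Y - P 0) + Y / 2 * integral {0..Y} (N s)
        - (Y * integral {0..Y} (\<lambda>z. (N s z)\<^sup>2) - integral {0..Y} (\<lambda>z. z * (N s z)\<^sup>2)) / 2) {0..Y}"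
      by (intro has_integral_diff has_integral_add)
    then have "((\<lambda>z. (Y - z) * Ns s z) has_integral G s) {0..Y}"
      by (simp add: P_def G_def Ny_0)
    with 1 show ?thesis by (simp add: integral_unique)
  qed
  \<comment> \<open>\<open>g\<close> converges, so its increments over [n, n + 1] tend to 0; the
    mean value theorem makes them values of \<open>G\<close> at times tending to infinity.\<close>
  have "\<exists>r. real n < r \<and> r < real n + 1 \<and> g (real n + 1) - g (real n) = G r" for n
    using MVT2[of "real n" "real n + 1" g G] dg by auto
  then obtain r where r: "\<And>n. real n < r n" "\<And>n. g (real n + 1) - g (real n) = G (r n)"
    by metis
  have f0: "filterlim (\<lambda>n. real n) at_top sequentially" by (rule filterlim_real_sequentially)
  have f1: "filterlim (\<lambda>n. real n + 1) at_top sequentially"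
    by (rule filterlim_at_top_mono[OF f0]) simp
  have fr: "filterlim r at_top sequentially"
    by (rule filterlim_at_top_mono[OF f0]) (use r(1) in \<open>auto intro: always_eventually less_imp_le\<close>)
  note L = N_integral_limits[OF fr Y]
  have "(\<lambda>n. g (real n + 1) - g (real n)) \<longlonglongrightarrow> integral {0..Y} (\<lambda>z. (Y - z) * F z) - integral {0..Y} (\<lambda>z. (Y - z) * F z)"
    unfolding g_def by (intro tendsto_diff N_integral_limits(8) f0 f1 Y)
  then have "(\<lambda>n. G (r n)) \<longlonglongrightarrow> 0" by (simp add: r(2))
  moreover have "(\<lambda>n. G (r n)) \<longlonglongrightarrow> F Y / 2 - F 0 / 2 + Y / 2 * integral {0..Y} F
      - (Y * integral {0..Y} (\<lambda>z. (F z)\<^sup>2) - integral {0..Y} (\<lambda>z. z * (F z)\<^sup>2)) / 2"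
    unfolding G_def by (intro tendsto_intros L filterlim_compose[OF N_tendsto_F fr]) auto
  ultimately have "F Y / 2 - F 0 / 2 + Y / 2 * integral {0..Y} F
      - (Y * integral {0..Y} (\<lambda>z. (F z)\<^sup>2) - integral {0..Y} (\<lambda>z. z * (F z)\<^sup>2)) / 2 = 0"
    by (rule LIMSEQ_unique[symmetric])
  then show ?thesis by (simp add: field_simps)
qed

text \<open>As a supremum of continuous functions F is a priori only lower semicontinuous. The
  integral equation represents it on the right half line by indefinite integrals, and evenness does
  the rest.\<close>

lemma F_continuous: "continuous_on UNIV F"
proof -
  have F0: "filterlim real at_top sequentially" by (rule filterlim_real_sequentially)
  have "continuous_on {0..B} F" if B: "0 \<le> B" for B
  proof -
    note L = N_integral_limits[OF F0 B]
    have "continuous_on {0..B} (\<lambda>Y. F 0 - Y * integral {0..Y} F + Y * integral {0..Y} (\<lambda>z. (F z)\<^sup>2)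
        - integral {0..Y} (\<lambda>z. z * (F z)\<^sup>2))"
      by (intro continuous_intros indefinite_integral_continuous_1 L)
    then show ?thesis
      by (rule continuous_on_eq) (rule F_integral_equation[symmetric], simp)
  qed
  note c = this
  have "isCont (\<lambda>y. F \<bar>y\<bar>) x" for x
  proof -
    define B where "B = \<bar>x\<bar> + 1"
    have xi: "x \<in> {-B<..<B}" by (auto simp: B_def abs_if)
    have "continuous_on {-B<..<B} (\<lambda>y. F \<bar>y\<bar>)"
      by (rule continuous_on_compose2[OF c[of B]]) (auto intro!: continuous_intros simp: B_def)
    then show ?thesis using xi continuous_on_eq_continuous_at[OF open_greaterThanLessThan] by blast
  qed
  then have "continuous_on UNIV (\<lambda>y. F \<bar>y\<bar>)" by (simp add: continuous_at_imp_continuous_on)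
  moreover have "F \<bar>y\<bar> = F y" for y using F_even[of y] by (simp add: abs_if)
  ultimately show ?thesis by simp
qed

text \<open>With the continuity of F the integrals become primitives, and their parities extend the
  representation to negative arguments, so that it can be differentiated across 0. In the first
  derivative the terms y F^2 cancel, which leaves an expression that is again
  differentiable.\<close>

lemma F_ode:
  obtains F1 F2 where "\<And>y. (F has_real_derivative F1 y) (at y)" "\<And>y. (F1 has_real_derivative F2 y) (at y)"
    "\<And>y. F2 y = - 2 * F y - y * F1 y + (F y)\<^sup>2"
proof -
  have c2: "continuous_on UNIV (\<lambda>z. (F z)\<^sup>2)" "continuous_on UNIV (\<lambda>z. z * (F z)\<^sup>2)"
    by (intro continuous_intros F_continuous)+
  obtain A1 where A1: "\<And>x. (A1 has_real_derivative F x) (at x)" "A1 0 = 0"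
    "\<And>x. 0 \<le> x \<Longrightarrow> A1 x = integral {0..x} F"
    using antiderivative_exists[OF F_continuous] by blast
  obtain A2 where A2: "\<And>x. (A2 has_real_derivative (F x)\<^sup>2) (at x)" "A2 0 = 0"
    "\<And>x. 0 \<le> x \<Longrightarrow> A2 x = integral {0..x} (\<lambda>z. (F z)\<^sup>2)"
    using antiderivative_exists[OF c2(1)] by blast
  obtain A3 where A3: "\<And>x. (A3 has_real_derivative x * (F x)\<^sup>2) (at x)" "A3 0 = 0"
    "\<And>x. 0 \<le> x \<Longrightarrow> A3 x = integral {0..x} (\<lambda>z. z * (F z)\<^sup>2)"
    using antiderivative_exists[OF c2(2)] by blast
  have p: "A1 (- x) = - A1 x" "A2 (- x) = - A2 x" "A3 (- x) = A3 x" for x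
    by (rule antiderivative_parity[OF A1(1,2)] antiderivative_parity[OF A2(1,2)]
          antiderivative_parity[OF A3(1,2)], simp add: F_even)+
  have pos: "F y = F 0 - y * A1 y + y * A2 y - A3 y" if "0 \<le> y" for y
    using F_integral_equation[OF that] A1(3) A2(3) A3(3) that by simp
  have eq: "F y = F 0 - y * A1 y + y * A2 y - A3 y" for y
  proof (cases "0 \<le> y")
    case False
    then show ?thesis using pos[of "- y"] by (simp add: F_even p)
  qed (rule pos)
  define F1 where "F1 y = - A1 y - y * F y + A2 y" for y
  have d: "(F has_real_derivative F1 y) (at y)" for y
  proof -
    have "((\<lambda>y. F 0 - y * A1 y + y * A2 y - A3 y) has_real_derivative
        0 - (1 * A1 y + F y * y) + (1 * A2 y + (F y)\<^sup>2 * y) - y * (F y)\<^sup>2) (at y)"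
      by (intro DERIV_add DERIV_diff DERIV_mult DERIV_ident DERIV_const A1 A2 A3)
    moreover have "(\<lambda>y. F 0 - y * A1 y + y * A2 y - A3 y) = F"
      by (rule ext) (rule eq[symmetric])
    ultimately show ?thesis by (simp add: F1_def algebra_simps)
  qed
  show ?thesis
  proof (rule that[of F1 "\<lambda>y. - 2 * F y - y * F1 y + (F y)\<^sup>2"])
    fix y
    have "(F1 has_real_derivative - F y - (1 * F y + F1 y * y) + (F y)\<^sup>2) (at y)"
      unfolding F1_def[abs_def]
      by (intro DERIV_add DERIV_diff DERIV_minus DERIV_mult DERIV_ident A1 A2 d[unfolded F1_def])
    then show "(F1 has_real_derivative - 2 * F y - y * F1 y + (F y)\<^sup>2) (at y)"
      by (rule DERIV_cong) (simp add: algebra_simps)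
  qed (use d in auto)
qed

end

section \<open>Second order linear equations\<close>

lemma bound_from_derivative:
  fixes A :: "real \<Rightarrow> real"
  assumes d: "\<And>x. (A has_real_derivative A' x) (at x)" and z: "A 0 = 0"
    and b: "\<And>x. \<bar>x\<bar> \<le> R \<Longrightarrow> \<bar>A' x\<bar> \<le> K * \<bar>x\<bar> ^ n" and x: "\<bar>x\<bar> \<le> R"
  shows "\<bar>A x\<bar> \<le> K * \<bar>x\<bar> ^ Suc n / Suc n"
proof -
  have pos: "B x \<le> K * x ^ Suc n / Suc n"
    if dB: "\<And>x. (B has_real_derivative B' x) (at x)" and zB: "B 0 = 0"
      and bB: "\<And>x. 0 \<le> x \<Longrightarrow> x \<le> R \<Longrightarrow> B' x \<le> K * x ^ n" and x: "0 \<le> x" "x \<le> R" for B B' x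
  proof -
    have "K * 0 ^ Suc n / Suc n - B 0 \<le> K * x ^ Suc n / Suc n - B x"
    proof (rule DERIV_nonneg_imp_nondecreasing[OF x(1)])
      fix y assume y: "0 \<le> y" "y \<le> x"
      have "((\<lambda>x. K * x ^ Suc n / Suc n - B x) has_real_derivative K * y ^ n - B' y) (at y)"
        by (auto intro!: derivative_eq_intros dB simp del: power_Suc)
      moreover have "0 \<le> K * y ^ n - B' y" using bB[of y] y x by simp
      ultimately show "\<exists>D. ((\<lambda>x. K * x ^ Suc n / Suc n - B x) has_real_derivative D) (at y) \<and> 0 \<le> D" by blast
    qed
    then show ?thesis using zB by simp
  qed
  have dneg: "((\<lambda>x. - A x) has_real_derivative - A' x) (at x)" for x by (intro DERIV_minus d)
  have drefl: "((\<lambda>x. A (- x)) has_real_derivative - A' (- x)) (at x)" for x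
    using DERIV_chain2[OF d DERIV_minus[OF DERIV_ident], of x] by simp
  have dneg2: "((\<lambda>x. - A (- x)) has_real_derivative A' (- x)) (at x)" for x
    using DERIV_minus[OF drefl] by simp
  show ?thesis
  proof (cases "0 \<le> x")
    case True
    have "A x \<le> K * x ^ Suc n / Suc n" "- A x \<le> K * x ^ Suc n / Suc n"
      by (rule pos[OF d z] pos[OF dneg]; use True x z b in \<open>force simp: abs_le_iff\<close>)+
    then show ?thesis using True by (simp add: abs_le_iff)
  next
    case False
    have "A (- (- x)) \<le> K * (- x) ^ Suc n / Suc n"
    proof (rule pos[OF drefl])
      show "- A' (- y) \<le> K * y ^ n" if "0 \<le> y" "y \<le> R" for y using b[of "- y"] that by (auto simp: abs_le_iff)
    qed (use False x z in auto)
    moreover have "- A (- (- x)) \<le> K * (- x) ^ Suc n / Suc n"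
    proof (rule pos[OF dneg2])
      show "A' (- y) \<le> K * y ^ n" if "0 \<le> y" "y \<le> R" for y using b[of "- y"] that by (auto simp: abs_le_iff)
    qed (use False x z in auto)
    ultimately show ?thesis using False by (simp add: abs_le_iff)
  qed
qed

text \<open>Picard iteration in the form of a series: \<open>un\<close> and \<open>vn\<close> are
  the successive increments. On [-R, R] they are bounded by (C |x|)^n / n!, so the series may be
  differentiated termwise and the solution is global.\<close>

lemma linear_ode_exists:
  fixes Q :: "real \<Rightarrow> real"
  assumes Q: "continuous_on UNIV Q"
  obtains u v where "u 0 = 1" "v 0 = 0" "\<And>x. (u has_real_derivative v x) (at x)"
    "\<And>x. (v has_real_derivative x * v x + Q x * u x) (at x)"
proof -
  define prim :: "(real \<Rightarrow> real) \<Rightarrow> real \<Rightarrow> real" where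
    "prim f = (SOME A. (\<forall>x. (A has_real_derivative f x) (at x)) \<and> A 0 = 0)" for f
  have prim: "(prim f has_real_derivative f x) (at x)" "prim f 0 = 0" if f: "continuous_on UNIV f" for f x
  proof -
    obtain A where "\<forall>x. (A has_real_derivative f x) (at x)" "A 0 = 0"
      using antiderivative_exists[OF f] by blast
    then have "\<exists>A. (\<forall>x. (A has_real_derivative f x) (at x)) \<and> A 0 = 0" by blast
    from someI_ex[OF this] show "(prim f has_real_derivative f x) (at x)" "prim f 0 = 0"
      by (auto simp: prim_def)
  qed
  define step where "step w = (prim (snd w), prim (\<lambda>x. x * snd w x + Q x * fst w x))"
    for w :: "(real \<Rightarrow> real) \<times> (real \<Rightarrow> real)"
  define w where "w n = (step ^^ n) ((\<lambda>x. 1), (\<lambda>x. 0))" for n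
  define un vn where "un n = fst (w n)" and "vn n = snd (w n)" for n
  have w0: "un 0 = (\<lambda>x. 1)" "vn 0 = (\<lambda>x. 0)" by (simp_all add: un_def vn_def w_def)
  have wS: "un (Suc n) = prim (vn n)" "vn (Suc n) = prim (\<lambda>x. x * vn n x + Q x * un n x)" for n
    by (simp_all add: un_def vn_def w_def step_def)
  have cont: "continuous_on UNIV (un n) \<and> continuous_on UNIV (vn n)" for n
  proof (induction n)
    case (Suc n)
    then have "continuous_on UNIV (\<lambda>x. x * vn n x + Q x * un n x)" "continuous_on UNIV (vn n)"
      by (auto intro!: continuous_intros Q)
    from prim(1)[OF this(1)] prim(1)[OF this(2)] show ?case
      unfolding wS by (meson DERIV_isCont continuous_at_imp_continuous_on)
  qed (simp add: w0)
  have cont2: "continuous_on UNIV (\<lambda>x. x * vn n x + Q x * un n x)" for n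
    using cont[of n] by (auto intro!: continuous_intros Q)
  \<comment> \<open>The derivative of term n + 1 is built from term n, and term 0 is constant; hence
    the shift of the index.\<close>
  define du where "du n = (case n of 0 \<Rightarrow> (\<lambda>x. 0) | Suc m \<Rightarrow> vn m)" for n
  define dv where "dv n = (case n of 0 \<Rightarrow> (\<lambda>x. 0) | Suc m \<Rightarrow> (\<lambda>x. x * vn m x + Q x * un m x))" for n
  have dun: "(un n has_real_derivative du n x) (at x)" and dvn: "(vn n has_real_derivative dv n x) (at x)" for n x
  proof -
    have "(un n has_real_derivative du n x) (at x) \<and> (vn n has_real_derivative dv n x) (at x)"
    proof (cases n)
      case 0
      then show ?thesis by (simp add: w0 du_def dv_def)
    next
      case (Suc m)
      show ?thesis
        unfolding Suc wS du_def dv_def using prim(1)[OF conjunct2[OF cont[of m]]] prim(1)[OF cont2[of m]] by simp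
    qed
    then show "(un n has_real_derivative du n x) (at x)" "(vn n has_real_derivative dv n x) (at x)" by simp_all
  qed
  have bounds: "\<exists>C\<ge>0. \<forall>n x. \<bar>x\<bar> \<le> R \<longrightarrow> \<bar>un n x\<bar> \<le> (C * \<bar>x\<bar>) ^ n / fact n \<and> \<bar>vn n x\<bar> \<le> (C * \<bar>x\<bar>) ^ n / fact n" for R
  proof -
    have "bounded (Q ` {-\<bar>R\<bar>..\<bar>R\<bar>})"
      by (intro compact_imp_bounded compact_continuous_image continuous_on_subset[OF Q]) auto
    then obtain B where B: "\<And>x. x \<in> {-\<bar>R\<bar>..\<bar>R\<bar>} \<Longrightarrow> \<bar>Q x\<bar> \<le> B"
      unfolding bounded_iff by (metis imageI real_norm_def)
    have B0: "0 \<le> B" using B[of 0] by (auto intro: order_trans[OF abs_ge_zero])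
    define C where "C = 1 + \<bar>R\<bar> + B"
    have C: "1 \<le> C" "\<bar>R\<bar> + B \<le> C" using B0 by (auto simp: C_def)
    have "\<forall>x. \<bar>x\<bar> \<le> R \<longrightarrow> \<bar>un n x\<bar> \<le> (C * \<bar>x\<bar>) ^ n / fact n \<and> \<bar>vn n x\<bar> \<le> (C * \<bar>x\<bar>) ^ n / fact n" for n
    proof (induction n)
      case (Suc n)
      define K where "K = C ^ Suc n / fact n"
      have e: "C * ((C * \<bar>x\<bar>) ^ n / fact n) = K * \<bar>x\<bar> ^ n" for x
        by (simp add: K_def power_mult_distrib)
      have K2: "K * \<bar>x\<bar> ^ Suc n / Suc n = (C * \<bar>x\<bar>) ^ Suc n / fact (Suc n)" for x
        by (simp add: K_def power_mult_distrib field_simps del: power_Suc)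
      have b1: "\<bar>vn n x\<bar> \<le> K * \<bar>x\<bar> ^ n" if x: "\<bar>x\<bar> \<le> R" for x
      proof -
        have v: "\<bar>vn n x\<bar> \<le> (C * \<bar>x\<bar>) ^ n / fact n" using Suc x by blast
        also have "\<dots> \<le> C * ((C * \<bar>x\<bar>) ^ n / fact n)"
          using mult_right_mono[OF C(1), of "(C * \<bar>x\<bar>) ^ n / fact n"] C by simp
        finally show ?thesis by (simp only: e)
      qed
      have b2: "\<bar>x * vn n x + Q x * un n x\<bar> \<le> K * \<bar>x\<bar> ^ n" if x: "\<bar>x\<bar> \<le> R" for x
      proof -
        let ?t = "(C * \<bar>x\<bar>) ^ n / fact n"
        have v: "\<bar>vn n x\<bar> \<le> ?t" "\<bar>un n x\<bar> \<le> ?t" using Suc x by blast+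
        have q: "\<bar>Q x\<bar> \<le> B" by (rule B) (use x in \<open>auto simp: abs_le_iff\<close>)
        have t0: "0 \<le> ?t" using C by simp
        have "\<bar>x * vn n x + Q x * un n x\<bar> \<le> \<bar>x\<bar> * \<bar>vn n x\<bar> + \<bar>Q x\<bar> * \<bar>un n x\<bar>"
          by (metis abs_mult abs_triangle_ineq)
        also have "\<dots> \<le> \<bar>R\<bar> * ?t + B * ?t"
          using v q x t0 B0 by (intro add_mono mult_mono) auto
        also have "\<dots> = (\<bar>R\<bar> + B) * ?t" by (simp only: distrib_right)
        also have "\<dots> \<le> C * ?t" by (rule mult_right_mono[OF C(2) t0])
        finally show ?thesis by (simp only: e)
      qed
      have "\<bar>un (Suc n) x\<bar> \<le> (C * \<bar>x\<bar>) ^ Suc n / fact (Suc n)" if x: "\<bar>x\<bar> \<le> R" for x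
        unfolding K2[symmetric] wS
        by (rule bound_from_derivative[OF prim(1) prim(2) b1 x]) (use cont in auto)
      moreover have "\<bar>vn (Suc n) x\<bar> \<le> (C * \<bar>x\<bar>) ^ Suc n / fact (Suc n)" if x: "\<bar>x\<bar> \<le> R" for x
        unfolding K2[symmetric] wS
        by (rule bound_from_derivative[OF prim(1) prim(2) b2 x]) (use cont2 in auto)
      ultimately show ?case by blast
    qed (simp add: w0)
    then show ?thesis using C by (intro exI[of _ C]) auto
  qed
  define u where "u x = (\<Sum>n. un n x)" for x
  define v where "v x = (\<Sum>n. vn n x)" for x
  have main: "(u has_real_derivative v x) (at x)" "(v has_real_derivative x * v x + Q x * u x) (at x)" for x
  proof -
    define R where "R = \<bar>x\<bar> + 1"
    obtain C where C: "C \<ge> 0"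
      "\<And>n x. \<bar>x\<bar> \<le> R \<Longrightarrow> \<bar>un n x\<bar> \<le> (C * \<bar>x\<bar>) ^ n / fact n"
      "\<And>n x. \<bar>x\<bar> \<le> R \<Longrightarrow> \<bar>vn n x\<bar> \<le> (C * \<bar>x\<bar>) ^ n / fact n" using bounds[of R] by blast
    have R0: "0 \<le> R" by (simp add: R_def)
    have M: "(C * \<bar>y\<bar>) ^ n / fact n \<le> (C * R) ^ n / fact n" if "\<bar>y\<bar> \<le> R" for n y
      using that C(1) by (intro divide_right_mono power_mono mult_left_mono) auto
    have sM: "summable (\<lambda>n. (C * R) ^ n / fact n)"
      using summable_exp[of "C * R"] by (simp add: divide_inverse mult.commute)
    have su: "summable (\<lambda>n. un n y)" "summable (\<lambda>n. vn n y)" if "\<bar>y\<bar> \<le> R" for y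
      by (rule summable_comparison_test'[OF sM, of 0]; use C(2,3)[OF that] M[OF that] in \<open>auto intro: order_trans\<close>)+
    have bounded: "bounded (Q ` {-R..R})"
      by (intro compact_imp_bounded compact_continuous_image continuous_on_subset[OF Q]) auto
    then obtain B where B: "\<And>x. x \<in> {-R..R} \<Longrightarrow> \<bar>Q x\<bar> \<le> B"
      unfolding bounded_iff by (metis imageI real_norm_def)
    have B0: "0 \<le> B" using B[of 0] R0 by (auto intro: order_trans[OF abs_ge_zero])
    define m where "m n = (case n of 0 \<Rightarrow> 0 | Suc k \<Rightarrow> (1 + R + B) * ((C * R) ^ k / fact k))" for n
    have "summable (\<lambda>n. m (Suc n))"
      unfolding m_def nat.case by (intro summable_mult sM)
    then have sm: "summable m" by (simp only: summable_Suc_iff)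
    have bu: "norm (du n y) \<le> m n \<and> norm (dv n y) \<le> m n" if y: "y \<in> {-R..R}" for n y
    proof (cases n)
      case (Suc k)
      have yR: "\<bar>y\<bar> \<le> R" using y by auto
      let ?t = "(C * R) ^ k / fact k"
      have t0: "0 \<le> ?t" using C R0 by simp
      have a: "\<bar>un k y\<bar> \<le> ?t" "\<bar>vn k y\<bar> \<le> ?t"
        using C(2,3)[OF yR, of k] M[OF yR, of k] by linarith+
      have "\<bar>vn k y\<bar> \<le> 1 * ?t" using a by simp
      also have "\<dots> \<le> (1 + R + B) * ?t" using R0 B0 by (intro mult_right_mono t0) auto
      finally have 1: "norm (du n y) \<le> m n" by (simp add: Suc du_def m_def)
      have "\<bar>y * vn k y + Q y * un k y\<bar> \<le> \<bar>y\<bar> * \<bar>vn k y\<bar> + \<bar>Q y\<bar> * \<bar>un k y\<bar>"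
        by (metis abs_mult abs_triangle_ineq)
      also have "\<dots> \<le> R * ?t + B * ?t"
        using a B[OF y] yR t0 B0 R0 by (intro add_mono mult_mono) auto
      also have "\<dots> = (R + B) * ?t" by (simp only: distrib_right)
      also have "\<dots> \<le> (1 + R + B) * ?t" by (intro mult_right_mono t0) simp
      finally have "norm (dv n y) \<le> m n" by (simp add: Suc dv_def m_def)
      with 1 show ?thesis by blast
    qed (simp_all add: du_def dv_def m_def)
    have xi: "x \<in> interior {-R..R}" by (auto simp: R_def abs_if)
    have ud: "uniformly_convergent_on {-R..R} (\<lambda>n x. \<Sum>i<n. du i x)"
      "uniformly_convergent_on {-R..R} (\<lambda>n x. \<Sum>i<n. dv i x)"
      by (rule Weierstrass_m_test'[OF _ sm]; use bu in blast)+
    have xR: "\<bar>x\<bar> \<le> R" by (simp add: R_def)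
    have "((\<lambda>x. \<Sum>n. un n x) has_real_derivative (\<Sum>n. du n x)) (at x)"
      by (rule has_field_derivative_series'(2)[OF _ has_field_derivative_at_within[OF dun] ud(1) _ su(1) xi, of 0])
         (use R0 in auto)
    moreover have "(\<Sum>n. du n x) = v x"
    proof -
      have "(\<Sum>n. du (Suc n) x) = (\<Sum>n. du n x) - du 0 x"
        by (rule suminf_split_head) (use su(2)[OF xR] summable_Suc_iff[of "\<lambda>n. du n x"] in \<open>simp add: du_def\<close>)
      then show ?thesis by (simp add: du_def v_def)
    qed
    ultimately show "(u has_real_derivative v x) (at x)" by (simp add: u_def[abs_def])
    have "((\<lambda>x. \<Sum>n. vn n x) has_real_derivative (\<Sum>n. dv n x)) (at x)"
      by (rule has_field_derivative_series'(2)[OF _ has_field_derivative_at_within[OF dvn] ud(2) _ su(2) xi, of 0])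
         (use R0 in auto)
    moreover have "(\<Sum>n. dv n x) = x * v x + Q x * u x"
    proof -
      have s: "summable (\<lambda>n. x * vn n x + Q x * un n x)"
        by (intro summable_add summable_mult su xR)
      have "(\<Sum>n. dv (Suc n) x) = (\<Sum>n. dv n x) - dv 0 x"
        by (rule suminf_split_head) (use s summable_Suc_iff[of "\<lambda>n. dv n x"] in \<open>simp add: dv_def\<close>)
      moreover have "(\<Sum>n. x * vn n x + Q x * un n x) = x * v x + Q x * u x"
        unfolding u_def v_def using su[OF xR] by (simp add: suminf_add suminf_mult summable_mult flip: suminf_add suminf_mult)
      ultimately show ?thesis by (simp add: dv_def)
    qed
    ultimately show "(v has_real_derivative x * v x + Q x * u x) (at x)" by (simp add: v_def[abs_def])
  qed
  have "un n 0 = (if n = 0 then 1 else 0) \<and> vn n 0 = 0" for n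
  proof (cases n)
    case (Suc m)
    show ?thesis
      unfolding Suc wS using prim(2)[OF conjunct2[OF cont[of m]]] prim(2)[OF cont2[of m]] by simp
  qed (simp add: w0)
  then have "u 0 = (\<Sum>n. if n = 0 then 1 else 0)" "v 0 = 0" by (simp_all add: u_def v_def)
  moreover have "(\<Sum>n. if n = 0 then 1 else (0::real)) = 1"
    using sums_single[of 0 "\<lambda>_. 1::real"] by (simp add: sums_iff)
  ultimately show ?thesis using that main by metis
qed

lemma first_zero:
  fixes \<psi> :: "real \<Rightarrow> real"
  assumes c: "continuous_on UNIV \<psi>" and p: "0 < \<psi> a" and n: "\<psi> x \<le> 0" and x: "a < x"
  obtains z where "a < z" "z \<le> x" "\<psi> z = 0" "\<And>y. a \<le> y \<Longrightarrow> y < z \<Longrightarrow> 0 < \<psi> y"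
proof -
  define S where "S = {y \<in> {a..x}. \<psi> y \<le> 0}"
  have "S = {a..x} \<inter> {y. \<psi> y \<le> 0}" by (auto simp: S_def)
  then have "compact S"
    using c by (auto intro!: compact_Int_closed closed_Collect_le)
  have "x \<in> S" using n x by (simp add: S_def)
  then have "S \<noteq> {}" by blast
  from compact_attains_inf[OF \<open>compact S\<close> this]
  obtain z where z: "z \<in> S" "\<And>y. y \<in> S \<Longrightarrow> z \<le> y" by blast
  have pos: "0 < \<psi> y" if "a \<le> y" "y < z" for y
  proof (rule ccontr)
    assume "\<not> 0 < \<psi> y"
    then have "y \<in> S" using that z(1) by (auto simp: S_def)
    from z(2)[OF this] that show False by simp
  qed
  have az: "a < z" using z(1) p by (cases "a = z") (auto simp: S_def)
  have "\<psi> z = 0"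
  proof (rule ccontr)
    assume "\<psi> z \<noteq> 0"
    then have "\<psi> z < 0" using z(1) by (auto simp: S_def)
    then obtain w where "a \<le> w" "w \<le> z" "\<psi> w = 0"
      using IVT2'[of \<psi> z 0 a] p az continuous_on_subset[OF c] by auto
    with pos[of w] \<open>\<psi> z < 0\<close> show False by (cases "w = z") auto
  qed
  with az z(1) pos show ?thesis by (intro that[of z]) (auto simp: S_def)
qed

text \<open>Since \<open>g w\<^sup>2 + 1 / (g w\<^sup>2) \<ge> 2\<close> and \<open>1 / (g w\<^sup>2)\<close> is
  dominated by the integrable derivative of \<open>- 1 / w\<close>, the function \<open>g w\<^sup>2\<close> is not integrable.\<close>

lemma not_square_integrable:
  fixes w g h :: "real \<Rightarrow> real"
  assumes d: "\<And>x. X \<le> x \<Longrightarrow> (w has_real_derivative w' x) (at x)"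
    and w: "\<And>x. X \<le> x \<Longrightarrow> 0 < w x" and g: "\<And>x. X \<le> x \<Longrightarrow> 0 < g x"
    and \<delta>: "0 < \<delta>" and w': "\<And>x. X \<le> x \<Longrightarrow> \<delta> / g x \<le> w' x"
    and h: "\<And>x. X \<le> x \<Longrightarrow> h x = g x * (w x)\<^sup>2" and h0: "\<And>x. 0 \<le> h x"
    and c: "continuous_on UNIV h" and i: "integrable lborel h"
  shows False
proof -
  define I where "I = (\<integral>x. h x \<partial>lborel)"
  obtain A where A: "\<And>x. (A has_real_derivative h x) (at x)"
    using antiderivative_exists[OF c] by blast
  have upper: "A Y - A X \<le> I" if "X \<le> Y" for Y
  proof -
    have "(h has_integral (A Y - A X)) {X..Y}"
      by (rule fundamental_theorem_of_calculus[OF that])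
         (use A in \<open>auto simp: has_real_derivative_iff_has_vector_derivative [symmetric] intro: has_field_derivative_at_within\<close>)
    then have "A Y - A X = integral {X..Y} h" by (simp add: integral_unique)
    also have "set_integrable lborel {X..Y} h"
      by (rule borel_integrable_atLeastAtMost') (rule continuous_on_subset[OF c], simp)
    then have "integral {X..Y} h = (\<integral>y. indicator {X..Y} y * h y \<partial>lborel)"
      using set_borel_integral_eq_integral(2)[of "{X..Y}" h] by (simp add: set_lebesgue_integral_def)
    also have "\<dots> \<le> I"
      unfolding I_def
      by (rule integral_mono) (use \<open>set_integrable lborel {X..Y} h\<close> i h0 in \<open>auto simp: set_integrable_def indicator_def\<close>)
    finally show ?thesis .
  qed
  have lower: "A X - 2 * X - 1 / (\<delta> * w X) \<le> A Y - 2 * Y - 1 / (\<delta> * w Y)" if "X \<le> Y" for Y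
  proof (rule DERIV_nonneg_imp_nondecreasing[OF that])
    fix x assume x: "X \<le> x" "x \<le> Y"
    have wx: "0 < w x" "0 < g x" using w g x by auto
    have "((\<lambda>x. A x - 2 * x - 1 / (\<delta> * w x)) has_real_derivative h x - 2 + w' x / (\<delta> * (w x)\<^sup>2)) (at x)"
      using wx \<delta> by (auto intro!: derivative_eq_intros A d[OF x(1)] simp: field_simps power2_eq_square)
    moreover have "0 \<le> h x - 2 + w' x / (\<delta> * (w x)\<^sup>2)"
    proof -
      have "0 < h x" using h[OF x(1)] wx by simp
      have "1 / h x = (\<delta> / g x) / (\<delta> * (w x)\<^sup>2)" using h[OF x(1)] wx \<delta> by simp
      also have "\<dots> \<le> w' x / (\<delta> * (w x)\<^sup>2)" using w'[OF x(1)] wx \<delta> by (intro divide_right_mono) auto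
      finally have "1 / h x \<le> w' x / (\<delta> * (w x)\<^sup>2)" .
      moreover have "0 \<le> (h x - 1)\<^sup>2 / h x" using \<open>0 < h x\<close> by simp
      then have "0 \<le> h x - 2 + 1 / h x" using \<open>0 < h x\<close> by (simp add: field_simps power2_eq_square)
      ultimately show ?thesis by linarith
    qed
    ultimately show "\<exists>D. ((\<lambda>x. A x - 2 * x - 1 / (\<delta> * w x)) has_real_derivative D) (at x) \<and> 0 \<le> D" by blast
  qed
  \<comment> \<open>Far enough that 2 (Y - X) exceeds I + 1 / (\<delta> w X), the most that the two
    bounds together allow.\<close>
  define Y where "Y = X + (\<bar>I\<bar> + 1 / (\<delta> * w X) + 1)"
  have wX: "0 < 1 / (\<delta> * w X)" using w[of X] \<delta> by simp
  have XY: "X \<le> Y" using wX by (simp add: Y_def)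
  have "0 < 1 / (\<delta> * w Y)" using w[OF XY] \<delta> by simp
  with upper[OF XY] lower[OF XY] have "2 * (Y - X) \<le> I + 1 / (\<delta> * w X)" by argo
  then have "2 * (\<bar>I\<bar> + 1 / (\<delta> * w X) + 1) \<le> I + 1 / (\<delta> * w X)" by (simp only: Y_def add_diff_cancel_left')
  with wX show False by argo
qed

text \<open>Gronwall's inequality for the squared distance in phase space, forward from 0. With e =
  0 it gives uniqueness, with e = 2 (\<mu> - \<mu>0) continuous dependence on the level.\<close>

lemma ode_stability:
  fixes u1 v1 u2 v2 :: "real \<Rightarrow> real"
  assumes d1: "\<And>x. (u1 has_real_derivative v1 x) (at x)"
      "\<And>x. (v1 has_real_derivative x * v1 x + Q1 x * u1 x) (at x)"
    and d2: "\<And>x. (u2 has_real_derivative v2 x) (at x)"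
      "\<And>x. (v2 has_real_derivative x * v2 x + Q2 x * u2 x) (at x)"
    and init: "u1 0 = u2 0" "v1 0 = v2 0"
    and Q: "\<And>x. \<bar>Q1 x\<bar> \<le> B" "\<And>x. Q2 x = Q1 x + e" and u2: "\<And>x. 0 \<le> x \<Longrightarrow> x \<le> X \<Longrightarrow> \<bar>u2 x\<bar> \<le> K"
    and x: "0 \<le> x" "x \<le> X"
  shows "(u1 x - u2 x)\<^sup>2 + (v1 x - v2 x)\<^sup>2 \<le> (e * K)\<^sup>2 * X * exp ((2 + 2 * X + B) * X)"
proof -
  define L where "L = 2 + 2 * X + B"
  define E where "E x = (u1 x - u2 x)\<^sup>2 + (v1 x - v2 x)\<^sup>2" for x
  have B0: "0 \<le> B" using Q(1)[of 0] by linarith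
  have L0: "0 \<le> L" using x B0 by (simp add: L_def)
  have "exp (- (L * x)) * E x - (e * K)\<^sup>2 * x \<le> exp (- (L * 0)) * E 0 - (e * K)\<^sup>2 * 0"
  proof (rule DERIV_nonpos_imp_nonincreasing[OF x(1)])
    fix y assume y: "0 \<le> y" "y \<le> x"
    define a b where "a = u1 y - u2 y" and "b = v1 y - v2 y"
    define E' where "E' = 2 * a * b + 2 * b * (y * b + Q1 y * a - e * u2 y)"
    have dE: "(E has_real_derivative E') (at y)"
      unfolding E_def[abs_def] E'_def a_def b_def
      by (auto intro!: derivative_eq_intros d1 d2 simp: Q(2) algebra_simps power2_eq_square)
    have "E' \<le> L * E y + (e * K)\<^sup>2"
    proof -
      have 1: "2 * a * b \<le> a\<^sup>2 + b\<^sup>2" using sum_squares_bound[of a b] by simp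
      have 2: "2 * b * (y * b) \<le> 2 * X * b\<^sup>2"
        using mult_right_mono[of y X "b\<^sup>2"] y x by (simp add: power2_eq_square mult_ac)
      have 3: "2 * b * (Q1 y * a) \<le> B * (a\<^sup>2 + b\<^sup>2)"
      proof -
        have "2 * b * (Q1 y * a) \<le> \<bar>Q1 y\<bar> * (2 * \<bar>a\<bar> * \<bar>b\<bar>)"
          using abs_ge_self[of "2 * b * (Q1 y * a)"] by (simp add: abs_mult mult_ac)
        also have "\<dots> \<le> B * (a\<^sup>2 + b\<^sup>2)"
          using sum_squares_bound[of "\<bar>a\<bar>" "\<bar>b\<bar>"] Q(1) B0 by (intro mult_mono) auto
        finally show ?thesis .
      qed
      have 4: "2 * b * (- e * u2 y) \<le> b\<^sup>2 + (e * K)\<^sup>2"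
      proof -
        have "2 * b * (- e * u2 y) \<le> b\<^sup>2 + (e * u2 y)\<^sup>2"
          using sum_squares_bound[of b "- e * u2 y"] by simp
        moreover have "\<bar>e * u2 y\<bar> \<le> \<bar>e * K\<bar>"
          using u2[of y] y x unfolding abs_mult by (intro mult_left_mono) auto
        then have "(e * u2 y)\<^sup>2 \<le> (e * K)\<^sup>2" by (simp only: abs_le_square_iff)
        ultimately show ?thesis by linarith
      qed
      have "E' = 2 * a * b + 2 * b * (y * b) + 2 * b * (Q1 y * a) + 2 * b * (- e * u2 y)"
        by (simp add: E'_def algebra_simps)
      also have "\<dots> \<le> (a\<^sup>2 + b\<^sup>2) + 2 * X * b\<^sup>2 + B * (a\<^sup>2 + b\<^sup>2) + (b\<^sup>2 + (e * K)\<^sup>2)"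
        using 1 2 3 4 by linarith
      also have "\<dots> \<le> L * E y + (e * K)\<^sup>2"
      proof -
        have "L * E y = (a\<^sup>2 + b\<^sup>2) + 2 * X * b\<^sup>2 + B * (a\<^sup>2 + b\<^sup>2) + b\<^sup>2 + (a\<^sup>2 + 2 * X * a\<^sup>2)"
          by (simp add: L_def E_def a_def b_def algebra_simps)
        moreover have "0 \<le> a\<^sup>2 + 2 * X * a\<^sup>2" using x by simp
        ultimately show ?thesis by linarith
      qed
      finally show ?thesis .
    qed
    then have 5: "E' - L * E y \<le> (e * K)\<^sup>2" by linarith
    have "exp (- (L * y)) * (E' - L * E y) \<le> exp (- (L * y)) * (e * K)\<^sup>2"
      by (intro mult_left_mono 5) simp
    also have "\<dots> \<le> 1 * (e * K)\<^sup>2" using L0 y by (intro mult_right_mono) auto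
    finally have "exp (- (L * y)) * (E' - L * E y) \<le> 1 * (e * K)\<^sup>2" .
    moreover have "((\<lambda>x. exp (- (L * x)) * E x - (e * K)\<^sup>2 * x) has_real_derivative
        exp (- (L * y)) * (E' - L * E y) - (e * K)\<^sup>2) (at y)"
      by (auto intro!: derivative_eq_intros dE simp: algebra_simps)
    ultimately show "\<exists>D. ((\<lambda>x. exp (- (L * x)) * E x - (e * K)\<^sup>2 * x) has_real_derivative D) (at y) \<and> D \<le> 0"
      by (intro exI conjI) auto
  qed
  then have "exp (- (L * x)) * E x \<le> (e * K)\<^sup>2 * x" using init by (simp add: E_def)
  then have "E x \<le> (e * K)\<^sup>2 * x * exp (L * x)" by (simp add: exp_minus field_simps)
  also have "\<dots> \<le> (e * K)\<^sup>2 * X * exp (L * X)"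
    using x L0 by (intro mult_mono) (auto intro: mult_left_mono)
  finally show ?thesis by (simp add: E_def L_def)
qed

section \<open>The ground state by shooting\<close>

text \<open>In the application f = F exp (y^2 / 2). As F - 1 = 2 (F / 2 - 1/2), the equation for f
  is the eigenvalue equation with potential F / 2 at level 1/2, and its positive solution serves as
  a comparison function.\<close>

locale potential =
  fixes F f f1 f2 :: "real \<Rightarrow> real" and M :: real
  assumes F_cont: "continuous_on UNIV F" and F_sym: "\<And>x. F (- x) = F x"
    and F_gt_0: "\<And>x. 0 < F x" and F_le_M: "\<And>x. F x \<le> M"
    and f_pos: "\<And>x. 0 < f x" and df: "\<And>x. (f has_real_derivative f1 x) (at x)"
    and df1: "\<And>x. (f1 has_real_derivative f2 x) (at x)" and f1_0: "f1 0 = 0"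
    and f_ode: "\<And>x. f2 x = x * f1 x + (F x - 1) * f x"
begin

definition Q :: "real \<Rightarrow> real \<Rightarrow> real" where "Q \<mu> x = 2 * (F x - \<mu>)"

text \<open>The data 1 and 0 at the origin select the even solution, which is where a ground state
  of a symmetric potential has to be sought.\<close>

definition solution :: "real \<Rightarrow> (real \<Rightarrow> real) \<times> (real \<Rightarrow> real)" where
  "solution \<mu> = (SOME w. fst w 0 = 1 \<and> snd w 0 = 0 \<and>
     (\<forall>x. (fst w has_real_derivative snd w x) (at x)) \<and>
     (\<forall>x. (snd w has_real_derivative x * snd w x + Q \<mu> x * fst w x) (at x)))"

definition psi :: "real \<Rightarrow> real \<Rightarrow> real" where "psi \<mu> = fst (solution \<mu>)"
definition dpsi :: "real \<Rightarrow> real \<Rightarrow> real" where "dpsi \<mu> = snd (solution \<mu>)"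

lemma psi_ode: "psi \<mu> 0 = 1" "dpsi \<mu> 0 = 0" "(psi \<mu> has_real_derivative dpsi \<mu> x) (at x)"
  "(dpsi \<mu> has_real_derivative x * dpsi \<mu> x + Q \<mu> x * psi \<mu> x) (at x)"
proof -
  have "continuous_on UNIV (Q \<mu>)" unfolding Q_def by (intro continuous_intros F_cont)
  then obtain u v where "u 0 = 1" "v 0 = 0" "\<And>x. (u has_real_derivative v x) (at x)"
    "\<And>x. (v has_real_derivative x * v x + Q \<mu> x * u x) (at x)"
    using linear_ode_exists by blast
  then have "\<exists>w. fst w 0 = 1 \<and> snd w 0 = 0 \<and>
     (\<forall>x. (fst w has_real_derivative snd w x) (at x)) \<and>
     (\<forall>x. (snd w has_real_derivative x * snd w x + Q \<mu> x * fst w x) (at x))"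
    by (intro exI[of _ "(u, v)"]) auto
  from someI_ex[OF this]
  show "psi \<mu> 0 = 1" "dpsi \<mu> 0 = 0" "(psi \<mu> has_real_derivative dpsi \<mu> x) (at x)"
    "(dpsi \<mu> has_real_derivative x * dpsi \<mu> x + Q \<mu> x * psi \<mu> x) (at x)"
    by (auto simp: psi_def dpsi_def solution_def)
qed

lemma psi_cont: "continuous_on A (psi \<mu>)" "continuous_on A (dpsi \<mu>)"
  using psi_ode(3,4) by (meson DERIV_isCont continuous_at_imp_continuous_on)+

lemma Q_bound: "\<bar>Q \<mu> x\<bar> \<le> 2 * (M + \<bar>\<mu>\<bar>)"
  using F_gt_0[of x] F_le_M[of x] by (simp add: Q_def abs_if)

text \<open>The reflection solves the same initial value problem, and \<open>ode_stability\<close>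
  with e = 0 identifies the two.\<close>

lemma psi_even: "psi \<mu> (- x) = psi \<mu> x"
proof -
  have pos: "psi \<mu> (- x) = psi \<mu> x" if x: "0 \<le> x" for x
  proof -
    have d1: "((\<lambda>x. psi \<mu> (- x)) has_real_derivative - dpsi \<mu> (- x)) (at x)" for x
      using DERIV_chain2[OF psi_ode(3) DERIV_minus[OF DERIV_ident], of \<mu> x] by simp
    have "((\<lambda>x. dpsi \<mu> (- x)) has_real_derivative (- x * dpsi \<mu> (- x) + Q \<mu> (- x) * psi \<mu> (- x)) * (- 1)) (at x)" for x
      using DERIV_chain2[OF psi_ode(4) DERIV_minus[OF DERIV_ident], of \<mu> x] by simp
    from DERIV_minus[OF this]
    have d2: "((\<lambda>x. - dpsi \<mu> (- x)) has_real_derivative x * - dpsi \<mu> (- x) + Q \<mu> x * psi \<mu> (- x)) (at x)" for x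
      by (rule DERIV_cong) (simp add: Q_def F_sym algebra_simps)
    have "compact (psi \<mu> ` {0..x})" by (intro compact_continuous_image psi_cont) simp
    then have "bounded (psi \<mu> ` {0..x})" by (rule compact_imp_bounded)
    then obtain K where K: "\<And>y. y \<in> {0..x} \<Longrightarrow> \<bar>psi \<mu> y\<bar> \<le> K"
      unfolding bounded_iff by (metis imageI real_norm_def)
    have "(psi \<mu> (- x) - psi \<mu> x)\<^sup>2 + (- dpsi \<mu> (- x) - dpsi \<mu> x)\<^sup>2
        \<le> (0 * K)\<^sup>2 * x * exp ((2 + 2 * x + 2 * (M + \<bar>\<mu>\<bar>)) * x)"
      by (rule ode_stability[OF d1 d2 psi_ode(3,4)]) (use psi_ode(1,2) Q_bound K x in auto)
    then have "(psi \<mu> (- x) - psi \<mu> x)\<^sup>2 + (- dpsi \<mu> (- x) - dpsi \<mu> x)\<^sup>2 \<le> 0" by simp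
    then show ?thesis by (simp only: sum_power2_le_zero_iff) simp
  qed
  show ?thesis using pos[of x] pos[of "- x"] by (cases "0 \<le> x") auto
qed

lemma psi_stable:
  assumes "0 < e"
  obtains \<eta> where "0 < \<eta>" "\<And>\<mu> x. \<bar>\<mu> - \<mu>0\<bar> < \<eta> \<Longrightarrow> 0 \<le> x \<Longrightarrow> x \<le> X \<Longrightarrow>
     \<bar>psi \<mu> x - psi \<mu>0 x\<bar> < e \<and> \<bar>dpsi \<mu> x - dpsi \<mu>0 x\<bar> < e"
proof -
  have "compact (psi \<mu>0 ` {0..X})" by (intro compact_continuous_image psi_cont) simp
  then have "bounded (psi \<mu>0 ` {0..X})" by (rule compact_imp_bounded)
  then obtain K where K: "\<And>y. y \<in> {0..X} \<Longrightarrow> \<bar>psi \<mu>0 y\<bar> \<le> K"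
    unfolding bounded_iff by (metis imageI real_norm_def)
  define B where "B = 2 * (M + \<bar>\<mu>0\<bar> + 1)"
  define G where "G = (2 * K)\<^sup>2 * \<bar>X\<bar> * exp ((2 + 2 * X + B) * X)"
  have G0: "0 \<le> G" by (simp add: G_def)
  define \<eta> where "\<eta> = min 1 (e / (G + 1))"
  have \<eta>: "0 < \<eta>" "\<eta> \<le> 1" "\<eta> \<le> e / (G + 1)" using assms G0 by (auto simp: \<eta>_def)
  have \<eta>G: "\<eta> * (G + 1) \<le> e" using \<eta>(3) G0 by (simp add: pos_le_divide_eq)
  have "\<bar>psi \<mu> x - psi \<mu>0 x\<bar> < e \<and> \<bar>dpsi \<mu> x - dpsi \<mu>0 x\<bar> < e"
    if \<mu>: "\<bar>\<mu> - \<mu>0\<bar> < min \<eta> e" and x: "0 \<le> x" "x \<le> X" for \<mu> x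
  proof -
    define m where "m = \<mu> - \<mu>0"
    have QB: "\<bar>Q \<mu> x\<bar> \<le> B" for x
    proof -
      have "\<bar>\<mu>\<bar> \<le> \<bar>\<mu>0\<bar> + 1" using \<mu> \<eta>(2) by arith
      then show ?thesis using Q_bound[of \<mu> x] unfolding B_def by argo
    qed
    have \<mu>m: "\<bar>m\<bar> < min \<eta> e" using \<mu> by (simp add: m_def)
    have "(psi \<mu> x - psi \<mu>0 x)\<^sup>2 + (dpsi \<mu> x - dpsi \<mu>0 x)\<^sup>2
        \<le> (2 * m * K)\<^sup>2 * X * exp ((2 + 2 * X + B) * X)"
      by (rule ode_stability[OF psi_ode(3,4) psi_ode(3,4)]) (use psi_ode(1,2) QB K x in \<open>auto simp: Q_def m_def\<close>)
    also have "\<dots> = m\<^sup>2 * G" using x by (simp add: G_def power_mult_distrib)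
    also have "\<dots> < e\<^sup>2"
    proof (cases "m = 0")
      case False
      have "m\<^sup>2 * G \<le> m\<^sup>2 * (G + 1)" by (intro mult_left_mono) auto
      also have "\<dots> = \<bar>m\<bar> * (\<bar>m\<bar> * (G + 1))" by (simp add: power2_eq_square flip: abs_mult)
      also have "\<dots> \<le> \<bar>m\<bar> * (\<eta> * (G + 1))" using \<mu>m G0 by (intro mult_left_mono mult_right_mono) auto
      also have "\<dots> \<le> \<bar>m\<bar> * e" using \<eta>G by (intro mult_left_mono) auto
      also have "\<dots> < e * e" using \<mu>m assms by (intro mult_strict_right_mono) auto
      finally show ?thesis by (simp add: power2_eq_square)
    qed (use assms in simp)
    finally have s: "(psi \<mu> x - psi \<mu>0 x)\<^sup>2 + (dpsi \<mu> x - dpsi \<mu>0 x)\<^sup>2 < e\<^sup>2" .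
    have "(psi \<mu> x - psi \<mu>0 x)\<^sup>2 < e\<^sup>2" "(dpsi \<mu> x - dpsi \<mu>0 x)\<^sup>2 < e\<^sup>2"
      using s zero_le_power2[of "psi \<mu> x - psi \<mu>0 x"] zero_le_power2[of "dpsi \<mu> x - dpsi \<mu>0 x"] by linarith+
    then have "\<bar>psi \<mu> x - psi \<mu>0 x\<bar>\<^sup>2 < e\<^sup>2" "\<bar>dpsi \<mu> x - dpsi \<mu>0 x\<bar>\<^sup>2 < e\<^sup>2" by simp_all
    from this[THEN power_less_imp_less_base] show ?thesis using assms by simp
  qed
  then show ?thesis using \<eta>(1) assms by (intro that[of "min \<eta> e"]) auto
qed

text \<open>A reversed Gronwall estimate: exp ((1 + B) x) times the squared phase space norm is
  nondecreasing for x \<ge> 0, where the drift term 2 x b^2 has a good sign, and it equals 1 at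
  0.\<close>

lemma psi_no_double_zero:
  assumes "0 \<le> x" "psi \<mu> x = 0"
  shows "dpsi \<mu> x \<noteq> 0"
proof
  assume z: "dpsi \<mu> x = 0"
  define B where "B = 2 * (M + \<bar>\<mu>\<bar>)"
  define E where "E x = (psi \<mu> x)\<^sup>2 + (dpsi \<mu> x)\<^sup>2" for x
  have B0: "0 \<le> B" using F_gt_0[of 0] F_le_M[of 0] by (simp add: B_def)
  have "exp ((1 + B) * 0) * E 0 \<le> exp ((1 + B) * x) * E x"
  proof (rule DERIV_nonneg_imp_nondecreasing[OF assms(1)])
    fix y assume y: "0 \<le> y" "y \<le> x"
    define a b where "a = psi \<mu> y" and "b = dpsi \<mu> y"
    define E' where "E' = 2 * a * b + 2 * b * (y * b + Q \<mu> y * a)"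
    have dE: "(E has_real_derivative E') (at y)"
      unfolding E_def[abs_def] E'_def a_def b_def
      by (auto intro!: derivative_eq_intros psi_ode simp: algebra_simps power2_eq_square)
    have "0 \<le> E' + (1 + B) * E y"
    proof -
      have 1: "- (a\<^sup>2 + b\<^sup>2) \<le> 2 * a * b" using sum_squares_bound[of "- a" b] by simp
      have 2: "0 \<le> 2 * y * b\<^sup>2" using y by simp
      have 3: "- (B * (a\<^sup>2 + b\<^sup>2)) \<le> 2 * b * (Q \<mu> y * a)"
      proof -
        have "- (2 * b * (Q \<mu> y * a)) \<le> \<bar>2 * b * (Q \<mu> y * a)\<bar>" by (rule abs_ge_minus_self)
        also have "\<dots> = \<bar>Q \<mu> y\<bar> * (2 * \<bar>a\<bar> * \<bar>b\<bar>)" by (simp add: abs_mult)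
        also have "\<dots> \<le> B * (a\<^sup>2 + b\<^sup>2)"
          using sum_squares_bound[of "\<bar>a\<bar>" "\<bar>b\<bar>"] Q_bound[of \<mu> y] B0 by (intro mult_mono) (auto simp: B_def)
        finally show ?thesis by linarith
      qed
      have "E' + (1 + B) * E y = (2 * a * b + (a\<^sup>2 + b\<^sup>2)) + 2 * y * b\<^sup>2 + (2 * b * (Q \<mu> y * a) + B * (a\<^sup>2 + b\<^sup>2))"
        by (simp add: E'_def E_def a_def b_def algebra_simps power2_eq_square)
      with 1 2 3 show ?thesis by linarith
    qed
    then have "0 \<le> exp ((1 + B) * y) * (E' + (1 + B) * E y)" by simp
    moreover have "((\<lambda>x. exp ((1 + B) * x) * E x) has_real_derivative exp ((1 + B) * y) * (E' + (1 + B) * E y)) (at y)"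
      by (auto intro!: derivative_eq_intros dE simp: algebra_simps)
    ultimately show "\<exists>D. ((\<lambda>x. exp ((1 + B) * x) * E x) has_real_derivative D) (at y) \<and> 0 \<le> D" by blast
  qed
  then show False using assms z psi_ode(1,2)[of \<mu>] by (simp add: E_def)
qed

end

lemma integrable_exp_abs_gaussian: "integrable lborel (\<lambda>x::real. exp (a * \<bar>x\<bar>) * exp (- x\<^sup>2 / 2))"
proof -
  have "integrable lborel (\<lambda>z. sqrt (2 * pi) * (std_normal_density z * exp (a * \<bar>z\<bar>)))"
    using integrable_gauss_exp_abs[of a] by (subst (asm) integrable_gauss_iff) auto
  moreover have "sqrt (2 * pi) * (std_normal_density z * exp (a * \<bar>z\<bar>)) = exp (a * \<bar>z\<bar>) * exp (- z\<^sup>2 / 2)" for z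
    by (simp add: std_normal_density_def)
  ultimately show ?thesis by simp
qed

section \<open>Sturm comparison and the critical level\<close>

context potential
begin

definition zeros :: "real set" where "zeros = {\<mu>. \<exists>x>0. psi \<mu> x \<le> 0}"

text \<open>The Gaussian weight puts the equation in self-adjoint form, so the first order terms
  cancel in the derivative.\<close>

definition wronskian :: "real \<Rightarrow> real \<Rightarrow> real" where
  "wronskian \<mu> x = exp (- x\<^sup>2 / 2) * (f1 x * psi \<mu> x - f x * dpsi \<mu> x)"

lemma wronskian_0: "wronskian \<mu> 0 = 0"
  by (simp add: wronskian_def f1_0 psi_ode)

lemma wronskian_deriv:
  "(wronskian \<mu> has_real_derivative exp (- x\<^sup>2 / 2) * (f x * psi \<mu> x * (2 * \<mu> - 1 - F x))) (at x)"
proof (rule DERIV_cong)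
  have e: "((\<lambda>x. exp (- x\<^sup>2 / 2)) has_real_derivative - x * exp (- x\<^sup>2 / 2)) (at x)"
    by (auto intro!: derivative_eq_intros)
  show "(wronskian \<mu> has_real_derivative
      (- x * exp (- x\<^sup>2 / 2)) * (f1 x * psi \<mu> x - f x * dpsi \<mu> x) +
      ((f2 x * psi \<mu> x + dpsi \<mu> x * f1 x) - (f1 x * dpsi \<mu> x + (x * dpsi \<mu> x + Q \<mu> x * psi \<mu> x) * f x))
        * exp (- x\<^sup>2 / 2)) (at x)"
    unfolding wronskian_def[abs_def] by (intro DERIV_mult DERIV_diff e df df1 psi_ode)
  show "(- x * exp (- x\<^sup>2 / 2)) * (f1 x * psi \<mu> x - f x * dpsi \<mu> x) +
      ((f2 x * psi \<mu> x + dpsi \<mu> x * f1 x) - (f1 x * dpsi \<mu> x + (x * dpsi \<mu> x + Q \<mu> x * psi \<mu> x) * f x))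
        * exp (- x\<^sup>2 / 2) = exp (- x\<^sup>2 / 2) * (f x * psi \<mu> x * (2 * \<mu> - 1 - F x))"
    unfolding f_ode Q_def by (simp add: algebra_simps)
qed

lemma quotient_deriv:
  "((\<lambda>x. psi \<mu> x / f x) has_real_derivative - wronskian \<mu> x * exp (x\<^sup>2 / 2) / (f x)\<^sup>2) (at x)"
proof (rule DERIV_cong)
  show "((\<lambda>x. psi \<mu> x / f x) has_real_derivative (dpsi \<mu> x * f x - psi \<mu> x * f1 x) / (f x * f x)) (at x)"
    by (intro DERIV_divide psi_ode df) (use f_pos[of x] in simp)
  show "(dpsi \<mu> x * f x - psi \<mu> x * f1 x) / (f x * f x) = - wronskian \<mu> x * exp (x\<^sup>2 / 2) / (f x)\<^sup>2"
  proof -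
    have "exp (- x\<^sup>2 / 2) * exp (x\<^sup>2 / 2) = 1" by (simp flip: exp_add)
    then have "wronskian \<mu> x * exp (x\<^sup>2 / 2) = f1 x * psi \<mu> x - f x * dpsi \<mu> x"
      unfolding wronskian_def by algebra
    then have "- wronskian \<mu> x * exp (x\<^sup>2 / 2) = dpsi \<mu> x * f x - psi \<mu> x * f1 x" by (simp add: algebra_simps)
    then show ?thesis by (simp only: power2_eq_square)
  qed
qed

lemma wronskian_nonpos:
  assumes "\<mu> \<le> 1/2" "0 \<le> y" "\<And>x. 0 \<le> x \<Longrightarrow> x \<le> y \<Longrightarrow> 0 \<le> psi \<mu> x"
  shows "wronskian \<mu> y \<le> 0"
proof -
  have "wronskian \<mu> y \<le> wronskian \<mu> 0"
  proof (rule DERIV_nonpos_imp_nonincreasing[OF assms(2)])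
    fix x assume x: "0 \<le> x" "x \<le> y"
    have "f x * psi \<mu> x * (2 * \<mu> - 1 - F x) \<le> 0"
      using assms(1) assms(3)[OF x] f_pos[of x] F_gt_0[of x] by (intro mult_nonneg_nonpos) auto
    then have "exp (- x\<^sup>2 / 2) * (f x * psi \<mu> x * (2 * \<mu> - 1 - F x)) \<le> 0"
      by (rule mult_nonneg_nonpos[rotated]) simp
    then show "\<exists>D. (wronskian \<mu> has_real_derivative D) (at x) \<and> D \<le> 0" using wronskian_deriv by blast
  qed
  then show ?thesis by (simp add: wronskian_0)
qed

text \<open>For \<mu> \<le> 1/2 the coefficient 2 (F - \<mu>) exceeds the coefficient F - 1 of f. As
  long as psi is nonnegative the Wronskian is nonpositive, so psi / f does not decrease and cannot
  reach 0.\<close>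

lemma psi_pos_half:
  assumes \<mu>: "\<mu> \<le> 1/2" and x: "0 \<le> x"
  shows "0 < psi \<mu> x"
proof (rule ccontr)
  assume "\<not> 0 < psi \<mu> x"
  then have n: "psi \<mu> x \<le> 0" by simp
  then have "0 < x" using x psi_ode(1)[of \<mu>] by (cases "x = 0") auto
  then obtain z where z: "0 < z" "psi \<mu> z = 0" "\<And>y. 0 \<le> y \<Longrightarrow> y < z \<Longrightarrow> 0 < psi \<mu> y"
    using first_zero[OF psi_cont(1), of \<mu> 0 x] n psi_ode(1)[of \<mu>] by auto
  have "psi \<mu> 0 / f 0 \<le> psi \<mu> z / f z"
  proof (rule DERIV_nonneg_imp_nondecreasing[OF less_imp_le[OF z(1)]])
    fix y assume y: "0 \<le> y" "y \<le> z"
    have "0 \<le> psi \<mu> x" if "0 \<le> x" "x \<le> y" for x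
      using z(2) z(3)[of x] that y by (cases "x = z") auto
    then have "wronskian \<mu> y \<le> 0" by (rule wronskian_nonpos[OF \<mu> y(1)])
    then have "0 \<le> - wronskian \<mu> y * exp (y\<^sup>2 / 2) / (f y)\<^sup>2" by (intro divide_nonneg_nonneg mult_nonneg_nonneg) auto
    then show "\<exists>D. ((\<lambda>x. psi \<mu> x / f x) has_real_derivative D) (at y) \<and> 0 \<le> D" using quotient_deriv by blast
  qed
  then show False using z(2) f_pos[of 0] psi_ode(1)[of \<mu>] by (simp add: field_simps)
qed

text \<open>At this level Q \<le> - 2 exp (1/2), while the Gaussian weight is at least exp (- 1/2)
  on [0, 1]. A positive psi would be decreasing with slope at most - 2 psi 1 on [1, 2], so that psi
  2 \<le> - psi 1.\<close>

lemma zeros_nonempty: "M + exp (1/2) \<in> zeros"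
proof (rule ccontr)
  define \<mu> where "\<mu> = M + exp (1/2)"
  assume "M + exp (1/2) \<notin> zeros"
  then have pos0: "0 < psi \<mu> x" if "0 < x" for x using that by (force simp: zeros_def \<mu>_def)
  have pos: "0 < psi \<mu> x" if "0 \<le> x" for x using that pos0[of x] psi_ode(1)[of \<mu>] by (cases "x = 0") auto
  define V where "V x = exp (- x\<^sup>2 / 2) * dpsi \<mu> x" for x
  have dV: "(V has_real_derivative exp (- x\<^sup>2 / 2) * (Q \<mu> x * psi \<mu> x)) (at x)" for x
  proof (rule DERIV_cong)
    have e: "((\<lambda>x. exp (- x\<^sup>2 / 2)) has_real_derivative - x * exp (- x\<^sup>2 / 2)) (at x)"
      by (auto intro!: derivative_eq_intros)
    show "(V has_real_derivative (- x * exp (- x\<^sup>2 / 2)) * dpsi \<mu> x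
        + (x * dpsi \<mu> x + Q \<mu> x * psi \<mu> x) * exp (- x\<^sup>2 / 2)) (at x)"
      unfolding V_def[abs_def] by (intro DERIV_mult e psi_ode)
  qed (simp add: algebra_simps)
  have Qb: "Q \<mu> x \<le> - (2 * exp (1/2))" for x using F_le_M[of x] by (simp add: Q_def \<mu>_def)
  have Qn: "Q \<mu> x \<le> 0" for x by (rule order_trans[OF Qb]) simp
  have Vdec: "V y \<le> V x" if "0 \<le> x" "x \<le> y" for x y
  proof (rule DERIV_nonpos_imp_nonincreasing[OF that(2)])
    fix t assume t: "x \<le> t" "t \<le> y"
    have "Q \<mu> t * psi \<mu> t \<le> 0" using Qn pos[of t] t that by (intro mult_nonpos_nonneg) auto
    then have "exp (- t\<^sup>2 / 2) * (Q \<mu> t * psi \<mu> t) \<le> 0" by (rule mult_nonneg_nonpos[rotated]) simp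
    then show "\<exists>D. (V has_real_derivative D) (at t) \<and> D \<le> 0" using dV by blast
  qed
  have dneg: "dpsi \<mu> x \<le> 0" if "0 \<le> x" for x
    using Vdec[of 0 x] that psi_ode(2)[of \<mu>] by (simp add: V_def mult_le_0_iff)
  have dec: "psi \<mu> y \<le> psi \<mu> x" if "0 \<le> x" "x \<le> y" for x y
    by (rule DERIV_nonpos_imp_nonincreasing[OF that(2)])
       (use psi_ode(3) dneg that in \<open>meson order_trans\<close>)
  have "V 1 + 2 * psi \<mu> 1 * 1 \<le> V 0 + 2 * psi \<mu> 1 * 0"
  proof (rule DERIV_nonpos_imp_nonincreasing[OF zero_le_one])
    fix t :: real assume t: "0 \<le> t" "t \<le> 1"
    have "t\<^sup>2 \<le> 1" using t by (simp add: power_le_one)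
    then have "exp (- (1/2)) \<le> exp (- t\<^sup>2 / 2)" by simp
    then have "exp (- (1/2)) * (2 * exp (1/2) * psi \<mu> 1) \<le> exp (- t\<^sup>2 / 2) * (- Q \<mu> t * psi \<mu> t)"
      using Qb[of t] Qn[of t] dec[of t 1] t pos[of 1] by (intro mult_mono) auto
    moreover have "exp (- (1/2)) * (2 * exp (1/2) * psi \<mu> 1) = 2 * psi \<mu> 1"
      by (simp add: exp_minus)
    ultimately have "2 * psi \<mu> 1 \<le> - (exp (- t\<^sup>2 / 2) * (Q \<mu> t * psi \<mu> t))"
      by (simp only: minus_mult_left mult_minus_right)
    moreover have "((\<lambda>x. V x + 2 * psi \<mu> 1 * x) has_real_derivative
        exp (- t\<^sup>2 / 2) * (Q \<mu> t * psi \<mu> t) + 2 * psi \<mu> 1) (at t)"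
      by (intro DERIV_add dV DERIV_cmult_Id)
    ultimately show "\<exists>D. ((\<lambda>x. V x + 2 * psi \<mu> 1 * x) has_real_derivative D) (at t) \<and> D \<le> 0"
      by (intro exI conjI) auto
  qed
  then have V1: "V 1 \<le> - 2 * psi \<mu> 1" using psi_ode(2)[of \<mu>] by (simp add: V_def)
  have "psi \<mu> 2 + 2 * psi \<mu> 1 * 2 \<le> psi \<mu> 1 + 2 * psi \<mu> 1 * 1"
  proof (rule DERIV_nonpos_imp_nonincreasing[where f = "\<lambda>x. psi \<mu> x + 2 * psi \<mu> 1 * x"])
    fix t :: real assume t: "1 \<le> t" "t \<le> 2"
    have "V t \<le> - 2 * psi \<mu> 1" using Vdec[of 1 t] V1 t by simp
    moreover have "dpsi \<mu> t \<le> V t"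
    proof -
      have "exp (- t\<^sup>2 / 2) * (- dpsi \<mu> t) \<le> 1 * (- dpsi \<mu> t)"
        using dneg[of t] t by (intro mult_right_mono) auto
      then show ?thesis by (simp add: V_def)
    qed
    ultimately have "dpsi \<mu> t + 2 * psi \<mu> 1 \<le> 0" by simp
    moreover have "((\<lambda>x. psi \<mu> x + 2 * psi \<mu> 1 * x) has_real_derivative dpsi \<mu> t + 2 * psi \<mu> 1) (at t)"
      by (intro DERIV_add psi_ode DERIV_cmult_Id)
    ultimately show "\<exists>D. ((\<lambda>x. psi \<mu> x + 2 * psi \<mu> 1 * x) has_real_derivative D) (at t) \<and> D \<le> 0" by blast
  qed simp
  with pos[of 1] pos[of 2] show False by simp
qed

definition mu0 :: real where "mu0 = Inf zeros"

lemma zeros_gt_half: "\<mu> \<in> zeros \<Longrightarrow> 1/2 < \<mu>"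
  using psi_pos_half[of \<mu>] by (force simp: zeros_def not_less[symmetric])

lemma zeros_bdd: "bdd_below zeros"
  using zeros_gt_half by (meson bdd_belowI less_imp_le)

lemma mu0_ge_half: "1/2 \<le> mu0"
  unfolding mu0_def by (rule cInf_greatest) (use zeros_nonempty zeros_gt_half in \<open>auto intro: less_imp_le\<close>)

text \<open>A zero at the critical level would be a genuine sign change, because double zeros are
  excluded. The negative value behind it persists for slightly smaller \<mu>, against the
  infimum.\<close>

lemma psi_pos_right:
  assumes x: "0 \<le> x"
  shows "0 < psi mu0 x"
proof (rule ccontr)
  assume "\<not> 0 < psi mu0 x"
  then have n: "psi mu0 x \<le> 0" by simp
  then have "0 < x" using x psi_ode(1)[of mu0] by (cases "x = 0") auto
  then obtain z where z: "0 < z" "psi mu0 z = 0" "\<And>y. 0 \<le> y \<Longrightarrow> y < z \<Longrightarrow> 0 < psi mu0 y"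
    using first_zero[OF psi_cont(1), of mu0 0 x] n psi_ode(1)[of mu0] by auto
  have "dpsi mu0 z < 0"
  proof (rule ccontr)
    assume "\<not> dpsi mu0 z < 0"
    then have "0 < dpsi mu0 z" using psi_no_double_zero[of z mu0] z by simp
    from DERIV_pos_inc_left[OF psi_ode(3) this] obtain d where
      d: "d > 0" "\<And>h. 0 < h \<Longrightarrow> h < d \<Longrightarrow> psi mu0 (z - h) < psi mu0 z" by auto
    define h where "h = min (d / 2) z"
    have "0 < h" "h < d" "h \<le> z" using d z by (auto simp: h_def)
    with d(2)[of h] z(2) z(3)[of "z - h"] show False by simp
  qed
  from DERIV_neg_dec_right[OF psi_ode(3) this] obtain d where
    d: "d > 0" "\<And>h. 0 < h \<Longrightarrow> h < d \<Longrightarrow> psi mu0 (z + h) < psi mu0 z" by auto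
  define y where "y = z + d / 2"
  have y: "0 < y" "psi mu0 y < 0" using d(2)[of "d / 2"] d(1) z by (auto simp: y_def)
  then have "0 < - psi mu0 y" by simp
  then obtain \<eta> where \<eta>: "0 < \<eta>" "\<And>\<mu> x. \<bar>\<mu> - mu0\<bar> < \<eta> \<Longrightarrow> 0 \<le> x \<Longrightarrow> x \<le> y \<Longrightarrow>
     \<bar>psi \<mu> x - psi mu0 x\<bar> < - psi mu0 y \<and> \<bar>dpsi \<mu> x - dpsi mu0 x\<bar> < - psi mu0 y"
    using psi_stable[of "- psi mu0 y" mu0 y] by blast
  have "psi (mu0 - \<eta> / 2) y < 0" using \<eta>(2)[of "mu0 - \<eta> / 2" y] \<eta>(1) y by auto
  then have "mu0 - \<eta> / 2 \<in> zeros" using y by (auto simp: zeros_def intro!: exI[of _ y] less_imp_le)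
  then have "mu0 \<le> mu0 - \<eta> / 2" unfolding mu0_def by (rule cInf_lower[OF _ zeros_bdd])
  with \<eta>(1) show False by simp
qed

lemma psi_pos: "0 < psi mu0 x"
  using psi_pos_right[of x] psi_pos_right[of "- x"] by (cases "0 \<le> x") (auto simp: psi_even)

text \<open>Faster growth of \<open>\<psi>\<close> would be an open condition in \<open>\<mu>\<close> that prevents the solutions for
  slightly larger \<open>\<mu>\<close> from having a zero.\<close>

lemma psi_growth:
  assumes X: "2 * mu0 + 4 \<le> X"
  shows "dpsi mu0 X \<le> psi mu0 X"
proof (rule ccontr)
  assume "\<not> dpsi mu0 X \<le> psi mu0 X"
  then have k0: "0 < dpsi mu0 X - psi mu0 X" by simp
  have X0: "0 \<le> X" using X mu0_ge_half by simp
  obtain x1 where x1: "x1 \<in> {0..X}" "\<And>x. x \<in> {0..X} \<Longrightarrow> psi mu0 x1 \<le> psi mu0 x"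
    using continuous_attains_inf[of "{0..X}" "psi mu0"] X0 psi_cont by auto
  \<comment> \<open>Small enough that positivity on [0, X] and the strict inequality dpsi > psi at X
    both survive the passage to a nearby level in \<open>zeros\<close>.\<close>
  define e where "e = min (psi mu0 x1) ((dpsi mu0 X - psi mu0 X) / 2)"
  have e: "0 < e" using k0 psi_pos[of x1] by (simp add: e_def)
  obtain \<eta> where \<eta>: "0 < \<eta>" "\<And>\<mu> x. \<bar>\<mu> - mu0\<bar> < \<eta> \<Longrightarrow> 0 \<le> x \<Longrightarrow> x \<le> X \<Longrightarrow>
     \<bar>psi \<mu> x - psi mu0 x\<bar> < e \<and> \<bar>dpsi \<mu> x - dpsi mu0 x\<bar> < e"
    using psi_stable[OF e, of mu0 X] by blast
  obtain \<mu> where \<mu>: "\<mu> \<in> zeros" "\<mu> < mu0 + min \<eta> 1"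
    using cInf_lessD[of zeros "mu0 + min \<eta> 1"] zeros_nonempty \<eta>(1) by (auto simp: mu0_def)
  have "mu0 \<le> \<mu>" unfolding mu0_def by (rule cInf_lower[OF \<mu>(1) zeros_bdd])
  with \<mu>(2) have close: "\<bar>\<mu> - mu0\<bar> < \<eta>" "\<mu> < mu0 + 1" by auto
  have posX: "0 < psi \<mu> x" if "0 \<le> x" "x \<le> X" for x
    using \<eta>(2)[OF close(1) that] x1(2)[of x] that by (auto simp: e_def)
  have kX: "psi \<mu> X < dpsi \<mu> X"
  proof -
    have "\<bar>psi \<mu> X - psi mu0 X\<bar> < (dpsi mu0 X - psi mu0 X) / 2" "\<bar>dpsi \<mu> X - dpsi mu0 X\<bar> < (dpsi mu0 X - psi mu0 X) / 2"
      using \<eta>(2)[OF close(1) X0 order_refl] by (auto simp: e_def)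
    then show ?thesis unfolding abs_less_iff by argo
  qed
  have "0 < psi \<mu> x" if xX: "X < x" for x
  proof (rule ccontr)
    assume "\<not> 0 < psi \<mu> x"
    then have "psi \<mu> x \<le> 0" by simp
    from first_zero[OF psi_cont(1) posX[OF X0 order_refl] this xX]
    obtain z where z: "X < z" "psi \<mu> z = 0" "\<And>y. X \<le> y \<Longrightarrow> y < z \<Longrightarrow> 0 < psi \<mu> y" by blast
    have nn: "0 \<le> psi \<mu> y" if "X \<le> y" "y \<le> z" for y
      using z(2) z(3)[of y] that by (cases "y = z") auto
    have k: "0 < dpsi \<mu> y - psi \<mu> y" if y: "X \<le> y" "y \<le> z" for y
    proof -
      have "exp (- (X\<^sup>2 / 2 - X)) * (dpsi \<mu> X - psi \<mu> X) \<le> exp (- (y\<^sup>2 / 2 - y)) * (dpsi \<mu> y - psi \<mu> y)"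
      proof (rule DERIV_nonneg_imp_nondecreasing[OF y(1)])
        fix t assume t: "X \<le> t" "t \<le> y"
        have "((\<lambda>t. exp (- (t\<^sup>2 / 2 - t)) * (dpsi \<mu> t - psi \<mu> t)) has_real_derivative
            exp (- (t\<^sup>2 / 2 - t)) * ((t - 1 + Q \<mu> t) * psi \<mu> t)) (at t)"
        proof (rule DERIV_cong)
          have e: "((\<lambda>t. exp (- (t\<^sup>2 / 2 - t))) has_real_derivative - (t - 1) * exp (- (t\<^sup>2 / 2 - t))) (at t)"
            by (auto intro!: derivative_eq_intros)
          show "((\<lambda>t. exp (- (t\<^sup>2 / 2 - t)) * (dpsi \<mu> t - psi \<mu> t)) has_real_derivative
            (- (t - 1) * exp (- (t\<^sup>2 / 2 - t))) * (dpsi \<mu> t - psi \<mu> t)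
             + (t * dpsi \<mu> t + Q \<mu> t * psi \<mu> t - dpsi \<mu> t) * exp (- (t\<^sup>2 / 2 - t))) (at t)"
            by (intro DERIV_mult DERIV_diff e psi_ode)
        qed (simp add: algebra_simps)
        \<comment> \<open>The threshold 2 mu0 + 4 makes t - 1 - 2 \<mu> positive for \<mu> < mu0 +
          1. Once dpsi exceeds psi it therefore does so up to any first zero, which is
          impossible.\<close>
        moreover have "0 \<le> t - 1 + Q \<mu> t" using t X close F_gt_0[of t] by (simp add: Q_def)
        then have "0 \<le> exp (- (t\<^sup>2 / 2 - t)) * ((t - 1 + Q \<mu> t) * psi \<mu> t)"
          using nn[of t] t y by simp
        ultimately show "\<exists>D. ((\<lambda>t. exp (- (t\<^sup>2 / 2 - t)) * (dpsi \<mu> t - psi \<mu> t)) has_real_derivative D) (at t) \<and> 0 \<le> D"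
          by blast
      qed
      moreover have "0 < exp (- (X\<^sup>2 / 2 - X)) * (dpsi \<mu> X - psi \<mu> X)" using kX by simp
      ultimately have "0 < exp (- (y\<^sup>2 / 2 - y)) * (dpsi \<mu> y - psi \<mu> y)" by linarith
      then show ?thesis by (simp add: zero_less_mult_iff)
    qed
    have "exp (- X) * psi \<mu> X \<le> exp (- z) * psi \<mu> z"
    proof (rule DERIV_nonneg_imp_nondecreasing[OF less_imp_le[OF z(1)]])
      fix t assume t: "X \<le> t" "t \<le> z"
      have "((\<lambda>t. exp (- t) * psi \<mu> t) has_real_derivative exp (- t) * (dpsi \<mu> t - psi \<mu> t)) (at t)"
        by (auto intro!: derivative_eq_intros psi_ode simp: algebra_simps)
      then show "\<exists>D. ((\<lambda>t. exp (- t) * psi \<mu> t) has_real_derivative D) (at t) \<and> 0 \<le> D"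
        using k[OF t] by (intro exI conjI) auto
    qed
    then show False using z(2) posX[OF X0 order_refl] by (simp add: mult_le_0_iff)
  qed
  with posX have "0 < psi \<mu> x" if "0 < x" for x using that by (cases "x \<le> X") auto
  with \<mu>(1) show False by (force simp: zeros_def)
qed

text \<open>By \<open>psi_growth\<close> exp (- x) psi is nonincreasing beyond a fixed point.
  Exponential growth is square integrable against the Gaussian, which makes the shooting solution an
  eigenfunction.\<close>

lemma psi_le_exp: obtains C where "0 < C" "\<And>x. psi mu0 x \<le> C * exp \<bar>x\<bar>"
proof -
  define X where "X = 2 * mu0 + 4"
  have X0: "0 \<le> X" using mu0_ge_half by (simp add: X_def)
  obtain x1 where x1: "x1 \<in> {0..X}" "\<And>x. x \<in> {0..X} \<Longrightarrow> psi mu0 x \<le> psi mu0 x1"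
    using continuous_attains_sup[of "{0..X}" "psi mu0"] X0 psi_cont by auto
  define C where "C = psi mu0 x1"
  have C0: "0 < C" by (simp add: C_def psi_pos)
  have pos: "psi mu0 x \<le> C * exp x" if x: "0 \<le> x" for x
  proof (cases "x \<le> X")
    case True
    then have "psi mu0 x \<le> C * 1" using x1(2)[of x] x by (simp add: C_def)
    also have "\<dots> \<le> C * exp x" using C0 x by (intro mult_left_mono) auto
    finally show ?thesis .
  next
    case False
    then have "X \<le> x" by simp
    then have "exp (- x) * psi mu0 x \<le> exp (- X) * psi mu0 X"
    proof (rule DERIV_nonpos_imp_nonincreasing)
      fix t assume t: "X \<le> t" "t \<le> x"
      have "((\<lambda>t. exp (- t) * psi mu0 t) has_real_derivative exp (- t) * (dpsi mu0 t - psi mu0 t)) (at t)"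
        by (auto intro!: derivative_eq_intros psi_ode simp: algebra_simps)
      moreover have "exp (- t) * (dpsi mu0 t - psi mu0 t) \<le> 0"
        using psi_growth[of t] t by (intro mult_nonneg_nonpos) (auto simp: X_def)
      ultimately show "\<exists>D. ((\<lambda>t. exp (- t) * psi mu0 t) has_real_derivative D) (at t) \<and> D \<le> 0" by blast
    qed
    also have "\<dots> \<le> 1 * C" using x1(2)[of X] X0 psi_pos[of X] by (intro mult_mono) (auto simp: C_def)
    finally show ?thesis by (simp add: exp_minus field_simps)
  qed
  have "psi mu0 x \<le> C * exp \<bar>x\<bar>" for x
    using pos[of x] pos[of "- x"] by (cases "0 \<le> x") (auto simp: psi_even)
  with C0 show ?thesis by (rule that)
qed

lemma psi_square_integrable: "integrable lborel (\<lambda>x. (psi mu0 x)\<^sup>2 * exp (- x\<^sup>2 / 2))"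
proof -
  obtain C where C: "0 < C" "\<And>x. psi mu0 x \<le> C * exp \<bar>x\<bar>" using psi_le_exp by blast
  show ?thesis
  proof (rule Bochner_Integration.integrable_bound)
    show "integrable lborel (\<lambda>x. C\<^sup>2 * (exp (2 * \<bar>x\<bar>) * exp (- x\<^sup>2 / 2)))"
      by (intro integrable_mult_right integrable_exp_abs_gaussian)
    have "continuous_on UNIV (\<lambda>x. (psi mu0 x)\<^sup>2 * exp (- x\<^sup>2 / 2))"
      by (intro continuous_intros psi_cont) auto
    then show "(\<lambda>x. (psi mu0 x)\<^sup>2 * exp (- x\<^sup>2 / 2)) \<in> borel_measurable lborel"
      using borel_measurable_continuous_onI by auto
    show "AE x in lborel. norm ((psi mu0 x)\<^sup>2 * exp (- x\<^sup>2 / 2)) \<le> norm (C\<^sup>2 * (exp (2 * \<bar>x\<bar>) * exp (- x\<^sup>2 / 2)))"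
    proof (rule AE_I2)
      fix x
      have "(psi mu0 x)\<^sup>2 \<le> (C * exp \<bar>x\<bar>)\<^sup>2" using C(2) psi_pos[of x] by (intro power_mono) auto
      also have "\<dots> = C\<^sup>2 * exp (2 * \<bar>x\<bar>)" by (simp add: power_mult_distrib exp_double [symmetric])
      finally have "(psi mu0 x)\<^sup>2 * exp (- x\<^sup>2 / 2) \<le> C\<^sup>2 * exp (2 * \<bar>x\<bar>) * exp (- x\<^sup>2 / 2)"
        by (intro mult_right_mono) auto
      then show "norm ((psi mu0 x)\<^sup>2 * exp (- x\<^sup>2 / 2)) \<le> norm (C\<^sup>2 * (exp (2 * \<bar>x\<bar>) * exp (- x\<^sup>2 / 2)))"
        by (simp add: mult.assoc)
    qed
  qed
qed

text \<open>At level 1/2 the Wronskian with f would decrease strictly from 0 and stay below some -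
  \<delta>. Then psi / f has slope at least \<delta> / (p f^2), and
  \<open>not_square_integrable\<close> contradicts the integrability of psi. The strict positivity
  of F is what separates the levels.\<close>

lemma mu0_gt_half: "1/2 < mu0"
proof (rule ccontr)
  assume "\<not> 1/2 < mu0"
  then have \<mu>: "mu0 = 1/2" using mu0_ge_half by simp
  define \<delta> where "\<delta> = - wronskian mu0 1"
  have d: "(wronskian mu0 has_real_derivative - (exp (- x\<^sup>2 / 2) * (f x * psi mu0 x * F x))) (at x)" for x
    by (rule DERIV_cong[OF wronskian_deriv]) (simp only: \<mu> mult_1_right, simp)
  have neg: "- (exp (- x\<^sup>2 / 2) * (f x * psi mu0 x * F x)) < 0" for x
    using f_pos F_gt_0 psi_pos by simp
  have "wronskian mu0 1 < wronskian mu0 0"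
    by (rule DERIV_neg_imp_decreasing[OF zero_less_one]) (use d neg in blast)
  then have \<delta>: "0 < \<delta>" by (simp add: \<delta>_def wronskian_0)
  have W: "wronskian mu0 x \<le> - \<delta>" if "1 \<le> x" for x
    unfolding \<delta>_def minus_minus
    by (rule DERIV_nonpos_imp_nonincreasing[OF that]) (use d neg in \<open>meson less_imp_le\<close>)
  show False
  proof (rule not_square_integrable[where X = 1 and w = "\<lambda>x. psi mu0 x / f x" and g = "\<lambda>x. exp (- x\<^sup>2 / 2) * (f x)\<^sup>2"
        and \<delta> = \<delta> and h = "\<lambda>x. (psi mu0 x)\<^sup>2 * exp (- x\<^sup>2 / 2)"
        and w' = "\<lambda>x. - wronskian mu0 x * exp (x\<^sup>2 / 2) / (f x)\<^sup>2"])
    fix x :: real assume x: "1 \<le> x"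
    have "\<delta> / (exp (- x\<^sup>2 / 2) * (f x)\<^sup>2) = \<delta> * exp (x\<^sup>2 / 2) / (f x)\<^sup>2"
      by (simp add: exp_minus field_simps)
    also have "\<dots> \<le> - wronskian mu0 x * exp (x\<^sup>2 / 2) / (f x)\<^sup>2"
      using W[OF x] by (intro divide_right_mono mult_right_mono) auto
    finally show "\<delta> / (exp (- x\<^sup>2 / 2) * (f x)\<^sup>2) \<le> - wronskian mu0 x * exp (x\<^sup>2 / 2) / (f x)\<^sup>2" .
    show "(psi mu0 x)\<^sup>2 * exp (- x\<^sup>2 / 2) = exp (- x\<^sup>2 / 2) * (f x)\<^sup>2 * (psi mu0 x / f x)\<^sup>2"
      using f_pos[of x] by (simp add: power_divide)
  next
    show "continuous_on UNIV (\<lambda>x. (psi mu0 x)\<^sup>2 * exp (- x\<^sup>2 / 2))"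
      by (intro continuous_intros psi_cont) auto
  qed (use quotient_deriv psi_pos f_pos \<delta> psi_square_integrable in \<open>auto simp: zero_less_divide_iff less_imp_neq[THEN not_sym]\<close>)
qed

text \<open>An eigenvalue below \<open>\<mu>\<^sub>0\<close> is excluded by \<open>not_square_integrable\<close> applied to the quotient of
  the eigenfunction by the ground state, on the half line where the quotient and its flux agree in sign.\<close>

definition eigenfunction :: "real \<Rightarrow> (real \<Rightarrow> real) \<Rightarrow> (real \<Rightarrow> real) \<Rightarrow> bool" where
  "eigenfunction \<mu> \<phi> \<phi>' \<longleftrightarrow> (\<forall>x. (\<phi> has_real_derivative \<phi>' x) (at x)) \<and>
     (\<forall>x. (\<phi>' has_real_derivative x * \<phi>' x + Q \<mu> x * \<phi> x) (at x)) \<and>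
     integrable lborel (\<lambda>x. (\<phi> x)\<^sup>2 * exp (- x\<^sup>2 / 2))"

definition flux :: "(real \<Rightarrow> real) \<Rightarrow> (real \<Rightarrow> real) \<Rightarrow> real \<Rightarrow> real" where
  "flux \<phi> \<phi>' x = exp (- x\<^sup>2 / 2) * (\<phi>' x * psi mu0 x - \<phi> x * dpsi mu0 x)"

lemma flux_deriv:
  assumes "eigenfunction \<mu> \<phi> \<phi>'"
  shows "(flux \<phi> \<phi>' has_real_derivative exp (- x\<^sup>2 / 2) * (2 * (mu0 - \<mu>) * \<phi> x * psi mu0 x)) (at x)"
proof (rule DERIV_cong)
  have d: "(\<phi> has_real_derivative \<phi>' x) (at x)" "(\<phi>' has_real_derivative x * \<phi>' x + Q \<mu> x * \<phi> x) (at x)"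
    using assms by (auto simp: eigenfunction_def)
  have e: "((\<lambda>x. exp (- x\<^sup>2 / 2)) has_real_derivative - x * exp (- x\<^sup>2 / 2)) (at x)"
    by (auto intro!: derivative_eq_intros)
  show "(flux \<phi> \<phi>' has_real_derivative (- x * exp (- x\<^sup>2 / 2)) * (\<phi>' x * psi mu0 x - \<phi> x * dpsi mu0 x)
      + (((x * \<phi>' x + Q \<mu> x * \<phi> x) * psi mu0 x + dpsi mu0 x * \<phi>' x)
        - (\<phi>' x * dpsi mu0 x + (x * dpsi mu0 x + Q mu0 x * psi mu0 x) * \<phi> x)) * exp (- x\<^sup>2 / 2)) (at x)"
    unfolding flux_def[abs_def] by (intro DERIV_mult DERIV_diff e d psi_ode)
qed (simp add: Q_def algebra_simps)

lemma flux_quotient_deriv: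
  assumes "eigenfunction \<mu> \<phi> \<phi>'"
  shows "((\<lambda>x. \<phi> x / psi mu0 x) has_real_derivative flux \<phi> \<phi>' x / (exp (- x\<^sup>2 / 2) * (psi mu0 x)\<^sup>2)) (at x)"
proof (rule DERIV_cong)
  show "((\<lambda>x. \<phi> x / psi mu0 x) has_real_derivative
      (\<phi>' x * psi mu0 x - \<phi> x * dpsi mu0 x) / (psi mu0 x * psi mu0 x)) (at x)"
    by (intro DERIV_divide psi_ode) (use assms psi_pos[of x] in \<open>auto simp: eigenfunction_def\<close>)
qed (simp add: flux_def power2_eq_square)

text \<open>While \<phi> is nonnegative its flux does not decrease, and a positive flux makes \<phi>
  / psi increase. Both signs thus propagate to all x \<ge> a, where
  \<open>not_square_integrable\<close> applies.\<close>

lemma no_growing_eigenfunction: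
  assumes E: "eigenfunction \<mu> \<phi> \<phi>'" and \<mu>: "\<mu> < mu0" and p: "0 < \<phi> a" and q: "0 < flux \<phi> \<phi>' a"
  shows False
proof -
  have c: "continuous_on UNIV \<phi>"
    using E unfolding eigenfunction_def by (meson DERIV_isCont continuous_at_imp_continuous_on)
  have mono: "flux \<phi> \<phi>' a \<le> flux \<phi> \<phi>' y" if "a \<le> y" "\<And>x. a \<le> x \<Longrightarrow> x \<le> y \<Longrightarrow> 0 \<le> \<phi> x" for y
  proof (rule DERIV_nonneg_imp_nondecreasing[OF that(1)])
    fix x assume x: "a \<le> x" "x \<le> y"
    have "0 \<le> exp (- x\<^sup>2 / 2) * (2 * (mu0 - \<mu>) * \<phi> x * psi mu0 x)"
      using that(2)[OF x] \<mu> psi_pos[of x] by simp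
    then show "\<exists>D. (flux \<phi> \<phi>' has_real_derivative D) (at x) \<and> 0 \<le> D" using flux_deriv[OF E] by blast
  qed
  have pos: "0 < \<phi> x" if xa: "a \<le> x" for x
  proof (rule ccontr)
    assume "\<not> 0 < \<phi> x"
    then have "\<phi> x \<le> 0" "a < x" using p xa by (auto simp: less_le)
    from first_zero[OF c p this] obtain z where
      z: "a < z" "\<phi> z = 0" "\<And>y. a \<le> y \<Longrightarrow> y < z \<Longrightarrow> 0 < \<phi> y" by blast
    have nn: "0 \<le> \<phi> y" if "a \<le> y" "y \<le> z" for y using z(2) z(3)[of y] that by (cases "y = z") auto
    have "\<phi> a / psi mu0 a \<le> \<phi> z / psi mu0 z"
    proof (rule DERIV_nonneg_imp_nondecreasing[OF less_imp_le[OF z(1)]])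
      fix y assume y: "a \<le> y" "y \<le> z"
      have "flux \<phi> \<phi>' a \<le> flux \<phi> \<phi>' y" by (rule mono[OF y(1)]) (use nn y in auto)
      then have "0 \<le> flux \<phi> \<phi>' y / (exp (- y\<^sup>2 / 2) * (psi mu0 y)\<^sup>2)" using q by simp
      then show "\<exists>D. ((\<lambda>x. \<phi> x / psi mu0 x) has_real_derivative D) (at y) \<and> 0 \<le> D"
        using flux_quotient_deriv[OF E] by blast
    qed
    moreover have "0 < \<phi> a / psi mu0 a" using p psi_pos[of a] by simp
    ultimately show False using z(2) by simp
  qed
  show False
  proof (rule not_square_integrable[where X = a and w = "\<lambda>x. \<phi> x / psi mu0 x"
        and g = "\<lambda>x. exp (- x\<^sup>2 / 2) * (psi mu0 x)\<^sup>2" and \<delta> = "flux \<phi> \<phi>' a"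
        and h = "\<lambda>x. (\<phi> x)\<^sup>2 * exp (- x\<^sup>2 / 2)"
        and w' = "\<lambda>x. flux \<phi> \<phi>' x / (exp (- x\<^sup>2 / 2) * (psi mu0 x)\<^sup>2)"])
    fix x assume x: "a \<le> x"
    have "flux \<phi> \<phi>' a \<le> flux \<phi> \<phi>' x" by (rule mono[OF x]) (use pos in \<open>auto intro: less_imp_le\<close>)
    then show "flux \<phi> \<phi>' a / (exp (- x\<^sup>2 / 2) * (psi mu0 x)\<^sup>2) \<le> flux \<phi> \<phi>' x / (exp (- x\<^sup>2 / 2) * (psi mu0 x)\<^sup>2)"
      by (intro divide_right_mono) auto
    show "0 < \<phi> x / psi mu0 x" using pos[OF x] psi_pos[of x] by simp
    show "0 < exp (- x\<^sup>2 / 2) * (psi mu0 x)\<^sup>2" using psi_pos[of x] by simp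
    show "(\<phi> x)\<^sup>2 * exp (- x\<^sup>2 / 2) = exp (- x\<^sup>2 / 2) * (psi mu0 x)\<^sup>2 * (\<phi> x / psi mu0 x)\<^sup>2"
      using psi_pos[of x] by (simp add: power_divide)
    show "((\<lambda>x. \<phi> x / psi mu0 x) has_real_derivative flux \<phi> \<phi>' x / (exp (- x\<^sup>2 / 2) * (psi mu0 x)\<^sup>2)) (at x)"
      by (rule flux_quotient_deriv[OF E])
  next
    show "continuous_on UNIV (\<lambda>x. (\<phi> x)\<^sup>2 * exp (- x\<^sup>2 / 2))" by (intro continuous_intros c) auto
    show "integrable lborel (\<lambda>x. (\<phi> x)\<^sup>2 * exp (- x\<^sup>2 / 2))" using E by (simp add: eigenfunction_def)
  qed (use q in auto)
qed

section \<open>Symmetries of eigenfunctions and minimality of the critical level\<close>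

lemma dpsi_odd: "dpsi \<mu> (- x) = - dpsi \<mu> x"
proof -
  have "((\<lambda>x. psi \<mu> (- x)) has_real_derivative dpsi \<mu> (- x) * (- 1)) (at x)"
    by (rule DERIV_chain2[OF psi_ode(3)]) (auto intro!: derivative_eq_intros)
  then have "(psi \<mu> has_real_derivative - dpsi \<mu> (- x)) (at x)" by (simp add: psi_even)
  from DERIV_unique[OF this psi_ode(3)] show ?thesis by simp
qed

lemma eigenfunction_minus: "eigenfunction \<mu> \<phi> \<phi>' \<Longrightarrow> eigenfunction \<mu> (\<lambda>x. - \<phi> x) (\<lambda>x. - \<phi>' x)"
proof -
  assume E: "eigenfunction \<mu> \<phi> \<phi>'"
  then have d: "(\<phi> has_real_derivative \<phi>' x) (at x)" "(\<phi>' has_real_derivative x * \<phi>' x + Q \<mu> x * \<phi> x) (at x)" for x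
    by (auto simp: eigenfunction_def)
  have "((\<lambda>x. - \<phi>' x) has_real_derivative x * - \<phi>' x + Q \<mu> x * - \<phi> x) (at x)" for x
    by (rule DERIV_cong[OF DERIV_minus[OF d(2)]]) simp
  with E DERIV_minus[OF d(1)] show ?thesis by (simp add: eigenfunction_def)
qed

lemma eigenfunction_reflect:
  assumes E: "eigenfunction \<mu> \<phi> \<phi>'"
  shows "eigenfunction \<mu> (\<lambda>x. \<phi> (- x)) (\<lambda>x. - \<phi>' (- x))"
proof -
  have d: "(\<phi> has_real_derivative \<phi>' x) (at x)" "(\<phi>' has_real_derivative x * \<phi>' x + Q \<mu> x * \<phi> x) (at x)" for x
    using E by (auto simp: eigenfunction_def)
  have m: "((\<lambda>x. - x) has_real_derivative - 1) (at x)" for x :: real by (auto intro!: derivative_eq_intros)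
  have "((\<lambda>x. - \<phi>' (- x)) has_real_derivative x * - \<phi>' (- x) + Q \<mu> x * \<phi> (- x)) (at x)" for x
    by (rule DERIV_cong[OF DERIV_minus[OF DERIV_chain2[OF d(2) m]]]) (simp add: Q_def F_sym)
  moreover have "((\<lambda>x. \<phi> (- x)) has_real_derivative - \<phi>' (- x)) (at x)" for x
    by (rule DERIV_cong[OF DERIV_chain2[OF d(1) m]]) simp
  moreover have "integrable lborel (\<lambda>x. (\<phi> (- x))\<^sup>2 * exp (- x\<^sup>2 / 2))"
    using lborel_integrable_real_affine[of "\<lambda>x. (\<phi> x)\<^sup>2 * exp (- x\<^sup>2 / 2)" "-1" 0] E by (simp add: eigenfunction_def)
  ultimately show ?thesis by (simp add: eigenfunction_def)
qed

text \<open>Below the critical level flux times \<phi> cannot be positive anywhere; changing the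
  sign of \<phi> covers negative values. Reflection reverses the flux, so the product vanishes
  identically.\<close>

lemma eigenvalue_ge_mu0:
  assumes E: "eigenfunction \<mu> \<phi> \<phi>'" and nz: "\<phi> x0 \<noteq> 0"
  shows "mu0 \<le> \<mu>"
proof (rule ccontr)
  assume "\<not> mu0 \<le> \<mu>"
  then have \<mu>: "\<mu> < mu0" by simp
  have nonpos: "flux \<phi> \<phi>' x * \<phi> x \<le> 0" if E: "eigenfunction \<mu> \<phi> \<phi>'" for \<phi> \<phi>' x
  proof (rule ccontr)
    assume "\<not> flux \<phi> \<phi>' x * \<phi> x \<le> 0"
    then consider "0 < \<phi> x" "0 < flux \<phi> \<phi>' x" | "\<phi> x < 0" "flux \<phi> \<phi>' x < 0"
      by (auto simp: not_le zero_less_mult_iff)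
    then show False
    proof cases
      case 1
      then show False by (rule no_growing_eigenfunction[OF E \<mu>])
    next
      case 2
      have "flux (\<lambda>x. - \<phi> x) (\<lambda>x. - \<phi>' x) x = - flux \<phi> \<phi>' x" by (simp add: flux_def algebra_simps)
      with 2 show False
        using no_growing_eigenfunction[OF eigenfunction_minus[OF E] \<mu>, of x] by simp
    qed
  qed
  have zero: "flux \<phi> \<phi>' x * \<phi> x = 0" for x
  proof -
    have "flux (\<lambda>x. \<phi> (- x)) (\<lambda>x. - \<phi>' (- x)) (- x) = - flux \<phi> \<phi>' x"
      by (simp add: flux_def dpsi_odd psi_even algebra_simps)
    with nonpos[OF eigenfunction_reflect[OF E], of "- x"] nonpos[OF E, of x] show ?thesis by simp
  qed
  \<comment> \<open>The function is constantly 0, yet its derivative is 2 (mu0 - \<mu>) p \<phi>^2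
    plus a nonnegative term, which is positive at x0.\<close>
  have "((\<lambda>x. flux \<phi> \<phi>' x * (\<phi> x / psi mu0 x)) has_real_derivative
      exp (- x0\<^sup>2 / 2) * (2 * (mu0 - \<mu>) * \<phi> x0 * psi mu0 x0) * (\<phi> x0 / psi mu0 x0)
      + flux \<phi> \<phi>' x0 / (exp (- x0\<^sup>2 / 2) * (psi mu0 x0)\<^sup>2) * flux \<phi> \<phi>' x0) (at x0)"
    by (intro DERIV_mult flux_deriv[OF E] flux_quotient_deriv[OF E])
  moreover have "(\<lambda>x. flux \<phi> \<phi>' x * (\<phi> x / psi mu0 x)) = (\<lambda>x. 0)"
    using zero by (auto simp: fun_eq_iff)
  ultimately have "((\<lambda>x. 0) has_real_derivative
      exp (- x0\<^sup>2 / 2) * (2 * (mu0 - \<mu>) * \<phi> x0 * psi mu0 x0) * (\<phi> x0 / psi mu0 x0)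
      + flux \<phi> \<phi>' x0 / (exp (- x0\<^sup>2 / 2) * (psi mu0 x0)\<^sup>2) * flux \<phi> \<phi>' x0) (at x0)"
    by (simp only:)
  from DERIV_unique[OF this DERIV_const]
  have "exp (- x0\<^sup>2 / 2) * (2 * (mu0 - \<mu>) * \<phi> x0 * psi mu0 x0) * (\<phi> x0 / psi mu0 x0)
      + flux \<phi> \<phi>' x0 / (exp (- x0\<^sup>2 / 2) * (psi mu0 x0)\<^sup>2) * flux \<phi> \<phi>' x0 = 0" .
  moreover have "0 < exp (- x0\<^sup>2 / 2) * (2 * (mu0 - \<mu>) * \<phi> x0 * psi mu0 x0) * (\<phi> x0 / psi mu0 x0)"
  proof -
    have "exp (- x0\<^sup>2 / 2) * (2 * (mu0 - \<mu>) * \<phi> x0 * psi mu0 x0) * (\<phi> x0 / psi mu0 x0)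
        = exp (- x0\<^sup>2 / 2) * (2 * (mu0 - \<mu>)) * (\<phi> x0)\<^sup>2"
      using psi_pos[of x0] by (simp add: power2_eq_square)
    then show ?thesis using \<mu> nz by simp
  qed
  moreover have "0 \<le> flux \<phi> \<phi>' x0 / (exp (- x0\<^sup>2 / 2) * (psi mu0 x0)\<^sup>2) * flux \<phi> \<phi>' x0"
    by (simp add: zero_le_mult_iff)
  ultimately show False by linarith
qed

lemma ground_state: "eigenfunction mu0 (psi mu0) (dpsi mu0)"
  using psi_ode psi_square_integrable by (simp add: eigenfunction_def)

end

section \<open>Exponential convergence to the stationary profile\<close>

context selfsimilar
begin

text \<open>Dini's theorem: the sets where the deficit is below e are open and increase with s, so
  finitely many cover the compact interval.\<close>

lemma N_uniform_limit:
  assumes e: "0 < e"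
  obtains s0 where "\<And>y. \<bar>y\<bar> \<le> Y \<Longrightarrow> F y - N s0 y < e"
proof -
  define T where "T s = {y. F y - N s y < e}" for s
  have "open (T s)" for s
    unfolding T_def
    by (intro open_Collect_less continuous_intros F_continuous N_space_cont)
  moreover have "\<exists>s. y \<in> T s" for y
  proof -
    have "\<forall>\<^sub>F s in at_top. F y - e < N s y" using order_tendstoD(1)[OF N_tendsto_F, of "F y - e" y] e by simp
    then obtain s where "F y - e < N s y" unfolding eventually_at_top_linorder by blast
    then have "y \<in> T s" by (simp add: T_def)
    then show ?thesis ..
  qed
  then have "{- Y..Y} \<subseteq> (\<Union>s\<in>UNIV. T s)" by blast
  ultimately obtain C where C: "finite C" "{- Y..Y} \<subseteq> (\<Union>s\<in>C. T s)"
    using compactE_image[of "{- Y..Y}" UNIV T] by auto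
  obtain s0 where s0: "\<And>s. s \<in> C \<Longrightarrow> s \<le> s0"
    using bdd_above_finite[OF C(1)] by (auto simp: bdd_above_def)
  show ?thesis
  proof (rule that)
    fix y assume "\<bar>y\<bar> \<le> Y"
    then have "y \<in> {- Y..Y}" by auto
    then obtain s where "s \<in> C" "y \<in> T s" using C(2) by blast
    then show "F y - N s0 y < e" using N_mono[OF s0, of s y] by (simp add: T_def)
  qed
qed

text \<open>Doubling the eigenvalue equation puts it into the form used for shooting, and continuity
  of the second derivative follows from the equation. Hence the infimum of \<open>eigvals_LF\<close>
  is a minimum, attained at the critical level.\<close>

lemma lambda0_ground_state:
  obtains \<psi> \<psi>' C where
    "\<And>x. (\<psi> has_real_derivative \<psi>' x) (at x)"
    "\<And>x. (\<psi>' has_real_derivative x * \<psi>' x + 2 * (F x - lambda0) * \<psi> x) (at x)"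
    "\<And>x. 0 < \<psi> x" "0 < C" "\<And>x. \<psi> x \<le> C * exp \<bar>x\<bar>" "1/2 < lambda0"
proof -
  obtain F1 F2 where dF: "\<And>y. (F has_real_derivative F1 y) (at y)" and dF1: "\<And>y. (F1 has_real_derivative F2 y) (at y)"
    and F2: "\<And>y. F2 y = - 2 * F y - y * F1 y + (F y)\<^sup>2"
    using F_ode by blast
  have "((\<lambda>y. F (- y)) has_real_derivative F1 (- 0) * (- 1)) (at 0)"
    by (rule DERIV_chain2[OF dF]) (auto intro!: derivative_eq_intros)
  then have "(F has_real_derivative - F1 0) (at 0)" by (simp add: F_even)
  from DERIV_unique[OF this dF] have F10: "F1 0 = 0" by simp
  have de: "((\<lambda>y. exp (y\<^sup>2 / 2)) has_real_derivative y * exp (y\<^sup>2 / 2)) (at y)" for y :: real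
    by (auto intro!: derivative_eq_intros)
  interpret P: potential F "\<lambda>y. F y * exp (y\<^sup>2 / 2)" "\<lambda>y. (F1 y + y * F y) * exp (y\<^sup>2 / 2)"
    "\<lambda>y. (F2 y + 2 * y * F1 y + (1 + y\<^sup>2) * F y) * exp (y\<^sup>2 / 2)" Kbar
  proof
    show "F x \<le> Kbar" for x using F_le_barrier[of x] barrier_le[of x] by (simp add: Kbar_def)
    show "((\<lambda>y. F y * exp (y\<^sup>2 / 2)) has_real_derivative (F1 x + x * F x) * exp (x\<^sup>2 / 2)) (at x)" for x
      by (rule DERIV_cong[OF DERIV_mult[OF dF de]]) (simp add: algebra_simps)
    show "((\<lambda>y. (F1 y + y * F y) * exp (y\<^sup>2 / 2)) has_real_derivative
        (F2 x + 2 * x * F1 x + (1 + x\<^sup>2) * F x) * exp (x\<^sup>2 / 2)) (at x)" for x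
      by (rule DERIV_cong[OF DERIV_mult[OF DERIV_add[OF dF1 DERIV_mult[OF DERIV_ident dF]] de]])
         (simp add: algebra_simps power2_eq_square)
    show "(F2 x + 2 * x * F1 x + (1 + x\<^sup>2) * F x) * exp (x\<^sup>2 / 2)
       = x * ((F1 x + x * F x) * exp (x\<^sup>2 / 2)) + (F x - 1) * (F x * exp (x\<^sup>2 / 2))" for x
      unfolding F2[of x] by (simp add: algebra_simps power2_eq_square)
    show "(F1 0 + 0 * F 0) * exp (0\<^sup>2 / 2) = 0" by (simp add: F10)
  qed (simp_all add: F_continuous F_even F_pos)
  have eigvals: "\<mu> \<in> eigvals_LF \<longleftrightarrow> (\<exists>\<phi> \<phi>'. P.eigenfunction \<mu> \<phi> \<phi>' \<and> (\<exists>x. \<phi> x \<noteq> 0))" for \<mu>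
  proof
    assume "\<mu> \<in> eigvals_LF"
    then obtain \<phi> \<phi>' \<phi>'' where e: "\<And>x. (\<phi> has_real_derivative \<phi>' x) (at x)"
        "\<And>x. (\<phi>' has_real_derivative \<phi>'' x) (at x)"
        "integrable lborel (\<lambda>x. (\<phi> x)\<^sup>2 * exp (- x\<^sup>2 / 2))" "\<exists>x. \<phi> x \<noteq> 0"
        "\<And>x. \<phi>'' x / 2 - x / 2 * \<phi>' x - F x * \<phi> x = - \<mu> * \<phi> x"
      unfolding eigvals_LF_def Fpot_eq by blast
    have eq: "\<phi>'' x = x * \<phi>' x + P.Q \<mu> x * \<phi> x" for x
      using e(5)[of x] by (simp add: P.Q_def algebra_simps)
    have "(\<phi>' has_real_derivative x * \<phi>' x + P.Q \<mu> x * \<phi> x) (at x)" for x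
      using e(2)[of x] unfolding eq .
    then have "P.eigenfunction \<mu> \<phi> \<phi>'" using e(1,3) by (simp add: P.eigenfunction_def)
    then show "\<exists>\<phi> \<phi>'. P.eigenfunction \<mu> \<phi> \<phi>' \<and> (\<exists>x. \<phi> x \<noteq> 0)" using e(4) by blast
  next
    assume "\<exists>\<phi> \<phi>'. P.eigenfunction \<mu> \<phi> \<phi>' \<and> (\<exists>x. \<phi> x \<noteq> 0)"
    then obtain \<phi> \<phi>' where e: "\<And>x. (\<phi> has_real_derivative \<phi>' x) (at x)"
        "\<And>x. (\<phi>' has_real_derivative x * \<phi>' x + P.Q \<mu> x * \<phi> x) (at x)"
        "integrable lborel (\<lambda>x. (\<phi> x)\<^sup>2 * exp (- x\<^sup>2 / 2))" "\<exists>x. \<phi> x \<noteq> 0"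
      by (auto simp: P.eigenfunction_def)
    have c: "continuous_on UNIV \<phi>" "continuous_on UNIV \<phi>'"
      using e(1,2) by (meson DERIV_isCont continuous_at_imp_continuous_on)+
    have "continuous_on UNIV (\<lambda>x. x * \<phi>' x + P.Q \<mu> x * \<phi> x)"
      unfolding P.Q_def by (intro continuous_intros c F_continuous)
    moreover have "(x * \<phi>' x + P.Q \<mu> x * \<phi> x) / 2 - x / 2 * \<phi>' x - F x * \<phi> x = - \<mu> * \<phi> x" for x
      by (simp add: P.Q_def field_simps)
    ultimately show "\<mu> \<in> eigvals_LF"
      unfolding eigvals_LF_def Fpot_eq mem_Collect_eq using e
      by (intro exI[of _ \<phi>] exI[of _ \<phi>'] exI[of _ "\<lambda>x. x * \<phi>' x + P.Q \<mu> x * \<phi> x"]) blast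
  qed
  have l0: "lambda0 = P.mu0"
    unfolding lambda0_def
  proof (rule cInf_eq_minimum)
    show "P.mu0 \<in> eigvals_LF"
    proof (unfold eigvals, intro exI conjI)
      show "P.eigenfunction P.mu0 (P.psi P.mu0) (P.dpsi P.mu0)" by (rule P.ground_state)
      show "P.psi P.mu0 0 \<noteq> 0" by (simp add: P.psi_ode(1))
    qed
    show "P.mu0 \<le> \<mu>" if "\<mu> \<in> eigvals_LF" for \<mu>
      using that unfolding eigvals by (elim exE conjE) (rule P.eigenvalue_ge_mu0)
  qed
  obtain C where C: "0 < C" "\<And>x. P.psi P.mu0 x \<le> C * exp \<bar>x\<bar>" using P.psi_le_exp by blast
  have d: "(P.dpsi P.mu0 has_real_derivative x * P.dpsi P.mu0 x + 2 * (F x - lambda0) * P.psi P.mu0 x) (at x)" for x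
    using P.psi_ode(4)[of P.mu0 x] unfolding P.Q_def l0 .
  show ?thesis
    by (rule that[OF P.psi_ode(3) d P.psi_pos C]) (use P.mu0_gt_half l0 in simp)
qed

text \<open>With D = F - N one has F^2 / 2 - N^2 / 2 = F D - D^2 / 2, so linearisation at F produces
  the potential F and a quadratic remainder of positive sign.\<close>

lemma deficit_deriv:
  obtains D1 D2 where "\<And>s y. ((\<lambda>s. F y - N s y) has_real_derivative - Ns s y) (at s)"
    "\<And>s y. ((\<lambda>y. F y - N s y) has_real_derivative D1 s y) (at y)"
    "\<And>s y. (D1 s has_real_derivative D2 s y) (at y)"
    "\<And>s y. - Ns s y = D2 s y / 2 + y / 2 * D1 s y + (F y - N s y) - F y * (F y - N s y) + (F y - N s y)\<^sup>2 / 2"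
proof -
  obtain F1 F2 where dF: "\<And>y. (F has_real_derivative F1 y) (at y)" and dF1: "\<And>y. (F1 has_real_derivative F2 y) (at y)"
    and F2: "\<And>y. F2 y = - 2 * F y - y * F1 y + (F y)\<^sup>2"
    using F_ode by blast
  show ?thesis
  proof (rule that[of "\<lambda>s y. F1 y - Ny s y" "\<lambda>s y. F2 y - Nyy s y"])
    fix s y
    show "((\<lambda>s. F y - N s y) has_real_derivative - Ns s y) (at s)"
      using DERIV_diff[OF DERIV_const dNs] by simp
    show "((\<lambda>y. F y - N s y) has_real_derivative F1 y - Ny s y) (at y)" by (intro DERIV_diff dF dNy)
    show "((\<lambda>y. F1 y - Ny s y) has_real_derivative F2 y - Nyy s y) (at y)" by (intro DERIV_diff dF1 dNyy)
    show "- Ns s y = (F2 y - Nyy s y) / 2 + y / 2 * (F1 y - Ny s y) + (F y - N s y) - F y * (F y - N s y) + (F y - N s y)\<^sup>2 / 2"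
      unfolding F2[of y] N_pde[of s y] by (simp add: algebra_simps power2_eq_square add_divide_distrib diff_divide_distrib)
  qed
qed

text \<open>The ground state term has the right decay but is not comparable with \<open>F\<close> uniformly in space. The
  operator sends \<open>exp (- y\<^sup>2 / 2) cosh (2 y)\<close> to an arbitrarily large negative multiple of itself at large
  \<open>\<bar>y\<bar>\<close>, so this term can decay like \<open>exp (- 2 \<beta> s)\<close> and still control the tails.\<close>

definition ansatz :: "(real \<Rightarrow> real) \<Rightarrow> (real \<Rightarrow> real) \<Rightarrow> (real \<Rightarrow> real) \<Rightarrow> real \<Rightarrow> real \<Rightarrow> real" where
  "ansatz \<psi> a b s y = exp (- y\<^sup>2 / 2) * (a s * \<psi> y + b s * cosh (2 * y))"

text \<open>Conjugation with p turns M into h'' / 2 - y h' / 2 + h / 2. On \<psi> this, minus the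
  potential, gives 1/2 - \<open>lambda0\<close>; on cosh (2 y) the constant is 2 + 1/2 = 5/2 and the
  drift gives - y sinh (2 y).\<close>

lemma ansatz_deriv:
  assumes d\<psi>: "\<And>x. (\<psi> has_real_derivative \<psi>' x) (at x)"
    "\<And>x. (\<psi>' has_real_derivative x * \<psi>' x + 2 * (F x - lambda0) * \<psi> x) (at x)"
    and da: "\<And>s. (a has_real_derivative a' s) (at s)" and db: "\<And>s. (b has_real_derivative b' s) (at s)"
  obtains T1 T2 where
    "\<And>s y. ((\<lambda>s. ansatz \<psi> a b s y) has_real_derivative exp (- y\<^sup>2 / 2) * (a' s * \<psi> y + b' s * cosh (2 * y))) (at s)"
    "\<And>s y. (ansatz \<psi> a b s has_real_derivative T1 s y) (at y)"
    "\<And>s y. (T1 s has_real_derivative T2 s y) (at y)"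
    "\<And>s y. T2 s y / 2 + y / 2 * T1 s y + ansatz \<psi> a b s y - F y * ansatz \<psi> a b s y
      = exp (- y\<^sup>2 / 2) * (- (lambda0 - 1/2) * a s * \<psi> y + b s * ((5/2 - F y) * cosh (2 * y) - y * sinh (2 * y)))"
proof -
  define h h1 h2 where "h s y = a s * \<psi> y + b s * cosh (2 * y)"
    and "h1 s y = a s * \<psi>' y + b s * (2 * sinh (2 * y))"
    and "h2 s y = a s * (y * \<psi>' y + 2 * (F y - lambda0) * \<psi> y) + b s * (4 * cosh (2 * y))" for s y :: real
  have dh: "(h s has_real_derivative h1 s y) (at y)" for s y
    unfolding h_def[abs_def] h1_def by (auto intro!: derivative_eq_intros d\<psi>)
  have dh1: "(h1 s has_real_derivative h2 s y) (at y)" for s y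
    unfolding h1_def[abs_def] h2_def by (auto intro!: derivative_eq_intros d\<psi>)
  have e: "((\<lambda>y. exp (- y\<^sup>2 / 2)) has_real_derivative - y * exp (- y\<^sup>2 / 2)) (at y)" for y :: real
    by (auto intro!: derivative_eq_intros)
  show ?thesis
  proof (rule that[of "\<lambda>s y. exp (- y\<^sup>2 / 2) * (h1 s y - y * h s y)"
        "\<lambda>s y. exp (- y\<^sup>2 / 2) * (h2 s y - 2 * y * h1 s y + (y\<^sup>2 - 1) * h s y)"])
    fix s y :: real
    show "((\<lambda>s. ansatz \<psi> a b s y) has_real_derivative exp (- y\<^sup>2 / 2) * (a' s * \<psi> y + b' s * cosh (2 * y))) (at s)"
      unfolding ansatz_def by (intro DERIV_cmult DERIV_add DERIV_cmult_right da db)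
    have "(ansatz \<psi> a b s has_real_derivative - y * exp (- y\<^sup>2 / 2) * h s y + h1 s y * exp (- y\<^sup>2 / 2)) (at y)"
      unfolding ansatz_def[abs_def] h_def[symmetric] by (intro DERIV_mult e dh)
    then show "(ansatz \<psi> a b s has_real_derivative exp (- y\<^sup>2 / 2) * (h1 s y - y * h s y)) (at y)"
      by (rule DERIV_cong) (simp add: algebra_simps)
    have "((\<lambda>y. exp (- y\<^sup>2 / 2) * (h1 s y - y * h s y)) has_real_derivative
        - y * exp (- y\<^sup>2 / 2) * (h1 s y - y * h s y) + (h2 s y - (1 * h s y + h1 s y * y)) * exp (- y\<^sup>2 / 2)) (at y)"
      by (intro DERIV_mult DERIV_diff e dh dh1 DERIV_ident)
    then show "((\<lambda>y. exp (- y\<^sup>2 / 2) * (h1 s y - y * h s y)) has_real_derivative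
        exp (- y\<^sup>2 / 2) * (h2 s y - 2 * y * h1 s y + (y\<^sup>2 - 1) * h s y)) (at y)"
      by (rule DERIV_cong) (simp add: algebra_simps power2_eq_square)
    have "exp (- y\<^sup>2 / 2) * (h2 s y - 2 * y * h1 s y + (y\<^sup>2 - 1) * h s y) / 2
        + y / 2 * (exp (- y\<^sup>2 / 2) * (h1 s y - y * h s y)) + ansatz \<psi> a b s y - F y * ansatz \<psi> a b s y
      = exp (- y\<^sup>2 / 2) * (h2 s y / 2 - y / 2 * h1 s y + h s y / 2 - F y * h s y)"
      unfolding ansatz_def h_def[symmetric] by (simp add: algebra_simps power2_eq_square add_divide_distrib diff_divide_distrib)
    also have "h2 s y / 2 - y / 2 * h1 s y + h s y / 2 - F y * h s y
      = - (lambda0 - 1/2) * a s * \<psi> y + b s * ((5/2 - F y) * cosh (2 * y) - y * sinh (2 * y))"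
      by (simp add: h_def h1_def h2_def field_simps)
    finally show "exp (- y\<^sup>2 / 2) * (h2 s y - 2 * y * h1 s y + (y\<^sup>2 - 1) * h s y) / 2
        + y / 2 * (exp (- y\<^sup>2 / 2) * (h1 s y - y * h s y)) + ansatz \<psi> a b s y - F y * ansatz \<psi> a b s y
      = exp (- y\<^sup>2 / 2) * (- (lambda0 - 1/2) * a s * \<psi> y + b s * ((5/2 - F y) * cosh (2 * y) - y * sinh (2 * y)))" .
  qed
qed

lemma ansatz_cont:
  assumes "\<And>x. (\<psi> has_real_derivative \<psi>' x) (at x)"
    "\<And>s. (a has_real_derivative a' s) (at s)" "\<And>s. (b has_real_derivative b' s) (at s)"
  shows "continuous_on A (\<lambda>(s, y). ansatz \<psi> a b s y)"
proof -
  have c: "continuous_on UNIV \<psi>" "continuous_on UNIV a" "continuous_on UNIV b"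
    using assms by (meson DERIV_isCont continuous_at_imp_continuous_on)+
  have "continuous_on A (\<lambda>p. \<psi> (snd p))" "continuous_on A (\<lambda>p. a (fst p))" "continuous_on A (\<lambda>p. b (fst p))"
    by (rule continuous_on_compose2[OF c(1)] continuous_on_compose2[OF c(2)] continuous_on_compose2[OF c(3)];
        auto intro!: continuous_intros)+
  then show ?thesis unfolding ansatz_def case_prod_beta' cosh_def by (intro continuous_intros) auto
qed

lemma deficit_cont: "continuous_on A (\<lambda>(s, y). F y - N s y)"
proof -
  have "continuous_on A (\<lambda>p. F (snd p))"
    by (rule continuous_on_compose2[OF F_continuous]) (auto intro!: continuous_intros)
  moreover have "continuous_on A (\<lambda>p. N (fst p) (snd p))"
    using continuous_on_N_strip[of A 0] by simp
  ultimately show ?thesis unfolding case_prod_beta' by (intro continuous_intros)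
qed

end

section \<open>Elementary bounds for the tails\<close>

lemma wide_gaussian_decay:
  fixes e :: real
  assumes "0 < e"
  obtains R where "\<And>y. \<bar>y\<bar> > R \<Longrightarrow> K * exp (- y\<^sup>2 / 4) \<le> e"
proof -
  obtain R where R: "\<And>y. \<bar>y\<bar> > R \<Longrightarrow> K * exp (- y\<^sup>2 / 2) \<le> e"
    using gaussian_decay[OF assms, of K] by blast
  show ?thesis
  proof (rule that)
    fix y assume "\<bar>y\<bar> > R * sqrt 2"
    then have "R < \<bar>y / sqrt 2\<bar>" by (simp add: field_simps)
    from R[OF this] show "K * exp (- y\<^sup>2 / 4) \<le> e" by (simp add: power_divide)
  qed
qed

lemma barrier_le_wide: "barrier y \<le> 12 * exp (3/2) * exp (- y\<^sup>2 / 4)"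
proof -
  have "1 + y\<^sup>2 / 4 \<le> exp (y\<^sup>2 / 4)" by (rule exp_ge_add_one_self)
  then have "(1 + y\<^sup>2) * exp (- y\<^sup>2 / 2) \<le> 4 * exp (y\<^sup>2 / 4) * exp (- y\<^sup>2 / 2)"
    using exp_gt_zero[of "y\<^sup>2 / 4"] by (intro mult_right_mono, linarith, simp)
  also have "\<dots> = 4 * exp (- y\<^sup>2 / 4)" by (simp flip: exp_add)
  finally show ?thesis by (simp add: barrier_def)
qed

lemma exp_abs_gaussian_le: "exp (- y\<^sup>2 / 2) * exp \<bar>y\<bar> \<le> exp 1 * exp (- y\<^sup>2 / 4)" for y :: real
proof -
  have "0 \<le> (\<bar>y\<bar> / 2 - 1)\<^sup>2" by simp
  then have "\<bar>y\<bar> \<le> 1 + y\<^sup>2 / 4" by (simp add: power2_diff power_divide)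
  then show ?thesis by (simp flip: exp_add)
qed

lemma cosh_double_ge: "exp (2 * \<bar>y\<bar>) / 2 \<le> cosh (2 * y)" for y :: real
  by (cases "0 \<le> y") (auto simp: cosh_def)

lemma cosh_gaussian_le: "exp (- y\<^sup>2 / 2) * cosh (2 * y) \<le> exp 2" for y :: real
proof -
  have "0 \<le> (\<bar>y\<bar> - 2)\<^sup>2" by simp
  then have "2 * \<bar>y\<bar> - y\<^sup>2 / 2 \<le> 2" by (simp add: power2_diff)
  then have 1: "exp (- y\<^sup>2 / 2) * exp (2 * \<bar>y\<bar>) \<le> exp 2" by (simp flip: exp_add)
  have "cosh (2 * y) \<le> exp (2 * \<bar>y\<bar>)" by (cases "0 \<le> y") (auto simp: cosh_def)
  then have "exp (- y\<^sup>2 / 2) * cosh (2 * y) \<le> exp (- y\<^sup>2 / 2) * exp (2 * \<bar>y\<bar>)" by (intro mult_left_mono) auto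
  also note 1
  finally show ?thesis .
qed

text \<open>For |y| \<ge> 1, cosh (2 y) is at most 2 |sinh (2 y)|, and the rest of the threshold
  supplies |y| \<ge> 2 L.\<close>

lemma sinh_dominates_cosh:
  fixes y :: real
  assumes L: "0 \<le> L" and y: "2 * L + 1 \<le> \<bar>y\<bar>"
  shows "L * cosh (2 * y) \<le> y * sinh (2 * y)"
proof -
  have pos: "L * cosh (2 * y) \<le> y * sinh (2 * y)" if y: "2 * L + 1 \<le> y" for y :: real
  proof -
    have "1 + 2 * (2 * y) \<le> exp (2 * (2 * y))" using exp_ge_add_one_self[of "2 * (2 * y)"] by simp
    then have "3 \<le> exp (2 * (2 * y))" using y L by linarith
    then have "3 \<le> exp (2 * y) * exp (2 * y)" by (simp flip: exp_add)
    then have "3 * exp (- (2 * y)) \<le> exp (2 * y)" by (simp add: exp_minus field_simps)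
    then have c: "cosh (2 * y) \<le> 2 * sinh (2 * y)" by (simp add: cosh_def sinh_def)
    have "L * cosh (2 * y) \<le> L * (2 * sinh (2 * y))" using c L by (rule mult_left_mono)
    also have "\<dots> = (2 * L) * sinh (2 * y)" by simp
    also have "\<dots> \<le> y * sinh (2 * y)" using y L by (intro mult_right_mono) auto
    finally show ?thesis .
  qed
  show ?thesis using pos[of y] pos[of "- y"] y by (cases "0 \<le> y") auto
qed

context selfsimilar
begin

text \<open>D^2 / 2 works against an upper bound, but z^2 / 2 - F z is nonincreasing for z \<le> F,
  and D \<le> F because N is positive. Where D exceeds the nonnegative ansatz, the nonlinear terms
  therefore still compare in the right direction.\<close>

lemma deficit_upper:
  assumes d\<psi>: "\<And>x. (\<psi> has_real_derivative \<psi>' x) (at x)"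
    "\<And>x. (\<psi>' has_real_derivative x * \<psi>' x + 2 * (F x - lambda0) * \<psi> x) (at x)"
    and da: "\<And>s. (a has_real_derivative a' s) (at s)" and db: "\<And>s. (b has_real_derivative b' s) (at s)"
    and nonneg: "\<And>s y. s0 \<le> s \<Longrightarrow> 0 \<le> ansatz \<psi> a b s y"
    and super: "\<And>s y. s0 \<le> s \<Longrightarrow> - (lambda0 - 1/2) * a s * \<psi> y
        + b s * ((5/2 - F y) * cosh (2 * y) - y * sinh (2 * y))
        + exp (- y\<^sup>2 / 2) * (a s * \<psi> y + b s * cosh (2 * y))\<^sup>2 / 2 \<le> a' s * \<psi> y + b' s * cosh (2 * y)"
    and init: "\<And>y. F y - N s0 y \<le> ansatz \<psi> a b s0 y" and s: "s0 \<le> s"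
  shows "F y - N s y \<le> ansatz \<psi> a b s y"
proof -
  obtain D1 D2 where D: "\<And>s y. ((\<lambda>s. F y - N s y) has_real_derivative - Ns s y) (at s)"
    "\<And>s y. ((\<lambda>y. F y - N s y) has_real_derivative D1 s y) (at y)"
    "\<And>s y. (D1 s has_real_derivative D2 s y) (at y)"
    "\<And>s y. - Ns s y = D2 s y / 2 + y / 2 * D1 s y + (F y - N s y) - F y * (F y - N s y) + (F y - N s y)\<^sup>2 / 2"
    using deficit_deriv by blast
  obtain T1 T2 where T:
    "\<And>s y. ((\<lambda>s. ansatz \<psi> a b s y) has_real_derivative exp (- y\<^sup>2 / 2) * (a' s * \<psi> y + b' s * cosh (2 * y))) (at s)"
    "\<And>s y. (ansatz \<psi> a b s has_real_derivative T1 s y) (at y)"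
    "\<And>s y. (T1 s has_real_derivative T2 s y) (at y)"
    "\<And>s y. T2 s y / 2 + y / 2 * T1 s y + ansatz \<psi> a b s y - F y * ansatz \<psi> a b s y
      = exp (- y\<^sup>2 / 2) * (- (lambda0 - 1/2) * a s * \<psi> y + b s * ((5/2 - F y) * cosh (2 * y) - y * sinh (2 * y)))"
    using ansatz_deriv[OF d\<psi> da db] by blast
  have "(F y - N s y) - ansatz \<psi> a b s y \<le> 0"
  proof (rule maximum_principle[where a = s0 and b = s and C = 1 and w = "\<lambda>s y. (F y - N s y) - ansatz \<psi> a b s y"])
    show "continuous_on ({s0..s} \<times> UNIV) (\<lambda>(t, x). F x - N t x - ansatz \<psi> a b t x)"
      using continuous_on_diff[OF deficit_cont ansatz_cont[OF d\<psi>(1) da db]] by (simp add: case_prod_beta')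
    show "F x - N s0 x - ansatz \<psi> a b s0 x \<le> 0" for x using init[of x] by simp
    show "\<exists>R. \<forall>t\<in>{s0..s}. \<forall>x. \<bar>x\<bar> > R \<longrightarrow> F x - N t x - ansatz \<psi> a b t x \<le> e" if e: "0 < e" for e
    proof -
      obtain R where R: "\<And>y. \<bar>y\<bar> > R \<Longrightarrow> 12 * exp (3/2) * exp (- y\<^sup>2 / 4) \<le> e"
        using wide_gaussian_decay[OF e] by blast
      have "F x - N t x - ansatz \<psi> a b t x \<le> e" if "t \<in> {s0..s}" "\<bar>x\<bar> > R" for t x
        using R[OF that(2)] barrier_le_wide[of x] F_le_barrier[of x] N_pos[of t x] nonneg[of t x] that(1) by auto
      then show ?thesis by blast
    qed
  next
    fix t x assume t: "s0 < t" "t \<le> s" and w: "0 < F x - N t x - ansatz \<psi> a b t x"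
    define d \<Theta> where "d = F x - N t x" and "\<Theta> = ansatz \<psi> a b t x"
    have \<Theta>0: "0 \<le> \<Theta>" unfolding \<Theta>_def using nonneg t by simp
    have dF: "d \<le> F x" using N_pos[of t x] by (simp add: d_def)
    have w': "0 < d - \<Theta>" using w by (simp add: d_def \<Theta>_def)
    define E where "E = exp (- x\<^sup>2 / 2) * (a' t * \<psi> x + b' t * cosh (2 * x))"
    have sup: "T2 t x / 2 + x / 2 * T1 t x + \<Theta> - F x * \<Theta> + \<Theta>\<^sup>2 / 2 \<le> E"
    proof -
      have "exp (- x\<^sup>2 / 2) * (- (lambda0 - 1/2) * a t * \<psi> x
        + b t * ((5/2 - F x) * cosh (2 * x) - x * sinh (2 * x))
        + exp (- x\<^sup>2 / 2) * (a t * \<psi> x + b t * cosh (2 * x))\<^sup>2 / 2) \<le> E"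
        unfolding E_def using super[of t x] t by (intro mult_left_mono) auto
      moreover have "exp (- x\<^sup>2 / 2) * (exp (- x\<^sup>2 / 2) * (a t * \<psi> x + b t * cosh (2 * x))\<^sup>2 / 2) = \<Theta>\<^sup>2 / 2"
        by (simp add: \<Theta>_def ansatz_def power2_eq_square)
      ultimately show ?thesis using T(4)[of t x, folded \<Theta>_def] by (simp only: distrib_left)
    qed
    have "(d - \<Theta>) * ((d + \<Theta>) / 2 - F x) \<le> 0"
      using w' dF \<Theta>0 by (intro mult_nonneg_nonpos) auto
    moreover have "(d - \<Theta>) * ((d + \<Theta>) / 2 - F x) = (d\<^sup>2 / 2 - F x * d) - (\<Theta>\<^sup>2 / 2 - F x * \<Theta>)"
      by (simp add: field_simps power2_eq_square)
    ultimately have "- Ns t x - E \<le> (D2 t x - T2 t x) / 2 + x / 2 * (D1 t x - T1 t x) + 1 * (d - \<Theta>)"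
      using sup D(4)[of t x, folded d_def] by (simp add: algebra_simps diff_divide_distrib)
    then show "\<exists>wt wx wxx \<beta>. ((\<lambda>s. F x - N s x - ansatz \<psi> a b s x) has_real_derivative wt) (at t) \<and>
         (\<forall>y. ((\<lambda>y. F y - N t y - ansatz \<psi> a b t y) has_real_derivative wx y) (at y)) \<and>
         (wx has_real_derivative wxx) (at x) \<and>
         wt \<le> wxx / 2 + \<beta> * wx x + 1 * (F x - N t x - ansatz \<psi> a b t x)"
      unfolding d_def \<Theta>_def
      by (intro exI[of _ "- Ns t x - E"] exI[of _ "\<lambda>y. D1 t y - T1 t y"] exI[of _ "D2 t x - T2 t x"] exI[of _ "x / 2"]
           conjI allI DERIV_diff D T(2,3) T(1)[of x t, folded E_def])
  qed (use s in auto)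
  then show ?thesis by simp
qed

text \<open>D^2 / 2 can simply be discarded, so a subsolution of the linear equation suffices. It
  may be negative somewhere; the maximum principle only asks for decay of its upper bound.\<close>

lemma deficit_lower:
  assumes d\<psi>: "\<And>x. (\<psi> has_real_derivative \<psi>' x) (at x)"
    "\<And>x. (\<psi>' has_real_derivative x * \<psi>' x + 2 * (F x - lambda0) * \<psi> x) (at x)"
    and da: "\<And>s. (a has_real_derivative a' s) (at s)" and db: "\<And>s. (b has_real_derivative b' s) (at s)"
    and sub: "\<And>s y. s0 \<le> s \<Longrightarrow> a' s * \<psi> y + b' s * cosh (2 * y) \<le> - (lambda0 - 1/2) * a s * \<psi> y
        + b s * ((5/2 - F y) * cosh (2 * y) - y * sinh (2 * y))"
    and decay: "\<And>s y. s0 \<le> s \<Longrightarrow> ansatz \<psi> a b s y \<le> K * exp (- y\<^sup>2 / 4)"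
    and init: "\<And>y. ansatz \<psi> a b s0 y \<le> F y - N s0 y" and s: "s0 \<le> s"
  shows "ansatz \<psi> a b s y \<le> F y - N s y"
proof -
  obtain D1 D2 where D: "\<And>s y. ((\<lambda>s. F y - N s y) has_real_derivative - Ns s y) (at s)"
    "\<And>s y. ((\<lambda>y. F y - N s y) has_real_derivative D1 s y) (at y)"
    "\<And>s y. (D1 s has_real_derivative D2 s y) (at y)"
    "\<And>s y. - Ns s y = D2 s y / 2 + y / 2 * D1 s y + (F y - N s y) - F y * (F y - N s y) + (F y - N s y)\<^sup>2 / 2"
    using deficit_deriv by blast
  obtain T1 T2 where T:
    "\<And>s y. ((\<lambda>s. ansatz \<psi> a b s y) has_real_derivative exp (- y\<^sup>2 / 2) * (a' s * \<psi> y + b' s * cosh (2 * y))) (at s)"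
    "\<And>s y. (ansatz \<psi> a b s has_real_derivative T1 s y) (at y)"
    "\<And>s y. (T1 s has_real_derivative T2 s y) (at y)"
    "\<And>s y. T2 s y / 2 + y / 2 * T1 s y + ansatz \<psi> a b s y - F y * ansatz \<psi> a b s y
      = exp (- y\<^sup>2 / 2) * (- (lambda0 - 1/2) * a s * \<psi> y + b s * ((5/2 - F y) * cosh (2 * y) - y * sinh (2 * y)))"
    using ansatz_deriv[OF d\<psi> da db] by blast
  have "ansatz \<psi> a b s y - (F y - N s y) \<le> 0"
  proof (rule maximum_principle[where a = s0 and b = s and C = 1 and w = "\<lambda>s y. ansatz \<psi> a b s y - (F y - N s y)"])
    show "continuous_on ({s0..s} \<times> UNIV) (\<lambda>(t, x). ansatz \<psi> a b t x - (F x - N t x))"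
      using continuous_on_diff[OF ansatz_cont[OF d\<psi>(1) da db] deficit_cont] by (simp add: case_prod_beta')
    show "ansatz \<psi> a b s0 x - (F x - N s0 x) \<le> 0" for x using init[of x] by simp
    show "\<exists>R. \<forall>t\<in>{s0..s}. \<forall>x. \<bar>x\<bar> > R \<longrightarrow> ansatz \<psi> a b t x - (F x - N t x) \<le> e" if e: "0 < e" for e
    proof -
      obtain R where R: "\<And>y. \<bar>y\<bar> > R \<Longrightarrow> K * exp (- y\<^sup>2 / 4) \<le> e"
        using wide_gaussian_decay[OF e] by blast
      have "ansatz \<psi> a b t x - (F x - N t x) \<le> e" if "t \<in> {s0..s}" "\<bar>x\<bar> > R" for t x
        using R[OF that(2)] decay[of t x] N_le_F[of t x] that(1) by auto
      then show ?thesis by blast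
    qed
  next
    fix t x assume t: "s0 < t" "t \<le> s" and w: "0 < ansatz \<psi> a b t x - (F x - N t x)"
    define d \<Theta> where "d = F x - N t x" and "\<Theta> = ansatz \<psi> a b t x"
    have w': "0 < \<Theta> - d" using w by (simp add: d_def \<Theta>_def)
    define E where "E = exp (- x\<^sup>2 / 2) * (a' t * \<psi> x + b' t * cosh (2 * x))"
    have sub': "E \<le> T2 t x / 2 + x / 2 * T1 t x + \<Theta> - F x * \<Theta>"
      unfolding E_def \<Theta>_def T(4) using sub[of t x] t by (intro mult_left_mono) auto
    have "F x * d \<le> F x * \<Theta>" using w' F_pos[of x] by (intro mult_left_mono) auto
    moreover have "0 \<le> d\<^sup>2 / 2" by simp
    ultimately have "E - - Ns t x \<le> (T2 t x - D2 t x) / 2 + x / 2 * (T1 t x - D1 t x) + 1 * (\<Theta> - d)"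
      using sub' D(4)[of t x, folded d_def] unfolding right_diff_distrib diff_divide_distrib by linarith
    then show "\<exists>wt wx wxx \<beta>. ((\<lambda>s. ansatz \<psi> a b s x - (F x - N s x)) has_real_derivative wt) (at t) \<and>
         (\<forall>y. ((\<lambda>y. ansatz \<psi> a b t y - (F y - N t y)) has_real_derivative wx y) (at y)) \<and>
         (wx has_real_derivative wxx) (at x) \<and>
         wt \<le> wxx / 2 + \<beta> * wx x + 1 * (ansatz \<psi> a b t x - (F x - N t x))"
      unfolding d_def \<Theta>_def
      by (intro exI[of _ "E - - Ns t x"] exI[of _ "\<lambda>y. T1 t y - D1 t y"] exI[of _ "T2 t x - D2 t x"] exI[of _ "x / 2"]
           conjI allI DERIV_diff D T(2,3) T(1)[of x t, folded E_def])
  qed (use s in auto)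
  then show ?thesis by simp
qed

end

section \<open>Amplitudes of the super- and subsolution\<close>

lemma exp_decay_deriv: "((\<lambda>s. exp (- (\<beta> * (s - s0)))) has_real_derivative - \<beta> * exp (- (\<beta> * (s - s0)))) (at s)" for \<beta> s0 s :: real
  by (auto intro!: derivative_eq_intros)

lemma continuous_pos_lower_bound:
  fixes g :: "real \<Rightarrow> real"
  assumes "continuous_on UNIV g" "\<And>y. 0 < g y"
  obtains m where "0 < m" "\<And>y. \<bar>y\<bar> \<le> Y \<Longrightarrow> m \<le> g y"
proof -
  have "continuous_on {- \<bar>Y\<bar>..\<bar>Y\<bar>} g" by (rule continuous_on_subset[OF assms(1)]) simp
  moreover have "0 \<in> {- \<bar>Y\<bar>..\<bar>Y\<bar>}" by simp
  then have "{- \<bar>Y\<bar>..\<bar>Y\<bar>} \<noteq> {}" by blast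
  ultimately obtain x where x: "\<And>y. y \<in> {- \<bar>Y\<bar>..\<bar>Y\<bar>} \<Longrightarrow> g x \<le> g y"
    using continuous_attains_inf[OF compact_Icc, of "- \<bar>Y\<bar>" "\<bar>Y\<bar>" g] by blast
  have "g x \<le> g y" if "\<bar>y\<bar> \<le> Y" for y using that by (intro x) auto
  then show ?thesis using assms(2) by (rule that[rotated])
qed

text \<open>The amplitude a0 (2 e - e^2), with e decaying at rate \<beta>, decays more slowly than
  the eigenvalue prescribes, which leaves a surplus a0 \<beta> e^2 \<psi>. Half of it absorbs the
  square of the ground state part, the other half the term B k \<psi> from the drift of cosh. Of the
  coefficient 2 \<beta> + 1, the part 2 \<beta> matches the decay of e^2, and the 1 pays for the
  square of the cosh part.\<close>

lemma supersolution_algebra: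
  fixes e \<psi> c p P B k a0 \<beta> G :: real
  assumes e: "0 \<le> e" "e \<le> 1" and \<psi>: "0 \<le> \<psi>" "p * \<psi> \<le> P" and c: "0 \<le> c" "p * c * B \<le> 1" and p: "0 \<le> p"
    and a0: "0 \<le> a0" "8 * a0 * P \<le> \<beta>" and B: "0 \<le> B" "B * k \<le> a0 * \<beta> / 2"
    and G: "G \<le> k * \<psi> - (2 * \<beta> + 1) * c"
  shows "- \<beta> * (a0 * (2 * e - e\<^sup>2)) * \<psi> + B * e\<^sup>2 * G + p * (a0 * (2 * e - e\<^sup>2) * \<psi> + B * e\<^sup>2 * c)\<^sup>2 / 2
      \<le> a0 * (2 * \<beta> * e\<^sup>2 - 2 * \<beta> * e) * \<psi> + B * (- 2 * \<beta> * e\<^sup>2) * c"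
proof -
  define u v where "u = a0 * (2 * e - e\<^sup>2) * \<psi>" and "v = B * e\<^sup>2 * c"
  have e2: "e\<^sup>2 \<le> e" using e by (simp add: power2_eq_square mult_left_le)
  have u: "0 \<le> u" "u \<le> 2 * a0 * e * \<psi>"
    using e e2 a0 \<psi> by (auto simp: u_def mult_ac intro!: mult_left_mono)
  have pu: "p * u\<^sup>2 \<le> e\<^sup>2 * (a0 * \<beta> / 2 * \<psi>)"
  proof -
    have "p * u\<^sup>2 \<le> p * (2 * a0 * e * \<psi>)\<^sup>2" using u p by (intro mult_left_mono power_mono) auto
    also have "\<dots> = (4 * a0\<^sup>2 * e\<^sup>2 * \<psi>) * (p * \<psi>)" by (simp add: power2_eq_square)
    also have "\<dots> \<le> (4 * a0\<^sup>2 * e\<^sup>2 * \<psi>) * P" using \<psi> by (intro mult_left_mono) auto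
    also have "\<dots> = (e\<^sup>2 * a0 * \<psi> / 2) * (8 * a0 * P)" by (simp add: power2_eq_square)
    also have "\<dots> \<le> (e\<^sup>2 * a0 * \<psi> / 2) * \<beta>" using a0 \<psi> by (intro mult_left_mono) auto
    finally show ?thesis by (simp add: mult_ac)
  qed
  have pv: "p * v\<^sup>2 \<le> e\<^sup>2 * (B * c)"
  proof -
    have "p * v\<^sup>2 = (B * c * e\<^sup>2) * (e\<^sup>2 * (p * c * B))" by (simp add: v_def power2_eq_square mult_ac)
    also have "\<dots> \<le> (B * c * e\<^sup>2) * (1 * 1)"
      using e B c p by (intro mult_left_mono mult_mono) (auto simp: power_le_one)
    finally show ?thesis by (simp add: mult_ac)
  qed
  have "(u + v)\<^sup>2 / 2 \<le> u\<^sup>2 + v\<^sup>2" using sum_squares_bound[of u v] by (simp add: power2_sum)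
  then have "p * ((u + v)\<^sup>2 / 2) \<le> p * (u\<^sup>2 + v\<^sup>2)" using p by (rule mult_left_mono)
  then have q: "p * (u + v)\<^sup>2 / 2 \<le> e\<^sup>2 * (a0 * \<beta> / 2 * \<psi>) + e\<^sup>2 * (B * c)"
    using pu pv by (simp add: distrib_left)
  have "B * e\<^sup>2 * G \<le> B * e\<^sup>2 * (k * \<psi> - (2 * \<beta> + 1) * c)" using G B by (intro mult_left_mono) auto
  also have "\<dots> = e\<^sup>2 * ((B * k) * \<psi>) - B * e\<^sup>2 * (2 * \<beta> + 1) * c" by (simp add: algebra_simps)
  also have "\<dots> \<le> e\<^sup>2 * ((a0 * \<beta> / 2) * \<psi>) - B * e\<^sup>2 * (2 * \<beta> + 1) * c"
    using B \<psi> by (intro diff_right_mono mult_left_mono mult_right_mono) auto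
  finally have "- \<beta> * u + B * e\<^sup>2 * G + p * (u + v)\<^sup>2 / 2 \<le>
     - \<beta> * u + (e\<^sup>2 * ((a0 * \<beta> / 2) * \<psi>) - B * e\<^sup>2 * (2 * \<beta> + 1) * c) + (e\<^sup>2 * (a0 * \<beta> / 2 * \<psi>) + e\<^sup>2 * (B * c))"
    using q by linarith
  also have "\<dots> = a0 * (2 * \<beta> * e\<^sup>2 - 2 * \<beta> * e) * \<psi> + B * (- 2 * \<beta> * e\<^sup>2) * c"
    by (simp add: u_def algebra_simps)
  finally show ?thesis by (simp only: u_def v_def mult.assoc)
qed

text \<open>The correction b0 e^2 decays at the faster rate 2 \<beta> and so leaves a surplus A
  \<beta> b0 e^2 \<psi>, which covers the term k \<psi> caused by subtracting the cosh term.\<close>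

lemma subsolution_algebra:
  fixes e \<psi> c b0 k \<beta> G A :: real
  assumes "0 \<le> \<psi>" "0 \<le> c" "0 \<le> A" and b0: "k \<le> \<beta> * b0" and G: "G \<le> k * \<psi> - (2 * \<beta> + 1) * c"
  shows "A * (- \<beta> * e - 2 * \<beta> * b0 * e\<^sup>2) * \<psi> + A * (2 * \<beta> * e\<^sup>2) * c
      \<le> - \<beta> * (A * (e + b0 * e\<^sup>2)) * \<psi> + - (A * e\<^sup>2) * G"
proof -
  have "A * e\<^sup>2 * G \<le> A * e\<^sup>2 * (k * \<psi> - (2 * \<beta> + 1) * c)" using G assms by (intro mult_left_mono) auto
  moreover have "A * e\<^sup>2 * (k * \<psi>) \<le> A * e\<^sup>2 * (\<beta> * b0 * \<psi>)" using assms by (intro mult_left_mono mult_right_mono) auto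
  moreover have "0 \<le> A * e\<^sup>2 * c" using assms by simp
  ultimately show ?thesis by (simp add: algebra_simps)
qed

context selfsimilar
begin

text \<open>For large |y| the drift - y sinh (2 y) beats L cosh (2 y) with L = 5/2 + (2 \<beta> +
  1). On the remaining compact interval \<psi> is bounded below, and a large multiple of it
  compensates; the potential only helps.\<close>

lemma cosh_drift:
  assumes \<psi>: "continuous_on UNIV \<psi>" "\<And>y. 0 < \<psi> y" and \<beta>: "0 \<le> \<beta>"
  obtains k where "0 < k"
    "\<And>y. (5/2 - F y) * cosh (2 * y) - y * sinh (2 * y) \<le> k * \<psi> y - (2 * \<beta> + 1) * cosh (2 * y)"
proof -
  define L where "L = 7/2 + 2 * \<beta>"
  define Y where "Y = 2 * L + 1"
  have L: "0 < L" using \<beta> by (simp add: L_def)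
  obtain m where m: "0 < m" "\<And>y. \<bar>y\<bar> \<le> Y \<Longrightarrow> m \<le> \<psi> y"
    using continuous_pos_lower_bound[OF \<psi>] by blast
  define k where "k = L * cosh (2 * Y) / m"
  have k: "0 < k" "k * m = L * cosh (2 * Y)" using L m by (auto simp: k_def)
  show ?thesis
  proof (rule that[OF k(1)])
    fix y
    have "L * cosh (2 * y) - y * sinh (2 * y) \<le> k * \<psi> y"
    proof (cases "\<bar>y\<bar> \<le> Y")
      case True
      have "0 \<le> y * sinh (2 * y)" by (cases "0 \<le> y") (auto simp: mult_nonpos_nonpos)
      then have "L * cosh (2 * y) - y * sinh (2 * y) \<le> L * cosh (2 * y)" by simp
      also have "\<dots> \<le> L * cosh (2 * Y)"
      proof (rule mult_left_mono[OF _ less_imp_le[OF L]])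
        have "cosh (2 * y) = cosh (2 * \<bar>y\<bar>)" by (cases "0 \<le> y") auto
        also have "\<dots> \<le> cosh (2 * Y)" using True by (subst cosh_real_nonneg_le_iff) auto
        finally show "cosh (2 * y) \<le> cosh (2 * Y)" .
      qed
      also have "\<dots> = k * m" using k by simp
      also have "\<dots> \<le> k * \<psi> y" using m(2)[OF True] less_imp_le[OF k(1)] by (rule mult_left_mono)
      finally show ?thesis .
    next
      case False
      then have "L * cosh (2 * y) \<le> y * sinh (2 * y)" using L by (intro sinh_dominates_cosh) (auto simp: Y_def)
      then show ?thesis using k \<psi>(2)[of y] mult_pos_pos[of k "\<psi> y"] by linarith
    qed
    moreover have "0 \<le> F y * cosh (2 * y)" using F_pos[of y] by simp
    ultimately show "(5/2 - F y) * cosh (2 * y) - y * sinh (2 * y) \<le> k * \<psi> y - (2 * \<beta> + 1) * cosh (2 * y)"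
      by (simp add: L_def algebra_simps)
  qed
qed

text \<open>The quadratic remainder forces small amplitudes, so the comparison starts only at a late
  time s0. On a compact interval uniform convergence puts the deficit below the ground state part;
  outside, the stationary barrier is already below the cosh part.\<close>

lemma deficit_exponential_upper:
  obtains C where "0 < C" "\<And>s y. F y - N s y \<le> C * exp (- ((lambda0 - 1/2) * s))"
proof -
  obtain \<psi> \<psi>' C0 where \<psi>: "\<And>x. (\<psi> has_real_derivative \<psi>' x) (at x)"
    "\<And>x. (\<psi>' has_real_derivative x * \<psi>' x + 2 * (F x - lambda0) * \<psi> x) (at x)"
    and \<psi>0: "\<And>x. 0 < \<psi> x" and C0: "0 < C0" "\<And>x. \<psi> x \<le> C0 * exp \<bar>x\<bar>" and l0: "1/2 < lambda0"
    using lambda0_ground_state by blast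
  define \<beta> where "\<beta> = lambda0 - 1/2"
  have \<beta>: "0 < \<beta>" using l0 by (simp add: \<beta>_def)
  have c\<psi>: "continuous_on UNIV \<psi>" using \<psi>(1) by (meson DERIV_isCont continuous_at_imp_continuous_on)
  obtain k where k: "0 < k"
    "\<And>y. (5/2 - F y) * cosh (2 * y) - y * sinh (2 * y) \<le> k * \<psi> y - (2 * \<beta> + 1) * cosh (2 * y)"
    using cosh_drift[OF c\<psi> \<psi>0 less_imp_le[OF \<beta>]] by blast
  define P where "P = C0 * exp 1"
  have P: "0 < P" using C0 by (simp add: P_def)
  have p\<psi>: "exp (- y\<^sup>2 / 2) * \<psi> y \<le> P" for y
  proof -
    have "exp (- y\<^sup>2 / 2) * \<psi> y \<le> exp (- y\<^sup>2 / 2) * (C0 * exp \<bar>y\<bar>)" using C0(2)[of y] by simp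
    also have "\<dots> = C0 * (exp (- y\<^sup>2 / 2) * exp \<bar>y\<bar>)" by simp
    also have "\<dots> \<le> C0 * (exp 1 * exp (- y\<^sup>2 / 4))"
      using exp_abs_gaussian_le[of y] C0(1) by (intro mult_left_mono) auto
    also have "\<dots> \<le> C0 * (exp 1 * 1)" using C0(1) by (intro mult_left_mono) auto
    finally show ?thesis by (simp add: P_def)
  qed
  \<comment> \<open>\<open>P\<close> bounds p \<psi>; this is the largest amplitude for which half
    of the surplus absorbs the square of the ground state part.\<close>
  define a0 where "a0 = \<beta> / (8 * P)"
  have a0: "0 < a0" "8 * a0 * P = \<beta>" using \<beta> P by (auto simp: a0_def)
  \<comment> \<open>The first bound leaves the other half of the surplus for the drift, the second
    gives B p cosh (2 y) \<le> 1.\<close>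
  define B where "B = min (a0 * \<beta> / (2 * k)) (exp (- 2))"
  have B: "0 < B" using a0 \<beta> k by (simp add: B_def)
  have Bk: "B * k \<le> a0 * \<beta> / 2"
  proof -
    have "B * k \<le> a0 * \<beta> / (2 * k) * k" using k(1) by (intro mult_right_mono) (auto simp: B_def)
    then show ?thesis using k(1) by simp
  qed
  have Bp: "exp (- y\<^sup>2 / 2) * cosh (2 * y) * B \<le> 1" for y
  proof -
    have "exp (- y\<^sup>2 / 2) * cosh (2 * y) * B \<le> exp 2 * exp (- 2)"
      using B cosh_gaussian_le[of y] by (intro mult_mono) (auto simp: B_def)
    then show ?thesis by (simp flip: exp_add)
  qed
  \<comment> \<open>Beyond \<open>Y\<close> one has 12 exp (3/2) \<le> B exp |y|, which together
    with 1 + y^2 \<le> 2 exp |y| puts the barrier below B p cosh (2 y).\<close>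
  define Y where "Y = 12 * exp (3/2) / B"
  obtain m where m: "0 < m" "\<And>y. \<bar>y\<bar> \<le> Y \<Longrightarrow> m \<le> exp (- y\<^sup>2 / 2) * \<psi> y"
  proof (rule continuous_pos_lower_bound[of "\<lambda>y. exp (- y\<^sup>2 / 2) * \<psi> y" Y])
    show "continuous_on UNIV (\<lambda>y. exp (- y\<^sup>2 / 2) * \<psi> y)" by (intro continuous_intros c\<psi>) simp
  qed (use \<psi>0 in auto)
  obtain s0 where s0: "\<And>y. \<bar>y\<bar> \<le> Y \<Longrightarrow> F y - N s0 y < a0 * m"
    using N_uniform_limit[of "a0 * m" Y] a0 m by auto
  define e where "e s = exp (- (\<beta> * (s - s0)))" for s
  have de: "(e has_real_derivative - \<beta> * e s) (at s)" for s unfolding e_def[abs_def] by (rule exp_decay_deriv)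
  have e: "0 < e s" for s by (simp add: e_def)
  have e1: "e s \<le> 1" if "s0 \<le> s" for s using that \<beta> by (simp add: e_def)
  have da: "((\<lambda>s. a0 * (2 * e s - (e s)\<^sup>2)) has_real_derivative a0 * (2 * \<beta> * (e s)\<^sup>2 - 2 * \<beta> * e s)) (at s)" for s
    by (auto intro!: derivative_eq_intros de simp: algebra_simps power2_eq_square)
  have db: "((\<lambda>s. B * (e s)\<^sup>2) has_real_derivative B * (- 2 * \<beta> * (e s)\<^sup>2)) (at s)" for s
    by (auto intro!: derivative_eq_intros de simp: algebra_simps power2_eq_square)
  define \<Theta> where "\<Theta> = ansatz \<psi> (\<lambda>s. a0 * (2 * e s - (e s)\<^sup>2)) (\<lambda>s. B * (e s)\<^sup>2)"
  have up: "F y - N s y \<le> \<Theta> s y" if s: "s0 \<le> s" for s y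
    unfolding \<Theta>_def
  proof (rule deficit_upper[OF \<psi> da db _ _ _ s])
    fix s y assume s: "s0 \<le> s"
    have "(e s)\<^sup>2 \<le> e s" using e[of s] e1[OF s] by (simp add: power2_eq_square mult_left_le)
    then have "0 \<le> 2 * e s - (e s)\<^sup>2" using e[of s] by linarith
    then show "0 \<le> ansatz \<psi> (\<lambda>s. a0 * (2 * e s - (e s)\<^sup>2)) (\<lambda>s. B * (e s)\<^sup>2) s y"
      unfolding ansatz_def using a0 B \<psi>0[of y] by (intro mult_nonneg_nonneg add_nonneg_nonneg) auto
    show "- (lambda0 - 1/2) * (a0 * (2 * e s - (e s)\<^sup>2)) * \<psi> y
        + B * (e s)\<^sup>2 * ((5/2 - F y) * cosh (2 * y) - y * sinh (2 * y))
        + exp (- y\<^sup>2 / 2) * (a0 * (2 * e s - (e s)\<^sup>2) * \<psi> y + B * (e s)\<^sup>2 * cosh (2 * y))\<^sup>2 / 2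
       \<le> a0 * (2 * \<beta> * (e s)\<^sup>2 - 2 * \<beta> * e s) * \<psi> y + B * (- 2 * \<beta> * (e s)\<^sup>2) * cosh (2 * y)"
      unfolding \<beta>_def[symmetric]
      by (rule supersolution_algebra[OF _ e1[OF s] _ p\<psi> _ Bp _ _ _ _ Bk k(2)])
         (use e[of s] \<psi>0[of y] a0 B in auto)
  next
    fix y
    have es0: "e s0 = 1" by (simp add: e_def)
    have "F y - N s0 y \<le> exp (- y\<^sup>2 / 2) * (a0 * \<psi> y + B * cosh (2 * y))"
    proof (cases "\<bar>y\<bar> \<le> Y")
      case True
      have "F y - N s0 y \<le> a0 * m" using s0[OF True] by simp
      also have "\<dots> \<le> a0 * (exp (- y\<^sup>2 / 2) * \<psi> y)" using m(2)[OF True] a0 by simp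
      also have "\<dots> = exp (- y\<^sup>2 / 2) * (a0 * \<psi> y)" by simp
      also have "\<dots> \<le> exp (- y\<^sup>2 / 2) * (a0 * \<psi> y + B * cosh (2 * y))" using B by simp
      finally show ?thesis .
    next
      case False
      then have "Y \<le> \<bar>y\<bar>" by simp
      also have "\<bar>y\<bar> \<le> exp \<bar>y\<bar>" using exp_ge_add_one_self[of "\<bar>y\<bar>"] by linarith
      finally have "12 * exp (3/2) \<le> B * exp \<bar>y\<bar>" using B by (simp add: Y_def field_simps)
      then have 1: "12 * exp (3/2) * exp \<bar>y\<bar> \<le> B * exp \<bar>y\<bar> * exp \<bar>y\<bar>" by (intro mult_right_mono) auto
      have "1 + \<bar>y\<bar> + \<bar>y\<bar>\<^sup>2 / 2 \<le> exp \<bar>y\<bar>" by (rule exp_lower_Taylor_quadratic) simp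
      then have "1 + y\<^sup>2 \<le> 2 * exp \<bar>y\<bar>" by simp
      then have "3 * exp (3/2) * (1 + y\<^sup>2) \<le> 3 * exp (3/2) * (2 * exp \<bar>y\<bar>)" by (intro mult_left_mono) auto
      also have "\<dots> \<le> B * (exp (2 * \<bar>y\<bar>) / 2)"
        using 1 by (simp add: exp_double power2_eq_square)
      also have "\<dots> \<le> B * cosh (2 * y)" using B cosh_double_ge[of y] by (intro mult_left_mono) auto
      finally have 2: "exp (- y\<^sup>2 / 2) * (3 * exp (3/2) * (1 + y\<^sup>2)) \<le> exp (- y\<^sup>2 / 2) * (B * cosh (2 * y))"
        by (intro mult_left_mono) auto
      have "F y - N s0 y \<le> barrier y" using F_le_barrier[of y] N_pos[of s0 y] by linarith
      also have "\<dots> = exp (- y\<^sup>2 / 2) * (3 * exp (3/2) * (1 + y\<^sup>2))" by (simp add: barrier_def)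
      also note 2
      also have "exp (- y\<^sup>2 / 2) * (B * cosh (2 * y)) \<le> exp (- y\<^sup>2 / 2) * (a0 * \<psi> y + B * cosh (2 * y))"
        using a0 \<psi>0[of y] by simp
      finally show ?thesis .
    qed
    then show "F y - N s0 y \<le> ansatz \<psi> (\<lambda>s. a0 * (2 * e s - (e s)\<^sup>2)) (\<lambda>s. B * (e s)\<^sup>2) s0 y"
      by (simp add: ansatz_def es0)
  qed
  \<comment> \<open>The bound is claimed for all real s. The added \<open>Kbar\<close> covers s <
    s0, where e s \<ge> 1 and the trivial bound suffices.\<close>
  define C where "C = (2 * a0 * P + 1 + Kbar) * exp (\<beta> * s0)"
  have Kbar: "0 < Kbar" by (simp add: Kbar_def)
  have eC: "C * exp (- (\<beta> * s)) = (2 * a0 * P + 1 + Kbar) * e s" for s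
    by (simp add: C_def e_def right_diff_distrib flip: exp_add)
  have "F y - N s y \<le> C * exp (- (\<beta> * s))" for s y
  proof (cases "s0 \<le> s")
    case True
    have "\<Theta> s y = exp (- y\<^sup>2 / 2) * \<psi> y * (a0 * (2 * e s - (e s)\<^sup>2)) + exp (- y\<^sup>2 / 2) * cosh (2 * y) * B * (e s)\<^sup>2"
      by (simp add: \<Theta>_def ansatz_def algebra_simps)
    also have "\<dots> \<le> P * (a0 * (2 * e s)) + 1 * e s"
    proof -
      have "(e s)\<^sup>2 \<le> e s" using e[of s] e1[OF True] by (simp add: power2_eq_square mult_left_le)
      moreover have "(e s)\<^sup>2 \<le> 2 * e s" using calculation e[of s] by linarith
      ultimately show ?thesis
        by (intro add_mono mult_mono) (use p\<psi> Bp a0(1) P in auto)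
    qed
    also have "\<dots> = (2 * a0 * P + 1) * e s" by (simp add: algebra_simps)
    also have "\<dots> \<le> C * exp (- (\<beta> * s))" unfolding eC using Kbar e[of s] by (intro mult_right_mono) auto
    finally show ?thesis using up[OF True, of y] by linarith
  next
    case False
    have "F y - N s y \<le> Kbar" using F_le_barrier[of y] barrier_le[of y] N_pos[of s y] by (simp add: Kbar_def)
    also have "\<dots> \<le> (2 * a0 * P + 1 + Kbar) * 1" using a0 P by simp
    also have "\<dots> \<le> C * exp (- (\<beta> * s))"
      unfolding eC using False \<beta> a0 P Kbar by (intro mult_left_mono) (auto simp: e_def mult_nonneg_nonpos)
    finally show ?thesis .
  qed
  moreover have "0 < C" using a0 P Kbar by (simp add: C_def add_pos_pos)
  ultimately show ?thesis using that unfolding \<beta>_def by blast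
qed

text \<open>The subsolution is linear, so it can start at s = 0 with a small factor A, below the
  Gaussian gap. It is positive on |y| \<le> K only after the cosh correction has decayed; earlier
  times are covered by monotonicity.\<close>

lemma deficit_exponential_lower:
  obtains C where "0 < C" "\<And>(s :: real) y. 0 \<le> s \<Longrightarrow> \<bar>y\<bar> \<le> K \<Longrightarrow> C * exp (- ((lambda0 - 1/2) * s)) \<le> F y - N s y"
proof -
  obtain \<psi> \<psi>' C0 where \<psi>: "\<And>x. (\<psi> has_real_derivative \<psi>' x) (at x)"
    "\<And>x. (\<psi>' has_real_derivative x * \<psi>' x + 2 * (F x - lambda0) * \<psi> x) (at x)"
    and \<psi>0: "\<And>x. 0 < \<psi> x" and C0: "0 < C0" "\<And>x. \<psi> x \<le> C0 * exp \<bar>x\<bar>" and l0: "1/2 < lambda0"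
    using lambda0_ground_state by blast
  define \<beta> where "\<beta> = lambda0 - 1/2"
  have \<beta>: "0 < \<beta>" using l0 by (simp add: \<beta>_def)
  have c\<psi>: "continuous_on UNIV \<psi>" using \<psi>(1) by (meson DERIV_isCont continuous_at_imp_continuous_on)
  obtain k where k: "0 < k"
    "\<And>y. (5/2 - F y) * cosh (2 * y) - y * sinh (2 * y) \<le> k * \<psi> y - (2 * \<beta> + 1) * cosh (2 * y)"
    using cosh_drift[OF c\<psi> \<psi>0 less_imp_le[OF \<beta>]] by blast
  define b0 where "b0 = k / \<beta>"
  have b0: "0 < b0" "k \<le> \<beta> * b0" using \<beta> k by (auto simp: b0_def)
  obtain g where g: "0 < g" "\<And>y. g * exp (- y\<^sup>2 / 2) \<le> F y - N 0 y" using F_gap by blast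
  define q where "q = (1 + b0) * C0"
  have q: "0 < q" using b0 C0 by (simp add: q_def)
  \<comment> \<open>At s = 0 the subsolution divided by A p is at most q z - z^2 / 2 with z = exp
    |y|, whose maximum is q^2 / 2. This A brings it below the gap g.\<close>
  define A where "A = g / (q\<^sup>2 / 2)"
  have A: "0 < A" "A * (q\<^sup>2 / 2) = g" using q g by (auto simp: A_def)
  define e where "e s = exp (- (\<beta> * (s - 0)))" for s
  have de: "(e has_real_derivative - \<beta> * e s) (at s)" for s unfolding e_def[abs_def] by (rule exp_decay_deriv)
  have e: "0 < e s" for s by (simp add: e_def)
  have e1: "e s \<le> 1" if "0 \<le> s" for s using that \<beta> by (simp add: e_def)
  have da: "((\<lambda>s. A * (e s + b0 * (e s)\<^sup>2)) has_real_derivative A * (- \<beta> * e s - 2 * \<beta> * b0 * (e s)\<^sup>2)) (at s)" for s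
    by (auto intro!: derivative_eq_intros de simp: algebra_simps power2_eq_square)
  have db: "((\<lambda>s. - (A * (e s)\<^sup>2)) has_real_derivative A * (2 * \<beta> * (e s)\<^sup>2)) (at s)" for s
    by (auto intro!: derivative_eq_intros de simp: algebra_simps power2_eq_square)
  have low: "ansatz \<psi> (\<lambda>s. A * (e s + b0 * (e s)\<^sup>2)) (\<lambda>s. - (A * (e s)\<^sup>2)) s y \<le> F y - N s y" if s: "0 \<le> s" for s y
  proof (rule deficit_lower[OF \<psi> da db _ _ _ s])
    fix s y :: real assume s: "0 \<le> s"
    show "A * (- \<beta> * e s - 2 * \<beta> * b0 * (e s)\<^sup>2) * \<psi> y + A * (2 * \<beta> * (e s)\<^sup>2) * cosh (2 * y)
      \<le> - (lambda0 - 1/2) * (A * (e s + b0 * (e s)\<^sup>2)) * \<psi> y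
        + - (A * (e s)\<^sup>2) * ((5/2 - F y) * cosh (2 * y) - y * sinh (2 * y))"
      unfolding \<beta>_def[symmetric]
      by (rule subsolution_algebra[OF _ _ _ b0(2) k(2)]) (use \<psi>0[of y] A in auto)
    have "(e s)\<^sup>2 \<le> 1" using e[of s] e1[OF s] by (simp add: power_le_one)
    then have "e s + b0 * (e s)\<^sup>2 \<le> 1 + b0" using e1[OF s] b0 by (simp add: add_mono mult_left_le)
    then have "A * (e s + b0 * (e s)\<^sup>2) * \<psi> y \<le> A * (1 + b0) * (C0 * exp \<bar>y\<bar>)"
      using A C0(2)[of y] \<psi>0[of y] b0 e[of s] by (intro mult_mono mult_left_mono) auto
    moreover have "0 \<le> A * (e s)\<^sup>2 * cosh (2 * y)" using A by simp
    ultimately have "A * (e s + b0 * (e s)\<^sup>2) * \<psi> y + - (A * (e s)\<^sup>2) * cosh (2 * y) \<le> A * q * exp \<bar>y\<bar>"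
      by (simp add: q_def mult.assoc)
    then have "ansatz \<psi> (\<lambda>s. A * (e s + b0 * (e s)\<^sup>2)) (\<lambda>s. - (A * (e s)\<^sup>2)) s y \<le> exp (- y\<^sup>2 / 2) * (A * q * exp \<bar>y\<bar>)"
      unfolding ansatz_def by (rule mult_left_mono) simp
    also have "\<dots> = A * q * (exp (- y\<^sup>2 / 2) * exp \<bar>y\<bar>)" by simp
    also have "\<dots> \<le> A * q * (exp 1 * exp (- y\<^sup>2 / 4))"
      using exp_abs_gaussian_le[of y] A q by (intro mult_left_mono) auto
    finally show "ansatz \<psi> (\<lambda>s. A * (e s + b0 * (e s)\<^sup>2)) (\<lambda>s. - (A * (e s)\<^sup>2)) s y \<le> A * q * exp 1 * exp (- y\<^sup>2 / 4)"
      by (simp add: mult.assoc)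
  next
    fix y
    have "(1 + b0) * \<psi> y - cosh (2 * y) \<le> q * exp \<bar>y\<bar> - (exp \<bar>y\<bar>)\<^sup>2 / 2"
    proof -
      have "(1 + b0) * \<psi> y \<le> (1 + b0) * (C0 * exp \<bar>y\<bar>)" using C0(2)[of y] b0 by (intro mult_left_mono) auto
      with cosh_double_ge[of y] show ?thesis by (simp add: q_def exp_double mult.assoc)
    qed
    also have "\<dots> \<le> q\<^sup>2 / 2" using sum_squares_bound[of q "exp \<bar>y\<bar>"] by simp
    finally have "A * ((1 + b0) * \<psi> y - cosh (2 * y)) \<le> A * (q\<^sup>2 / 2)"
      by (rule mult_left_mono) (use A in simp)
    then have "exp (- y\<^sup>2 / 2) * (A * ((1 + b0) * \<psi> y - cosh (2 * y))) \<le> exp (- y\<^sup>2 / 2) * g"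
      unfolding A(2) by simp
    also have "\<dots> \<le> F y - N 0 y" using g(2)[of y] by (simp add: mult.commute)
    finally show "ansatz \<psi> (\<lambda>s. A * (e s + b0 * (e s)\<^sup>2)) (\<lambda>s. - (A * (e s)\<^sup>2)) 0 y \<le> F y - N 0 y"
      by (simp add: ansatz_def e_def algebra_simps)
  qed
  obtain m where m: "0 < m" "\<And>y. \<bar>y\<bar> \<le> K \<Longrightarrow> m \<le> \<psi> y"
    using continuous_pos_lower_bound[OF c\<psi> \<psi>0] by blast
  \<comment> \<open>From \<open>sK\<close> = r / \<beta> on, exp (\<beta> s) \<ge> r, so the cosh
    correction takes at most half of the lower bound m of \<psi>.\<close>
  define r where "r = 2 * cosh (2 * K) / m"
  have r: "0 < r" using m by (simp add: r_def)
  define sK where "sK = r / \<beta>"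
  have sK: "0 < sK" using r \<beta> by (simp add: sK_def)
  define C where "C = A * m / 2 * exp (- K\<^sup>2 / 2)"
  have C: "0 < C" using A m by (simp add: C_def)
  have large: "C * e s \<le> F y - N s y" if s: "sK \<le> s" and y: "\<bar>y\<bar> \<le> K" for s y
  proof -
    have s0: "0 \<le> s" using sK s by simp
    have "r \<le> \<beta> * s" using s \<beta> by (simp add: sK_def field_simps)
    also have "\<dots> \<le> exp (\<beta> * s)" using exp_ge_add_one_self[of "\<beta> * s"] by linarith
    finally have "r * e s \<le> exp (\<beta> * s) * e s" using e[of s] by simp
    also have "\<dots> = 1" by (simp add: e_def flip: exp_add)
    finally have "2 * cosh (2 * K) * e s \<le> m" using m(1) by (simp add: r_def field_simps)
    moreover have "cosh (2 * y) \<le> cosh (2 * K)"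
    proof -
      have "cosh (2 * y) = cosh (2 * \<bar>y\<bar>)" by (cases "0 \<le> y") auto
      also have "\<dots> \<le> cosh (2 * K)" using y by (subst cosh_real_nonneg_le_iff) auto
      finally show ?thesis .
    qed
    then have "2 * cosh (2 * y) * e s \<le> 2 * cosh (2 * K) * e s" using e[of s] by simp
    ultimately have "e s * cosh (2 * y) \<le> \<psi> y - m / 2" using m(2)[OF y] by (simp add: mult_ac)
    then have "m / 2 \<le> \<psi> y - e s * cosh (2 * y)" by linarith
    moreover have "0 \<le> b0 * e s * \<psi> y" using b0 e[of s] \<psi>0[of y] by simp
    ultimately have "m / 2 \<le> \<psi> y + b0 * e s * \<psi> y - e s * cosh (2 * y)" by linarith
    then have "exp (- K\<^sup>2 / 2) * (A * e s * (m / 2)) \<le>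
        exp (- y\<^sup>2 / 2) * (A * e s * (\<psi> y + b0 * e s * \<psi> y - e s * cosh (2 * y)))"
      using A e[of s] m(1) power_mono[OF y, of 2] by (intro mult_mono mult_left_mono) auto
    also have "\<dots> = ansatz \<psi> (\<lambda>s. A * (e s + b0 * (e s)\<^sup>2)) (\<lambda>s. - (A * (e s)\<^sup>2)) s y"
      by (simp add: ansatz_def algebra_simps power2_eq_square)
    also have "\<dots> \<le> F y - N s y" by (rule low[OF s0])
    finally show ?thesis by (simp add: C_def mult_ac)
  qed
  show ?thesis
  proof (rule that[of "C * e sK"])
    show "0 < C * e sK" using C e[of sK] by simp
    fix s y :: real assume s: "0 \<le> s" and y: "\<bar>y\<bar> \<le> K"
    have es: "exp (- ((lambda0 - 1/2) * s)) = e s" by (simp add: e_def \<beta>_def)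
    show "C * e sK * exp (- ((lambda0 - 1/2) * s)) \<le> F y - N s y"
    proof (cases "sK \<le> s")
      case True
      have "C * e sK * e s \<le> C * 1 * e s" using C e[of s] e1[of sK] sK by (intro mult_right_mono mult_left_mono) auto
      then show ?thesis using large[OF True y] by (simp add: es)
    next
      \<comment> \<open>Before \<open>sK\<close> the subsolution may be negative. The deficit does
        not increase in s, so its value at \<open>sK\<close> bounds it below.\<close>
      case False
      have "C * e sK * e s \<le> C * e sK * 1" using C e[of sK] e1[OF s] by (intro mult_left_mono) auto
      then show ?thesis using large[OF order_refl y] N_mono[of s sK y] False by (simp add: es)
    qed
  qed
qed

end

section \<open>Return to the original variables\<close>

lemma selfsimilar_scaling:
  fixes lam t l :: real
  assumes "0 < lam" "0 < t"
  shows "exp (- ((l - 1/2) * ln (lam\<^sup>2 * t))) / t = t powr (- 1/2 - l) * lam powr (- (2 * l - 1))"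
proof -
  have "ln (lam\<^sup>2 * t) = 2 * ln lam + ln t" using assms by (simp add: ln_mult ln_realpow)
  then have "exp (- ((l - 1/2) * ln (lam\<^sup>2 * t))) / t = exp (- ((l - 1/2) * (2 * ln lam + ln t))) / exp (ln t)"
    using assms by simp
  also have "\<dots> = exp ((- 1/2 - l) * ln t + - (2 * l - 1) * ln lam)"
    by (simp add: algebra_simps flip: exp_diff)
  finally show ?thesis using assms by (simp add: powr_def exp_add)
qed

theorem theorem1p4:
  shows "\<exists>Cbar > 0. \<exists>Clow :: real \<Rightarrow> real.
    (\<forall>t > 0. \<forall>lam > 0. \<forall>x.
        Vinf t x - Vsol lam t x \<le> Cbar * t powr (- 1/2 - lambda0) * lam powr (- (2 * lambda0 - 1))) \<and>
    (\<forall>K \<ge> 1. Clow K > 0 \<and>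
       (\<forall>t > 0. \<forall>lam. lam \<ge> t powr (- 1/2) \<longrightarrow> (\<forall>x. \<bar>x\<bar> \<le> K * sqrt t \<longrightarrow>
          Clow K * t powr (- 1/2 - lambda0) * lam powr (- (2 * lambda0 - 1)) \<le> Vinf t x - Vsol lam t x)))"
proof -
  obtain N Ns Ny Nyy where "selfsimilar N Ns Ny Nyy"
    using selfsimilar_solution_exists unfolding selfsimilar_def by metis
  then interpret selfsimilar N Ns Ny Nyy .
  have deficit: "Vinf t x - Vsol lam t x = (F (x / sqrt t) - N (ln (lam\<^sup>2 * t)) (x / sqrt t)) / t"
    if "0 < lam" "0 < t" for lam t x
    using that by (simp add: Vinf_eq Vsol_eq diff_divide_distrib)
  obtain Cbar where Cbar: "0 < Cbar" "\<And>s y. F y - N s y \<le> Cbar * exp (- ((lambda0 - 1/2) * s))"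
    using deficit_exponential_upper by blast
  have "\<exists>C>0. \<forall>s y. 0 \<le> s \<longrightarrow> \<bar>y\<bar> \<le> K \<longrightarrow> C * exp (- ((lambda0 - 1/2) * s)) \<le> F y - N s y" for K
    using deficit_exponential_lower[of K] by metis
  then obtain Clow where Clow: "\<And>K. 0 < Clow K"
    "\<And>K s y. 0 \<le> s \<Longrightarrow> \<bar>y\<bar> \<le> K \<Longrightarrow> Clow K * exp (- ((lambda0 - 1/2) * s)) \<le> F y - N s y"
    by metis
  have upper: "Vinf t x - Vsol lam t x \<le> Cbar * t powr (- 1/2 - lambda0) * lam powr (- (2 * lambda0 - 1))"
    if "0 < lam" "0 < t" for lam t x
  proof -
    have "Vinf t x - Vsol lam t x \<le> Cbar * exp (- ((lambda0 - 1/2) * ln (lam\<^sup>2 * t))) / t"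
      unfolding deficit[OF that] using that Cbar(2) by (intro divide_right_mono) auto
    then show ?thesis
      unfolding times_divide_eq_right[symmetric] selfsimilar_scaling[OF that] by (simp only: mult.assoc)
  qed
  have lower: "Clow K * t powr (- 1/2 - lambda0) * lam powr (- (2 * lambda0 - 1)) \<le> Vinf t x - Vsol lam t x"
    if t: "0 < t" and lam: "t powr (- 1/2) \<le> lam" and x: "\<bar>x\<bar> \<le> K * sqrt t" for K t lam x
  proof -
    have "0 < t powr (- 1/2)" using t by simp
    then have lam0: "0 < lam" using lam by linarith
    \<comment> \<open>The condition lam \<ge> t^(-1/2) says exactly that the logarithmic time ln
      (lam^2 t) is nonnegative, the range of the lower estimate.\<close>
    have "1 = (t powr (- 1/2))\<^sup>2 * t"
      using t by (simp add: power2_eq_square powr_minus field_simps flip: powr_add)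
    also have "\<dots> \<le> lam\<^sup>2 * t" using lam t \<open>0 < t powr (- 1/2)\<close> by (intro mult_right_mono power_mono) auto
    finally have s: "0 \<le> ln (lam\<^sup>2 * t)" by simp
    have y: "\<bar>x / sqrt t\<bar> \<le> K" using x t by (simp add: field_simps)
    have "Clow K * exp (- ((lambda0 - 1/2) * ln (lam\<^sup>2 * t))) / t \<le> Vinf t x - Vsol lam t x"
      unfolding deficit[OF lam0 t] using t Clow(2)[OF s y] by (intro divide_right_mono) auto
    then show ?thesis
      unfolding times_divide_eq_right[symmetric] selfsimilar_scaling[OF lam0 t] by (simp only: mult.assoc)
  qed
  show ?thesis
    using Cbar(1) Clow(1) upper lower by (intro exI[of _ Cbar] exI[of _ Clow] conjI allI impI) auto
qed

end
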